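(* Let $S$ be a $\pi$-adically complete $o_L$-algebra and $A=S[\![Z]\!]$. Suppose $\tau:G_L\to o_L^\times$ is surjective and that the map $\mathcal{K}_1^*:\mathrm{Hom}_{o_L}(o_\infty,S)\to A^{\psi_q=0}$, $\ell\mapsto\sum_{n\ge0}\ell(P_n(\Omega))Z^n$, is an isomorphism. Then $\mathcal{K}^*:\mathrm{Hom}_{o_L}(\mathcal{C}^0_{Gal}(o_L,o_{\mathbb{C}_p}),S)\to A^{\psi_q\text{-int}}$, $\lambda\mapsto\sum_{n\ge0}\lambda(a\mapsto P_n(a\Omega))Z^n$, is an isomorphism as well.
   Context: $L/\mathbb{Q}_p$ finite, $o_L$, uniformizer $\pi$, $q=|o_L/\pi|$, $G_L=\mathrm{Gal}(\overline L/L)$. $\mathcal{G}$ is a Lubin–Tate formal group for $\pi$ with coordinate $Z$, addition $\oplus$, logarithm $\log_{LT}$; $\tau=\chi_{cyc}\chi_\pi^{-1}:G_L\to o_L^\times$ is the character of the Tate module of the dual $p$-divisible group; $\Omega\in\mathbb{C}_p$ is the period ($\exp(\Omega\log_{LT}Z)-1$ generates the $o_L$-module of formal group maps $\mathcal{G}\to\widehat{\mathbb{G}}_m$ over $o_{\mathbb{C}_p}$), so $\sigma(\Omega)=\tau(\sigma)\Omega$. $P_n(Y)\in L[Y]$ are defined by $\exp(Y\log_{LT}(Z))=\sum P_n(Y)Z^n$; one has $P_n(a\Omega)\in o_{\mathbb{C}_p}$ for $a\in o_L$. $L_\infty=\mathbb{C}_p^{\ker\tau}$ (the closure of $L(\Omega)$)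 and $o_\infty=L_\infty\cap o_{\mathbb{C}_p}$. $\mathcal{C}^0_{Gal}(o_L,o_{\mathbb{C}_p})$ is the $o_L$-module of continuous $f:o_L\to o_{\mathbb{C}_p}$ with $\sigma(f(a))=f(\tau(\sigma)a)$ for all $a\in o_L$, $\sigma\in G_L$. On $A$, $\varphi(F)(Z)=F([\pi](Z))$, $\psi_{Col}$ is the $S$-linear endomorphism with $\varphi(\psi_{Col}(F))(Z)=\sum_{\zeta}F(\zeta\oplus Z)$ (sum over the $q$ $\pi$-torsion points $\zeta$ of $\mathcal{G}$), $\psi_q=\frac1q\psi_{Col}$ on $A\otimes_{o_L}L$, $A^{\psi_q=0}$ is its kernel on $A$, and $A^{\psi_q\text{-int}}=\{F\in A:\psi_q^n(F)\in A\ \text{for all } n\ge0\}$. *)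

theory Defs
  imports "HOL-Analysis.Analysis"
begin

unbundle no vec_syntax
unbundle fps_syntax

section \<open>The field of \<open>p\<close>-adic complex numbers\<close>

text \<open>
  The libraries contain no \<open>p\<close>-adic fields.  We work in an arbitrary model of \<open>\<complex>\<^sub>p\<close>: a type
  \<open>'c\<close> which is an algebraically closed field of characteristic \<open>0\<close> and a complete metric space,
  whose metric comes from a multiplicative ultrametric absolute value with \<open>|p| = 1/p\<close>, and in
  which the algebraic closure of \<open>\<rat>\<^sub>p\<close> is dense.  Any two models are isometrically isomorphic.
  The absolute value is the distance to \<open>0\<close>, so that the topological notions of the library
  (closure, continuity, infinite sums) apply to \<open>\<complex>\<^sub>p\<close>.
\<close>

definition cabs :: "'c::{zero,metric_space} \<Rightarrow> real" where
  "cabs x = dist x 0"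

definition Qp :: "'c::{field_char_0,metric_space} set" where
  "Qp = closure \<rat>"

definition Zp :: "'c::{field_char_0,metric_space} set" where
  "Zp = closure \<int>"

definition alg_closure_in :: "'c::field set \<Rightarrow> 'c set" where
  "alg_closure_in K = {x. \<exists>f. f \<noteq> 0 \<and> (\<forall>i. coeff f i \<in> K) \<and> poly f x = 0}"

definition is_Cp :: "nat \<Rightarrow> 'c::{alg_closed_field,field_char_0,complete_space} itself \<Rightarrow> bool" where
  "is_Cp p C \<longleftrightarrow>
     prime p \<and>
     (\<forall>x y :: 'c. dist x y = cabs (x - y)) \<and>
     (\<forall>x y :: 'c. cabs (x * y) = cabs x * cabs y) \<and>
     (\<forall>x y :: 'c. cabs (x + y) \<le> max (cabs x) (cabs y)) \<and>
     cabs (of_nat p :: 'c) = 1 / real p \<and>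
     closure (alg_closure_in Qp) = (UNIV :: 'c set)"

definition o_Cp :: "'c::{zero,metric_space} set" where
  "o_Cp = {x. cabs x \<le> 1}"


section \<open>The base field \<open>L\<close> and its Galois group\<close>

definition finite_ext_Qp :: "'c::{field_char_0,metric_space} set \<Rightarrow> bool" where
  "finite_ext_Qp L \<longleftrightarrow>
     Qp \<subseteq> L \<and>
     (\<forall>x\<in>L. \<forall>y\<in>L. x + y \<in> L \<and> x * y \<in> L) \<and>
     (\<forall>x\<in>L. - x \<in> L \<and> inverse x \<in> L) \<and>
     (\<exists>B. finite B \<and> B \<subseteq> L \<and> (\<forall>x\<in>L. \<exists>c. (\<forall>b\<in>B. c b \<in> Qp) \<and> x = (\<Sum>b\<in>B. c b * b)))"

definition o_ring :: "'c::{zero,metric_space} set \<Rightarrow> 'c set" where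
  "o_ring L = {x \<in> L. cabs x \<le> 1}"

definition o_units :: "'c::{zero,metric_space} set \<Rightarrow> 'c set" where
  "o_units L = {x \<in> L. cabs x = 1}"

definition uniformizer :: "'c::{field,metric_space} set \<Rightarrow> 'c \<Rightarrow> bool" where
  "uniformizer L \<pi> \<longleftrightarrow> \<pi> \<noteq> 0 \<and> {x \<in> L. cabs x < 1} = (\<lambda>x. \<pi> * x) ` o_ring L"

definition residue_card :: "'c::{field,metric_space} set \<Rightarrow> 'c \<Rightarrow> nat" where
  "residue_card L \<pi> =
     card (o_ring L //
       {(x, y). x \<in> o_ring L \<and> y \<in> o_ring L \<and> x - y \<in> (\<lambda>z. \<pi> * z) ` o_ring L})"

text \<open>
  The group \<open>Gal(Lbar/L)\<close> with its action on \<open>\<complex>\<^sub>p\<close>: every automorphism of \<open>Lbar\<close> over \<open>L\<close> is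
  isometric and hence has a unique continuous extension to \<open>\<complex>\<^sub>p\<close>; it is represented by that
  extension.
\<close>

definition galois_group :: "'c::{field_char_0,metric_space} set \<Rightarrow> ('c \<Rightarrow> 'c) set" where
  "galois_group L =
     {\<sigma>. continuous_on UNIV \<sigma> \<and>
         bij_betw \<sigma> (alg_closure_in L) (alg_closure_in L) \<and>
         (\<forall>x\<in>alg_closure_in L. \<forall>y\<in>alg_closure_in L.
            \<sigma> (x + y) = \<sigma> x + \<sigma> y \<and> \<sigma> (x * y) = \<sigma> x * \<sigma> y) \<and>
         (\<forall>x\<in>L. \<sigma> x = x)}"


section \<open>Formal groups\<close>

text \<open>
  A power series in two variables \<open>X\<close>, \<open>Y\<close> is an element of \<open>'c fps fps\<close>, the coefficient of
  \<open>X\<^sup>iY\<^sup>j\<close> in \<open>F\<close> being \<open>F $ j $ i\<close>.  The composition of the library is not applicable to \<open>G(F(X,Y))\<close>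
  because \<open>F(X,0)\<close> need not vanish.
\<close>

definition coeffs_in :: "'c::zero set \<Rightarrow> 'c fps \<Rightarrow> bool" where
  "coeffs_in R G \<longleftrightarrow> (\<forall>n. G $ n \<in> R)"

text \<open>\<open>G(F(X,Y))\<close> for \<open>F(0,0) = 0\<close>; then \<open>X\<^sup>iY\<^sup>j\<close> does not occur in \<open>F\<^sup>r\<close> for \<open>r > i + j\<close>.\<close>

definition subst_out :: "'c::field_char_0 fps \<Rightarrow> 'c fps fps \<Rightarrow> 'c fps fps" where
  "subst_out G F = Abs_fps (\<lambda>j. Abs_fps (\<lambda>i. \<Sum>r\<le>i + j. G $ r * (F ^ r) $ j $ i))"

text \<open>\<open>F(G(X),H(Y))\<close> for \<open>G(0) = H(0) = 0\<close>.\<close>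

definition subst_in :: "'c::field_char_0 fps fps \<Rightarrow> 'c fps \<Rightarrow> 'c fps \<Rightarrow> 'c fps fps" where
  "subst_in F G H =
     Abs_fps (\<lambda>j. Abs_fps (\<lambda>i. \<Sum>s\<le>j. \<Sum>r\<le>i. F $ s $ r * (G ^ r) $ i * (H ^ s) $ j))"

text \<open>
  One-dimensional commutative formal group laws over \<open>R\<close>.  The last condition is associativity:
  it compares the coefficients of \<open>X\<^sup>iY\<^sup>jZ\<^sup>k\<close> in \<open>F(F(X,Y),Z)\<close> and \<open>F(X,F(Y,Z))\<close>.
\<close>

definition formal_group_law :: "'c::field_char_0 set \<Rightarrow> 'c fps fps \<Rightarrow> bool" where
  "formal_group_law R F \<longleftrightarrow>
     (\<forall>j. coeffs_in R (F $ j)) \<and>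
     F $ 0 = fps_X \<and>
     (\<forall>j. F $ j $ 0 = (if j = 1 then 1 else 0)) \<and>
     (\<forall>i j. F $ j $ i = F $ i $ j) \<and>
     (\<forall>i j k. (\<Sum>r\<le>i + j. F $ k $ r * (F ^ r) $ j $ i) = (\<Sum>r\<le>j + k. F $ r $ i * (F ^ r) $ k $ j))"

definition formal_hom :: "'c::field_char_0 fps fps \<Rightarrow> 'c fps fps \<Rightarrow> 'c fps \<Rightarrow> bool" where
  "formal_hom F F' h \<longleftrightarrow> h $ 0 = 0 \<and> subst_out h F = subst_in F' h h"

definition formal_Ga :: "'c::field_char_0 fps fps" where
  "formal_Ga = fps_const fps_X + fps_X"

definition formal_Gm :: "'c::field_char_0 fps fps" where
  "formal_Gm = fps_const fps_X + fps_X + fps_const fps_X * fps_X"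

definition formal_log :: "'c::field_char_0 fps fps \<Rightarrow> 'c fps" where
  "formal_log F = (THE l. formal_hom F formal_Ga l \<and> l $ 1 = 1)"

definition formal_mult :: "'c::{field_char_0,metric_space} set \<Rightarrow> 'c fps fps \<Rightarrow> 'c \<Rightarrow> 'c fps" where
  "formal_mult L F a = (THE g. coeffs_in (o_ring L) g \<and> formal_hom F F g \<and> g $ 1 = a)"

text \<open>
  \<open>F\<close> is the group law of a Lubin--Tate formal group for \<open>\<pi>\<close>: it has an endomorphism
  \<open>e \<equiv> \<pi>Z\<close> modulo degree \<open>2\<close> with \<open>e \<equiv> Z\<^sup>q\<close> modulo \<open>\<pi>\<close>.
\<close>

definition lubin_tate_group :: "'c::{field_char_0,metric_space} set \<Rightarrow> 'c \<Rightarrow> 'c fps fps \<Rightarrow> bool" where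
  "lubin_tate_group L \<pi> F \<longleftrightarrow>
     formal_group_law (o_ring L) F \<and>
     (\<exists>e. coeffs_in (o_ring L) e \<and> formal_hom F F e \<and> e $ 1 = \<pi> \<and>
          (\<forall>n. e $ n - (if n = residue_card L \<pi> then 1 else 0) \<in> (\<lambda>x. \<pi> * x) ` o_ring L))"

definition fps_value :: "'c::{field_char_0,metric_space} fps \<Rightarrow> 'c \<Rightarrow> 'c" where
  "fps_value G z = (\<Sum>n. G $ n * z ^ n)"

definition torsion_points ::
    "'c::{field_char_0,metric_space} set \<Rightarrow> 'c fps fps \<Rightarrow> 'c \<Rightarrow> 'c set" where
  "torsion_points L F a = {z. cabs z < 1 \<and> fps_value (formal_mult L F a) z = 0}"

text \<open>The power series \<open>\<zeta> \<oplus> Z\<close> in \<open>Z\<close>.\<close>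

definition translate :: "'c::{field_char_0,metric_space} fps fps \<Rightarrow> 'c \<Rightarrow> 'c fps" where
  "translate F \<zeta> = Abs_fps (\<lambda>j. fps_value (F $ j) \<zeta>)"


section \<open>The characters and the period\<close>

definition chi_cyc :: "nat \<Rightarrow> ('c \<Rightarrow> 'c) \<Rightarrow> 'c::{field_char_0,metric_space}" where
  "chi_cyc p \<sigma> = (THE u. u \<in> Zp \<and>
     (\<forall>n k \<zeta>. \<zeta> ^ (p ^ n) = 1 \<longrightarrow> cabs (u - of_nat k) \<le> 1 / real p ^ n \<longrightarrow> \<sigma> \<zeta> = \<zeta> ^ k))"

definition chi_LT ::
    "'c::{field_char_0,metric_space} set \<Rightarrow> 'c \<Rightarrow> 'c fps fps \<Rightarrow> ('c \<Rightarrow> 'c) \<Rightarrow> 'c" where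
  "chi_LT L \<pi> F \<sigma> = (THE u. u \<in> o_units L \<and>
     (\<forall>n. \<forall>z\<in>torsion_points L F (\<pi> ^ n). \<sigma> z = fps_value (formal_mult L F u) z))"

definition tau ::
    "nat \<Rightarrow> 'c::{field_char_0,metric_space} set \<Rightarrow> 'c \<Rightarrow> 'c fps fps \<Rightarrow> ('c \<Rightarrow> 'c) \<Rightarrow> 'c" where
  "tau p L \<pi> F \<sigma> = chi_cyc p \<sigma> * inverse (chi_LT L \<pi> F \<sigma>)"

text \<open>
  \<open>exp(\<Omega> log(Z)) - 1\<close> generates the \<open>o\<^sub>L\<close>-module of homomorphisms from \<open>F\<close> to the formal
  multiplicative group over \<open>o\<^bsub>\<complex>p\<^esub>\<close>, on which \<open>a \<in> o\<^sub>L\<close> acts by composition with \<open>[a]\<close>.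
\<close>

definition is_period :: "'c::{field_char_0,metric_space} set \<Rightarrow> 'c fps fps \<Rightarrow> 'c \<Rightarrow> bool" where
  "is_period L F \<Omega> \<longleftrightarrow>
     {h. coeffs_in o_Cp h \<and> formal_hom F formal_Gm h} =
     {((fps_exp \<Omega> oo formal_log F) - 1) oo formal_mult L F a | a. a \<in> o_ring L}"

text \<open>\<open>P\<^sub>n\<close> is the coefficient of \<open>Z\<^sup>n\<close> in \<open>exp(Y log(Z)) = \<Sum>\<^sub>k Y\<^sup>k log(Z)\<^sup>k / k!\<close>.\<close>

definition P_poly :: "'c::field_char_0 fps fps \<Rightarrow> nat \<Rightarrow> 'c poly" where
  "P_poly F n = (\<Sum>k\<le>n. monom ((formal_log F ^ k) $ n / fact k) k)"

lemma poly_P_poly: "poly (P_poly F n) y = (fps_exp y oo formal_log F) $ n"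
  by (simp add: P_poly_def poly_sum poly_monom fps_compose_nth atLeast0AtMost mult_ac)

definition o_infty :: "nat \<Rightarrow> 'c::{field_char_0,metric_space} set \<Rightarrow> 'c \<Rightarrow> 'c fps fps \<Rightarrow> 'c set" where
  "o_infty p L \<pi> F = {x. \<forall>\<sigma>\<in>galois_group L. tau p L \<pi> F \<sigma> = 1 \<longrightarrow> \<sigma> x = x} \<inter> o_Cp"

text \<open>Functions on \<open>o\<^sub>L\<close> are extended by \<open>0\<close>, so that the module operations are pointwise.\<close>

definition C_Gal ::
    "nat \<Rightarrow> 'c::{field_char_0,metric_space} set \<Rightarrow> 'c \<Rightarrow> 'c fps fps \<Rightarrow> ('c \<Rightarrow> 'c) set" where
  "C_Gal p L \<pi> F =
     {f. continuous_on (o_ring L) f \<and> f ` o_ring L \<subseteq> o_Cp \<and> (\<forall>a. a \<notin> o_ring L \<longrightarrow> f a = 0) \<and>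
         (\<forall>a\<in>o_ring L. \<forall>\<sigma>\<in>galois_group L. \<sigma> (f a) = f (tau p L \<pi> F \<sigma> * a))}"


section \<open>The coefficient ring \<open>S\<close> and the operators on \<open>S[[Z]]\<close>\<close>

text \<open>
  A commutative \<open>o\<^sub>L\<close>-algebra \<open>S\<close> is given by its structure map \<open>\<iota>\<close>, of which only the values on \<open>o\<^sub>L\<close>
  matter.  The unit of \<open>S\<close> is \<open>\<iota> 1\<close>; the class \<open>comm_ring\<close> (rather than \<open>comm_ring_1\<close>, which
  demands \<open>0 \<noteq> 1\<close>) admits the zero algebra.
\<close>

definition o_algebra :: "'c::{field_char_0,metric_space} set \<Rightarrow> ('c \<Rightarrow> 's::comm_ring) \<Rightarrow> bool" where
  "o_algebra L \<iota> \<longleftrightarrow>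
     (\<forall>x\<in>o_ring L. \<forall>y\<in>o_ring L. \<iota> (x + y) = \<iota> x + \<iota> y \<and> \<iota> (x * y) = \<iota> x * \<iota> y) \<and>
     (\<forall>s. \<iota> 1 * s = s)"

definition adic_cong :: "('c::field_char_0 \<Rightarrow> 's::comm_ring) \<Rightarrow> 'c \<Rightarrow> nat \<Rightarrow> 's \<Rightarrow> 's \<Rightarrow> bool" where
  "adic_cong \<iota> \<pi> n s t \<longleftrightarrow> (\<exists>r. s - t = \<iota> (\<pi> ^ n) * r)"

text \<open>The map from \<open>S\<close> to the inverse limit of the \<open>S/\<pi>\<^sup>nS\<close> is injective and surjective.\<close>

definition adically_complete :: "('c::field_char_0 \<Rightarrow> 's::comm_ring) \<Rightarrow> 'c \<Rightarrow> bool" where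
  "adically_complete \<iota> \<pi> \<longleftrightarrow>
     (\<forall>s. (\<forall>n. adic_cong \<iota> \<pi> n s 0) \<longrightarrow> s = 0) \<and>
     (\<forall>s. (\<forall>n. adic_cong \<iota> \<pi> n (s (Suc n)) (s n)) \<longrightarrow> (\<exists>l. \<forall>n. adic_cong \<iota> \<pi> n l (s n)))"

definition adic_suminf ::
    "('c::field_char_0 \<Rightarrow> 's::comm_ring) \<Rightarrow> 'c \<Rightarrow> (nat \<Rightarrow> 's) \<Rightarrow> 's" where
  "adic_suminf \<iota> \<pi> u = (THE l. \<forall>n. \<exists>M. \<forall>m\<ge>M. adic_cong \<iota> \<pi> n (\<Sum>i<m. u i) l)"

text \<open>\<open>F([\<pi>](Z))\<close> for \<open>F \<in> S[[Z]]\<close>, where \<open>G\<close> is the group law.\<close>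

definition phi ::
    "'c::{field_char_0,metric_space} set \<Rightarrow> 'c \<Rightarrow> 'c fps fps \<Rightarrow> ('c \<Rightarrow> 's::comm_ring) \<Rightarrow> 's fps \<Rightarrow> 's fps"
  where
  "phi L \<pi> G \<iota> F = Abs_fps (\<lambda>n. \<Sum>i\<le>n. \<iota> ((formal_mult L G \<pi> ^ i) $ n) * F $ i)"

text \<open>
  The sum of \<open>F(\<zeta> \<oplus> Z)\<close> over the \<open>\<pi>\<close>-torsion points \<open>\<zeta>\<close>.  For \<open>F = \<Sum> F\<^sub>i Z\<^sup>i\<close> it equals
  \<open>\<Sum>\<^sub>i F\<^sub>i T\<^sub>i(Z)\<close> with \<open>T\<^sub>i = \<Sum>\<^sub>\<zeta> (\<zeta> \<oplus> Z)\<^sup>i\<close>.  The coefficients of \<open>T\<^sub>i\<close> lie in \<open>o\<^sub>L\<close>,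
  and for fixed \<open>n\<close> the \<open>n\<close>-th ones tend to \<open>0\<close> as \<open>i\<close> grows, so that the coefficients of the sum
  are \<open>\<pi>\<close>-adically convergent series in \<open>S\<close>.
\<close>

definition torsion_trace ::
    "'c::{field_char_0,metric_space} set \<Rightarrow> 'c \<Rightarrow> 'c fps fps \<Rightarrow> ('c \<Rightarrow> 's::comm_ring) \<Rightarrow> 's fps \<Rightarrow> 's fps"
  where
  "torsion_trace L \<pi> G \<iota> F =
     Abs_fps (\<lambda>n. adic_suminf \<iota> \<pi>
       (\<lambda>i. \<iota> ((\<Sum>\<zeta>\<in>torsion_points L G \<pi>. translate G \<zeta> ^ i) $ n) * F $ i))"

definition S_linear :: "('s::comm_ring fps \<Rightarrow> 's fps) \<Rightarrow> bool" where
  "S_linear \<psi> \<longleftrightarrow>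
     (\<forall>F H. \<psi> (F + H) = \<psi> F + \<psi> H) \<and> (\<forall>s F. \<psi> (fps_const s * F) = fps_const s * \<psi> F)"

definition psi_Col ::
    "'c::{field_char_0,metric_space} set \<Rightarrow> 'c \<Rightarrow> 'c fps fps \<Rightarrow> ('c \<Rightarrow> 's::comm_ring) \<Rightarrow> 's fps \<Rightarrow> 's fps"
  where
  "psi_Col L \<pi> G \<iota> =
     (THE \<psi>. S_linear \<psi> \<and> (\<forall>F. phi L \<pi> G \<iota> (\<psi> F) = torsion_trace L \<pi> G \<iota> F))"

text \<open>
  \<open>A \<otimes> L\<close> for \<open>A = S[[Z]]\<close> is the localization of \<open>A\<close> at the nonzero elements of \<open>o\<^sub>L\<close>; the pair
  \<open>(F, s)\<close> represents \<open>F/s\<close>.  Since \<open>S\<close> may have torsion, \<open>A\<close> need not embed into \<open>A \<otimes> L\<close>.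
\<close>

definition loc_rel ::
    "'c::{field_char_0,metric_space} set \<Rightarrow> ('c \<Rightarrow> 's::comm_ring) \<Rightarrow> (('s fps \<times> 'c) \<times> ('s fps \<times> 'c)) set"
  where
  "loc_rel L \<iota> = {((F, s), (H, t)).
     s \<in> o_ring L - {0} \<and> t \<in> o_ring L - {0} \<and>
     (\<exists>u\<in>o_ring L - {0}. fps_const (\<iota> u) * (fps_const (\<iota> t) * F - fps_const (\<iota> s) * H) = 0)}"

definition loc_emb ::
    "'c::{field_char_0,metric_space} set \<Rightarrow> ('c \<Rightarrow> 's::comm_ring) \<Rightarrow> 's fps \<Rightarrow> ('s fps \<times> 'c) set" where
  "loc_emb L \<iota> F = loc_rel L \<iota> `` {(F, 1)}"

definition psi_q ::
    "'c::{field_char_0,metric_space} set \<Rightarrow> 'c \<Rightarrow> 'c fps fps \<Rightarrow> ('c \<Rightarrow> 's::comm_ring) \<Rightarrow>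
     ('s fps \<times> 'c) set \<Rightarrow> ('s fps \<times> 'c) set" where
  "psi_q L \<pi> G \<iota> x =
     (\<Union>(F, s)\<in>x. loc_rel L \<iota> `` {(psi_Col L \<pi> G \<iota> F, of_nat (residue_card L \<pi>) * s)})"

definition psi_q_kernel ::
    "'c::{field_char_0,metric_space} set \<Rightarrow> 'c \<Rightarrow> 'c fps fps \<Rightarrow> ('c \<Rightarrow> 's::comm_ring) \<Rightarrow> 's fps set" where
  "psi_q_kernel L \<pi> G \<iota> = {F. psi_q L \<pi> G \<iota> (loc_emb L \<iota> F) = loc_emb L \<iota> 0}"

definition psi_q_int ::
    "'c::{field_char_0,metric_space} set \<Rightarrow> 'c \<Rightarrow> 'c fps fps \<Rightarrow> ('c \<Rightarrow> 's::comm_ring) \<Rightarrow> 's fps set" where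
  "psi_q_int L \<pi> G \<iota> = {F. \<forall>n. (psi_q L \<pi> G \<iota> ^^ n) (loc_emb L \<iota> F) \<in> range (loc_emb L \<iota>)}"


section \<open>The maps \<open>K\<^sub>1\<^sup>*\<close> and \<open>K\<^sup>*\<close>\<close>

text \<open>
  \<open>o\<^sub>L\<close>-linear maps from \<open>M\<close> to \<open>S\<close>, extended by \<open>0\<close> outside \<open>M\<close>.  The arguments \<open>add\<close> and \<open>smul\<close>
  are the module operations of \<open>M\<close>.
\<close>

definition Hom_o ::
    "'c::{field_char_0,metric_space} set \<Rightarrow> ('c \<Rightarrow> 's::comm_ring) \<Rightarrow>
     ('m \<Rightarrow> 'm \<Rightarrow> 'm) \<Rightarrow> ('c \<Rightarrow> 'm \<Rightarrow> 'm) \<Rightarrow> 'm set \<Rightarrow> ('m \<Rightarrow> 's) set" where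
  "Hom_o L \<iota> add smul M =
     {l. (\<forall>x\<in>M. \<forall>y\<in>M. l (add x y) = l x + l y) \<and>
         (\<forall>a\<in>o_ring L. \<forall>x\<in>M. l (smul a x) = \<iota> a * l x) \<and>
         (\<forall>x. x \<notin> M \<longrightarrow> l x = 0)}"

definition Hom_o_infty ::
    "nat \<Rightarrow> 'c::{field_char_0,metric_space} set \<Rightarrow> 'c \<Rightarrow> 'c fps fps \<Rightarrow> ('c \<Rightarrow> 's::comm_ring) \<Rightarrow>
     ('c \<Rightarrow> 's) set" where
  "Hom_o_infty p L \<pi> G \<iota> = Hom_o L \<iota> (+) (*) (o_infty p L \<pi> G)"

definition Hom_C_Gal ::
    "nat \<Rightarrow> 'c::{field_char_0,metric_space} set \<Rightarrow> 'c \<Rightarrow> 'c fps fps \<Rightarrow> ('c \<Rightarrow> 's::comm_ring) \<Rightarrow>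
     (('c \<Rightarrow> 'c) \<Rightarrow> 's) set" where
  "Hom_C_Gal p L \<pi> G \<iota> =
     Hom_o L \<iota> (\<lambda>f g a. f a + g a) (\<lambda>c f a. c * f a) (C_Gal p L \<pi> G)"

definition K1_star :: "'c::field_char_0 fps fps \<Rightarrow> 'c \<Rightarrow> ('c \<Rightarrow> 's::comm_ring) \<Rightarrow> 's fps" where
  "K1_star G \<Omega> l = Abs_fps (\<lambda>n. l (poly (P_poly G n) \<Omega>))"

definition K_star ::
    "'c::{field_char_0,metric_space} set \<Rightarrow> 'c fps fps \<Rightarrow> 'c \<Rightarrow> (('c \<Rightarrow> 'c) \<Rightarrow> 's::comm_ring) \<Rightarrow> 's fps"
  where
  "K_star L G \<Omega> l =
     Abs_fps (\<lambda>n. l (\<lambda>a. if a \<in> o_ring L then poly (P_poly G n) (a * \<Omega>) else 0))"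

definition S_module_iso ::
    "(('m \<Rightarrow> 's) \<Rightarrow> 's::comm_ring fps) \<Rightarrow> ('m \<Rightarrow> 's) set \<Rightarrow> 's fps set \<Rightarrow> bool" where
  "S_module_iso \<Phi> M N \<longleftrightarrow>
     bij_betw \<Phi> M N \<and>
     (\<forall>l\<in>M. \<forall>k\<in>M. \<Phi> (\<lambda>x. l x + k x) = \<Phi> l + \<Phi> k) \<and>
     (\<forall>s. \<forall>l\<in>M. \<Phi> (\<lambda>x. s * l x) = fps_const s * \<Phi> l)"

end

(*
  Restriction to the units and a -> f(pi a) split C = C_Gal(o_L, o_Cp) as o_infty + C: an equivariant
  function on o_L^* is the orbit map of its value at 1, and it is continuous because, by Ax-Sen-Tate,
  every element of o_infty is a limit of algebraic elements of L_infty.  Under K_1^* and K^* this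
  splitting becomes F = (F - phi(psi_q F)) + phi(psi_q F).  Iterating it, injectivity holds since a
  functional killed by K^* is divisible by every power of pi on every f (f(pi^m a) -> f(0)), and
  surjectivity since the summands F^(m) - phi(F^(m+1)), F^(m) = psi_q^m F, come from functionals on
  o_infty whose sum converges pi-adically.  The hypothesis on K_1^* also forces S to be
  pi-torsion-free, and Omega to be nonzero unless S = 0; then sigma(Omega) = tau(sigma) Omega makes
  tau a homomorphism.
*)
theory Submission
  imports Defs
begin

section \<open>The ultrametric absolute value\<close>

text \<open>Most objects of the statement are descriptions (\<open>THE\<close>), and S may a priori
  have torsion, so much of the work makes them usable. Lubin-Tate theory yields the logarithm,
  \<open>[a]\<close> and both characters; \<open>psi_Col\<close> exists because the trace over the
  torsion points descends along \<open>[\<pi>]\<close> and \<open>phi\<close> is injective. The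
  relation psi(phi(F)) = q F and torsion-freeness then turn statements in the localization into
  equations in A: F is in the kernel iff \<open>PS F = 0\<close>, and integral iff q^n divides the
  n-th iterate \<open>PS\<close> of F for all n. Convergence has one obstacle, the constant
  coefficient: \<open>phi\<close> fixes it, whereas in each degree n > 0 the iterates of
  \<open>phi\<close> tend to 0. On the side of functions this is the value f(0), which restriction
  and scaling never reduce. Hence a functional is rebuilt from f(0) and the differences f(\<pi>^m) -
  f(0), which tend to 0 by continuity. The zero algebra is treated apart, because the period may
  vanish there.\<close>

locale Cp =
  fixes p :: nat and C :: "'c::{alg_closed_field,field_char_0,complete_space} itself"
  assumes Cp: "is_Cp p C"
begin

lemma p_prime: "prime p" using Cp by (simp add: is_Cp_def)

lemma dist_cabs: "dist x y = cabs (x - y :: 'c)" using Cp unfolding is_Cp_def by blast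

lemma cabs_mult [simp]: "cabs (x * y :: 'c) = cabs x * cabs y" using Cp unfolding is_Cp_def by blast

lemma cabs_add: "cabs (x + y :: 'c) \<le> max (cabs x) (cabs y)" using Cp unfolding is_Cp_def by blast

lemma cabs_p: "cabs (of_nat p :: 'c) = 1 / real p" using Cp unfolding is_Cp_def by blast

lemma closure_alg: "closure (alg_closure_in Qp) = (UNIV :: 'c set)" using Cp unfolding is_Cp_def by blast

lemma p_gt_1: "p > 1" using p_prime prime_gt_1_nat by blast

lemma cabs_p_less_1: "cabs (of_nat p :: 'c) < 1" using p_gt_1 by (simp add: cabs_p)

lemma cabs_0 [simp]: "cabs (0 :: 'c) = 0" by (simp add: cabs_def)

lemma cabs_nonneg [simp]: "cabs (x :: 'c) \<ge> 0" by (simp add: cabs_def)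

lemma cabs_eq_0 [simp]: "cabs (x :: 'c) = 0 \<longleftrightarrow> x = 0" by (simp add: cabs_def)

lemma cabs_pos [simp]: "cabs (x :: 'c) > 0 \<longleftrightarrow> x \<noteq> 0" using cabs_nonneg[of x] cabs_eq_0[of x] by linarith

lemma cabs_not_le_0 [simp]: "cabs (x :: 'c) \<le> 0 \<longleftrightarrow> x = 0" using cabs_pos[of x] by linarith

lemma cabs_1 [simp]: "cabs (1 :: 'c) = 1"
proof -
  have "cabs (1 * 1 :: 'c) = cabs (1::'c) * cabs (1::'c)" by (rule cabs_mult)
  then show ?thesis by simp
qed

lemma cabs_minus [simp]: "cabs (- x :: 'c) = cabs x"
proof -
  have "cabs (-1 * -1 :: 'c) = cabs (-1::'c) * cabs (-1::'c)" by (rule cabs_mult)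
  then have "cabs (-1::'c) * cabs (-1::'c) = 1" by simp
  then have "cabs (-1::'c) = 1" by (metis abs_of_nonneg cabs_nonneg real_sqrt_abs2 real_sqrt_one)
  then show ?thesis using cabs_mult[of "-1" x] by simp
qed

lemma cabs_minus_commute: "cabs (x - y :: 'c) = cabs (y - x)" using cabs_minus[of "x - y"] by simp

lemma cabs_diff: "cabs (x - y :: 'c) \<le> max (cabs x) (cabs y)" using cabs_add[of x "- y"] by simp

lemma cabs_power [simp]: "cabs (x ^ n :: 'c) = cabs x ^ n" by (induction n) auto

lemma cabs_inverse [simp]: "cabs (inverse x :: 'c) = inverse (cabs x)"
proof (cases "x = 0")
  case False
  then have "cabs x * cabs (inverse x) = 1" by (metis cabs_1 cabs_mult right_inverse)
  then show ?thesis using False by (simp add: field_simps)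
qed simp

lemma cabs_divide [simp]: "cabs (x / y :: 'c) = cabs x / cabs y" by (simp add: divide_inverse)

lemma cabs_add_le: "cabs (x :: 'c) \<le> B \<Longrightarrow> cabs y \<le> B \<Longrightarrow> cabs (x + y) \<le> B" using cabs_add[of x y] by linarith

lemma cabs_diff_le: "cabs (x :: 'c) \<le> B \<Longrightarrow> cabs y \<le> B \<Longrightarrow> cabs (x - y) \<le> B"
  using cabs_diff[of x y] by linarith

lemma cabs_add_less: "cabs (x :: 'c) < B \<Longrightarrow> cabs y < B \<Longrightarrow> cabs (x + y) < B" using cabs_add[of x y] by linarith

lemma cabs_diff_less: "cabs (x :: 'c) < B \<Longrightarrow> cabs y < B \<Longrightarrow> cabs (x - y) < B" using cabs_diff[of x y] by linarith

lemma cabs_diff_triangle: "cabs (x - y :: 'c) \<le> B \<Longrightarrow> cabs (y - z) \<le> B \<Longrightarrow> cabs (x - z) \<le> B"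
  using cabs_add_le[of "x - y" B "y - z"] by simp

lemma cabs_diff_triangle_less: "cabs (x - y :: 'c) < B \<Longrightarrow> cabs (y - z) < B \<Longrightarrow> cabs (x - z) < B"
  using cabs_add_less[of "x - y" B "y - z"] by simp

lemma cabs_sum_le:
  assumes "\<And>i. i \<in> A \<Longrightarrow> cabs (f i :: 'c) \<le> B" "B \<ge> 0"
  shows "cabs (sum f A) \<le> B"
  using assms(1)
proof (induction A rule: infinite_finite_induct)
  case (insert x F)
  then show ?case by (simp add: cabs_add_le)
qed (use assms(2) in auto)

lemma cabs_prod: "cabs (prod f A :: 'c) = (\<Prod>i\<in>A. cabs (f i))" by (induction A rule: infinite_finite_induct) auto

lemma cabs_of_nat_le: "cabs (of_nat n :: 'c) \<le> 1" by (induction n) (auto intro: cabs_add_le)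

lemma cabs_of_int_le: "cabs (of_int n :: 'c) \<le> 1"
  by (cases n) (use cabs_of_nat_le in \<open>auto simp: cabs_of_nat_le simp del: of_nat_Suc\<close>)

text \<open>Equality in the ultrametric inequality when the values differ: y is recovered as (x + y)
  - x, so its value cannot exceed both others. Most exact absolute values below come from
  this.\<close>

lemma cabs_add_eq: "cabs (x :: 'c) < cabs y \<Longrightarrow> cabs (x + y) = cabs y"
proof -
  assume a: "cabs x < cabs y"
  have "cabs y \<le> max (cabs (x + y)) (cabs x)" using cabs_diff[of "x + y" x] by simp
  moreover have "cabs (x + y) \<le> cabs y" using cabs_add[of x y] a by simp
  ultimately show ?thesis using a by linarith
qed

lemma cabs_eq_of_near: "cabs (x - y :: 'c) < cabs y \<Longrightarrow> cabs x = cabs y" using cabs_add_eq[of "x - y" y] by simp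

lemma cabs_eq_of_near': "cabs (x - y :: 'c) < B \<Longrightarrow> cabs y = B \<Longrightarrow> cabs x = B" using cabs_eq_of_near[of x y] by simp

text \<open>By Bezout, v a = 1 - u p has value 1; as neither v nor a exceeds 1, both have value
  1.\<close>

lemma cabs_of_int_unit:
  assumes "\<not> int p dvd a" shows "cabs (of_int a :: 'c) = 1"
proof -
  have "coprime (int p) a" using p_prime assms by (simp add: prime_imp_coprime)
  then obtain u v where "u * int p + v * a = 1" using bezout_int[of "int p" a] by auto
  then have "(of_int (u * int p + v * a) :: 'c) = 1" by simp
  then have "of_int v * of_int a = 1 - of_int u * (of_nat p :: 'c)" by (simp add: algebra_simps)
  moreover have "cabs (of_int u * (of_nat p :: 'c)) < 1"
  proof -
    have "cabs (of_int u :: 'c) * cabs (of_nat p :: 'c) \<le> 1 * cabs (of_nat p :: 'c)" using cabs_of_int_le by (intro mult_right_mono) auto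
    then show ?thesis using cabs_p_less_1 by simp
  qed
  then have "cabs (1 - of_int u * (of_nat p :: 'c)) = 1" using cabs_eq_of_near[of "1 - of_int u * (of_nat p :: 'c)" 1] by simp
  ultimately have "cabs (of_int v :: 'c) * cabs (of_int a :: 'c) = 1" by (metis cabs_mult)
  moreover have "cabs (of_int v :: 'c) \<le> 1" "cabs (of_int a :: 'c) \<le> 1" by (rule cabs_of_int_le)+
  ultimately show ?thesis using mult_left_le_one_le[of "cabs (of_int a :: 'c)" "cabs (of_int v :: 'c)"] by simp
qed

lemma cabs_of_nat_unit: "\<not> p dvd n \<Longrightarrow> cabs (of_nat n :: 'c) = 1"
  using cabs_of_int_unit[of "int n"] by (metis int_dvd_int_iff of_int_of_nat_eq)

lemma cabs_of_nat_less_1_iff: "cabs (of_nat n :: 'c) < 1 \<longleftrightarrow> p dvd n"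
proof
  assume "p dvd n"
  then obtain k where "n = p * k" by blast
  then have "cabs (of_nat n :: 'c) = cabs (of_nat p :: 'c) * cabs (of_nat k :: 'c)" by simp
  also have "\<dots> \<le> cabs (of_nat p :: 'c) * 1" using cabs_of_nat_le by (intro mult_left_mono) auto
  finally show "cabs (of_nat n :: 'c) < 1" using cabs_p_less_1 by simp
qed (use cabs_of_nat_unit in force)

section \<open>Convergence and closed sets for an ultrametric absolute value\<close>

lemma LIMSEQ_cabs: "X \<longlonglongrightarrow> (l::'c) \<longleftrightarrow> (\<forall>e>0. \<exists>N. \<forall>n\<ge>N. cabs (X n - l) < e)"
  by (simp add: LIMSEQ_def dist_cabs)

lemma LIMSEQ_cabs_unique:
  assumes "\<And>e. e > 0 \<Longrightarrow> cabs (x - y :: 'c) \<le> e" shows "x = y"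
proof -
  have "cabs (x - y) \<le> 0" by (rule field_le_epsilon) (use assms in auto)
  then show ?thesis by simp
qed

lemma small_power: "cabs (x::'c) < 1 \<Longrightarrow> e > 0 \<Longrightarrow> \<exists>n. cabs x ^ n < e" by (simp add: real_arch_pow_inv)

lemma small_power_mono:
  assumes "0 \<le> (r::real)" "r < 1" "e > 0" shows "\<exists>N. \<forall>n\<ge>N. r ^ n < e"
proof -
  obtain N where N: "r ^ N < e" using assms real_arch_pow_inv by blast
  have "r ^ n < e" if "n \<ge> N" for n using power_decreasing[OF that assms(1)] assms N by simp
  then show ?thesis by blast
qed

lemma eq_of_cabs_le_power:
  assumes "0 \<le> r" "r < 1" "\<And>N. cabs (x - y :: 'c) \<le> r ^ N" shows "x = y"
  by (rule LIMSEQ_cabs_unique) (meson assms less_eq_real_def order_trans real_arch_pow_inv)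

lemma cabs_le_limit:
  assumes "X \<longlonglongrightarrow> (l::'c)" "\<And>n. n \<ge> N \<Longrightarrow> cabs (X n - a) \<le> B" shows "cabs (l - a) \<le> B"
proof (rule field_le_epsilon)
  fix e :: real assume "e > 0"
  then obtain M where "\<forall>n\<ge>M. cabs (X n - l) < e" using assms(1) LIMSEQ_cabs by blast
  then have *: "cabs (l - X (max M N)) \<le> e" by (simp add: cabs_minus_commute less_imp_le)
  have "0 \<le> B" using assms(2)[of N] cabs_nonneg[of "X N - a"] by linarith
  with \<open>e > 0\<close> have "cabs (X (max M N) - a) \<le> B + e" "cabs (l - X (max M N)) \<le> B + e" using assms(2)[of "max M N"] * by auto
  then show "cabs (l - a) \<le> B + e" using cabs_diff_triangle by blast
qed

text \<open>The ultrametric inequality bounds the distance of any two late terms by the largest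
  distance of consecutive ones. Hence a series converges as soon as its terms tend to 0.\<close>

lemma nonarch_Cauchy:
  assumes "\<And>e. e > 0 \<Longrightarrow> \<exists>N. \<forall>n\<ge>N. cabs (X (Suc n) - X n :: 'c) < e"
  shows "convergent X"
proof -
  have "Cauchy X"
  proof (rule CauchyI')
    fix e :: real assume "e > 0"
    then obtain N where N: "\<forall>n\<ge>N. cabs (X (Suc n) - X n) < e" using assms by blast
    have "cabs (X (m + k) - X m) < e" if "m \<ge> N" for m k
    proof (induction k)
      case (Suc k)
      then show ?case using N that cabs_diff_triangle_less[of "X (Suc (m+k))" "X (m+k)" e "X m"] by simp
    qed (use \<open>e > 0\<close> in simp)
    then show "\<exists>M. \<forall>m\<ge>M. \<forall>n>m. dist (X m) (X n) < e" by (metis dist_cabs dist_commute less_imp_add_positive)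
  qed
  then show ?thesis by (simp add: Cauchy_convergent_iff)
qed

lemma nonarch_sums:
  assumes "\<And>e. e > 0 \<Longrightarrow> \<exists>N. \<forall>n\<ge>N. cabs (a n :: 'c) < e"
  shows "\<exists>l. (\<lambda>n. \<Sum>i<n. a i) \<longlonglongrightarrow> l"
  using nonarch_Cauchy[of "\<lambda>n. \<Sum>i<n. a i"] assms by (simp add: convergent_def)

lemma cabs_sum_diff_le:
  fixes N n :: nat
  assumes "\<And>i. i \<ge> N \<Longrightarrow> cabs (a i :: 'c) \<le> B" "n \<ge> N" "B \<ge> 0"
  shows "cabs ((\<Sum>i<n. a i) - (\<Sum>i<N. a i)) \<le> B"
proof -
  have "(\<Sum>i<n. a i) - (\<Sum>i<N. a i) = (\<Sum>i=N..<n. a i)" using sum_diff_nat_ivl[of 0 N n a] assms(2) by (simp add: lessThan_atLeast0)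
  then show ?thesis using assms by (auto intro: cabs_sum_le)
qed

lemma closure_cabs: "x \<in> closure (A :: 'c set) \<longleftrightarrow> (\<forall>e>0. \<exists>a\<in>A. cabs (x - a) < e)"
  by (simp add: closure_approachable dist_cabs cabs_minus_commute)

lemma closed_cabs:
  "closed (A :: 'c set) \<longleftrightarrow> (\<forall>x. (\<forall>e>0. \<exists>a\<in>A. cabs (x - a) < e) \<longrightarrow> x \<in> A)"
proof -
  have "closed A \<longleftrightarrow> closure A \<subseteq> A" by (metis closure_closed closed_closure closure_subset subset_antisym order_refl)
  then show ?thesis unfolding closure_cabs[symmetric] by blast
qed

lemma closed_LIMSEQ: "closed (A::'c set) \<Longrightarrow> (\<And>n. X n \<in> A) \<Longrightarrow> X \<longlonglongrightarrow> l \<Longrightarrow> l \<in> A"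
  by (rule closed_sequentially)

lemma continuous_cabs:
  "continuous_on A (f :: 'c \<Rightarrow> 'c) \<longleftrightarrow>
    (\<forall>x\<in>A. \<forall>e>0. \<exists>d>0. \<forall>y\<in>A. cabs (y - x) < d \<longrightarrow> cabs (f y - f x) < e)"
  by (simp add: continuous_on_iff dist_cabs)

lemma cabs_le_1_power: "cabs (x::'c) \<le> 1 \<Longrightarrow> cabs (x ^ n) \<le> 1" by (simp add: power_le_one)

lemma cabs_le_1_mult: "cabs (x::'c) \<le> 1 \<Longrightarrow> cabs y \<le> 1 \<Longrightarrow> cabs (x * y) \<le> 1" by (simp add: mult_le_one)

lemma cabs_mult_le: "cabs (x::'c) \<le> 1 \<Longrightarrow> cabs y \<le> B \<Longrightarrow> cabs (x * y) \<le> B"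
  by (smt (verit) cabs_mult cabs_nonneg mult_left_le_one_le)

lemma cabs_mult_less: "cabs (x::'c) \<le> 1 \<Longrightarrow> cabs y < B \<Longrightarrow> cabs (x * y) < B"
  by (smt (verit) cabs_mult cabs_nonneg mult_left_le_one_le)

end

section \<open>Subfields and algebraic closures\<close>

text \<open>A predicate on subsets, because all fields that occur (\<open>Qp\<close>,
  \<open>L\<close>, closures and algebraic closures) lie inside one type.\<close>

definition subfld :: "'a::field set \<Rightarrow> bool" where
  "subfld K \<longleftrightarrow> 1 \<in> K \<and> (\<forall>x\<in>K. \<forall>y\<in>K. x + y \<in> K \<and> x * y \<in> K) \<and>
     (\<forall>x\<in>K. - x \<in> K \<and> inverse x \<in> K)"

lemma subfld_1: "subfld K \<Longrightarrow> 1 \<in> K"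
  and subfld_add: "subfld K \<Longrightarrow> x \<in> K \<Longrightarrow> y \<in> K \<Longrightarrow> x + y \<in> K"
  and subfld_mult: "subfld K \<Longrightarrow> x \<in> K \<Longrightarrow> y \<in> K \<Longrightarrow> x * y \<in> K"
  and subfld_minus: "subfld K \<Longrightarrow> x \<in> K \<Longrightarrow> - x \<in> K"
  and subfld_inverse: "subfld K \<Longrightarrow> x \<in> K \<Longrightarrow> inverse x \<in> K" by (auto simp: subfld_def)

lemma subfld_0: "subfld K \<Longrightarrow> 0 \<in> K" using subfld_1[of K] subfld_minus[of K 1] subfld_add[of K 1 "-1"] by simp

lemma subfld_diff: "subfld K \<Longrightarrow> x \<in> K \<Longrightarrow> y \<in> K \<Longrightarrow> x - y \<in> K"
  using subfld_add[of K x "-y"] subfld_minus[of K y] by simp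

lemma subfld_divide: "subfld K \<Longrightarrow> x \<in> K \<Longrightarrow> y \<in> K \<Longrightarrow> x / y \<in> K"
  using subfld_mult[of K x "inverse y"] subfld_inverse[of K y] by (simp add: divide_inverse)

lemma subfld_sum: "subfld K \<Longrightarrow> (\<And>i. i \<in> A \<Longrightarrow> f i \<in> K) \<Longrightarrow> sum f A \<in> K"
  by (induction A rule: infinite_finite_induct) (auto simp: subfld_0 subfld_add)

lemma subfld_prod: "subfld K \<Longrightarrow> (\<And>i. i \<in> A \<Longrightarrow> f i \<in> K) \<Longrightarrow> prod f A \<in> K"
  by (induction A rule: infinite_finite_induct) (auto simp: subfld_1 subfld_mult)

lemma subfld_power: "subfld K \<Longrightarrow> x \<in> K \<Longrightarrow> x ^ n \<in> K" by (induction n) (auto simp: subfld_1 subfld_mult)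

lemma subfld_of_nat: "subfld K \<Longrightarrow> of_nat n \<in> K" by (induction n) (auto simp: subfld_0 subfld_1 subfld_add)

lemma subfld_of_int: "subfld K \<Longrightarrow> of_int n \<in> K" by (cases n) (auto simp: subfld_of_nat subfld_minus simp del: of_nat_Suc)

lemmas subfld_intros = subfld_0 subfld_1 subfld_add subfld_mult subfld_minus subfld_inverse
  subfld_diff subfld_divide subfld_sum subfld_prod subfld_power subfld_of_nat subfld_of_int

section \<open>Finite linear combinations over a subfield\<close>

definition lspan :: "'a::field set \<Rightarrow> 'a set \<Rightarrow> 'a set" where
  "lspan K B = {x. \<exists>c. (\<forall>b\<in>B. c b \<in> K) \<and> x = (\<Sum>b\<in>B. c b * b)}"

lemma lspanI: "(\<And>b. b \<in> B \<Longrightarrow> c b \<in> K) \<Longrightarrow> (\<Sum>b\<in>B. c b * b) \<in> lspan K B"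
  unfolding lspan_def by auto

lemma lspan_0: "subfld K \<Longrightarrow> 0 \<in> lspan K B" unfolding lspan_def by (auto intro!: exI[of _ "\<lambda>_. 0"] simp: subfld_0)

lemma lspan_add:
  assumes "subfld K" "x \<in> lspan K B" "y \<in> lspan K B" shows "x + y \<in> lspan K B"
proof -
  obtain c d where "\<forall>b\<in>B. c b \<in> K" "x = (\<Sum>b\<in>B. c b * b)" "\<forall>b\<in>B. d b \<in> K" "y = (\<Sum>b\<in>B. d b * b)"
    using assms unfolding lspan_def by auto
  then have "\<forall>b\<in>B. c b + d b \<in> K" "x + y = (\<Sum>b\<in>B. (c b + d b) * b)"
    using assms(1) by (auto simp: subfld_add sum.distrib distrib_right)
  then show ?thesis using lspanI[of B "\<lambda>b. c b + d b" K] by auto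
qed

lemma lspan_mult:
  assumes "subfld K" "x \<in> lspan K B" "a \<in> K" shows "a * x \<in> lspan K B"
proof -
  obtain c where "\<forall>b\<in>B. c b \<in> K" "x = (\<Sum>b\<in>B. c b * b)" using assms unfolding lspan_def by auto
  then have "\<forall>b\<in>B. a * c b \<in> K" "a * x = (\<Sum>b\<in>B. (a * c b) * b)"
    using assms by (auto simp: subfld_mult sum_distrib_left mult.assoc)
  then show ?thesis using lspanI[of B "\<lambda>b. a * c b" K] by auto
qed

lemma lspan_minus: "subfld K \<Longrightarrow> x \<in> lspan K B \<Longrightarrow> - x \<in> lspan K B"
  using lspan_mult[of K x B "-1"] by (simp add: subfld_minus subfld_1)

lemma lspan_diff: "subfld K \<Longrightarrow> x \<in> lspan K B \<Longrightarrow> y \<in> lspan K B \<Longrightarrow> x - y \<in> lspan K B"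
  using lspan_add[of K x B "-y"] lspan_minus[of K y B] by simp

lemma lspan_base:
  assumes "subfld K" "finite B" "b \<in> B" shows "b \<in> lspan K B"
proof -
  have "(\<Sum>x\<in>B. (if x = b then 1 else 0) * x) = b" using assms by (subst sum.cong[OF refl, of _ _ "\<lambda>x. if x = b then b else 0"]) auto
  then show ?thesis unfolding lspan_def using assms by (auto intro!: exI[of _ "\<lambda>x. if x = b then 1 else 0"] simp: subfld_0 subfld_1)
qed

lemma lspan_sum: "subfld K \<Longrightarrow> (\<And>i. i \<in> A \<Longrightarrow> f i \<in> lspan K B) \<Longrightarrow> sum f A \<in> lspan K B"
  by (induction A rule: infinite_finite_induct) (auto simp: lspan_0 lspan_add)

lemma lspan_insert:
  assumes "finite B" "b \<notin> B"
  shows "x \<in> lspan K (insert b B) \<longleftrightarrow> (\<exists>a\<in>K. \<exists>w\<in>lspan K B. x = a * b + w)"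
proof
  assume "x \<in> lspan K (insert b B)"
  then obtain c where "\<forall>b\<in>insert b B. c b \<in> K" "x = (\<Sum>b\<in>insert b B. c b * b)" unfolding lspan_def by auto
  then show "\<exists>a\<in>K. \<exists>w\<in>lspan K B. x = a * b + w" using assms unfolding lspan_def by auto
next
  assume "\<exists>a\<in>K. \<exists>w\<in>lspan K B. x = a * b + w"
  then obtain a c where "a \<in> K" "\<forall>b\<in>B. c b \<in> K" "x = a * b + (\<Sum>b\<in>B. c b * b)" unfolding lspan_def by auto
  moreover have "(\<Sum>x\<in>B. c x * x) = (\<Sum>x\<in>B. (c(b := a)) x * x)" using assms by (intro sum.cong) auto
  ultimately have "(\<forall>x\<in>insert b B. (c(b := a)) x \<in> K) \<and> x = (\<Sum>x\<in>insert b B. (c(b := a)) x * x)" using assms by auto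
  then show "x \<in> lspan K (insert b B)" unfolding lspan_def by blast
qed

lemma lspan_subset:
  assumes "subfld K" "finite B" "finite B'" "B \<subseteq> lspan K B'" shows "lspan K B \<subseteq> lspan K B'"
proof
  fix x assume "x \<in> lspan K B"
  then obtain c where "\<forall>b\<in>B. c b \<in> K" "x = (\<Sum>b\<in>B. c b * b)" unfolding lspan_def by auto
  then show "x \<in> lspan K B'" using assms by (auto intro!: lspan_sum lspan_mult)
qed

text \<open>Gaussian elimination: a vector with nonzero coordinate at the generator b serves as
  pivot, and subtracting multiples of it moves the other vectors into the span of one generator
  fewer.\<close>

lemma lspan_dependent:
  assumes "subfld K" "finite B" "finite I" "card B < card I" "\<And>i. i \<in> I \<Longrightarrow> v i \<in> lspan K B"
  shows "\<exists>c. (\<forall>i\<in>I. c i \<in> K) \<and> (\<exists>i\<in>I. c i \<noteq> 0) \<and> (\<Sum>i\<in>I. c i * v i) = 0"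
  using assms(2-)
proof (induction B arbitrary: I v rule: finite_induct)
  case empty
  then have "I \<noteq> {}" "\<forall>i\<in>I. v i = 0" by (auto simp: lspan_def)
  then show ?case using subfld_1[OF assms(1)] by (intro exI[of _ "\<lambda>_. 1"]) auto
next
  case (insert b B)
  have "\<forall>i\<in>I. \<exists>a w. a \<in> K \<and> w \<in> lspan K B \<and> v i = a * b + w"
    using insert.prems(3) insert.hyps by (auto simp: lspan_insert) blast
  then obtain a w where aw: "\<And>i. i \<in> I \<Longrightarrow> a i \<in> K \<and> w i \<in> lspan K B \<and> v i = a i * b + w i" by metis
  show ?case
  proof (cases "\<exists>i\<in>I. a i \<noteq> 0")
    case False
    then have "\<And>i. i \<in> I \<Longrightarrow> v i \<in> lspan K B" using aw by auto
    then show ?thesis using insert.IH[of I v] insert.prems insert.hyps by auto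
  next
    case True
    then obtain j where j: "j \<in> I" "a j \<noteq> 0" by blast
    define v' where "v' i = v i - (a i / a j) * v j" for i
    have v': "v' i = w i - (a i / a j) * w j" if "i \<in> I" for i using aw[OF that] aw[OF j(1)] j(2) by (simp add: v'_def field_simps)
    have "v' i \<in> lspan K B" if "i \<in> I - {j}" for i
    proof -
      have "i \<in> I" "a i / a j \<in> K" using that aw j assms(1) subfld_divide[of K "a i" "a j"] by auto
      then have "w i - (a i / a j) * w j \<in> lspan K B" using aw j assms(1) by (intro lspan_diff lspan_mult) auto
      then show ?thesis using v' \<open>i \<in> I\<close> by simp
    qed
    moreover have "card B < card (I - {j})" using insert.prems insert.hyps j by auto
    ultimately obtain c where c: "\<forall>i\<in>I-{j}. c i \<in> K" "\<exists>i\<in>I-{j}. c i \<noteq> 0"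
        "(\<Sum>i\<in>I-{j}. c i * v' i) = 0" using insert.IH[of "I - {j}" v'] insert.prems by auto
    \<comment> \<open>The coefficient of the pivot undoes the multiples of \<open>v j\<close> that
      were subtracted in the elimination.\<close>
    define d where "d = c(j := - (\<Sum>i\<in>I-{j}. c i * (a i / a j)))"
    have "d j \<in> K" unfolding d_def using c(1) aw j assms(1) by (auto intro!: subfld_minus subfld_sum subfld_mult subfld_divide)
    then have "\<forall>i\<in>I. d i \<in> K" using c(1) by (auto simp: d_def)
    moreover have "\<exists>i\<in>I. d i \<noteq> 0" using c(2) by (auto simp: d_def)
    moreover have "(\<Sum>i\<in>I. d i * v i) = 0"
    proof -
      have "(\<Sum>i\<in>I. d i * v i) = d j * v j + (\<Sum>i\<in>I-{j}. c i * v i)"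
        using j insert.prems(1) by (subst sum.remove[of I j]) (auto simp: d_def)
      also have "(\<Sum>i\<in>I-{j}. c i * v i) = (\<Sum>i\<in>I-{j}. c i * v' i) + (\<Sum>i\<in>I-{j}. c i * (a i / a j)) * v j"
      proof -
        have "c i * v i = c i * v' i + c i * (a i / a j) * v j" for i by (simp add: v'_def right_diff_distrib)
        then show ?thesis by (simp add: sum.distrib sum_distrib_right)
      qed
      also have "d j * v j + \<dots> = 0" by (simp add: c(3) d_def)
      finally show ?thesis .
    qed
    ultimately show ?thesis by blast
  qed
qed

section \<open>Algebraic elements over a subfield\<close>

lemma alg_closure_inI: "f \<noteq> 0 \<Longrightarrow> (\<And>i. coeff f i \<in> K) \<Longrightarrow> poly f x = 0 \<Longrightarrow> x \<in> alg_closure_in K"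
  unfolding alg_closure_in_def by auto

lemma alg_closure_in_mono: "K \<subseteq> K' \<Longrightarrow> alg_closure_in K \<subseteq> alg_closure_in K'" unfolding alg_closure_in_def by blast

lemma subset_alg_closure_in: "subfld K \<Longrightarrow> K \<subseteq> alg_closure_in K"
proof
  fix x assume "subfld K" "x \<in> K"
  then show "x \<in> alg_closure_in K" by (intro alg_closure_inI[of "[:-x, 1:]"]) (auto simp: coeff_pCons subfld_intros split: nat.splits)
qed

text \<open>The powers with exponents 0 to \<open>card B\<close> outnumber the generators by one; a
  dependence between them is the polynomial.\<close>

lemma alg_closure_in_of_powers:
  assumes "subfld K" "finite B" "\<And>k. x ^ k \<in> lspan K B"
  shows "x \<in> alg_closure_in K"
proof -
  obtain c where c: "\<forall>i\<in>{..card B}. c i \<in> K" "\<exists>i\<in>{..card B}. c i \<noteq> 0" "(\<Sum>i\<le>card B. c i * x ^ i) = 0"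
    using lspan_dependent[of K B "{..card B}" "\<lambda>k. x ^ k"] assms by auto
  define f where "f = (\<Sum>i\<le>card B. monom (c i) i)"
  have cf: "coeff f i = (if i \<le> card B then c i else 0)" for i unfolding f_def by (simp add: coeff_sum)
  show ?thesis
  proof (rule alg_closure_inI)
    show "f \<noteq> 0" using c(2) cf by (metis atMost_iff coeff_0)
    show "coeff f i \<in> K" for i using c(1) assms(1) by (auto simp: cf subfld_0)
    show "poly f x = 0" using c(3) by (simp add: f_def poly_sum poly_monom)
  qed
qed

text \<open>Subrings of a finitely generated \<open>K\<close>-module replace finite extensions: they need not be given by a basis.\<close>

definition finK :: "'a::field set \<Rightarrow> 'a set \<Rightarrow> bool" where
  "finK K R \<longleftrightarrow> K \<subseteq> R \<and> (\<forall>x\<in>R. \<forall>y\<in>R. x + y \<in> R \<and> x * y \<in> R) \<and>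
     (\<exists>B. finite B \<and> R \<subseteq> lspan K B)"

lemma finK_self: "subfld K \<Longrightarrow> finK K K"
  unfolding finK_def using lspanI[of "{1}" "\<lambda>_. x" K for x] by (auto simp: subfld_add subfld_mult intro!: exI[of _ "{1}"])

lemma finK_power: "subfld K \<Longrightarrow> finK K R \<Longrightarrow> x \<in> R \<Longrightarrow> x ^ k \<in> R"
  by (induction k) (auto simp: finK_def subfld_1 subset_iff)

lemma finK_alg: "subfld K \<Longrightarrow> finK K R \<Longrightarrow> x \<in> R \<Longrightarrow> x \<in> alg_closure_in K"
proof -
  assume *: "subfld K" "finK K R" "x \<in> R"
  then obtain B where "finite B" "R \<subseteq> lspan K B" unfolding finK_def by blast
  then show ?thesis using alg_closure_in_of_powers[of K B x] finK_power[OF *] * by blast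
qed

text \<open>The new ring consists of the R-combinations of 1, x, ..., x^(d-1). It is closed under
  multiplication by x because the given relation rewrites x^d, hence closed under all products. The
  products of generators of R with these powers generate it over K.\<close>

lemma finK_adjoin:
  assumes K: "subfld K" and R: "finK K R"
    and x: "x ^ d = (\<Sum>i<d. a i * x ^ i)" "\<And>i. i < d \<Longrightarrow> a i \<in> R" "d > 0"
  shows "\<exists>R'. finK K R' \<and> R \<subseteq> R' \<and> x \<in> R'"
proof -
  define R' where "R' = {y. \<exists>r. (\<forall>i<d. r i \<in> R) \<and> y = (\<Sum>i<d. r i * x ^ i)}"
  obtain B where B: "finite B" "R \<subseteq> lspan K B" using R by (auto simp: finK_def)
  have Radd: "\<And>x y. x \<in> R \<Longrightarrow> y \<in> R \<Longrightarrow> x + y \<in> R" and Rmult: "\<And>x y. x \<in> R \<Longrightarrow> y \<in> R \<Longrightarrow> x * y \<in> R"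
    and KR: "K \<subseteq> R" using R by (auto simp: finK_def)
  have R0: "0 \<in> R" "1 \<in> R" using K KR by (auto simp: subfld_0 subfld_1 subset_iff)
  have I: "(\<Sum>i<d. r i * x ^ i) \<in> R'" if "\<And>i. i < d \<Longrightarrow> r i \<in> R" for r unfolding R'_def using that by auto
  have add: "y + z \<in> R'" if h: "y \<in> R'" "z \<in> R'" for y z
  proof -
    obtain r where "\<forall>i<d. r i \<in> R" "y = (\<Sum>i<d. r i * x ^ i)" using h unfolding R'_def by blast
    moreover obtain s where "\<forall>i<d. s i \<in> R" "z = (\<Sum>i<d. s i * x ^ i)" using h unfolding R'_def by blast
    ultimately have "y + z = (\<Sum>i<d. (r i + s i) * x ^ i)" "\<forall>i<d. r i + s i \<in> R" by (auto simp: distrib_right sum.distrib Radd)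
    then show ?thesis using I[of "\<lambda>i. r i + s i"] by auto
  qed
  have scale: "r * y \<in> R'" if h: "r \<in> R" "y \<in> R'" for r y
  proof -
    obtain s where "\<forall>i<d. s i \<in> R" "y = (\<Sum>i<d. s i * x ^ i)" using h unfolding R'_def by blast
    then have "r * y = (\<Sum>i<d. (r * s i) * x ^ i)" "\<forall>i<d. r * s i \<in> R" using h by (auto simp: sum_distrib_left mult.assoc Rmult)
    then show ?thesis using I[of "\<lambda>i. r * s i"] by auto
  qed
  have pw: "x ^ i \<in> R'" if "i < d" for i
  proof -
    have "(\<Sum>j<d. (if j = i then 1 else 0) * x ^ j) = x ^ i"
      using that by (subst sum.cong[OF refl, of _ _ "\<lambda>j. if j = i then x ^ i else 0"]) auto
    then show ?thesis using I[of "\<lambda>j. if j = i then 1 else 0"] R0 by auto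
  qed
  have sum: "sum f A \<in> R'" if "\<And>i. i \<in> A \<Longrightarrow> f i \<in> R'" for f and A :: "nat set" using that
  proof (induction A rule: infinite_finite_induct)
    case (insert x F) then show ?case by (auto simp: add)
  qed (use scale[OF R0(1) pw[OF x(3)]] in auto)
  have xmul: "x * y \<in> R'" if h: "y \<in> R'" for y
  proof -
    obtain s where s: "\<forall>i<d. s i \<in> R" "y = (\<Sum>i<d. s i * x ^ i)" using h unfolding R'_def by blast
    have "x * y = (\<Sum>i<d. s i * x ^ Suc i)" unfolding s by (simp add: sum_distrib_left mult_ac)
    moreover have "x ^ Suc i \<in> R'" if "i < d" for i
    proof (cases "Suc i < d")
      case True then show ?thesis by (rule pw)
    next
      case False
      then have "Suc i = d" using that by simp
      then show ?thesis using x I[of a] by simp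
    qed
    ultimately show ?thesis using s(1) by (simp only:) (intro sum scale; simp)
  qed
  have xpow: "x ^ k * y \<in> R'" if "y \<in> R'" for k y using that by (induction k) (auto simp: mult.assoc xmul)
  have mult: "y * z \<in> R'" if h: "y \<in> R'" "z \<in> R'" for y z
  proof -
    obtain s where s: "\<forall>i<d. s i \<in> R" "y = (\<Sum>i<d. s i * x ^ i)" using h unfolding R'_def by blast
    then have "y * z = (\<Sum>i<d. s i * (x ^ i * z))" by (simp add: sum_distrib_right mult.assoc)
    then show ?thesis using s h by (auto intro!: sum scale xpow)
  qed
  have RR': "R \<subseteq> R'" using scale[OF _ pw[OF x(3)]] by auto
  define B' where "B' = (\<lambda>(b,i). b * x ^ i) ` (B \<times> {..<d})"
  have B': "finite B'" using B by (auto simp: B'_def)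
  have "R' \<subseteq> lspan K B'"
  proof
    fix y assume "y \<in> R'"
    then obtain s where s: "\<forall>i<d. s i \<in> R" "y = (\<Sum>i<d. s i * x ^ i)" by (auto simp: R'_def)
    have "s i * x ^ i \<in> lspan K B'" if "i < d" for i
    proof -
      have "s i \<in> lspan K B" using s(1) that B(2) by auto
      then obtain c where "\<forall>b\<in>B. c b \<in> K" "s i = (\<Sum>b\<in>B. c b * b)" unfolding lspan_def by auto
      then have "s i * x ^ i = (\<Sum>b\<in>B. c b * (b * x ^ i))" by (simp add: sum_distrib_right mult.assoc)
      also have "\<dots> \<in> lspan K B'"
        using \<open>\<forall>b\<in>B. c b \<in> K\<close> that B' K by (intro lspan_sum lspan_mult lspan_base) (auto simp: B'_def)
      finally show ?thesis .
    qed
    then show "y \<in> lspan K B'" using s K by (auto intro!: lspan_sum)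
  qed
  then have "finK K R'" unfolding finK_def using RR' KR B' add mult by blast
  moreover have "x \<in> R'" using xmul[OF subsetD[OF RR' R0(2)]] by simp
  ultimately show ?thesis using RR' by blast
qed

lemma poly_root_power:
  fixes f :: "'a::field poly"
  assumes "poly f x = 0" "degree f > 0"
  shows "x ^ degree f = (\<Sum>i<degree f. (- coeff f i / lead_coeff f) * x ^ i)"
proof -
  let ?l = "lead_coeff f"
  have l: "?l \<noteq> 0" using assms(2) by auto
  have "(\<Sum>i\<le>degree f. coeff f i * x ^ i) = 0" using assms(1) by (simp add: poly_altdef)
  then have "?l * x ^ degree f = - (\<Sum>i<degree f. coeff f i * x ^ i)" by (simp add: lessThan_Suc_atMost[symmetric] add_eq_0_iff2 add.commute)
  then have "x ^ degree f = - (\<Sum>i<degree f. coeff f i * x ^ i) / ?l" using l by (simp add: field_simps)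
  also have "\<dots> = (\<Sum>i<degree f. (- coeff f i / ?l) * x ^ i)" by (simp add: sum_divide_distrib sum_negf)
  finally show ?thesis .
qed

lemma alg_root_degree: "f \<noteq> 0 \<Longrightarrow> poly f x = 0 \<Longrightarrow> degree (f :: 'a::field poly) > 0"
  by (auto elim!: degree_eq_zeroE intro!: Nat.gr0I)

lemma finK_adjoin_alg:
  assumes K: "subfld K" and R: "finK K R" and x: "x \<in> alg_closure_in K"
  shows "\<exists>R'. finK K R' \<and> R \<subseteq> R' \<and> x \<in> R'"
proof -
  obtain f where f: "f \<noteq> 0" "\<And>i. coeff f i \<in> K" "poly f x = 0" using x unfolding alg_closure_in_def by auto
  have d: "degree f > 0" using alg_root_degree f by blast
  have "- coeff f i / lead_coeff f \<in> R" for i using f(2) K R subfld_divide[of K "- coeff f i" "lead_coeff f"] subfld_minus[of K "coeff f i"]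
    by (auto simp: finK_def)
  then show ?thesis using finK_adjoin[OF K R poly_root_power[OF f(3) d]] d by blast
qed

lemma finK_adjoin_finite:
  assumes K: "subfld K" and "finite A" "A \<subseteq> alg_closure_in K"
  shows "\<exists>R. finK K R \<and> A \<subseteq> R"
  using assms(2,3)
proof (induction A rule: finite_induct)
  case empty then show ?case using finK_self[OF K] by blast
next
  case (insert a A)
  then obtain R where "finK K R" "A \<subseteq> R" by auto
  then show ?case using finK_adjoin_alg[OF K, of R a] insert.prems by auto
qed

lemma alg_closure_in_inverse:
  assumes "x \<in> alg_closure_in K" shows "inverse x \<in> alg_closure_in K"
proof (cases "x = 0")
  case False
  obtain f where f: "f \<noteq> 0" "\<And>i. coeff f i \<in> K" "poly f x = 0" using assms unfolding alg_closure_in_def by auto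
  have "0 \<in> K" using f(2)[of "Suc (degree f)"] by (simp add: coeff_eq_0)
  then have "coeff (reflect_poly f) i \<in> K" for i using f(2) by (simp add: coeff_reflect_poly)
  moreover have "poly (reflect_poly f) (inverse x) = 0" using f(3) False by (simp add: poly_reflect_poly_nz)
  ultimately show ?thesis using f(1) by (intro alg_closure_inI[of "reflect_poly f"]) auto
qed (use assms in auto)

text \<open>Two algebraic elements lie in a common ring that is finite over K, and every element of
  such a ring is algebraic.\<close>

lemma subfld_alg_closure:
  assumes K: "subfld K" shows "subfld (alg_closure_in K)"
proof -
  have "x + y \<in> alg_closure_in K \<and> x * y \<in> alg_closure_in K \<and> - x \<in> alg_closure_in K"
    if h: "x \<in> alg_closure_in K" "y \<in> alg_closure_in K" for x y
  proof -
    obtain R where R: "finK K R" "x \<in> R" "y \<in> R"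
    proof -
      have "finite {x, y}" "{x, y} \<subseteq> alg_closure_in K" using h by auto
      from finK_adjoin_finite[OF K this] show ?thesis using that by blast
    qed
    have "-1 \<in> R" using R subfld_minus[OF K subfld_1[OF K]] by (auto simp: finK_def)
    then have "-1 * x \<in> R" using R by (meson finK_def)
    then show ?thesis using R finK_alg[OF K R(1)] by (auto simp: finK_def)
  qed
  then show ?thesis unfolding subfld_def using alg_closure_in_inverse subset_alg_closure_in[OF K] subfld_1[OF K] by blast
qed

text \<open>Transitivity of algebraicity: first the finitely many normalized coefficients are
  adjoined, then x, which satisfies a monic equation over the result.\<close>

lemma alg_closure_in_root:
  assumes K: "subfld K" and f: "f \<noteq> 0" "\<And>i. coeff f i \<in> alg_closure_in K" "poly f x = 0"
  shows "x \<in> alg_closure_in K"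
proof -
  have d: "degree f > 0" using alg_root_degree f by blast
  define A where "A = (\<lambda>i. - coeff f i / lead_coeff f) ` {..degree f}"
  have "A \<subseteq> alg_closure_in K" unfolding A_def using f(2) subfld_alg_closure[OF K] by (auto intro!: subfld_divide subfld_minus)
  moreover have "finite A" by (simp add: A_def)
  ultimately obtain R where R: "finK K R" "A \<subseteq> R" using finK_adjoin_finite[OF K] by blast
  have "- coeff f i / lead_coeff f \<in> R" if "i < degree f" for i using R(2) that unfolding A_def by force
  then obtain R' where "finK K R'" "x \<in> R'" using finK_adjoin[OF K R(1) poly_root_power[OF f(3) d]] d by blast
  then show ?thesis using finK_alg[OF K] by blast
qed

lemma alg_powers_lspan:
  assumes K: "subfld K" and f: "f \<noteq> 0" "\<And>i. coeff f i \<in> K" "poly f x = 0"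
  shows "x ^ k \<in> lspan K ((\<lambda>i. x ^ i) ` {..<degree f})"
proof (induction k rule: less_induct)
  case (less k)
  let ?d = "degree f" and ?B = "(\<lambda>i. x ^ i) ` {..<degree f}"
  have d: "?d > 0" using alg_root_degree f by blast
  show ?case
  proof (cases "k < ?d")
    case True then show ?thesis by (intro lspan_base K) auto
  next
    case False
    then have "x ^ k = x ^ ?d * x ^ (k - ?d)" by (simp add: power_add[symmetric])
    also have "\<dots> = (\<Sum>i<?d. (- coeff f i / lead_coeff f) * x ^ (i + (k - ?d)))"
      unfolding poly_root_power[OF f(3) d] by (simp add: sum_distrib_right mult.assoc power_add)
    also have "\<dots> \<in> lspan K ?B" using less False f(2) K by (intro lspan_sum lspan_mult subfld_divide subfld_minus) auto
    finally show ?thesis .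
  qed
qed

section \<open>The Galois group\<close>

context Cp begin

section \<open>Closed subfields and finite-dimensional spaces over them\<close>

lemma subfld_closure:
  assumes K: "subfld (K :: 'c set)" shows "subfld (closure K)"
proof -
  have "x + y \<in> closure K" "x * y \<in> closure K" if h: "x \<in> closure K" "y \<in> closure K" for x y
  proof -
    obtain X where X: "\<forall>n. X n \<in> K" "X \<longlonglongrightarrow> x" using h(1) closure_sequential by blast
    obtain Y where Y: "\<forall>n. Y n \<in> K" "Y \<longlonglongrightarrow> y" using h(2) closure_sequential by blast
    show "x + y \<in> closure K" unfolding closure_cabs
    proof (intro allI impI)
      fix e :: real assume "e > 0"
      then obtain a b where "a \<in> K" "b \<in> K" "cabs (x - a) < e" "cabs (y - b) < e" using h unfolding closure_cabs by meson
      then have "cabs ((x - a) + (y - b)) < e" by (intro cabs_add_less)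
      then show "\<exists>c\<in>K. cabs (x + y - c) < e"
        using subfld_add[OF K \<open>a \<in> K\<close> \<open>b \<in> K\<close>] by (intro bexI[of _ "a + b"]) (auto simp: algebra_simps)
    qed
    show "x * y \<in> closure K" unfolding closure_cabs
    proof (intro allI impI)
      fix e :: real assume e: "e > 0"
      \<comment> \<open>Each of the two error terms of a product is d times a factor below 1 + |x| +
        |y|; the cap 1 keeps |b| below that bound.\<close>
      define d where "d = min 1 (e / (1 + cabs x + cabs y))"
      have den: "1 + cabs x + cabs y > 0" using cabs_nonneg[of x] cabs_nonneg[of y] by linarith
      have "d \<le> e / (1 + cabs x + cabs y)" by (simp add: d_def)
      then have "d * (1 + cabs x + cabs y) \<le> e" using den by (simp add: pos_le_divide_eq)
      then have d: "d > 0" "d \<le> 1" "d * (1 + cabs x + cabs y) \<le> e" using e den by (auto simp: d_def)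
      then obtain a b where ab: "a \<in> K" "b \<in> K" "cabs (x - a) < d" "cabs (y - b) < d" using h unfolding closure_cabs by meson
      have "cabs b \<le> max (cabs y) (cabs (y - b))" using cabs_diff[of y "y - b"] by simp
      then have bb: "cabs b < 1 + cabs x + cabs y" using ab d cabs_nonneg[of x] cabs_nonneg[of y] by linarith
      have "cabs (x * (y - b)) < e"
      proof -
        have "cabs x * cabs (y - b) \<le> cabs x * d" using ab by (intro mult_left_mono) auto
        also have "\<dots> < (1 + cabs x + cabs y) * d" using d cabs_nonneg[of y] by (intro mult_strict_right_mono) linarith+
        finally show ?thesis using d by (simp add: mult.commute)
      qed
      moreover have "cabs ((x - a) * b) < e"
      proof -
        have "cabs (x - a) * cabs b \<le> d * cabs b" using ab by (intro mult_right_mono) auto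
        also have "\<dots> < d * (1 + cabs x + cabs y)" using d bb by (intro mult_strict_left_mono) auto
        finally show ?thesis using d by simp
      qed
      ultimately have "cabs (x * (y - b) + (x - a) * b) < e" by (rule cabs_add_less)
      then show "\<exists>c\<in>K. cabs (x * y - c) < e"
        using subfld_mult[OF K \<open>a \<in> K\<close> \<open>b \<in> K\<close>] by (intro bexI[of _ "a * b"]) (auto simp: algebra_simps)
    qed
  qed
  moreover have "- x \<in> closure K" if h: "x \<in> closure K" for x unfolding closure_cabs
  proof (intro allI impI)
    fix e :: real assume "e > 0"
    then obtain a where "a \<in> K" "cabs (x - a) < e" using h unfolding closure_cabs by meson
    then show "\<exists>c\<in>K. cabs (- x - c) < e"
      using subfld_minus[OF K \<open>a \<in> K\<close>] cabs_minus[of "x - a"] by (intro bexI[of _ "- a"]) auto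
  qed
  moreover have "inverse x \<in> closure K" if h: "x \<in> closure K" for x
  proof (cases "x = 0")
    case False
    show ?thesis unfolding closure_cabs
    proof (intro allI impI)
      fix e :: real assume e: "e > 0"
      \<comment> \<open>The first bound forces |a| = |x|, the second makes (a - x) / (x a) smaller
        than e.\<close>
      have "min (cabs x) (e * cabs x * cabs x) > 0" using e False by simp
      then obtain a where a: "a \<in> K" "cabs (x - a) < min (cabs x) (e * cabs x * cabs x)" using h unfolding closure_cabs by meson
      then have ax: "cabs a = cabs x" using cabs_eq_of_near[of a x] by (simp add: cabs_minus_commute)
      then have a0: "a \<noteq> 0" using False by auto
      have "inverse x - inverse a = (a - x) / (x * a)" using False a0 by (simp add: field_simps)
      then have "cabs (inverse x - inverse a) = cabs (x - a) / (cabs x * cabs x)" by (simp add: ax cabs_minus_commute)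
      also have "\<dots> < e" using a False by (simp add: field_simps)
      finally show "\<exists>c\<in>K. cabs (inverse x - c) < e" using subfld_inverse[OF K a(1)] by blast
    qed
  next
    case True then show ?thesis using h by simp
  qed
  moreover have "1 \<in> closure K" using closure_subset[of K] subfld_1[OF K] by blast
  ultimately show ?thesis by (simp add: subfld_def)
qed

lemma subfld_Rats: "subfld (\<rat> :: 'c set)" by (auto simp: subfld_def)

lemma subfld_Qp: "subfld (Qp :: 'c set)" unfolding Qp_def by (rule subfld_closure[OF subfld_Rats])

lemma closed_Qp: "closed (Qp :: 'c set)" by (simp add: Qp_def)

definition lin_on :: "'c set \<Rightarrow> 'c set \<Rightarrow> ('c \<Rightarrow> 'c) \<Rightarrow> bool" where
  "lin_on K V T \<longleftrightarrow> (\<forall>v\<in>V. \<forall>w\<in>V. T (v + w) = T v + T w) \<and> (\<forall>c\<in>K. \<forall>v\<in>V. T (c * v) = c * T v)"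

text \<open>The equivalence of norms over a complete field. Closedness and boundedness are proved
  together because the induction needs the former: a new generator b has positive distance from the
  closed smaller span, which bounds the coordinate at b by a multiple of the vector. Then
  coordinates of convergent sequences converge, and linear maps are bounded coordinatewise.\<close>

lemma lspan_closed_bounded:
  assumes K: "subfld (K :: 'c set)" "closed K" and B: "finite B"
  shows "closed (lspan K B) \<and> (\<forall>T. lin_on K (lspan K B) T \<longrightarrow> (\<exists>M\<ge>0. \<forall>v\<in>lspan K B. cabs (T v) \<le> M * cabs v))"
  using B
proof (induction B rule: finite_induct)
  case empty
  have "lspan K {} = {0::'c}" by (auto simp: lspan_def)
  moreover have "T 0 = 0" if "lin_on K {0} T" for T
  proof -
    have "T (0 * 0) = 0 * T 0" using that subfld_0[OF K(1)] unfolding lin_on_def by blast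
    then show ?thesis by simp
  qed
  ultimately show ?case by (auto intro!: exI[of _ 0])
next
  case (insert b B)
  let ?V = "lspan K B" and ?W = "lspan K (insert b B)"
  have Vc: "closed ?V" using insert.IH by simp
  show ?case
  proof (cases "b \<in> ?V")
    case True
    have "?W = ?V"
    proof
      show "?W \<subseteq> ?V" using True insert.hyps K lspan_base[OF K(1) insert.hyps(1)] by (intro lspan_subset) auto
      show "?V \<subseteq> ?W" using insert.hyps K lspan_base[OF K(1), of "insert b B"] by (intro lspan_subset) auto
    qed
    then show ?thesis using insert.IH by simp
  next
    case False
    \<comment> \<open>The distance d of b from the smaller span is the constant behind
      \<open>abound\<close>, hence behind all estimates of coordinates.\<close>
    then obtain d where d: "d > 0" "\<And>v. v \<in> ?V \<Longrightarrow> cabs (b - v) \<ge> d" using Vc unfolding closed_cabs by (meson not_less)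
    have split: "\<exists>a\<in>K. \<exists>w\<in>?V. x = a * b + w" if "x \<in> ?W" for x using that insert.hyps by (simp add: lspan_insert)
    have abound: "cabs a * d \<le> cabs (a * b + w)" if "a \<in> K" "w \<in> ?V" for a w
    proof (cases "a = 0")
      case False
      have "(- inverse a) * w \<in> ?V" using that K by (intro lspan_mult subfld_minus subfld_inverse) auto
      from d(2)[OF this] have "d \<le> cabs (b + inverse a * w)" by simp
      then have "cabs a * d \<le> cabs a * cabs (b + inverse a * w)" by (intro mult_left_mono) auto
      also have "\<dots> = cabs (a * b + w)" using False by (simp add: cabs_mult[symmetric] distrib_left mult.assoc[symmetric] del: cabs_mult)
      finally show ?thesis .
    qed simp
    define M where "M = max 1 (cabs b / d)"
    have wbound: "cabs w \<le> M * cabs (a * b + w)" if "a \<in> K" "w \<in> ?V" for a w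
    proof -
      let ?x = "a * b + w"
      have "cabs a * cabs b * d \<le> cabs b * cabs ?x" using mult_left_mono[OF abound[OF that], of "cabs b"] by (simp add: mult_ac)
      then have "cabs (a * b) \<le> (cabs b / d) * cabs ?x" using d by (simp add: field_simps)
      also have "\<dots> \<le> M * cabs ?x" by (intro mult_right_mono) (auto simp: M_def)
      finally have 1: "cabs (a * b) \<le> M * cabs ?x" .
      have "1 * cabs ?x \<le> M * cabs ?x" by (intro mult_right_mono) (auto simp: M_def)
      then have "cabs (?x - a * b) \<le> M * cabs ?x" using 1 by (intro cabs_diff_le) auto
      then show ?thesis by simp
    qed
    have "closed ?W"
    proof (subst closed_sequential_limits, intro allI impI)
      fix X x assume X: "(\<forall>n. X n \<in> ?W) \<and> X \<longlonglongrightarrow> x"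
      then have "\<forall>n. \<exists>a w. a \<in> K \<and> w \<in> ?V \<and> X n = a * b + w" using split by blast
      then obtain a where "\<forall>n. \<exists>w. a n \<in> K \<and> w \<in> ?V \<and> X n = a n * b + w" by (rule choice[THEN exE])
      moreover from this obtain w where "\<forall>n. a n \<in> K \<and> w n \<in> ?V \<and> X n = a n * b + w n" by (rule choice[THEN exE])
      ultimately have aw: "\<And>n. a n \<in> K" "\<And>n. w n \<in> ?V" "\<And>n. X n = a n * b + w n" by blast+
      have "convergent a"
      proof (rule nonarch_Cauchy)
        fix e :: real assume e: "e > 0"
        then have "e * d > 0" using d by simp
        then obtain N where N: "\<forall>n\<ge>N. cabs (X n - x) < e * d" using X unfolding LIMSEQ_cabs by blast
        have "cabs (a (Suc n) - a n) < e" if "n \<ge> N" for n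
        proof -
          have "cabs (a (Suc n) - a n) * d \<le> cabs ((a (Suc n) - a n) * b + (w (Suc n) - w n))"
            using aw K by (intro abound subfld_diff lspan_diff) auto
          also have "(a (Suc n) - a n) * b + (w (Suc n) - w n) = X (Suc n) - X n" by (simp add: aw algebra_simps)
          also have "cabs \<dots> < e * d" using N that cabs_diff_triangle_less[of "X (Suc n)" x "e * d" "X n"] by (simp add: cabs_minus_commute)
          finally show ?thesis using d by simp
        qed
        then show "\<exists>N. \<forall>n\<ge>N. cabs (a (Suc n) - a n) < e" by blast
      qed
      then obtain a' where a': "a \<longlonglongrightarrow> a'" unfolding convergent_def by blast
      then have "a' \<in> K" using closed_LIMSEQ[OF K(2)] aw by blast
      have "w \<longlonglongrightarrow> x - a' * b" unfolding LIMSEQ_cabs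
      proof (intro allI impI)
        fix e :: real assume e: "e > 0"
        then have "e / (1 + cabs b) > 0" using cabs_nonneg[of b] by (simp add: add_pos_nonneg)
        then obtain N1 where N1: "\<forall>n\<ge>N1. cabs (a n - a') < e / (1 + cabs b)" using a' unfolding LIMSEQ_cabs by blast
        obtain N2 where N2: "\<forall>n\<ge>N2. cabs (X n - x) < e" using X e unfolding LIMSEQ_cabs by blast
        have "cabs (w n - (x - a' * b)) < e" if "n \<ge> max N1 N2" for n
        proof -
          have "1 + cabs b > 0" using cabs_nonneg[of b] by linarith
          then have "cabs (a n - a') * (1 + cabs b) < e" using N1 that by (simp add: field_simps)
          moreover have "cabs (a n - a') * cabs b \<le> cabs (a n - a') * (1 + cabs b)" by (intro mult_left_mono) auto
          ultimately have "cabs ((a n - a') * b) < e" by simp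
          then have "cabs ((X n - x) - (a n - a') * b) < e" using N2 that by (intro cabs_diff_less[of "X n - x"]) auto
          then show ?thesis by (simp add: aw algebra_simps)
        qed
        then show "\<exists>N. \<forall>n\<ge>N. cabs (w n - (x - a' * b)) < e" by blast
      qed
      then have "x - a' * b \<in> ?V" using closed_LIMSEQ[OF Vc] aw by blast
      then have "\<exists>a\<in>K. \<exists>w\<in>?V. x = a * b + w" using \<open>a' \<in> K\<close>
        by (intro bexI[of _ a'] bexI[of _ "x - a' * b"]) auto
      then show "x \<in> ?W" using insert.hyps by (simp add: lspan_insert)
    qed
    moreover have "\<exists>M'\<ge>0. \<forall>v\<in>?W. cabs (T v) \<le> M' * cabs v" if T: "lin_on K ?W T" for T
    proof -
      have VW: "?V \<subseteq> ?W" using insert.hyps K lspan_base[OF K(1), of "insert b B"] by (intro lspan_subset) auto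
      then have "lin_on K ?V T" using T unfolding lin_on_def by blast
      then obtain N where N: "N \<ge> 0" "\<forall>v\<in>?V. cabs (T v) \<le> N * cabs v" using insert.IH by blast
      have bW: "b \<in> ?W" using lspan_base[OF K(1), of "insert b B"] insert.hyps by auto
      define M' where "M' = max (cabs (T b) / d) (N * M)"
      have "cabs (T v) \<le> M' * cabs v" if vW: "v \<in> ?W" for v
      proof -
        obtain a w where aw: "a \<in> K" "w \<in> ?V" "v = a * b + w" using split[OF vW] by blast
        have "T (a * b + w) = T (a * b) + T w" "T (a * b) = a * T b" using T aw bW VW lspan_mult[OF K(1) bW aw(1)] unfolding lin_on_def by blast+
        then have "T v = a * T b + T w" using aw(3) by simp
        moreover have "cabs (a * T b) \<le> M' * cabs v"
        proof -
          have "cabs a * d * cabs (T b) \<le> cabs v * cabs (T b)" using abound[OF aw(1,2)] aw(3) by (intro mult_right_mono) auto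
          then have "cabs (a * T b) \<le> (cabs (T b) / d) * cabs v" using d by (simp add: field_simps)
          also have "\<dots> \<le> M' * cabs v" by (intro mult_right_mono) (auto simp: M'_def)
          finally show ?thesis .
        qed
        moreover have "cabs (T w) \<le> M' * cabs v"
        proof -
          have "cabs (T w) \<le> N * cabs w" using N aw by blast
          also have "\<dots> \<le> N * (M * cabs v)" using wbound[OF aw(1,2)] aw(3) N by (intro mult_left_mono) auto
          also have "\<dots> \<le> M' * cabs v" unfolding mult.assoc[symmetric] by (intro mult_right_mono) (auto simp: M'_def)
          finally show ?thesis .
        qed
        ultimately show ?thesis by (simp add: cabs_add_le)
      qed
      moreover have "M' \<ge> 0" using d by (auto simp: M'_def le_max_iff_disj)
      ultimately show ?thesis by blast
    qed
    ultimately show ?thesis by blast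
  qed
qed

end

section \<open>The Galois group of L and its isometric action\<close>

locale LField = Cp p C for p :: nat and C :: "'c::{alg_closed_field,field_char_0,complete_space} itself" +
  fixes L :: "'c set" and \<pi> :: 'c
  assumes finL: "finite_ext_Qp L" and unif: "uniformizer L \<pi>"
begin

abbreviation "Lbar \<equiv> alg_closure_in L"
abbreviation "GL \<equiv> galois_group L"

lemma Qp_L: "Qp \<subseteq> L" using finL by (simp add: finite_ext_Qp_def)

lemma subfld_L: "subfld L" using finL Qp_L subfld_1[OF subfld_Qp] unfolding finite_ext_Qp_def subfld_def by blast

lemma L_span: obtains B where "finite B" "L = lspan Qp B"
proof -
  obtain B where B: "finite B" "B \<subseteq> L" "\<forall>x\<in>L. \<exists>c. (\<forall>b\<in>B. c b \<in> Qp) \<and> x = (\<Sum>b\<in>B. c b * b)"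
    using finL unfolding finite_ext_Qp_def by blast
  have "lspan Qp B \<subseteq> L" unfolding lspan_def using B(2) Qp_L by (auto intro!: subfld_sum[OF subfld_L] subfld_mult[OF subfld_L])
  moreover have "L \<subseteq> lspan Qp B" using B(3) unfolding lspan_def by blast
  ultimately show ?thesis using that B(1) by blast
qed

lemma closed_L: "closed L" using L_span lspan_closed_bounded[OF subfld_Qp closed_Qp] by metis

lemma subfld_Lbar: "subfld Lbar" by (rule subfld_alg_closure[OF subfld_L])

lemma L_Lbar: "L \<subseteq> Lbar" by (rule subset_alg_closure_in[OF subfld_L])

lemma closure_Lbar: "closure Lbar = UNIV" using closure_mono[OF alg_closure_in_mono[OF Qp_L]] closure_alg by auto

lemma Lbar_dense: "e > 0 \<Longrightarrow> \<exists>a\<in>Lbar. cabs (x - a) < e" using closure_cabs[of x Lbar] closure_Lbar by auto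

text \<open>The algebraic part of membership in the Galois group; isometry is derived from it, and
  bijectivity once Lbar is mapped into itself.\<close>

definition hom_L :: "('c \<Rightarrow> 'c) \<Rightarrow> bool" where
  "hom_L \<sigma> \<longleftrightarrow> (\<forall>x\<in>Lbar. \<forall>y\<in>Lbar. \<sigma> (x + y) = \<sigma> x + \<sigma> y \<and> \<sigma> (x * y) = \<sigma> x * \<sigma> y) \<and> (\<forall>x\<in>L. \<sigma> x = x)"

lemma hom_L_power: "hom_L \<sigma> \<Longrightarrow> x \<in> Lbar \<Longrightarrow> \<sigma> (x ^ n) = \<sigma> x ^ n"
  by (induction n) (auto simp: hom_L_def subfld_1[OF subfld_L] subfld_power[OF subfld_Lbar])

text \<open>All powers of x lie in one finite-dimensional space over the complete field L, on which
  \<sigma> is linear and hence bounded by some M. So |\<sigma>(x)|^k <= M |x|^k for all k, which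
  excludes |\<sigma>(x)| > |x|. This is the uniqueness of the extension of the absolute
  value.\<close>

lemma hom_L_isometric_le:
  assumes s: "hom_L \<sigma>" and x: "x \<in> Lbar" shows "cabs (\<sigma> x) \<le> cabs x"
proof (rule ccontr)
  assume *: "\<not> ?thesis"
  obtain f where f: "f \<noteq> 0" "\<And>i. coeff f i \<in> L" "poly f x = 0" using x unfolding alg_closure_in_def by auto
  define B where "B = (\<lambda>i. x ^ i) ` {..<degree f}"
  have B: "finite B" "B \<subseteq> Lbar" using x by (auto simp: B_def subfld_power[OF subfld_Lbar])
  have sp: "lspan L B \<subseteq> Lbar" unfolding lspan_def using B L_Lbar by (auto intro!: subfld_sum[OF subfld_Lbar] subfld_mult[OF subfld_Lbar])
  have "lin_on L (lspan L B) \<sigma>" unfolding lin_on_def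
  proof (intro conjI ballI)
    fix v w assume "v \<in> lspan L B" "w \<in> lspan L B"
    then show "\<sigma> (v + w) = \<sigma> v + \<sigma> w" using s sp unfolding hom_L_def by blast
  next
    fix c v assume "c \<in> L" "v \<in> lspan L B"
    then have "\<sigma> (c * v) = \<sigma> c * \<sigma> v" "\<sigma> c = c" using s sp L_Lbar unfolding hom_L_def by blast+
    then show "\<sigma> (c * v) = c * \<sigma> v" by simp
  qed
  then obtain M where M: "\<forall>v\<in>lspan L B. cabs (\<sigma> v) \<le> M * cabs v" using lspan_closed_bounded[OF subfld_L closed_L B(1)] by blast
  have le: "cabs (\<sigma> x) ^ k \<le> M * cabs x ^ k" for k
    using M alg_powers_lspan[OF subfld_L f] hom_L_power[OF s x] unfolding B_def by (metis cabs_power)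
  show False
  proof (cases "x = 0")
    case True
    then show False using le[of 1] * by simp
  next
    case False
    then have "cabs (\<sigma> x) / cabs x > 1" using * by (simp add: field_simps)
    then obtain k where "M < (cabs (\<sigma> x) / cabs x) ^ k" using real_arch_pow by blast
    moreover have "(cabs (\<sigma> x) / cabs x) ^ k \<le> M" using le[of k] False by (simp add: power_divide field_simps)
    ultimately show False by simp
  qed
qed

text \<open>The opposite inequality is the same bound for the inverse of x.\<close>

lemma hom_L_isometric:
  assumes s: "hom_L \<sigma>" and x: "x \<in> Lbar" shows "cabs (\<sigma> x) = cabs x"
proof (cases "x = 0")
  case True
  then show ?thesis using s subfld_0[OF subfld_L] by (auto simp: hom_L_def)
next
  case False
  have i: "inverse x \<in> Lbar" using x subfld_inverse[OF subfld_Lbar] by blast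
  have "\<sigma> x * \<sigma> (inverse x) = \<sigma> (x * inverse x)" using s x i unfolding hom_L_def by metis
  then have "\<sigma> x * \<sigma> (inverse x) = 1" using s False subfld_1[OF subfld_L] by (simp add: hom_L_def)
  then have "cabs (\<sigma> x) * cabs (\<sigma> (inverse x)) = 1" by (metis cabs_mult cabs_1)
  moreover have "cabs (\<sigma> x) * cabs (\<sigma> (inverse x)) \<le> cabs (\<sigma> x) * inverse (cabs x)"
    using hom_L_isometric_le[OF s i] by (intro mult_left_mono) auto
  ultimately have "1 \<le> cabs (\<sigma> x) * inverse (cabs x)" by simp
  then have "cabs x \<le> cabs (\<sigma> x)" using False by (simp add: field_simps)
  then show ?thesis using hom_L_isometric_le[OF s x] by simp
qed

lemma hom_L_diff:
  assumes "hom_L \<sigma>" "x \<in> Lbar" "y \<in> Lbar" shows "\<sigma> (x - y) = \<sigma> x - \<sigma> y"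
proof -
  have "\<sigma> ((x - y) + y) = \<sigma> (x - y) + \<sigma> y" using assms subfld_diff[OF subfld_Lbar] unfolding hom_L_def by metis
  then show ?thesis by simp
qed

lemma hom_L_dist: "hom_L \<sigma> \<Longrightarrow> x \<in> Lbar \<Longrightarrow> y \<in> Lbar \<Longrightarrow> cabs (\<sigma> x - \<sigma> y) = cabs (x - y)"
  using hom_L_diff[of \<sigma> x y] hom_L_isometric[of \<sigma> "x - y"] subfld_diff[OF subfld_Lbar] by simp

lemma GL_iff: "\<sigma> \<in> GL \<longleftrightarrow> continuous_on UNIV \<sigma> \<and> bij_betw \<sigma> Lbar Lbar \<and> hom_L \<sigma>"
  by (auto simp: galois_group_def hom_L_def)

text \<open>The definition of the group gives algebraic identities only on Lbar. They spread to the
  whole field by approximating an argument and its image simultaneously.\<close>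

lemma GL_approx:
  assumes s: "\<sigma> \<in> GL" and e: "e > 0"
  shows "\<exists>a\<in>Lbar. cabs (x - a) < e \<and> cabs (\<sigma> x - \<sigma> a) < e"
proof -
  have "\<forall>x\<in>UNIV. \<forall>e>0. \<exists>d>0. \<forall>y\<in>UNIV. cabs (y - x) < d \<longrightarrow> cabs (\<sigma> y - \<sigma> x) < e"
    using s unfolding GL_iff continuous_cabs by blast
  then obtain d where d: "d > 0" "\<forall>y. cabs (y - x) < d \<longrightarrow> cabs (\<sigma> y - \<sigma> x) < e" using e by blast
  obtain a where "a \<in> Lbar" "cabs (x - a) < min d e" using Lbar_dense[of "min d e" x] d e by auto
  then show ?thesis using d by (auto simp: cabs_minus_commute)
qed

lemma GL_isometric:
  assumes s: "\<sigma> \<in> GL" shows "cabs (\<sigma> x - \<sigma> y) = cabs (x - y)"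
proof (cases "x = y")
  case False
  then have e: "cabs (x - y) > 0" by simp
  obtain a where a: "a \<in> Lbar" "cabs (x - a) < cabs (x - y)" "cabs (\<sigma> x - \<sigma> a) < cabs (x - y)" using GL_approx[OF s e] by blast
  obtain b where b: "b \<in> Lbar" "cabs (y - b) < cabs (x - y)" "cabs (\<sigma> y - \<sigma> b) < cabs (x - y)" using GL_approx[OF s e] by blast
  have "cabs ((a - b) - (x - y)) < cabs (x - y)" using cabs_diff_less[OF b(2) a(2)] by (simp add: algebra_simps)
  then have ab: "cabs (a - b) = cabs (x - y)" by (rule cabs_eq_of_near)
  have sab: "cabs (\<sigma> a - \<sigma> b) = cabs (x - y)" using hom_L_dist a b s ab GL_iff by metis
  have "cabs ((\<sigma> x - \<sigma> y) - (\<sigma> a - \<sigma> b)) < cabs (x - y)" using cabs_diff_less[OF a(3) b(3)] by (simp add: algebra_simps)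
  then show ?thesis using cabs_eq_of_near'[OF _ sab] by blast
qed simp

lemma GL_add:
  assumes s: "\<sigma> \<in> GL" shows "\<sigma> (x + y) = \<sigma> x + \<sigma> y"
proof (rule LIMSEQ_cabs_unique)
  fix e :: real assume e: "e > 0"
  obtain a b where a: "a \<in> Lbar" "cabs (x - a) < e" and b: "b \<in> Lbar" "cabs (y - b) < e" using Lbar_dense e by meson
  have "\<sigma> (a + b) = \<sigma> a + \<sigma> b" using s a b unfolding GL_iff hom_L_def by blast
  moreover have "cabs (\<sigma> (x + y) - \<sigma> (a + b)) < e" using GL_isometric[OF s] cabs_add_less[OF a(2) b(2)] by (simp add: algebra_simps)
  moreover have "cabs ((\<sigma> a - \<sigma> x) + (\<sigma> b - \<sigma> y)) < e"
    using a b GL_isometric[OF s] by (intro cabs_add_less) (auto simp: cabs_minus_commute)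
  ultimately have "cabs ((\<sigma> (x + y) - (\<sigma> a + \<sigma> b)) + ((\<sigma> a - \<sigma> x) + (\<sigma> b - \<sigma> y))) < e"
    by (intro cabs_add_less[of "\<sigma> (x + y) - (\<sigma> a + \<sigma> b)"]) auto
  then show "cabs (\<sigma> (x + y) - (\<sigma> x + \<sigma> y)) \<le> e" by (simp add: algebra_simps)
qed

lemma GL_0: "\<sigma> \<in> GL \<Longrightarrow> \<sigma> 0 = 0" using GL_add[of \<sigma> 0 0] by simp

lemma GL_cabs: "\<sigma> \<in> GL \<Longrightarrow> cabs (\<sigma> x) = cabs x" using GL_isometric[of \<sigma> x 0] GL_0[of \<sigma>] by simp

lemma GL_mult:
  assumes s: "\<sigma> \<in> GL" shows "\<sigma> (x * y) = \<sigma> x * \<sigma> y"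
proof (rule LIMSEQ_cabs_unique)
  fix e :: real assume e: "e > 0"
  define d where "d = min 1 (e / (1 + cabs x + cabs y))"
  have den: "1 + cabs x + cabs y > 0" using cabs_nonneg[of x] cabs_nonneg[of y] by linarith
  then have d: "d > 0" "d \<le> 1" using e by (auto simp: d_def)
  have "d \<le> e / (1 + cabs x + cabs y)" by (simp add: d_def)
  then have d3: "d * (1 + cabs x + cabs y) \<le> e" using den by (simp add: pos_le_divide_eq)
  obtain a b where a: "a \<in> Lbar" "cabs (x - a) < d" and b: "b \<in> Lbar" "cabs (y - b) < d" using Lbar_dense d by meson
  have "cabs b \<le> max (cabs y) (cabs (y - b))" using cabs_diff[of y "y - b"] by simp
  then have bb: "cabs b \<le> 1 + cabs x + cabs y" using b d cabs_nonneg[of x] cabs_nonneg[of y] by linarith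
  have xx: "cabs x \<le> 1 + cabs x + cabs y" using cabs_nonneg[of y] by linarith
  \<comment> \<open>Here u v - u' v' = u (v - v') + (u - u') v', where u and v' are at most 1 + |x|
    + |y|.\<close>
  have key: "cabs (u * v - u' * v') \<le> e" if "cabs (u - u') < d" "cabs (v - v') < d" "cabs v' \<le> 1 + cabs x + cabs y"
     "cabs u \<le> 1 + cabs x + cabs y" for u v u' v' :: 'c
  proof -
    have "cabs u * cabs (v - v') \<le> (1 + cabs x + cabs y) * d" using that den by (intro mult_mono) auto
    moreover have "cabs (u - u') * cabs v' \<le> d * (1 + cabs x + cabs y)" using that d by (intro mult_mono) auto
    ultimately have "cabs (u * (v - v') + (u - u') * v') \<le> e" using d3 by (intro cabs_add_le) (auto simp: mult.commute)
    then show ?thesis by (simp add: algebra_simps)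
  qed
  have "\<sigma> (a * b) = \<sigma> a * \<sigma> b" using s a b unfolding GL_iff hom_L_def by blast
  moreover have "cabs (\<sigma> (x * y) - \<sigma> (a * b)) \<le> e" unfolding GL_isometric[OF s] using a b bb xx by (intro key) auto
  moreover have "cabs (\<sigma> x * \<sigma> y - \<sigma> a * \<sigma> b) \<le> e"
    using a b bb xx by (intro key) (auto simp: GL_isometric[OF s] GL_cabs[OF s])
  ultimately show "cabs (\<sigma> (x * y) - \<sigma> x * \<sigma> y) \<le> e"
    using cabs_diff_triangle[of "\<sigma> (x * y)" "\<sigma> a * \<sigma> b" e "\<sigma> x * \<sigma> y"] by (simp add: cabs_minus_commute)
qed

lemma GL_fix: "\<sigma> \<in> GL \<Longrightarrow> x \<in> L \<Longrightarrow> \<sigma> x = x" by (auto simp: GL_iff hom_L_def)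

lemma GL_1: "\<sigma> \<in> GL \<Longrightarrow> \<sigma> 1 = 1" using GL_fix subfld_1[OF subfld_L] by blast

lemma GL_minus: "\<sigma> \<in> GL \<Longrightarrow> \<sigma> (- x) = - \<sigma> x"
  using GL_add[of \<sigma> x "- x"] GL_0[of \<sigma>] by (simp add: eq_neg_iff_add_eq_0 add.commute)

lemma GL_diff: "\<sigma> \<in> GL \<Longrightarrow> \<sigma> (x - y) = \<sigma> x - \<sigma> y"
  using GL_add[of \<sigma> x "- y"] GL_minus[of \<sigma> y] by simp

lemma GL_power: "\<sigma> \<in> GL \<Longrightarrow> \<sigma> (x ^ n) = \<sigma> x ^ n" by (induction n) (auto simp: GL_1 GL_mult)

lemma GL_sum: "\<sigma> \<in> GL \<Longrightarrow> \<sigma> (sum f A) = (\<Sum>i\<in>A. \<sigma> (f i))"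
  by (induction A rule: infinite_finite_induct) (auto simp: GL_0 GL_add)

lemma GL_inj: "\<sigma> \<in> GL \<Longrightarrow> \<sigma> x = \<sigma> y \<Longrightarrow> x = y" using GL_isometric[of \<sigma> x y] by simp

lemma GL_inverse: "\<sigma> \<in> GL \<Longrightarrow> \<sigma> (inverse x) = inverse (\<sigma> x)"
proof (cases "x = 0")
  case False
  assume s: "\<sigma> \<in> GL"
  have "\<sigma> x * \<sigma> (inverse x) = 1" using GL_mult[OF s, of x "inverse x"] False GL_1[OF s] by simp
  then show ?thesis by (metis inverse_unique)
qed (auto simp: GL_0)

lemma GL_divide: "\<sigma> \<in> GL \<Longrightarrow> \<sigma> (x / y) = \<sigma> x / \<sigma> y" by (simp add: divide_inverse GL_mult GL_inverse)

lemma GL_Lbar: "\<sigma> \<in> GL \<Longrightarrow> x \<in> Lbar \<Longrightarrow> \<sigma> x \<in> Lbar" unfolding GL_iff bij_betw_def by blast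

text \<open>The image contains the dense set Lbar; since \<sigma> is an isometry, preimages of a
  convergent sequence in Lbar are again Cauchy.\<close>

lemma GL_surj:
  assumes s: "\<sigma> \<in> GL" shows "\<exists>x. \<sigma> x = y"
proof -
  obtain Y where Y: "\<And>n. Y n \<in> Lbar" "Y \<longlonglongrightarrow> y" using closure_sequential[of y Lbar] closure_Lbar by auto
  have "\<exists>x. x \<in> Lbar \<and> \<sigma> x = Y n" for n using Y(1)[of n] s unfolding GL_iff bij_betw_def by (metis imageE)
  then obtain X where X: "\<And>n. \<sigma> (X n) = Y n" by metis
  have "convergent X"
  proof (rule nonarch_Cauchy)
    fix e :: real assume "e > 0"
    then obtain N where N: "\<forall>n\<ge>N. cabs (Y n - y) < e" using Y(2) LIMSEQ_cabs by blast
    have "cabs (X (Suc n) - X n) < e" if "n \<ge> N" for n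
    proof -
      have "cabs (Y (Suc n) - Y n) < e" using N that cabs_diff_triangle_less[of "Y (Suc n)" y e "Y n"] by (simp add: cabs_minus_commute)
      then show ?thesis using GL_isometric[OF s, of "X (Suc n)" "X n"] by (simp add: X)
    qed
    then show "\<exists>N. \<forall>n\<ge>N. cabs (X (Suc n) - X n) < e" by blast
  qed
  then obtain x where x: "X \<longlonglongrightarrow> x" by (auto simp: convergent_def)
  have "Y \<longlonglongrightarrow> \<sigma> x" using x unfolding LIMSEQ_cabs X[symmetric] GL_isometric[OF s] .
  then show ?thesis using Y(2) LIMSEQ_unique by blast
qed

lemma GL_id: "(\<lambda>x. x) \<in> GL" unfolding GL_iff hom_L_def by (auto simp: bij_betw_def inj_on_def)

lemma GL_comp:
  assumes s: "\<sigma> \<in> GL" and t: "\<rho> \<in> GL" shows "(\<lambda>x. \<sigma> (\<rho> x)) \<in> GL"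
proof -
  have "continuous_on UNIV (\<sigma> \<circ> \<rho>)" using s t GL_iff continuous_on_compose2[of UNIV \<sigma> UNIV \<rho>] by (simp add: comp_def)
  moreover have "bij_betw (\<sigma> \<circ> \<rho>) Lbar Lbar" using s t GL_iff bij_betw_trans by blast
  ultimately show ?thesis unfolding GL_iff hom_L_def comp_def by (simp add: GL_add GL_mult GL_fix s t)
qed

lemma GL_inv:
  assumes s: "\<sigma> \<in> GL" shows "\<exists>\<rho>\<in>GL. (\<forall>x. \<rho> (\<sigma> x) = x) \<and> (\<forall>x. \<sigma> (\<rho> x) = x)"
proof -
  define \<rho> where "\<rho> = inv \<sigma>"
  have 1: "\<rho> (\<sigma> x) = x" for x unfolding \<rho>_def using GL_inj[OF s] by (intro inv_f_f) (auto simp: inj_def)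
  have 2: "\<sigma> (\<rho> x) = x" for x using GL_surj[OF s, of x] 1 by metis
  have "continuous_on UNIV \<rho>" unfolding continuous_cabs using GL_isometric[OF s, of "\<rho> x" "\<rho> y" for x y] by (auto simp: 2)
  moreover have "bij_betw \<rho> Lbar Lbar"
  proof (rule bij_betw_byWitness[where f' = \<sigma>])
    have img: "\<sigma> ` Lbar = Lbar" using s unfolding GL_iff bij_betw_def by blast
    then show "\<sigma> ` Lbar \<subseteq> Lbar" by simp
    have "\<rho> ` (\<sigma> ` Lbar) \<subseteq> Lbar" using 1 by auto
    then show "\<rho> ` Lbar \<subseteq> Lbar" unfolding img .
  qed (use 1 2 in auto)
  moreover have "hom_L \<rho>" unfolding hom_L_def
  proof (intro conjI ballI)
    fix x y
    have "\<rho> (\<sigma> (\<rho> x + \<rho> y)) = \<rho> x + \<rho> y" "\<rho> (\<sigma> (\<rho> x * \<rho> y)) = \<rho> x * \<rho> y" by (rule 1)+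
    then show "\<rho> (x + y) = \<rho> x + \<rho> y" "\<rho> (x * y) = \<rho> x * \<rho> y" unfolding GL_add[OF s] GL_mult[OF s] 2 .
  next
    fix x assume "x \<in> L"
    then show "\<rho> x = x" using 1[of x] GL_fix[OF s] by simp
  qed
  ultimately show ?thesis using 1 2 GL_iff by blast
qed


text \<open>Partial embeddings of \<open>Lbar\<close> over \<open>L\<close>, given by their graphs: subrings of \<open>Lbar \<times> Lbar\<close>.\<close>

definition emb_graph :: "('c \<times> 'c) set \<Rightarrow> bool" where
  "emb_graph R \<longleftrightarrow> R \<subseteq> Lbar \<times> Lbar \<and> (\<forall>x\<in>L. (x, x) \<in> R) \<and>
     (\<forall>a b c d. (a, b) \<in> R \<longrightarrow> (c, d) \<in> R \<longrightarrow> (a + c, b + d) \<in> R \<and> (a * c, b * d) \<in> R) \<and>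
     (\<forall>b. (0, b) \<in> R \<longrightarrow> b = 0)"

lemma emb_graph_add: "emb_graph R \<Longrightarrow> (a, b) \<in> R \<Longrightarrow> (c, d) \<in> R \<Longrightarrow> (a + c, b + d) \<in> R"
  and emb_graph_mult: "emb_graph R \<Longrightarrow> (a, b) \<in> R \<Longrightarrow> (c, d) \<in> R \<Longrightarrow> (a * c, b * d) \<in> R"
  and emb_graph_L: "emb_graph R \<Longrightarrow> x \<in> L \<Longrightarrow> (x, x) \<in> R"
  and emb_graph_zero: "emb_graph R \<Longrightarrow> (0, b) \<in> R \<Longrightarrow> b = 0"
  and emb_graph_Lbar: "emb_graph R \<Longrightarrow> (a, b) \<in> R \<Longrightarrow> a \<in> Lbar \<and> b \<in> Lbar" by (auto simp: emb_graph_def)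

lemma emb_graph_minus: "emb_graph R \<Longrightarrow> (a, b) \<in> R \<Longrightarrow> (- a, - b) \<in> R"
  using emb_graph_mult[of R "-1" "-1" a b] emb_graph_L[of R "-1"] by (simp add: subfld_minus[OF subfld_L] subfld_1[OF subfld_L])

lemma emb_graph_diff: "emb_graph R \<Longrightarrow> (a, b) \<in> R \<Longrightarrow> (c, d) \<in> R \<Longrightarrow> (a - c, b - d) \<in> R"
  using emb_graph_add[of R a b "-c" "-d"] emb_graph_minus[of R c d] by simp

lemma emb_graph_unique: "emb_graph R \<Longrightarrow> (a, b) \<in> R \<Longrightarrow> (a, c) \<in> R \<Longrightarrow> b = c"
  using emb_graph_diff[of R a b a c] emb_graph_zero[of R "b - c"] by simp

lemma emb_graph_0: "emb_graph R \<Longrightarrow> (0, 0) \<in> R" using emb_graph_L subfld_0[OF subfld_L] by blast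

lemma emb_graph_1: "emb_graph R \<Longrightarrow> (1, 1) \<in> R" using emb_graph_L subfld_1[OF subfld_L] by blast

lemma emb_graph_sum:
  "emb_graph R \<Longrightarrow> (\<And>i. i \<in> A \<Longrightarrow> (f i, g i) \<in> R) \<Longrightarrow> (sum f A, sum g A) \<in> R"
  by (induction A rule: infinite_finite_induct) (auto simp: emb_graph_0 emb_graph_add)

lemma emb_graph_power: "emb_graph R \<Longrightarrow> (a, b) \<in> R \<Longrightarrow> (a ^ n, b ^ n) \<in> R"
  by (induction n) (auto simp: emb_graph_1 emb_graph_mult)

text \<open>Only ring operations are demanded of a graph. A polynomial over L with root a, divided
  by its lowest power of X, writes the inverse of a as a polynomial in a over L, so the domain is a
  field nevertheless.\<close>

lemma emb_graph_inverse:
  assumes R: "emb_graph R" "(a, b) \<in> R" "a \<noteq> 0"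
  shows "\<exists>c. (inverse a, c) \<in> R"
proof -
  have "a \<in> Lbar" using R emb_graph_Lbar by blast
  then obtain f where f: "f \<noteq> 0" "\<And>i. coeff f i \<in> L" "poly f a = 0" unfolding alg_closure_in_def by auto
  obtain d where d: "d \<le> degree f" "coeff f d \<noteq> 0" "\<And>i. i < d \<Longrightarrow> coeff f i = 0"
  proof -
    define d where "d = (LEAST i. coeff f i \<noteq> 0)"
    have "coeff f (degree f) \<noteq> 0" using f(1) by simp
    then have "coeff f d \<noteq> 0" "d \<le> degree f" unfolding d_def by (rule LeastI, rule Least_le)
    moreover have "coeff f i = 0" if "i < d" for i using not_less_Least that unfolding d_def by blast
    ultimately show ?thesis using that by blast
  qed
  define g where "g = Poly (map (\<lambda>i. coeff f (d + Suc i)) [0..<degree f])"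
  have "0 = (\<Sum>i\<le>degree f. coeff f i * a ^ i)" using f(3) by (simp add: poly_altdef)
  also have "\<dots> = (\<Sum>i\<in>{d..degree f}. coeff f i * a ^ i)" using d by (intro sum.mono_neutral_right) auto
  \<comment> \<open>Coefficients beyond the degree vanish; the upper limit d + degree f allows the
    shift of indices by d.\<close>
  also have "\<dots> = (\<Sum>i\<in>{d..d + degree f}. coeff f i * a ^ i)" by (intro sum.mono_neutral_left) (auto intro: coeff_eq_0)
  also have "\<dots> = (\<Sum>i\<le>degree f. coeff f (d + i) * a ^ (d + i))"
    by (rule sum.reindex_bij_witness[of _ "\<lambda>i. d + i" "\<lambda>i. i - d"]) auto
  also have "\<dots> = a ^ d * (\<Sum>i\<le>degree f. coeff f (d + i) * a ^ i)" by (simp add: sum_distrib_left power_add mult_ac)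
  finally have "(\<Sum>i\<le>degree f. coeff f (d + i) * a ^ i) = 0" using R(3) by simp
  then have "coeff f d + (\<Sum>i<degree f. coeff f (d + Suc i) * a ^ Suc i) = 0" by (simp add: sum.atMost_shift)
  then have e: "a * (\<Sum>i<degree f. coeff f (d + Suc i) * a ^ i) = - coeff f d"
    by (simp add: sum_distrib_left mult_ac eq_neg_iff_add_eq_0 add.commute)
  define s where "s = (\<Sum>i<degree f. (- inverse (coeff f d) * coeff f (d + Suc i)) * a ^ i)"
  have "s = - inverse (coeff f d) * (\<Sum>i<degree f. coeff f (d + Suc i) * a ^ i)" unfolding s_def by (simp add: sum_distrib_left mult.assoc)
  then have "a * s = - inverse (coeff f d) * (a * (\<Sum>i<degree f. coeff f (d + Suc i) * a ^ i))" by simp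
  also have "\<dots> = 1" unfolding e using d by simp
  finally have "inverse a = s" using inverse_unique by metis
  moreover have "(s, \<Sum>i<degree f. (- inverse (coeff f d) * coeff f (d + Suc i)) * b ^ i) \<in> R" unfolding s_def using R(1,2) f(2)
    by (intro emb_graph_sum emb_graph_mult emb_graph_power emb_graph_L subfld_mult[OF subfld_L]
        subfld_minus[OF subfld_L] subfld_inverse[OF subfld_L])
  ultimately show ?thesis by blast
qed

lemma emb_graph_nonzero:
  assumes R: "emb_graph R" "(a, b) \<in> R" "a \<noteq> 0" shows "b \<noteq> 0"
proof
  assume b: "b = 0"
  obtain c where "(inverse a, c) \<in> R" using emb_graph_inverse R by blast
  then have "(a * inverse a, b * c) \<in> R" using R emb_graph_mult by blast
  then have "(1, 0) \<in> R" using R b by simp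
  then show False using emb_graph_unique[OF R(1) emb_graph_1[OF R(1)], of 0] by simp
qed

definition pairs_in :: "('c \<times> 'c) set \<Rightarrow> 'c poly \<Rightarrow> 'c poly \<Rightarrow> bool" where
  "pairs_in R f f' \<longleftrightarrow> (\<forall>i. (coeff f i, coeff f' i) \<in> R)"

lemma pairs_in_degree:
  assumes R: "emb_graph R" and f: "pairs_in R f f'" shows "degree f' = degree f"
proof -
  have "coeff f i = 0 \<longleftrightarrow> coeff f' i = 0" for i using f emb_graph_nonzero[OF R] emb_graph_zero[OF R] unfolding pairs_in_def by metis
  then show ?thesis unfolding degree_def by simp
qed

text \<open>Division by f, of minimal degree among the polynomials vanishing at z, is carried out on
  g and on its conjugate in parallel. Minimality forces the remainder of g to be 0, and then the
  conjugate remainder is 0 too.\<close>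

lemma pairs_in_root:
  assumes R: "emb_graph R" and f: "pairs_in R f f'" "f \<noteq> 0"
    and minimal: "\<forall>g g'. pairs_in R g g' \<longrightarrow> g \<noteq> 0 \<longrightarrow> poly g z = 0 \<longrightarrow> degree f \<le> degree g"
    and z: "poly f z = 0" "poly f' z' = 0" shows "pairs_in R g g' \<Longrightarrow> poly g z = 0 \<Longrightarrow> poly g' z' = 0"
proof (induction "degree g" arbitrary: g g' rule: less_induct)
  case less
  show ?case
  proof (cases "g = 0")
    case True
    then have "coeff g' i = 0" for i using less.prems emb_graph_zero[OF R] by (auto simp: pairs_in_def)
    then have "g' = 0" by (simp add: poly_eq_iff)
    then show ?thesis by simp
  next
    case False
    have dg: "degree f \<le> degree g" using minimal less.prems False by blast
    define k where "k = degree g - degree f"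
    have "(lead_coeff f, coeff f' (degree f)) \<in> R" using f by (auto simp: pairs_in_def)
    then obtain c where c: "(inverse (lead_coeff f), c) \<in> R" using emb_graph_inverse[OF R] f(2) by (metis leading_coeff_0_iff)
    define u where "u = lead_coeff g * inverse (lead_coeff f)"
    define u' where "u' = coeff g' (degree g) * c"
    have u: "(u, u') \<in> R" unfolding u_def u'_def using less.prems(1) c R by (auto simp: pairs_in_def intro: emb_graph_mult)
    define g1 where "g1 = g - monom u k * f"
    define g1' where "g1' = g' - monom u' k * f'"
    have cm: "coeff (monom a k * h) i = (if k \<le> i then a * coeff h (i - k) else 0)" for a i and h :: "'c poly" by (simp add: coeff_monom_mult)
    have p1: "pairs_in R g1 g1'" unfolding pairs_in_def
    proof
      fix i
      have "(coeff (monom u k * f) i, coeff (monom u' k * f') i) \<in> R"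
        unfolding cm using u f(1) R by (auto simp: pairs_in_def emb_graph_0 intro: emb_graph_mult)
      then show "(coeff g1 i, coeff g1' i) \<in> R" unfolding g1_def g1'_def using less.prems(1) R by (auto simp: pairs_in_def intro: emb_graph_diff)
    qed
    have r1: "poly g1 z = 0" using less.prems z by (simp add: g1_def)
    have "coeff g1 i = 0" if "i \<ge> degree g" for i
    proof (cases "i = degree g")
      case True
      then have "coeff g1 i = lead_coeff g - u * lead_coeff f" using dg by (simp add: g1_def coeff_monom_mult k_def)
      then show ?thesis using f(2) by (simp add: u_def)
    next
      case False
      then have "i > degree g" "i - k > degree f" using that dg by (auto simp: k_def)
      then show ?thesis by (simp add: g1_def cm coeff_eq_0)
    qed
    then have "g1 = 0 \<or> degree g1 < degree g" by (metis le_degree leading_coeff_0_iff not_le)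
    moreover have "poly g1' z' = 0" if "g1 = 0"
    proof -
      have "coeff g1' i = 0" for i using p1 that emb_graph_zero[OF R] by (auto simp: pairs_in_def)
      then have "g1' = 0" by (simp add: poly_eq_iff)
      then show ?thesis by simp
    qed
    ultimately have "poly g1' z' = 0" using less.hyps p1 r1 by blast
    then show ?thesis using z by (simp add: g1'_def)
  qed
qed

text \<open>The extension sends g(z) to g'(z') for conjugate g, g'. It is well defined by
  \<open>pairs_in_root\<close>, which shows that 0 is sent to 0 only.\<close>

lemma emb_graph_extend:
  assumes R: "emb_graph R" and f: "pairs_in R f f'" "f \<noteq> 0"
    and minimal: "\<forall>g g'. pairs_in R g g' \<longrightarrow> g \<noteq> 0 \<longrightarrow> poly g z = 0 \<longrightarrow> degree f \<le> degree g"
    and z: "poly f z = 0" "poly f' z' = 0" shows "\<exists>R'. emb_graph R' \<and> R \<subseteq> R' \<and> (z, z') \<in> R'"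
proof -
  define R' where "R' = {(poly g z, poly g' z') | g g'. pairs_in R g g'}"
  have I: "pairs_in R g g' \<Longrightarrow> (poly g z, poly g' z') \<in> R'" for g g' unfolding R'_def by blast
  have const: "(a, b) \<in> R'" if "(a, b) \<in> R" for a b
    using I[of "[:a:]" "[:b:]"] that by (auto simp: pairs_in_def coeff_pCons emb_graph_0[OF R] split: nat.splits)
  have zz: "(z, z') \<in> R'"
    using I[of "[:0, 1:]" "[:0, 1:]"] by (auto simp: pairs_in_def coeff_pCons emb_graph_0[OF R] emb_graph_1[OF R] split: nat.splits)
  have f'0: "f' \<noteq> 0" using f emb_graph_nonzero[OF R] unfolding pairs_in_def by (metis coeff_0 leading_coeff_0_iff)
  have zL: "z \<in> Lbar" "z' \<in> Lbar" using alg_closure_in_root[OF subfld_L f(2) _ z(1)] alg_closure_in_root[OF subfld_L f'0 _ z(2)]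
      f(1) emb_graph_Lbar[OF R] unfolding pairs_in_def by blast+
  have polyL: "poly g x \<in> Lbar" if "\<And>i. coeff g i \<in> Lbar" "x \<in> Lbar" for g x unfolding poly_altdef using that
    by (intro subfld_sum[OF subfld_Lbar] subfld_mult[OF subfld_Lbar] subfld_power[OF subfld_Lbar])
  have "emb_graph R'" unfolding emb_graph_def
  proof (intro conjI allI impI ballI)
    show "R' \<subseteq> Lbar \<times> Lbar" using zL emb_graph_Lbar[OF R] unfolding R'_def pairs_in_def by (auto intro!: polyL)
    show "(x, x) \<in> R'" if "x \<in> L" for x using const emb_graph_L[OF R that] by blast
    fix a b c d assume "(a, b) \<in> R'" "(c, d) \<in> R'"
    then obtain g g' h h' where gh: "pairs_in R g g'" "pairs_in R h h'"
      "a = poly g z" "b = poly g' z'" "c = poly h z" "d = poly h' z'" unfolding R'_def by blast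
    have "pairs_in R (g + h) (g' + h')" "pairs_in R (g * h) (g' * h')"
      using gh R by (auto simp: pairs_in_def coeff_mult intro!: emb_graph_add emb_graph_sum emb_graph_mult)
    from I[OF this(1)] I[OF this(2)] show "(a + c, b + d) \<in> R'" "(a * c, b * d) \<in> R'" by (simp_all add: gh)
  next
    fix b assume "(0, b) \<in> R'"
    then obtain g g' where "pairs_in R g g'" "poly g z = 0" "b = poly g' z'" unfolding R'_def by auto
    then show "b = 0" using pairs_in_root[OF R f minimal z] by blast
  qed
  then show ?thesis using const zz by auto
qed

lemma minimal_pair:
  assumes R: "emb_graph R" and z: "z \<in> Lbar"
  shows "\<exists>f f'. pairs_in R f f' \<and> f \<noteq> 0 \<and> poly f z = 0 \<and>
     (\<forall>g g'. pairs_in R g g' \<longrightarrow> g \<noteq> 0 \<longrightarrow> poly g z = 0 \<longrightarrow> degree f \<le> degree g)"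
proof -
  obtain f where f: "f \<noteq> 0" "\<And>i. coeff f i \<in> L" "poly f z = 0" using z unfolding alg_closure_in_def by auto
  let ?P = "\<lambda>n. \<exists>g g'. pairs_in R g g' \<and> g \<noteq> 0 \<and> poly g z = 0 \<and> degree g = n"
  have "pairs_in R f f" using f(2) emb_graph_L[OF R] by (auto simp: pairs_in_def)
  then have ex: "?P (degree f)" using f by blast
  have "?P (LEAST n. ?P n)" by (rule LeastI[of ?P, OF ex])
  then show ?thesis using Least_le[of ?P] by metis
qed

text \<open>Zorn's lemma: a maximal graph has domain Lbar, because the conjugate of a minimal
  polynomial has a root in the algebraically closed field and any root permits an extension.\<close>

lemma emb_graph_full:
  assumes R0: "emb_graph R0"
  shows "\<exists>\<sigma>. hom_L \<sigma> \<and> \<sigma> ` Lbar \<subseteq> Lbar \<and> (\<forall>(a, b)\<in>R0. \<sigma> a = b)"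
proof -
  define \<A> where "\<A> = {R. emb_graph R \<and> R0 \<subseteq> R}"
  have "\<exists>M\<in>\<A>. \<forall>X\<in>\<A>. M \<subseteq> X \<longrightarrow> X = M"
  proof (rule subset_Zorn_nonempty)
    show "\<A> \<noteq> {}" using R0 by (auto simp: \<A>_def)
    fix Ch assume Ch: "Ch \<noteq> {}" "subset.chain \<A> Ch"
    then have CA: "Ch \<subseteq> \<A>" and tot: "\<And>X Y. X \<in> Ch \<Longrightarrow> Y \<in> Ch \<Longrightarrow> X \<subseteq> Y \<or> Y \<subseteq> X"
      by (auto simp: subset.chain_def)
    have eg: "emb_graph X" if "X \<in> Ch" for X using CA that by (auto simp: \<A>_def)
    have "emb_graph (\<Union>Ch)" unfolding emb_graph_def
    proof (intro conjI allI impI ballI)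
      show "\<Union>Ch \<subseteq> Lbar \<times> Lbar" using CA emb_graph_Lbar by (auto simp: \<A>_def dest!: subsetD[OF CA])
      show "(x, x) \<in> \<Union>Ch" if "x \<in> L" for x
      proof -
        obtain X where "X \<in> Ch" using Ch(1) by blast
        then show ?thesis using emb_graph_L[OF eg \<open>x \<in> L\<close>] by blast
      qed
      show "b = 0" if "(0, b) \<in> \<Union>Ch" for b
      proof -
        obtain X where "X \<in> Ch" "(0, b) \<in> X" using \<open>(0, b) \<in> \<Union>Ch\<close> by blast
        then show ?thesis using emb_graph_zero[OF eg] by blast
      qed
      fix a b c d assume "(a, b) \<in> \<Union>Ch" "(c, d) \<in> \<Union>Ch"
      then obtain X Y where "X \<in> Ch" "Y \<in> Ch" "(a, b) \<in> X" "(c, d) \<in> Y" by blast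
      then obtain Z where "Z \<in> Ch" "(a, b) \<in> Z" "(c, d) \<in> Z" using tot by blast
      then have "(a + c, b + d) \<in> Z" "(a * c, b * d) \<in> Z" using emb_graph_add[OF eg] emb_graph_mult[OF eg] by blast+
      then show "(a + c, b + d) \<in> \<Union>Ch" "(a * c, b * d) \<in> \<Union>Ch" using \<open>Z \<in> Ch\<close> by blast+
    qed
    then show "\<Union>Ch \<in> \<A>" using Ch(1) CA by (auto simp: \<A>_def)
  qed
  then obtain M where M: "emb_graph M" "R0 \<subseteq> M" "\<And>X. emb_graph X \<Longrightarrow> M \<subseteq> X \<Longrightarrow> X = M"
    unfolding \<A>_def mem_Collect_eq by (elim bexE conjE) (metis order_trans mem_Collect_eq)
  have dom: "\<exists>b. (a, b) \<in> M" if a: "a \<in> Lbar" for a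
  proof -
    obtain f f' where f: "pairs_in M f f'" "f \<noteq> 0" "poly f a = 0"
      "\<forall>g g'. pairs_in M g g' \<longrightarrow> g \<noteq> 0 \<longrightarrow> poly g a = 0 \<longrightarrow> degree f \<le> degree g"
      using minimal_pair[OF M(1) a] by blast
    have "degree f' > 0" using pairs_in_degree[OF M(1) f(1)] alg_root_degree[OF f(2,3)] by simp
    then obtain z' where "poly f' z' = 0" using alg_closed_imp_poly_has_root by blast
    then obtain R' where "emb_graph R'" "M \<subseteq> R'" "(a, z') \<in> R'" using emb_graph_extend[OF M(1) f(1,2,4,3)] by blast
    then show ?thesis using M(3) by blast
  qed
  define \<sigma> where "\<sigma> a = (THE b. (a, b) \<in> M)" for a
  have s: "\<sigma> a = b" if "(a, b) \<in> M" for a b unfolding \<sigma>_def using that emb_graph_unique[OF M(1)] by blast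
  have sM: "(a, \<sigma> a) \<in> M" if "a \<in> Lbar" for a using dom[OF that] s by metis
  have "hom_L \<sigma>" unfolding hom_L_def
  proof (intro conjI ballI)
    fix x y assume "x \<in> Lbar" "y \<in> Lbar"
    then have "(x, \<sigma> x) \<in> M" "(y, \<sigma> y) \<in> M" using sM by blast+
    then show "\<sigma> (x + y) = \<sigma> x + \<sigma> y" "\<sigma> (x * y) = \<sigma> x * \<sigma> y"
      using s emb_graph_add[OF M(1)] emb_graph_mult[OF M(1)] by blast+
  next
    fix x assume "x \<in> L"
    then show "\<sigma> x = x" using s emb_graph_L[OF M(1)] by blast
  qed
  moreover have "\<sigma> ` Lbar \<subseteq> Lbar" using sM emb_graph_Lbar[OF M(1)] by blast
  moreover have "\<forall>(a, b)\<in>R0. \<sigma> a = b" using s M(2) by auto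
  ultimately show ?thesis by blast
qed

lemma hom_L_poly:
  assumes "hom_L \<sigma>" "x \<in> Lbar" "\<And>i. coeff f i \<in> L" shows "\<sigma> (poly f x) = poly f (\<sigma> x)"
proof -
  have sum: "\<sigma> (sum g A) = (\<Sum>i\<in>A. \<sigma> (g i)) \<and> sum g A \<in> Lbar" if "\<And>i. i \<in> A \<Longrightarrow> g i \<in> Lbar" for g and A :: "nat set"
    using that by (induction A rule: infinite_finite_induct)
      (use assms(1) in \<open>auto simp: hom_L_def subfld_0[OF subfld_L] subfld_0[OF subfld_Lbar] subfld_add[OF subfld_Lbar]\<close>)
  have "coeff f i * x ^ i \<in> Lbar" for i using assms L_Lbar by (intro subfld_mult[OF subfld_Lbar] subfld_power[OF subfld_Lbar]) auto
  then have "\<sigma> (poly f x) = (\<Sum>i\<le>degree f. \<sigma> (coeff f i * x ^ i))" unfolding poly_altdef by (intro sum[THEN conjunct1])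
  also have "\<dots> = poly f (\<sigma> x)" unfolding poly_altdef
  proof (intro sum.cong refl)
    fix i
    have "coeff f i \<in> Lbar" "x ^ i \<in> Lbar" using assms L_Lbar subfld_power[OF subfld_Lbar] by auto
    then have "\<sigma> (coeff f i * x ^ i) = \<sigma> (coeff f i) * \<sigma> (x ^ i)" using assms(1) unfolding hom_L_def by blast
    also have "\<dots> = coeff f i * \<sigma> x ^ i" using assms hom_L_power unfolding hom_L_def by simp
    finally show "\<sigma> (coeff f i * x ^ i) = coeff f i * \<sigma> x ^ i" .
  qed
  finally show ?thesis .
qed

text \<open>An isometry is injective, and it maps the finitely many roots in Lbar of a polynomial
  over L to such roots; so it permutes them.\<close>

lemma hom_L_bij:
  assumes s: "hom_L \<sigma>" "\<sigma> ` Lbar \<subseteq> Lbar" shows "bij_betw \<sigma> Lbar Lbar"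
proof -
  have inj: "inj_on \<sigma> Lbar" using hom_L_dist[OF s(1)] by (intro inj_onI) (metis cabs_eq_0 right_minus_eq)
  have "w \<in> \<sigma> ` Lbar" if w: "w \<in> Lbar" for w
  proof -
    obtain f where f: "f \<noteq> 0" "\<And>i. coeff f i \<in> L" "poly f w = 0" using w unfolding alg_closure_in_def by auto
    define A where "A = {x \<in> Lbar. poly f x = 0}"
    have "finite A" using poly_roots_finite[OF f(1)] by (auto simp: A_def)
    moreover have "\<sigma> 0 = 0" using s subfld_0[OF subfld_L] by (auto simp: hom_L_def)
    then have "\<sigma> ` A \<subseteq> A" using hom_L_poly[OF s(1) _ f(2)] s(2) by (auto simp: A_def) metis
    moreover have "inj_on \<sigma> A" using inj by (rule inj_on_subset) (auto simp: A_def)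
    ultimately have "\<sigma> ` A = A" by (rule endo_inj_surj)
    moreover have "w \<in> A" using w f(3) by (simp add: A_def)
    ultimately have "w \<in> \<sigma> ` A" by simp
    then show ?thesis by (auto simp: A_def)
  qed
  then show ?thesis using inj s(2) by (auto simp: bij_betw_def)
qed

text \<open>Isometry gives uniform continuity, so the map extends from the dense set Lbar.\<close>

lemma hom_L_extend_GL:
  assumes s: "hom_L \<sigma>" "\<sigma> ` Lbar \<subseteq> Lbar" shows "\<exists>\<rho>\<in>GL. \<forall>x\<in>Lbar. \<rho> x = \<sigma> x"
proof -
  have "uniformly_continuous_on Lbar \<sigma>" unfolding uniformly_continuous_on_def dist_cabs using hom_L_dist[OF s(1)] by metis
  then obtain g where g: "uniformly_continuous_on (closure Lbar) g" "\<And>x. x \<in> Lbar \<Longrightarrow> \<sigma> x = g x"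
    using uniformly_continuous_on_extension_on_closure by metis
  have "continuous_on UNIV g" using g(1) closure_Lbar uniformly_continuous_imp_continuous by simp
  moreover have "bij_betw g Lbar Lbar" using hom_L_bij[OF s] g(2) bij_betw_cong[of Lbar \<sigma> g] by simp
  moreover have "hom_L g" unfolding hom_L_def
  proof (intro conjI ballI)
    fix x y assume xy: "x \<in> Lbar" "y \<in> Lbar"
    have "g (x + y) = \<sigma> (x + y)" "g (x * y) = \<sigma> (x * y)" "g x = \<sigma> x" "g y = \<sigma> y"
      using g(2) xy subfld_add[OF subfld_Lbar xy] subfld_mult[OF subfld_Lbar xy] by auto
    then show "g (x + y) = g x + g y" "g (x * y) = g x * g y" using s(1) xy unfolding hom_L_def by auto
  next
    fix x assume "x \<in> L"
    moreover from this have "x \<in> Lbar" using L_Lbar by blast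
    ultimately show "g x = x" using g(2)[of x] s(1) unfolding hom_L_def by simp
  qed
  ultimately show ?thesis using GL_iff g(2) by metis
qed

text \<open>Every root of the minimal polynomial f is the image of y under some group element, hence
  equals y. So f = c (X - y)^n, and as the characteristic is 0, y can be read off from the
  coefficient -n c y of X^(n-1).\<close>

lemma GL_fixed_Lbar:
  assumes y: "y \<in> Lbar" and fixed: "\<And>\<sigma>. \<sigma> \<in> GL \<Longrightarrow> \<sigma> y = y" shows "y \<in> L"
proof -
  define R where "R = (\<lambda>x. (x, x)) ` L"
  have R: "emb_graph R" unfolding emb_graph_def R_def using L_Lbar subfld_add[OF subfld_L] subfld_mult[OF subfld_L] by auto
  obtain f f' where f: "pairs_in R f f'" "f \<noteq> 0" "poly f y = 0"
    and min: "\<forall>g g'. pairs_in R g g' \<longrightarrow> g \<noteq> 0 \<longrightarrow> poly g y = 0 \<longrightarrow> degree f \<le> degree g"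
    using minimal_pair[OF R y] by blast
  have cf: "coeff f i \<in> L" "coeff f' i = coeff f i" for i using f(1) by (auto simp: pairs_in_def R_def)
  then have [simp]: "f' = f" by (simp add: poly_eq_iff)
  have roots: "x = y" if root: "poly f x = 0" for x
  proof -
    obtain R' where R': "emb_graph R'" "(y, x) \<in> R'" using emb_graph_extend[OF R f(1,2) min f(3), of x] root by auto
    obtain \<sigma> where \<sigma>: "hom_L \<sigma>" "\<sigma> ` Lbar \<subseteq> Lbar" "\<forall>(a, b)\<in>R'. \<sigma> a = b"
      using emb_graph_full[OF R'(1)] by (elim exE conjE)
    have "\<sigma> y = x" using \<sigma>(3) R'(2) by auto
    obtain \<rho> where \<rho>: "\<rho> \<in> GL" "\<forall>x\<in>Lbar. \<rho> x = \<sigma> x" using hom_L_extend_GL[OF \<sigma>(1,2)] by (elim bexE)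
    then have "\<rho> y = x" using y \<open>\<sigma> y = x\<close> by simp
    then show ?thesis using fixed[OF \<rho>(1)] by simp
  qed
  define n where "n = degree f"
  have n: "n > 0" using alg_root_degree f n_def by blast
  obtain A where A: "size A = n" "f = smult (lead_coeff f) (\<Prod>x\<in>#A. [:-x, 1:])" using alg_closed_imp_factorization[OF f(2)] n_def by blast
  have "x = y" if "x \<in># A" for x
  proof (rule roots)
    show "poly f x = 0" using that by (subst A(2)) (auto simp: poly_prod_mset)
  qed
  then have "set_mset A \<subseteq> {y}" by blast
  then have "A = replicate_mset n y" using A(1) set_mset_subset_singletonD[of A y] by auto
  then have "f = smult (lead_coeff f) ([:-y, 1:] ^ n)" using A(2) by simp
  then have "coeff f (n - 1) = lead_coeff f * coeff ([:-y, 1:] ^ n) (n - 1)" by (metis coeff_smult)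
  also have "coeff ([:-y, 1:] ^ n) (n - 1) = - of_nat n * y"
  proof -
    have "n choose (n - 1) = n" using n binomial_symmetric[of "n - 1" n] by simp
    then show ?thesis using n by (simp add: coeff_linear_poly_power)
  qed
  finally have "y = - coeff f (n - 1) / (lead_coeff f * of_nat n)" using n f(2) by (simp add: field_simps)
  then show ?thesis using cf subfld_L by (metis subfld_divide subfld_minus subfld_mult subfld_of_nat)
qed

end

section \<open>The theorem of Ax, Sen and Tate\<close>

lemma coeff_linear_mult:
  "coeff ([:- b, 1:] * g) i = - b * coeff g i + (if i = 0 then 0 else coeff g (i - 1) :: 'a::comm_ring_1)" by (cases i) (auto simp: coeff_pCons)

lemma higher_pderiv_shift:
  "(pderiv ^^ m) (pcompose f [:a, 1:]) = pcompose ((pderiv ^^ m) f) [:a, 1 :: 'a::{comm_ring_1,semiring_no_zero_divisors}:]"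
  by (induction m) (simp_all add: pderiv_pcompose pderiv_pCons)

context Cp begin

text \<open>A positive i below p^k contains p with exponent less than k.\<close>

lemma cabs_of_nat_lt_power:
  assumes "0 < i" "i < p ^ k" shows "cabs (of_nat (p ^ k) :: 'c) < cabs (of_nat i :: 'c)"
proof -
  obtain u where u: "i = p ^ multiplicity p i * u" "\<not> p dvd u" by (rule multiplicity_decompose'[of i p]) (use assms p_gt_1 that in auto)
  define j where "j = multiplicity p i"
  have "u > 0" using u(2) by (auto intro: Nat.gr0I)
  then have "p ^ j \<le> i" using u(1) by (metis j_def mult_le_mono2 nat_mult_1_right Suc_leI One_nat_def)
  then have "p ^ j < p ^ k" using assms by simp
  then have jk: "j < k" using p_gt_1 power_less_imp_less_exp by blast
  have "cabs (of_nat i :: 'c) = cabs (of_nat p :: 'c) ^ j" using cabs_of_nat_unit[OF u(2)] by (subst u(1)) (simp add: j_def[symmetric] cabs_mult)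
  moreover have "cabs (of_nat (p ^ k) :: 'c) = cabs (of_nat p :: 'c) ^ k" by simp
  moreover have "cabs (of_nat p :: 'c) ^ k < cabs (of_nat p :: 'c) ^ j" using jk cabs_p_less_1 p_gt_1 by (intro power_strict_decreasing) auto
  ultimately show ?thesis by simp
qed

text \<open>With m = p^k and n = m d, the binomial coefficient is n/m = d times the product of (n -
  i)/(m - i) for 0 < i < m. Since |n| <= |m| < |i|, numerator and denominator both have the absolute
  value of i.\<close>

lemma cabs_binomial:
  assumes d: "d > 0"
  shows "cabs (of_nat ((p ^ k * d) choose (p ^ k)) :: 'c) = cabs (of_nat d :: 'c)"
proof -
  let ?m = "p ^ k" and ?n = "p ^ k * d"
  have m: "?m > 0" using p_gt_1 by simp
  have mn: "?m \<le> ?n" using d by simp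
  have "(of_nat (?n choose ?m) :: 'c) = (\<Prod>i=0..<?m. of_nat (?n - i) / of_nat (?m - i))" by (rule binomial_altdef_of_nat[OF mn])
  also have "{0..<?m} = insert 0 {1..<?m}" using m by auto
  also have "(\<Prod>i\<in>\<dots>. of_nat (?n - i) / of_nat (?m - i)) = (of_nat d :: 'c) * (\<Prod>i=1..<?m. of_nat (?n - i) / of_nat (?m - i))"
    using m by (subst prod.insert) auto
  finally have "cabs (of_nat (?n choose ?m) :: 'c) = cabs (of_nat d :: 'c) * (\<Prod>i=1..<?m. cabs (of_nat (?n - i) / of_nat (?m - i) :: 'c))"
    by (simp add: cabs_prod)
  also have "(\<Prod>i=1..<?m. cabs (of_nat (?n - i) / of_nat (?m - i) :: 'c)) = (\<Prod>i=1..<?m. 1)"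
  proof (rule prod.cong[OF refl])
    fix i assume "i \<in> {1..<?m}"
    then have i: "0 < i" "i < ?m" by auto
    have lt: "cabs (of_nat ?m :: 'c) < cabs (of_nat i :: 'c)" using cabs_of_nat_lt_power i by blast
    have "cabs (of_nat ?n :: 'c) \<le> cabs (of_nat ?m :: 'c)" using mult_left_mono[OF cabs_of_nat_le[of d], of "cabs (of_nat ?m :: 'c)"] by simp
    with lt have lt': "cabs (of_nat ?n :: 'c) < cabs (of_nat i :: 'c)" by simp
    have "i \<le> ?n" using i mn by linarith
    then have "cabs (of_nat (?n - i) :: 'c) = cabs (of_nat i :: 'c)" using cabs_add_eq[of "of_nat ?n" "- of_nat i"] lt' by (simp add: of_nat_diff)
    moreover have "cabs (of_nat (?m - i) :: 'c) = cabs (of_nat i :: 'c)"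
      using cabs_add_eq[of "of_nat ?m" "- of_nat i"] lt i by (simp add: of_nat_diff)
    moreover have "cabs (of_nat i :: 'c) \<noteq> 0" using i by simp
    ultimately show "cabs (of_nat (?n - i) / of_nat (?m - i) :: 'c) = 1" by simp
  qed
  finally show ?thesis by simp
qed

text \<open>Up to sign, the coefficient of X^i is the elementary symmetric function of degree
  \<open>card A - i\<close> of the roots.\<close>

lemma coeff_prod_linear_bound:
  assumes "finite A" "\<And>x. x \<in> A \<Longrightarrow> cabs (c x :: 'c) \<le> r" "r \<ge> 0"
  shows "degree (\<Prod>x\<in>A. [:- c x, 1:]) = card A \<and> coeff (\<Prod>x\<in>A. [:- c x, 1:]) (card A) = 1 \<and>
     (\<forall>i\<le>card A. cabs (coeff (\<Prod>x\<in>A. [:- c x, 1:]) i) \<le> r ^ (card A - i))" using assms(1,2)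
proof (induction A rule: finite_induct)
  case (insert a A)
  let ?g = "\<Prod>x\<in>A. [:- c x, 1:]"
  have IH: "degree ?g = card A" "coeff ?g (card A) = 1" "\<And>i. i \<le> card A \<Longrightarrow> cabs (coeff ?g i) \<le> r ^ (card A - i)"
    using insert by auto
  have eq: "(\<Prod>x\<in>insert a A. [:- c x, 1:]) = [:- c a, 1:] * ?g" using insert.hyps by simp
  have g0: "?g \<noteq> 0" using IH(2) by auto
  have "degree ([:- c a, 1:] * ?g) = Suc (card A)" using g0 IH(1) by (subst degree_mult_eq) auto
  moreover have "coeff ([:- c a, 1:] * ?g) (Suc (card A)) = 1" using IH by (simp add: coeff_linear_mult coeff_eq_0 del: mult_pCons_left)
  moreover have "cabs (coeff ([:- c a, 1:] * ?g) i) \<le> r ^ (Suc (card A) - i)" if i: "i \<le> Suc (card A)" for i unfolding coeff_linear_mult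
  proof (rule cabs_add_le)
    show "cabs (- c a * coeff ?g i) \<le> r ^ (Suc (card A) - i)"
    proof (cases "i \<le> card A")
      case True
      have "cabs (c a) * cabs (coeff ?g i) \<le> r * r ^ (card A - i)" using insert.prems IH(3)[OF True] assms(3) by (intro mult_mono) auto
      then show ?thesis using True by (simp add: Suc_diff_le)
    next
      case False
      then show ?thesis using IH(1) assms(3) by (simp add: coeff_eq_0)
    qed
    show "cabs (if i = 0 then 0 else coeff ?g (i - 1)) \<le> r ^ (Suc (card A) - i)" using IH(3)[of "i - 1"] i assms(3) by (cases i) auto
  qed
  ultimately show ?case using insert.hyps unfolding eq by (simp del: mult_pCons_left)
qed auto

text \<open>Up to sign, the product of the roots is the constant coefficient divided by the leading
  one, so the roots cannot all exceed B. This replaces Newton polygons.\<close>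

lemma small_root:
  assumes g: "degree (g :: 'c poly) > 0" and B: "B \<ge> 0"
    and le: "cabs (coeff g 0) \<le> cabs (lead_coeff g) * B ^ degree g" shows "\<exists>x. poly g x = 0 \<and> cabs x \<le> B"
proof (rule ccontr)
  assume no: "\<not> ?thesis"
  have g0: "g \<noteq> 0" using g by auto
  obtain A where A: "size A = degree g" "g = smult (lead_coeff g) (\<Prod>x\<in>#A. [:-x, 1:])" using alg_closed_imp_factorization[OF g0] by blast
  have "poly g x = 0" if "x \<in># A" for x using that by (subst A(2)) (auto simp: poly_prod_mset)
  then have big: "\<And>x. x \<in># A \<Longrightarrow> cabs x > B" using no by force

  have *: "(\<forall>x\<in>#M. cabs x > B) \<Longrightarrow> (M = {#} \<or> cabs (poly (\<Prod>x\<in>#M. [:-x, 1:]) 0) > B ^ size M)" for M :: "'c multiset"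
  proof (induction M)
    case (add x M)
    show ?case
    proof (cases "M = {#}")
      case True then show ?thesis using add.prems by simp
    next
      case False
      then have "cabs (poly (\<Prod>x\<in>#M. [:-x, 1:]) 0) > B ^ size M" using add by auto
      moreover have "cabs x > B" using add.prems by simp
      ultimately have "cabs x * cabs (poly (\<Prod>x\<in>#M. [:-x, 1:]) 0) > B * B ^ size M" using B by (intro mult_strict_mono') auto
      then show ?thesis by simp
    qed
  qed simp
  have "A \<noteq> {#}" using A(1) g by auto
  then have gt: "cabs (poly (\<Prod>x\<in>#A. [:-x, 1:]) 0) > B ^ degree g" using *[of A] big A(1) by auto
  have "coeff g 0 = poly g 0" by (simp add: poly_0_coeff_0)
  also have "\<dots> = lead_coeff g * poly (\<Prod>x\<in>#A. [:-x, 1:]) 0" by (subst A(2)) simp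
  finally have "cabs (coeff g 0) = cabs (lead_coeff g) * cabs (poly (\<Prod>x\<in>#A. [:-x, 1:]) 0)" by simp
  moreover have "cabs (lead_coeff g) * cabs (poly (\<Prod>x\<in>#A. [:-x, 1:]) 0) > cabs (lead_coeff g) * B ^ degree g"
    using gt g0 by (intro mult_strict_left_mono) auto
  ultimately show False using le by simp
qed

end

context LField begin

section \<open>Finite orbits and Ax's descent on the number of conjugates\<close>

lemma GL_coeff_prod:
  assumes s: "\<sigma> \<in> GL"
  shows "\<sigma> (coeff (\<Prod>x\<in>A. [:- x, 1:]) i) = coeff (\<Prod>x\<in>A. [:- \<sigma> x, 1:]) i"
proof (induction A arbitrary: i rule: infinite_finite_induct)
  case (insert x A)
  then show ?case by (simp add: coeff_linear_mult GL_add[OF s] GL_diff[OF s] GL_mult[OF s] GL_minus[OF s] GL_0[OF s] del: mult_pCons_left)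
qed (auto simp: GL_0[OF s] GL_1[OF s])

lemma GL_poly_fixed:
  assumes s: "\<sigma> \<in> GL" and f: "\<And>i. \<sigma> (coeff f i) = coeff f i"
  shows "\<sigma> (poly f x) = poly f (\<sigma> x)"
  unfolding poly_altdef by (simp add: GL_sum[OF s] GL_mult[OF s] GL_power[OF s] f)

text \<open>Inverses are not asked for: on a finite orbit an injective self-map is already a
  permutation.\<close>

definition subgp :: "('c \<Rightarrow> 'c) set \<Rightarrow> bool" where
  "subgp H \<longleftrightarrow> H \<subseteq> GL \<and> (\<lambda>x. x) \<in> H \<and> (\<forall>\<sigma>\<in>H. \<forall>\<rho>\<in>H. (\<lambda>x. \<sigma> (\<rho> x)) \<in> H)"

definition orbit :: "('c \<Rightarrow> 'c) set \<Rightarrow> 'c \<Rightarrow> 'c set" where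
  "orbit H x = (\<lambda>\<sigma>. \<sigma> x) ` H"

lemma subgp_GL: "subgp GL" unfolding subgp_def using GL_id GL_comp by blast

lemma orbit_subset_roots:
  assumes H: "H \<subseteq> GL" and f: "\<And>\<sigma> i. \<sigma> \<in> H \<Longrightarrow> \<sigma> (coeff f i) = coeff f i" and x: "poly f x = 0"
  shows "orbit H x \<subseteq> {y. poly f y = 0}"
proof -
  have "poly f (\<sigma> x) = 0" if "\<sigma> \<in> H" for \<sigma> using GL_poly_fixed[of \<sigma> f x] that H f[OF that] x GL_0[of \<sigma>] by auto
  then show ?thesis by (auto simp: orbit_def)
qed

lemma finite_orbit:
  assumes H: "H \<subseteq> GL" and x: "x \<in> Lbar" shows "finite (orbit H x)"
proof -
  obtain f where f: "f \<noteq> 0" "\<And>i. coeff f i \<in> L" "poly f x = 0" using x unfolding alg_closure_in_def by auto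
  have "orbit H x \<subseteq> {y. poly f y = 0}" using H GL_fix f by (intro orbit_subset_roots) auto
  then show ?thesis using poly_roots_finite[OF f(1)] finite_subset by blast
qed

lemma orbit_image:
  assumes H: "subgp H" and x: "x \<in> Lbar" and s: "\<sigma> \<in> H" shows "\<sigma> ` orbit H x = orbit H x"
proof (rule endo_inj_surj)
  show "finite (orbit H x)" using H x by (intro finite_orbit) (auto simp: subgp_def)
  show "\<sigma> ` orbit H x \<subseteq> orbit H x"
  proof
    fix y assume "y \<in> \<sigma> ` orbit H x"
    then obtain \<rho> where "\<rho> \<in> H" "y = \<sigma> (\<rho> x)" by (auto simp: orbit_def)
    moreover have "(\<lambda>x. \<sigma> (\<rho> x)) \<in> H" using H s \<open>\<rho> \<in> H\<close> by (auto simp: subgp_def)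
    ultimately show "y \<in> orbit H x" unfolding orbit_def by (intro image_eqI[of _ _ "\<lambda>x. \<sigma> (\<rho> x)"]) auto
  qed
  show "inj_on \<sigma> (orbit H x)" using H s GL_inj by (auto simp: inj_on_def subgp_def)
qed

text \<open>If n is a power of p, one factor p is left in d, so that d >= 2 and the derivative of
  order p^k does not exhaust the degree.\<close>

lemma factor_p_power:
  assumes "n \<ge> 2" shows "\<exists>k d. n = p ^ k * d \<and> d \<ge> 2 \<and> (\<not> p dvd d \<or> d = p)"
proof -
  obtain u where u: "n = p ^ multiplicity p n * u" "\<not> p dvd u" by (rule multiplicity_decompose'[of n p]) (use assms p_gt_1 that in auto)
  define j where "j = multiplicity p n"
  show ?thesis
  proof (cases "u = 1")
    case True
    then have n: "n = p ^ j" using u by (simp add: j_def)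
    then have "j \<noteq> 0" using assms by (auto intro: Nat.gr0I)
    then obtain i where "j = Suc i" by (cases j) auto
    then show ?thesis using n p_gt_1 by (intro exI[of _ i] exI[of _ p]) auto
  next
    case False
    have "u \<noteq> 0" using u assms by (metis mult_0_right not_numeral_le_zero)
    then show ?thesis using u False by (intro exI[of _ j] exI[of _ u]) (auto simp: j_def)
  qed
qed

text \<open>The point \<open>b\<close> is a root of the \<open>p\<^sup>k\<close>-th derivative of the polynomial with the conjugates of \<open>a\<close>
  as roots: it has fewer conjugates, and the binomial coefficient in the derivative controls \<open>|b - a|\<close>.\<close>

lemma Ax_step:
  assumes H: "subgp H" and a: "a \<in> Lbar" and n: "card (orbit H a) = p ^ k * d" and d: "d \<ge> 2"
    and r: "\<forall>\<sigma>\<in>H. cabs (\<sigma> a - a) \<le> r"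
    and B: "B \<ge> 0" "r ^ (p ^ k * d - p ^ k) = cabs (of_nat d :: 'c) * B ^ (p ^ k * d - p ^ k)"
  shows "\<exists>b\<in>Lbar. cabs (b - a) \<le> B \<and> card (orbit H b) \<le> p ^ k * d - p ^ k"
proof -
  let ?m = "p ^ k" and ?n = "p ^ k * d" and ?O = "orbit H a"
  define N where "N = ?n - ?m"
  have HG: "H \<subseteq> GL" and idH: "(\<lambda>x. x) \<in> H" using H by (auto simp: subgp_def)
  have m: "?m > 0" "?m < ?n" using p_gt_1 d by auto
  then have N: "N > 0" "N + ?m = ?n" by (auto simp: N_def)
  have fin: "finite ?O" using finite_orbit[OF HG a] .
  have r0: "r \<ge> 0" using bspec[OF r idH] by simp
  define f where "f = (\<Prod>x\<in>?O. [:- x, 1:])"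
  \<comment> \<open>Moving a to the origin gives roots of size at most r, hence coefficients bounded
    by powers of r.\<close>
  define f0 where "f0 = (\<Prod>x\<in>?O. [:- (x - a), 1:])"
  have f0: "f0 = pcompose f [:a, 1:]" unfolding f_def f0_def pcompose_prod by (intro prod.cong refl) (simp add: pcompose_pCons)
  have dist: "cabs (x - a) \<le> r" if "x \<in> ?O" for x using r that by (auto simp: orbit_def)
  have f0c: "degree f0 = ?n" "coeff f0 ?n = 1" "\<And>i. i \<le> ?n \<Longrightarrow> cabs (coeff f0 i) \<le> r ^ (?n - i)"
    using coeff_prod_linear_bound[OF fin dist r0] n unfolding f0_def by auto
  have fn: "degree f = ?n" "coeff f ?n = 1"
  proof -
    define M where "M = Max (insert 0 (cabs ` ?O))"
    have "M \<ge> 0" "\<And>x. x \<in> ?O \<Longrightarrow> cabs x \<le> M" unfolding M_def using fin by (auto intro!: Max_ge)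
    then show "degree f = ?n" "coeff f ?n = 1" using coeff_prod_linear_bound[OF fin, of "\<lambda>x. x" M] n unfolding f_def by auto
  qed
  have lead: "coeff ((pderiv ^^ ?m) g) N = of_nat (fact ?m * (?n choose ?m)) * coeff g ?n" for g :: "'c poly"
  proof -
    have "pochhammer (of_nat (Suc N) :: 'c) ?m = of_nat (pochhammer (Suc N) ?m)" by (simp only: pochhammer_of_nat)
    also have "pochhammer (Suc N) ?m = fact ?m * (?n choose ?m)"
    proof -
      have "fact N * pochhammer (Suc N) ?m = (fact ?n :: nat)" using pochhammer_product[of N ?n "1::nat"] N by (simp add: pochhammer_fact N_def)
      also have "\<dots> = fact N * (fact ?m * (?n choose ?m))" using binomial_fact_lemma[of ?m ?n] m by (simp add: N_def mult_ac)
      finally show ?thesis by simp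
    qed
    finally show ?thesis using N(2) by (simp add: coeff_higher_pderiv)
  qed
  have degN: "degree ((pderiv ^^ ?m) g) = N" if "degree g = ?n" "coeff g ?n = 1" for g :: "'c poly"
  proof (rule order_antisym)
    show "degree ((pderiv ^^ ?m) g) \<le> N" using that N by (intro degree_le) (auto simp: coeff_higher_pderiv coeff_eq_0)
    have "of_nat (fact ?m * (?n choose ?m)) \<noteq> (0::'c)" using d by (simp only: of_nat_eq_0_iff) simp
    then have "coeff ((pderiv ^^ ?m) g) N \<noteq> 0" unfolding lead using that by simp
    then show "N \<le> degree ((pderiv ^^ ?m) g)" by (rule le_degree)
  qed
  \<comment> \<open>The constant coefficient is m! times the m-th coefficient of \<open>f0\<close>,
    the leading one is m! times the binomial coefficient, of absolute value |d|. The factor m!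
    cancels, and what remains is the balance in the hypothesis on B.\<close>
  define g where "g = (pderiv ^^ ?m) f0"
  have dg: "degree g = N" using degN f0c by (simp add: g_def)
  have "cabs (coeff g 0) = cabs (fact ?m :: 'c) * cabs (coeff f0 ?m)" by (simp add: g_def coeff_higher_pderiv pochhammer_fact[symmetric])
  also have "\<dots> \<le> cabs (fact ?m :: 'c) * r ^ N" using f0c(3)[of ?m] m by (intro mult_left_mono) (auto simp: N_def)
  also have "\<dots> = cabs (lead_coeff g) * B ^ N" using B(2) cabs_binomial[of d k] d unfolding dg unfolding g_def lead f0c(2) by (simp add: N_def)
  finally have "\<exists>x. poly g x = 0 \<and> cabs x \<le> B" using dg N B(1) by (intro small_root) auto
  then obtain x where x: "poly g x = 0" "cabs x \<le> B" by blast
  define b where "b = x + a"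
  define F where "F = (pderiv ^^ ?m) f"
  have "g = pcompose F [:a, 1:]" unfolding g_def f0 F_def by (rule higher_pderiv_shift)
  then have Fb: "poly F b = 0" using x(1) by (simp add: poly_pcompose b_def add.commute)
  have F0: "F \<noteq> 0" "degree F = N" using degN[OF fn] N by (auto simp: F_def)
  have OL: "?O \<subseteq> Lbar" using HG GL_Lbar a by (auto simp: orbit_def)
  have "coeff (\<Prod>x\<in>A. [:- x, 1:]) i \<in> Lbar" if "A \<subseteq> Lbar" for A i using that
  proof (induction A arbitrary: i rule: infinite_finite_induct)
    case (insert x A)
    then have "- x * coeff (\<Prod>x\<in>A. [:- x, 1:]) i \<in> Lbar" "coeff (\<Prod>x\<in>A. [:- x, 1:]) (i - 1) \<in> Lbar"
      using insert by (auto simp del: mult_minus_left intro!: subfld_mult[OF subfld_Lbar] subfld_minus[OF subfld_Lbar])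
    then have "- x * coeff (\<Prod>x\<in>A. [:- x, 1:]) i + (if i = 0 then 0 else coeff (\<Prod>x\<in>A. [:- x, 1:]) (i - 1)) \<in> Lbar"
      using subfld_0[OF subfld_Lbar] by (intro subfld_add[OF subfld_Lbar]) simp_all
    then show ?case using insert.hyps by (simp only: prod.insert[OF insert.hyps] coeff_linear_mult)
  qed (auto simp: subfld_0[OF subfld_Lbar] subfld_1[OF subfld_Lbar] coeff_1)
  then have fL: "coeff f i \<in> Lbar" for i using OL by (simp add: f_def)
  have Fc: "coeff F i = of_nat (pochhammer (Suc i) ?m) * coeff f (i + ?m)" for i unfolding F_def coeff_higher_pderiv by (simp only: pochhammer_of_nat)
  have "coeff F i \<in> Lbar" for i unfolding Fc using fL by (intro subfld_mult[OF subfld_Lbar] subfld_of_nat[OF subfld_Lbar])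
  then have bL: "b \<in> Lbar" using alg_closure_in_root[OF subfld_L F0(1) _ Fb] by blast
  \<comment> \<open>H permutes the orbit of a, so it fixes the coefficients of f and of its
    derivative F. Hence the conjugates of b are among the at most N roots of F.\<close>
  have Ffix: "\<sigma> (coeff F i) = coeff F i" if s: "\<sigma> \<in> H" for \<sigma> i
  proof -
    have sG: "\<sigma> \<in> GL" using s HG by blast
    have "(\<Prod>x\<in>?O. [:- \<sigma> x, 1:]) = (\<Prod>x\<in>\<sigma> ` ?O. [:- x, 1:])"
      using GL_inj[OF sG] by (subst prod.reindex) (auto simp: inj_on_def)
    then have "(\<Prod>x\<in>?O. [:- \<sigma> x, 1:]) = f" using orbit_image[OF H a s] by (simp add: f_def)
    then have "\<sigma> (coeff f j) = coeff f j" for j using GL_coeff_prod[OF sG, of ?O j] by (simp add: f_def)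
    then show ?thesis unfolding Fc using GL_mult[OF sG] GL_fix[OF sG] subfld_of_nat[OF subfld_L] by simp
  qed
  have "card (orbit H b) \<le> card {y. poly F y = 0}" using HG Ffix Fb poly_roots_finite[OF F0(1)] by (intro card_mono orbit_subset_roots) auto
  also have "\<dots> \<le> N" using card_poly_roots_bound[OF F0(1)] F0(2) by simp
  finally show ?thesis using bL x(2) unfolding N_def b_def by (intro bexI[of _ "x + a"]) auto
qed

text \<open>\<open>Ax_step\<close> is repeated until the point is fixed. A step loses the factor
  p^(1/N) only if the number n of conjugates is a power of p. Then N = n - n/p and 1/N + (p - p/N) =
  p - p/n, so the exponent in the bound passes from N to n without excess; it never exceeds
  p.\<close>

lemma Ax_orbit:
  assumes H: "subgp H"
  shows "a \<in> Lbar \<Longrightarrow> \<forall>\<sigma>\<in>H. cabs (\<sigma> a - a) \<le> r \<Longrightarrow>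
     \<exists>y\<in>Lbar. (\<forall>\<sigma>\<in>H. \<sigma> y = y) \<and> cabs (y - a) \<le> r * real p powr (real p - real p / real (card (orbit H a)))"
proof (induction "card (orbit H a)" arbitrary: a r rule: less_induct)
  case less
  let ?n = "card (orbit H a)"
  have HG: "H \<subseteq> GL" and idH: "(\<lambda>x. x) \<in> H" using H by (auto simp: subgp_def)
  have r0: "r \<ge> 0" using bspec[OF less.prems(2) idH] by simp
  have fin: "finite (orbit H a)" using finite_orbit[OF HG less.prems(1)] .
  have aO: "a \<in> orbit H a" using idH by (force simp: orbit_def)
  have pos: "?n > 0" using fin aO card_gt_0_iff by blast
  have p1: "real p > 1" using p_gt_1 by simp
  show ?case
  proof (cases "?n \<ge> 2")
    case False
    then have "?n = 1" using pos by simp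
    then have "orbit H a = {a}" using aO by (metis card_1_singletonE singletonD)
    then have "\<forall>\<sigma>\<in>H. \<sigma> a = a" by (auto simp: orbit_def)
    then show ?thesis using less.prems(1) r0 by (intro bexI[of _ a]) auto
  next
    case True
    then obtain k d where kd: "?n = p ^ k * d" "d \<ge> 2" "\<not> p dvd d \<or> d = p" using factor_p_power by blast
    define N where "N = p ^ k * d - p ^ k"
    have "p ^ k * d \<ge> p ^ k * 2" using kd(2) by (intro mult_le_mono2)
    moreover have pk: "p ^ k > 0" using p_gt_1 by simp
    ultimately have N: "N > 0" "N < ?n" unfolding N_def kd(1) by linarith+
    \<comment> \<open>The loss exponent: if p divides d, then d = p, and r^N = |p| B^N requires B =
      r p^(1/N); otherwise |d| = 1 and B = r.\<close>
    define e where "e = (if p dvd d then 1 / real N else 0)"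
    define B where "B = r * real p powr e"
    have e0: "e \<ge> 0" by (simp add: e_def)
    have Br: "B \<ge> r" using r0 p1 e0 mult_left_mono[of 1 "real p powr e" r] ge_one_powr_ge_zero[of "real p" e] by (simp add: B_def)
    have eq: "r ^ N = cabs (of_nat d :: 'c) * B ^ N"
    proof (cases "p dvd d")
      case True
      then have "d = p" using kd by simp
      have "(real p powr e) ^ N = real p powr (e * real N)" using p1 by (simp add: powr_realpow[symmetric] powr_powr)
      also have "\<dots> = real p" using N True p1 by (simp add: e_def)
      finally show ?thesis using \<open>d = p\<close> p1 by (simp add: B_def power_mult_distrib cabs_p)
    next
      case False
      then show ?thesis using p1 by (simp add: B_def e_def cabs_of_nat_unit)
    qed
    obtain b where b: "b \<in> Lbar" "cabs (b - a) \<le> B" "card (orbit H b) \<le> N"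
      using Ax_step[OF H less.prems(1) kd(1,2) less.prems(2), of B] eq Br r0 unfolding N_def by force
    have inv: "cabs (\<sigma> b - b) \<le> B" if s: "\<sigma> \<in> H" for \<sigma>
    proof -
      have "cabs (\<sigma> b - \<sigma> a) \<le> B" using b(2) GL_isometric s HG by auto
      moreover have "cabs (\<sigma> a - b) \<le> B"
        using cabs_diff_triangle[of "\<sigma> a" a B b] bspec[OF less.prems(2) s] Br b(2) by (simp add: cabs_minus_commute)
      ultimately show ?thesis by (rule cabs_diff_triangle)
    qed
    let ?n' = "card (orbit H b)"
    obtain y where y: "y \<in> Lbar" "\<forall>\<sigma>\<in>H. \<sigma> y = y" "cabs (y - b) \<le> B * real p powr (real p - real p / real ?n')"
      using less.hyps[of b B] b inv N by auto
    have "b \<in> orbit H b" using idH by (force simp: orbit_def)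
    then have n'0: "?n' > 0" using finite_orbit[OF HG b(1)] card_gt_0_iff by blast
    have exp: "e + (real p - real p / real ?n') \<le> real p - real p / real ?n"
    proof -
      have "real p / real N \<le> real p / real ?n'" using b(3) n'0 p1 by (intro divide_left_mono) auto
      moreover have "e + (real p - real p / real N) \<le> real p - real p / real ?n"
      proof (cases "p dvd d")
        case True
        then have "d = p" using kd by simp
        have "real N = real (p ^ k) * (real p - 1)" unfolding N_def \<open>d = p\<close> using p_gt_1 by (simp add: of_nat_diff right_diff_distrib)
        moreover have "real ?n = real (p ^ k) * real p" unfolding kd(1) \<open>d = p\<close> by simp
        moreover have "real (p ^ k) > 0" using pk by simp
        ultimately have "(real p - 1) / real N = 1 / real (p ^ k)" "real p / real ?n = 1 / real (p ^ k)" using p1 by simp_all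
        moreover have "e + (real p - real p / real N) = real p - (real p - 1) / real N" using True by (simp add: e_def diff_divide_distrib)
        ultimately show ?thesis by simp
      next
        case False
        have "real p / real ?n \<le> real p / real N" using N p1 by (intro divide_left_mono) auto
        then show ?thesis using False by (simp add: e_def)
      qed
      ultimately show ?thesis by linarith
    qed
    have bd: "B * real p powr (real p - real p / real ?n') \<le> r * real p powr (real p - real p / real ?n)"
    proof -
      have "B * real p powr (real p - real p / real ?n') = r * real p powr (e + (real p - real p / real ?n'))" by (simp add: B_def powr_add)
      also have "\<dots> \<le> r * real p powr (real p - real p / real ?n)" using exp p1 r0 by (intro mult_left_mono powr_mono) auto
      finally show ?thesis .
    qed
    have "real p / real ?n' \<le> real p" using n'0 p1 by (simp add: field_simps)
    then have "real p powr (real p - real p / real ?n') \<ge> 1" using p1 by (intro ge_one_powr_ge_zero) auto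
    then have "B \<le> B * real p powr (real p - real p / real ?n')"
      using Br r0 mult_left_mono[of 1 "real p powr (real p - real p / real ?n')" B] by simp
    then have "cabs (b - a) \<le> r * real p powr (real p - real p / real ?n)" using b(2) bd by linarith
    moreover have "cabs (y - b) \<le> r * real p powr (real p - real p / real ?n)" using y(3) bd by linarith
    ultimately have "cabs (y - a) \<le> r * real p powr (real p - real p / real ?n)" using cabs_diff_triangle by blast
    then show ?thesis using y by blast
  qed
qed

theorem Ax_Sen_Tate:
  assumes H: "subgp H" and x: "\<forall>\<sigma>\<in>H. \<sigma> x = x" and e: "e > 0"
  shows "\<exists>y\<in>Lbar. (\<forall>\<sigma>\<in>H. \<sigma> y = y) \<and> cabs (x - y) < e"
proof -
  have HG: "H \<subseteq> GL" using H by (auto simp: subgp_def)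
  define M where "M = real p powr real p"
  have M: "M \<ge> 1" using p_gt_1 by (auto simp: M_def intro: ge_one_powr_ge_zero)
  \<comment> \<open>M = p^p bounds the constant of \<open>Ax_orbit\<close> independently of the
    orbit. Dividing by 2 M makes both r and r M smaller than e.\<close>
  define r where "r = e / (2 * M)"
  have r: "r > 0" "r * M < e" "r < e" using e M by (auto simp: r_def field_simps)
  obtain a where a: "a \<in> Lbar" "cabs (x - a) < r" using Lbar_dense r(1) by blast
  have "cabs (\<sigma> a - a) \<le> r" if s: "\<sigma> \<in> H" for \<sigma>
  proof -
    have "cabs (\<sigma> a - \<sigma> x) \<le> r" using GL_isometric[of \<sigma> a x] s HG a by (auto simp: cabs_minus_commute)
    then show ?thesis using cabs_diff_triangle[of "\<sigma> a" x r a] bspec[OF x s] a by simp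
  qed
  then obtain y where y: "y \<in> Lbar" "\<forall>\<sigma>\<in>H. \<sigma> y = y"
      "cabs (y - a) \<le> r * real p powr (real p - real p / real (card (orbit H a)))" using Ax_orbit[OF H a(1)] by blast
  have "real p powr (real p - real p / real (card (orbit H a))) \<le> M" unfolding M_def using p_gt_1 by (intro powr_mono) auto
  then have "r * real p powr (real p - real p / real (card (orbit H a))) \<le> r * M" using r by (intro mult_left_mono) auto
  then have "cabs (y - a) < e" using y(3) r by linarith
  then have "cabs (x - y) < e" using cabs_diff_triangle_less[of x a e y] a r by (simp add: cabs_minus_commute)
  then show ?thesis using y by blast
qed

corollary GL_fixed:
  assumes "\<forall>\<sigma>\<in>GL. \<sigma> x = x" shows "x \<in> L"
proof -
  have "\<exists>y\<in>L. cabs (x - y) < e" if "e > 0" for e using Ax_Sen_Tate[OF subgp_GL assms that] GL_fixed_Lbar by blast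
  then show ?thesis using closed_L unfolding closed_cabs by blast
qed

end

section \<open>The residue field\<close>

context Cp begin

text \<open>A nearby fraction in lowest terms is integral, so its denominator is prime to p and can
  be inverted modulo p. Thus the residue field of \<open>Qp\<close> is the prime field.\<close>

lemma Qp_approx:
  assumes x: "x \<in> (Qp :: 'c set)" "cabs x \<le> 1" shows "\<exists>k. cabs (x - of_nat k) < 1"
proof -
  obtain r where r: "r \<in> \<rat>" "cabs (x - r) < 1" using x(1) unfolding Qp_def closure_cabs by (meson zero_less_one)
  obtain a b where ab: "b > 0" "coprime a b" "r = of_int a / of_int b" using Rats_cases'[OF r(1)] by metis
  have r1: "cabs r \<le> 1" using cabs_diff_le[of x 1 "x - r"] x r by simp
  have pb: "\<not> int p dvd b"
  proof
    assume pb: "int p dvd b"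
    then have "\<not> int p dvd a" using ab(2) p_prime by (metis coprime_common_divisor not_prime_unit prime_int_nat_transfer of_nat_0_le_iff nat_int prime_nat_int_transfer)
    then have "cabs (of_int a :: 'c) = 1" by (rule cabs_of_int_unit)
    moreover have "cabs (of_int b :: 'c) < 1"
    proof -
      obtain c where c: "b = int p * c" using pb by blast
      have "cabs (of_int b :: 'c) = cabs (of_nat p :: 'c) * cabs (of_int c :: 'c)" unfolding c by simp
      also have "\<dots> \<le> cabs (of_nat p :: 'c) * 1" using cabs_of_int_le by (intro mult_left_mono) auto
      finally show ?thesis using cabs_p_less_1 by simp
    qed
    moreover have "cabs (of_int b :: 'c) > 0" using ab(1) by simp
    ultimately show False using r1 unfolding ab(3) by (simp add: field_simps)
  qed
  have "coprime (int p) b" using pb p_prime by (simp add: prime_imp_coprime)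
  then obtain u v where uv: "u * int p + v * b = 1" using bezout_int[of "int p" b] by auto
  define k where "k = nat ((a * v) mod int p)"
  have k: "int k = (a * v) mod int p" using p_gt_1 by (simp add: k_def)
  have "a - int k * b = a * (1 - v * b) + (a * v - int k) * b" by (simp add: algebra_simps)
  also have "1 - v * b = u * int p" using uv by simp
  also have "a * v - int k = int p * ((a * v) div int p)" unfolding k by (simp add: minus_mod_eq_mult_div)
  finally have "a - int k * b = int p * (a * u + (a * v) div int p * b)" by (simp add: algebra_simps)
  then have "(of_int (a - int k * b) :: 'c) = of_nat p * of_int (a * u + (a * v) div int p * b)" by (metis of_int_mult of_int_of_nat_eq)
  then have "cabs (of_int (a - int k * b) :: 'c) = cabs (of_nat p :: 'c) * cabs (of_int (a * u + (a * v) div int p * b) :: 'c)" by simp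
  also have "\<dots> \<le> cabs (of_nat p :: 'c) * 1" by (rule mult_left_mono[OF cabs_of_int_le[of "a * u + (a * v) div int p * b"]]) simp
  finally have lt: "cabs (of_int (a - int k * b) :: 'c) < 1" using cabs_p_less_1 by simp
  have b1: "cabs (of_int b :: 'c) = 1" using pb by (rule cabs_of_int_unit)
  then have "(of_int b :: 'c) \<noteq> 0" by auto
  then have "r - of_nat k = of_int (a - int k * b) / of_int b" unfolding ab(3) by (simp add: field_simps)
  then have "cabs (r - of_nat k) < 1" using lt b1 by simp
  then have "cabs (x - of_nat k) < 1" using cabs_diff_triangle_less r(2) by blast
  then show ?thesis by blast
qed

lemma cabs_prod_diff:
  assumes "finite A" "\<And>i. i \<in> A \<Longrightarrow> cabs (f i :: 'c) \<le> 1 \<and> cabs (g i) \<le> 1 \<and> cabs (f i - g i) < 1"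
  shows "cabs (prod f A - prod g A) < 1"
  using assms
proof (induction A rule: finite_induct)
  case (insert x A)
  have "cabs (prod f A) \<le> 1" "cabs (g x) \<le> 1" using insert.prems by (auto simp: cabs_prod intro!: prod_le_1)
  then have "cabs (prod f A * (f x - g x) + g x * (prod f A - prod g A)) < 1" using insert by (intro cabs_add_less cabs_mult_less) auto
  then show ?case using insert.hyps by (simp add: algebra_simps)
qed simp

text \<open>Over the residue field: a polynomial with more zeros than its degree is 0. Dividing by X
  - t keeps small values at the other points, because the differences s - t are units.\<close>

lemma poly_small_coeffs:
  assumes "finite T" "\<And>t. t \<in> T \<Longrightarrow> cabs (t :: 'c) \<le> 1"
    "\<And>s t. s \<in> T \<Longrightarrow> t \<in> T \<Longrightarrow> s \<noteq> t \<Longrightarrow> cabs (s - t) = 1"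
    "degree f < card T" "\<And>t. t \<in> T \<Longrightarrow> cabs (poly f t) < 1" shows "cabs (coeff f i) < 1" using assms
proof (induction T arbitrary: f i rule: finite_induct)
  case (insert t T)
  define g where "g = synthetic_div f t"
  have fg: "[:- t, 1:] * g + [:poly f t:] = f" unfolding g_def by (rule synthetic_div_correct')
  have ft: "cabs (poly f t) < 1" using insert.prems by simp
  have gi: "cabs (coeff g i) < 1" for i
  proof (cases "T = {}")
    case True
    then have "degree f = 0" using insert.prems(3) insert.hyps by simp
    then have "g = 0" by (simp add: g_def synthetic_div_eq_0_iff)
    then show ?thesis by simp
  next
    case False
    show ?thesis
    proof (rule insert.IH)
      have "card T > 0" using False insert.hyps by (simp add: card_gt_0_iff)
      moreover have "degree f \<le> card T" using insert.prems(3) insert.hyps by simp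
      ultimately show "degree g < card T" unfolding g_def degree_synthetic_div by linarith
      fix s assume s: "s \<in> T"
      then have st: "cabs (s - t) = 1" using insert.prems(2)[of s t] insert.hyps by auto
      have "poly f s = (s - t) * poly g s + poly f t" by (subst fg[symmetric]) (simp add: left_diff_distrib)
      then have "(s - t) * poly g s = poly f s - poly f t" by simp
      moreover have "cabs (poly f s - poly f t) < 1" using insert.prems s by (intro cabs_diff_less) auto
      ultimately show "cabs (poly g s) < 1" using st by (metis cabs_mult mult_1)
    qed (use insert.prems in auto)
  qed
  have "coeff f i = coeff ([:- t, 1:] * g) i + coeff [:poly f t:] i" by (metis fg coeff_add)
  also have "\<dots> = - t * coeff g i + (if i = 0 then 0 else coeff g (i - 1)) + (if i = 0 then poly f t else 0)"
    unfolding coeff_linear_mult by (auto simp: coeff_pCons split: nat.splits)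
  also have "cabs \<dots> < 1"
  proof (intro cabs_add_less)
    show "cabs (- t * coeff g i) < 1" using insert.prems(1)[of t] gi by (intro cabs_mult_less) auto
  qed (use gi ft in auto)
  finally show ?case .
qed simp

end

context LField begin

section \<open>The valuation ring of L\<close>

abbreviation "oL \<equiv> o_ring L"

lemma oL_iff: "x \<in> oL \<longleftrightarrow> x \<in> L \<and> cabs x \<le> 1" by (auto simp: o_ring_def)

lemma pi_nz: "\<pi> \<noteq> 0" and pi_oL: "\<pi> \<in> oL" and pi_lt_1: "cabs \<pi> < 1"
proof -
  show "\<pi> \<noteq> 0" using unif by (simp add: uniformizer_def)
  have "\<pi> * 1 \<in> (\<lambda>x. \<pi> * x) ` oL" using subfld_1[OF subfld_L] by (intro imageI) (simp add: oL_iff)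
  then have "\<pi> \<in> {x \<in> L. cabs x < 1}" using unif by (simp add: uniformizer_def)
  then show "\<pi> \<in> oL" "cabs \<pi> < 1" by (auto simp: oL_iff)
qed

lemma pi_L: "\<pi> \<in> L" using pi_oL by (simp add: oL_iff)

lemma pi_pos: "cabs \<pi> > 0" using pi_nz by simp

lemma oL_add: "x \<in> oL \<Longrightarrow> y \<in> oL \<Longrightarrow> x + y \<in> oL"
  and oL_mult: "x \<in> oL \<Longrightarrow> y \<in> oL \<Longrightarrow> x * y \<in> oL"
  and oL_minus: "x \<in> oL \<Longrightarrow> - x \<in> oL"
  and oL_diff: "x \<in> oL \<Longrightarrow> y \<in> oL \<Longrightarrow> x - y \<in> oL"
  and oL_0: "0 \<in> oL" and oL_1: "1 \<in> oL"
  and oL_of_nat: "of_nat n \<in> oL" using subfld_L by (auto simp: oL_iff subfld_intros cabs_add_le cabs_diff_le cabs_of_nat_le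
      simp del: cabs_mult intro: cabs_le_1_mult)

lemma oL_power: "x \<in> oL \<Longrightarrow> x ^ n \<in> oL" by (induction n) (auto simp: oL_1 oL_mult)

lemma oL_sum: "(\<And>i. i \<in> A \<Longrightarrow> f i \<in> oL) \<Longrightarrow> sum f A \<in> oL"
  by (induction A rule: infinite_finite_induct) (auto simp: oL_0 oL_add)

lemma oL_inverse: "x \<in> L \<Longrightarrow> cabs x = 1 \<Longrightarrow> inverse x \<in> oL" by (simp add: oL_iff subfld_inverse[OF subfld_L])

lemma closed_oL: "closed oL"
proof -
  have "oL = L \<inter> cball 0 1" by (auto simp: oL_iff cabs_def dist_commute)
  then show ?thesis using closed_Int[OF closed_L closed_cball] by metis
qed

lemma L_dvd_power:
  assumes "x \<in> L" "cabs x \<le> cabs \<pi> ^ n" shows "\<exists>y\<in>oL. x = \<pi> ^ n * y"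
proof -
  have "cabs (x / \<pi> ^ n) \<le> 1" using assms(2) pi_pos by (simp add: field_simps)
  then have "x / \<pi> ^ n \<in> oL" using assms(1) pi_L subfld_L by (simp add: oL_iff subfld_divide subfld_power)
  then show ?thesis using pi_nz by (intro bexI[of _ "x / \<pi> ^ n"]) auto
qed

lemma L_less_1: "x \<in> L \<Longrightarrow> cabs x < 1 \<Longrightarrow> cabs x \<le> cabs \<pi>"
proof -
  assume "x \<in> L" "cabs x < 1"
  then have "x \<in> (\<lambda>x. \<pi> * x) ` oL" using unif unfolding uniformizer_def by blast
  then obtain y where "y \<in> oL" "x = \<pi> * y" by blast
  then show ?thesis by (simp add: oL_iff mult_left_le)
qed

lemma L_less_power: "x \<in> L \<Longrightarrow> cabs x < cabs \<pi> ^ n \<Longrightarrow> cabs x \<le> cabs \<pi> ^ Suc n"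
proof -
  assume a: "x \<in> L" "cabs x < cabs \<pi> ^ n"
  then have "x / \<pi> ^ n \<in> L" "cabs (x / \<pi> ^ n) < 1" using pi_L subfld_L pi_pos by (simp_all add: subfld_divide subfld_power field_simps)
  then have "cabs (x / \<pi> ^ n) \<le> cabs \<pi>" by (rule L_less_1)
  then show ?thesis using pi_pos by (simp add: field_simps)
qed

lemma oL_factor:
  assumes "x \<in> oL" "x \<noteq> 0" shows "\<exists>k u. u \<in> L \<and> cabs u = 1 \<and> x = \<pi> ^ k * u"
proof -
  obtain n where "cabs \<pi> ^ n < cabs x" using small_power[OF pi_lt_1, of "cabs x"] assms(2) by auto
  then have ex: "\<exists>n. cabs \<pi> ^ Suc n < cabs x"
    by (intro exI[of _ n]) (use pi_lt_1 in \<open>auto intro: le_less_trans[rotated] simp: mult_left_le_one_le\<close>)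
  \<comment> \<open>With the least n such that |\<pi>|^(n+1) < |x|, the value of x lies in the
    interval above |\<pi>|^(k+1) and up to |\<pi>|^k; discreteness leaves only |\<pi>|^k.\<close>
  define k where "k = (LEAST n. cabs \<pi> ^ Suc n < cabs x)"
  have k: "cabs \<pi> ^ Suc k < cabs x" unfolding k_def using ex by (rule LeastI_ex)
  have "cabs x \<le> cabs \<pi> ^ k"
  proof (cases k)
    case 0 then show ?thesis using assms by (simp add: oL_iff)
  next
    case (Suc j)
    then have "\<not> cabs \<pi> ^ Suc j < cabs x" using not_less_Least[of j "\<lambda>n. cabs \<pi> ^ Suc n < cabs x"] unfolding k_def by auto
    then show ?thesis using Suc by simp
  qed
  moreover have "\<not> cabs x < cabs \<pi> ^ k" using k L_less_power[of x k] assms by (auto simp: oL_iff)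
  ultimately have "cabs x = cabs \<pi> ^ k" by simp
  then show ?thesis using pi_nz pi_L assms subfld_L by (intro exI[of _ k] exI[of _ "x / \<pi> ^ k"]) (auto simp: oL_iff subfld_divide subfld_power)
qed

section \<open>The residue field: finiteness, Fermat's theorem and binomial coefficients\<close>

definition resrel :: "('c \<times> 'c) set" where
  "resrel = {(x, y). x \<in> oL \<and> y \<in> oL \<and> x - y \<in> (\<lambda>z. \<pi> * z) ` oL}"

lemma resrel_iff: "(x, y) \<in> resrel \<longleftrightarrow> x \<in> oL \<and> y \<in> oL \<and> cabs (x - y) < 1"
proof -
  have "x - y \<in> (\<lambda>z. \<pi> * z) ` oL \<longleftrightarrow> cabs (x - y) < 1" if "x \<in> oL" "y \<in> oL"
  proof -
    have "x - y \<in> L" using that subfld_L by (auto simp: oL_iff subfld_diff)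
    then show ?thesis using unif unfolding uniformizer_def by blast
  qed
  then show ?thesis by (auto simp: resrel_def)
qed

abbreviation q :: nat where "q \<equiv> residue_card L \<pi>"

lemma residue_card_eq: "q = card (oL // resrel)" by (simp add: residue_card_def resrel_def)

lemma equiv_resrel: "equiv oL resrel"
proof (rule equivI)
  show "resrel \<subseteq> oL \<times> oL" by (auto simp: resrel_iff)
  show "refl_on oL resrel" by (auto simp: refl_on_def resrel_iff)
  show "sym resrel" by (auto simp: sym_def resrel_iff cabs_minus_commute)
  show "trans resrel" unfolding trans_def resrel_iff using cabs_diff_triangle_less by blast
qed

text \<open>If the residue field is infinite, finitely many residues have only finitely many
  combinations over the prime field. So a residue outside all of them can be added to an independent
  family.\<close>

lemma residue_independent:
  assumes inf: "infinite (oL // resrel)"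
  shows "\<exists>b::nat \<Rightarrow> 'c. (\<forall>i<n. b i \<in> oL) \<and>
     (\<forall>k::nat\<Rightarrow>nat. cabs (\<Sum>i<n. of_nat (k i) * b i) < 1 \<longrightarrow> (\<forall>i<n. p dvd k i))"
proof (induction n)
  case (Suc n)
  then obtain b where b0: "\<forall>i<n. b i \<in> oL"
    and ind: "\<forall>k::nat\<Rightarrow>nat. cabs (\<Sum>i<n. of_nat (k i) * b i) < 1 \<longrightarrow> (\<forall>i<n. p dvd k i)" by (elim exE conjE)
  have b: "b i \<in> oL" if "i < n" for i using b0 that by blast
  define S where "S k = (\<Sum>i<n. of_nat (k i) * b i)" for k :: "nat \<Rightarrow> nat"
  have SL: "S k \<in> oL" for k unfolding S_def using b by (intro oL_sum oL_mult oL_of_nat) auto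
  \<comment> \<open>Modulo p, coefficients from 0 to p - 1 suffice, so the combinations reduce to a
    finite set.\<close>
  define Cs where "Cs = S ` ({..<n} \<rightarrow>\<^sub>E {..<p})"
  have finC: "finite Cs" unfolding Cs_def by (intro finite_imageI finite_PiE) auto
  have red: "\<exists>c\<in>Cs. cabs (S k - c) < 1" for k
  proof -
    define k' where "k' = restrict (\<lambda>i. k i mod p) {..<n}"
    have "S k' \<in> Cs" unfolding Cs_def k'_def using p_gt_1 by (intro imageI restrict_PiE_iff[THEN iffD2]) auto
    moreover have "cabs (S k - S k') < 1"
    proof -
      have "S k - S k' = (\<Sum>i<n. (of_nat (k i) - of_nat (k i mod p)) * b i)"
        unfolding S_def k'_def by (simp add: sum_subtractf[symmetric] left_diff_distrib)
      also have "\<dots> = (\<Sum>i<n. of_nat p * (of_nat (k i div p) * b i))"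
      proof (rule sum.cong[OF refl])
        fix i
        have "(of_nat (k i) :: 'c) = of_nat (p * (k i div p) + k i mod p)" by simp
        then have "(of_nat (k i) :: 'c) - of_nat (k i mod p) = of_nat p * of_nat (k i div p)" by (simp only: of_nat_add of_nat_mult) simp
        then show "(of_nat (k i) - of_nat (k i mod p)) * b i = of_nat p * (of_nat (k i div p) * b i)" by simp
      qed
      also have "\<dots> = of_nat p * S (\<lambda>i. k i div p)" by (simp add: S_def sum_distrib_left)
      also have "cabs \<dots> < 1" using SL[of "\<lambda>i. k i div p"] cabs_p_less_1
        by (subst mult.commute) (intro cabs_mult_less, auto simp: oL_iff)
      finally show ?thesis .
    qed
    ultimately show ?thesis by blast
  qed
  have "\<exists>b'\<in>oL. \<forall>c\<in>Cs. \<not> cabs (b' - c) < 1"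
  proof (rule ccontr)
    assume "\<not> ?thesis"
    then have near: "\<And>x. x \<in> oL \<Longrightarrow> \<exists>c\<in>Cs. cabs (x - c) < 1" by blast
    have "oL // resrel \<subseteq> (\<lambda>c. resrel `` {c}) ` Cs"
    proof
      fix X assume "X \<in> oL // resrel"
      then obtain x where x: "x \<in> oL" "X = resrel `` {x}" by (auto simp: quotient_def)
      obtain c where c: "c \<in> Cs" "cabs (x - c) < 1" using near x by blast
      then have "(x, c) \<in> resrel" using x SL by (auto simp: resrel_iff Cs_def)
      then have "X = resrel `` {c}" using x equiv_class_eq[OF equiv_resrel] by simp
      then show "X \<in> (\<lambda>c. resrel `` {c}) ` Cs" using c by blast
    qed
    then show False using inf finC finite_surj by blast
  qed
  then obtain b' where b': "b' \<in> oL" "\<And>c. c \<in> Cs \<Longrightarrow> \<not> cabs (b' - c) < 1" by blast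
  have "\<forall>i<Suc n. p dvd k i" if k: "cabs (\<Sum>i<Suc n. of_nat (k i) * (b(n := b')) i) < 1" for k :: "nat \<Rightarrow> nat"
  proof -
    have k': "cabs (S k + of_nat (k n) * b') < 1" using k by (simp add: S_def)
    have "p dvd k n"
    proof (rule ccontr)
      assume "\<not> p dvd k n"
      then have "coprime (int p) (int (k n))" using p_prime by (simp add: prime_imp_coprime)
      then obtain u v where uv: "u * int p + v * int (k n) = 1" using bezout_int[of "int p" "int (k n)"] by auto
      \<comment> \<open>Since w = -v modulo p, the number w times \<open>k n\<close> is -1 modulo p.
        Multiplying the relation by w solves it for the new element, which would then be near a
        combination.\<close>
      define w where "w = nat ((- v) mod int p)"
      have w: "int w = (- v) mod int p" using p_gt_1 by (simp add: w_def)
      have "int p dvd int w + v" unfolding w by (metis add.commute diff_minus_eq_add dvd_minus_iff minus_diff_eq mod_eq_dvd_iff mod_mod_trivial)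
      then obtain t where t: "int w = int p * t - v" by (metis add_diff_cancel_right' dvdE)
      have "int (w * k n + 1) = int p * (t * int (k n) + u)" using uv by (simp add: t algebra_simps)
      then have "p dvd w * k n + 1" by (metis dvd_triv_left int_dvd_int_iff)
      then have c1: "cabs (of_nat (w * k n + 1) :: 'c) < 1" using cabs_of_nat_less_1_iff by blast
      have "cabs (of_nat w * (S k + of_nat (k n) * b')) < 1" using k' by (intro cabs_mult_less cabs_of_nat_le)
      moreover have "cabs (b' * of_nat (w * k n + 1)) < 1" using c1 b'(1) by (intro cabs_mult_less) (auto simp: oL_iff)
      ultimately have "cabs (of_nat w * (S k + of_nat (k n) * b') - b' * of_nat (w * k n + 1)) < 1" by (rule cabs_diff_less)
      moreover have e: "of_nat w * (S k + of_nat (k n) * b') - b' * of_nat (w * k n + 1) = S (\<lambda>i. w * k i) - b'"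
        by (simp add: S_def sum_distrib_left algebra_simps)
      ultimately have "cabs (S (\<lambda>i. w * k i) - b') < 1" by (simp only: e)
      then have "cabs (b' - S (\<lambda>i. w * k i)) < 1" by (subst cabs_minus_commute)
      then show False using red b'(2) cabs_diff_triangle_less by blast
    qed
    then have "cabs (b' * of_nat (k n)) < 1" using b'(1) cabs_of_nat_less_1_iff by (intro cabs_mult_less) (auto simp: oL_iff)
    from cabs_diff_less[OF k' this] have "cabs (S k) < 1" by (simp add: mult.commute)
    then show ?thesis using ind[rule_format, of k] \<open>p dvd k n\<close> by (auto simp: S_def less_Suc_eq)
  qed
  then show ?case using b b'(1) by (intro exI[of _ "b(n := b')"]) (auto simp: less_Suc_eq)
qed auto

text \<open>Residues independent over the prime field lift to elements independent over
  \<open>Qp\<close>: a relation divided by its largest coefficient is integral and reduces to a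
  relation in which one coefficient is 1. But L has finite dimension.\<close>

lemma finite_residue: "finite (oL // resrel)"
proof (rule ccontr)
  assume inf: "infinite (oL // resrel)"
  obtain B where B: "finite B" "L = lspan Qp B" using L_span by blast
  define n where "n = Suc (card B)"
  obtain b :: "nat \<Rightarrow> 'c" where b: "\<forall>i<n. b i \<in> oL"
    "\<forall>k::nat\<Rightarrow>nat. cabs (\<Sum>i<n. of_nat (k i) * b i) < 1 \<longrightarrow> (\<forall>i<n. p dvd k i)"
    using residue_independent[OF inf, of n] by blast
  have "\<exists>c. (\<forall>i\<in>{..<n}. c i \<in> Qp) \<and> (\<exists>i\<in>{..<n}. c i \<noteq> 0) \<and> (\<Sum>i\<in>{..<n}. c i * b i) = 0"
  proof (rule lspan_dependent[OF subfld_Qp B(1)])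
    show "b i \<in> lspan Qp B" if "i \<in> {..<n}" for i using b(1) that unfolding B(2)[symmetric] by (auto simp: oL_iff)
  qed (auto simp: n_def)
  then obtain c where c: "\<And>i. i < n \<Longrightarrow> c i \<in> Qp" "\<exists>i<n. c i \<noteq> 0" "(\<Sum>i<n. c i * b i) = 0" by auto
  have "Max ((\<lambda>i. cabs (c i)) ` {..<n}) \<in> (\<lambda>i. cabs (c i)) ` {..<n}" by (rule Max_in) (auto simp: n_def)
  then obtain j where j: "j < n" "Max ((\<lambda>i. cabs (c i)) ` {..<n}) = cabs (c j)" by auto
  have jm: "cabs (c i) \<le> cabs (c j)" if "i < n" for i using that unfolding j(2)[symmetric] by (intro Max_ge) auto
  then have cj: "c j \<noteq> 0" using c(2) by (metis cabs_0 cabs_not_le_0)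
  have "\<exists>k. cabs (c i / c j - of_nat k) < 1" if "i < n" for i
  proof (rule Qp_approx)
    show "c i / c j \<in> Qp" using c(1) that j subfld_divide[OF subfld_Qp] by blast
    show "cabs (c i / c j) \<le> 1" using jm[OF that] cj by simp
  qed
  then obtain k where k: "\<And>i. i < n \<Longrightarrow> cabs (c i / c j - of_nat (k i)) < 1" by metis
  have "cabs (\<Sum>i<n. of_nat (k i) * b i) < 1"
  proof -
    have "(\<Sum>i<n. (c i / c j) * b i) = 0" using c(3) by (simp add: sum_divide_distrib[symmetric])
    then have "(\<Sum>i<n. of_nat (k i) * b i) = - (\<Sum>i<n. (c i / c j - of_nat (k i)) * b i)" by (simp add: left_diff_distrib sum_subtractf)
    moreover have "cabs (\<Sum>i<m. b i * (c i / c j - of_nat (k i))) < 1" if "m \<le> n" for m using that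
    proof (induction m)
      case (Suc m)
      have "cabs (b m * (c m / c j - of_nat (k m))) < 1" using Suc.prems b(1) k by (intro cabs_mult_less) (auto simp: oL_iff)
      then show ?case using Suc by (simp add: cabs_add_less)
    qed simp
    ultimately show ?thesis by (simp add: mult.commute)
  qed
  then have "p dvd k j" using b(2) j by blast
  then have "cabs (of_nat (k j) :: 'c) < 1" using cabs_of_nat_less_1_iff by blast
  moreover have "cabs (1 - of_nat (k j) :: 'c) < 1" using k[OF j(1)] cj by simp
  ultimately have "cabs (1 - of_nat (k j) + of_nat (k j) :: 'c) < 1" by (intro cabs_add_less)
  then show False by simp
qed

lemma residue_reps:
  "\<exists>T. finite T \<and> T \<subseteq> oL \<and> card T = q \<and> (\<forall>x\<in>oL. \<exists>t\<in>T. cabs (x - t) < 1) \<and>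
    (\<forall>s\<in>T. \<forall>t\<in>T. cabs (s - t) < 1 \<longrightarrow> s = t)"
proof -
  define f where "f X = (SOME x. x \<in> X)" for X :: "'c set"
  have f: "f X \<in> X" if "X \<in> oL // resrel" for X
    using in_quotient_imp_non_empty[OF equiv_resrel that] unfolding f_def by (simp add: some_in_eq)
  have inj: "inj_on f (oL // resrel)"
  proof (rule inj_onI)
    fix X Y assume XY: "X \<in> oL // resrel" "Y \<in> oL // resrel" "f X = f Y"
    have "f X \<in> X \<inter> Y" using f[OF XY(1)] f[OF XY(2)] XY(3) by simp
    then show "X = Y" using quotient_disj[OF equiv_resrel XY(1,2)] by blast
  qed
  define T where "T = f ` (oL // resrel)"
  show ?thesis
  proof (intro exI[of _ T] conjI ballI impI)
    show "finite T" using finite_residue by (simp add: T_def)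
    show "T \<subseteq> oL" unfolding T_def using f in_quotient_imp_subset[OF equiv_resrel] by blast
    show "card T = q" unfolding T_def residue_card_eq by (rule card_image[OF inj])
    fix x assume x: "x \<in> oL"
    define X where "X = resrel `` {x}"
    have "X \<in> oL // resrel" using x by (auto simp: X_def quotient_def)
    then have "f X \<in> T" "(x, f X) \<in> resrel" using f by (auto simp: T_def X_def)
    then show "\<exists>t\<in>T. cabs (x - t) < 1" by (auto simp: resrel_iff)
  next
    fix s t assume st: "s \<in> T" "t \<in> T" "cabs (s - t) < 1"
    then obtain X Y where XY: "X \<in> oL // resrel" "Y \<in> oL // resrel" "s = f X" "t = f Y" by (auto simp: T_def)
    have "s \<in> oL" "t \<in> oL" using XY f in_quotient_imp_subset[OF equiv_resrel] by blast+
    then have "(s, t) \<in> resrel" using st by (simp add: resrel_iff)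
    then have "X = Y" using quotient_eqI[OF equiv_resrel XY(1,2) f[OF XY(1)] f[OF XY(2)]] XY(3,4) by simp
    then show "s = t" using XY by simp
  qed
qed

lemma q_ge_2: "q \<ge> 2"
proof -
  obtain T where T: "finite T" "T \<subseteq> oL" "card T = q" "\<forall>x\<in>oL. \<exists>t\<in>T. cabs (x - t) < 1"
    "\<forall>s\<in>T. \<forall>t\<in>T. cabs (s - t) < 1 \<longrightarrow> s = t" using residue_reps by (elim exE conjE)
  obtain s where s: "s \<in> T" "cabs (0 - s) < 1" using bspec[OF T(4) oL_0] by blast
  obtain t where t: "t \<in> T" "cabs (1 - t) < 1" using bspec[OF T(4) oL_1] by blast
  have "s \<noteq> t" using cabs_add_less[of "1 - t" 1 t] s t by auto
  then have "card {s, t} = 2" by simp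
  moreover have "card {s, t} \<le> card T" using s t T(1) by (intro card_mono) auto
  ultimately show ?thesis using T(3) by simp
qed

text \<open>Multiplication by a unit permutes the q - 1 nonzero residue classes. Comparing the
  products of their representatives gives x^(q-1) = 1 in the residue field.\<close>

lemma residue_Fermat:
  assumes x: "x \<in> oL" shows "cabs (x ^ q - x) < 1"
proof (cases "cabs x < 1")
  case True
  then have "cabs (x ^ q) < 1" using q_ge_2 by (simp add: power_Suc_less_one power_less_one_iff)
  then show ?thesis using True by (rule cabs_diff_less)
next
  case False
  then have x1: "cabs x = 1" using x by (simp add: oL_iff)
  obtain T where T: "finite T" "T \<subseteq> oL" "card T = q" "\<forall>x\<in>oL. \<exists>t\<in>T. cabs (x - t) < 1"
    "\<forall>s\<in>T. \<forall>t\<in>T. cabs (s - t) < 1 \<longrightarrow> s = t" using residue_reps by (elim exE conjE)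
  obtain z where z: "z \<in> T" "cabs (0 - z) < 1" using bspec[OF T(4) oL_0] by blast
  define U where "U = T - {z}"
  have U1: "cabs t = 1" if "t \<in> U" for t
  proof -
    have "\<not> cabs t < 1" using T(5)[rule_format, of t z] that z cabs_diff_less[of t 1 z] by (auto simp: U_def)
    then show ?thesis using that T(2) by (force simp: U_def oL_iff)
  qed
  have cU: "card U = q - 1" using T z by (simp add: U_def)
  have finU: "finite U" using T by (simp add: U_def)
  have "\<exists>s\<in>U. cabs (x * t - s) < 1" if t: "t \<in> U" for t
  proof -
    obtain s where s: "s \<in> T" "cabs (x * t - s) < 1"
      proof -
      have "x * t \<in> oL" using T(2) x t oL_mult by (auto simp: U_def)
      from bspec[OF T(4) this] show ?thesis using that by blast
    qed
    have "s \<noteq> z" using cabs_add_less[OF s(2), of z] z(2) x1 U1[OF t] by auto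
    then show ?thesis using s by (auto simp: U_def)
  qed
  then have "\<forall>t\<in>U. \<exists>s. s \<in> U \<and> cabs (x * t - s) < 1" by blast
  then obtain g where "\<forall>t\<in>U. g t \<in> U \<and> cabs (x * t - g t) < 1" by (rule bchoice[THEN exE])
  then have g: "g t \<in> U \<and> cabs (x * t - g t) < 1" if "t \<in> U" for t using that by blast
  have inj: "inj_on g U"
  proof (rule inj_onI)
    fix s t assume st: "s \<in> U" "t \<in> U" "g s = g t"
    have "cabs ((x * s - g s) - (x * t - g t)) < 1" using g[OF st(1)] g[OF st(2)] by (intro cabs_diff_less[of "x * s - g s" 1 "x * t - g t"]) simp_all
    then have "cabs (x * s - x * t) < 1" using st(3) by simp
    then have "cabs (x * (s - t)) < 1" by (simp add: right_diff_distrib)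
    then have "cabs (s - t) < 1" using x1 by simp
    then show "s = t" using T(5)[rule_format, of s t] st(1,2) unfolding U_def by blast
  qed
  have "g ` U \<subseteq> U" using g by blast
  then have "g ` U = U" using inj by (intro endo_inj_surj finU)
  then have "(\<Prod>t\<in>U. g t) = \<Prod>U" using prod.reindex[OF inj, of "\<lambda>t. t"] by (simp add: comp_def)
  moreover have "cabs ((\<Prod>t\<in>U. x * t) - (\<Prod>t\<in>U. g t)) < 1"
  proof (rule cabs_prod_diff[OF finU])
    fix t assume t: "t \<in> U"
    then have "cabs (g t) = 1" "cabs t = 1" "cabs (x * t - g t) < 1" using g[OF t] U1 by blast+
    then show "cabs (x * t) \<le> 1 \<and> cabs (g t) \<le> 1 \<and> cabs (x * t - g t) < 1" using x1 by simp
  qed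
  moreover have "(\<Prod>t\<in>U. x * t) = x ^ (q - 1) * \<Prod>U" by (simp add: prod.distrib cU)
  ultimately have "cabs ((x ^ (q - 1) - 1) * \<Prod>U) < 1" by (simp add: left_diff_distrib)
  moreover have "cabs (\<Prod>U) = 1" using U1 by (simp add: cabs_prod)
  ultimately have "cabs (x ^ (q - 1) - 1) < 1" by simp
  then have "cabs (x * (x ^ (q - 1) - 1)) < 1" using x1 by simp
  moreover have "x * x ^ (q - 1) = x ^ q" using q_ge_2 by (simp add: power_eq_if)
  ultimately show ?thesis by (simp add: right_diff_distrib)
qed

text \<open>The polynomial (X + 1)^q - X^q - 1 has degree below q, and by
  \<open>residue_Fermat\<close> it takes small values at q inequivalent points. So its coefficients
  are small. This avoids proving that q is a power of p.\<close>

lemma residue_binomial: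
  assumes "0 < k" "k < q" shows "cabs (of_nat (q choose k) :: 'c) < 1"
proof -
  obtain T where T: "finite T" "T \<subseteq> oL" "card T = q" "\<forall>x\<in>oL. \<exists>t\<in>T. cabs (x - t) < 1"
    "\<forall>s\<in>T. \<forall>t\<in>T. cabs (s - t) < 1 \<longrightarrow> s = t" using residue_reps by (elim exE conjE)
  define f where "f = [:1, 1:] ^ q - monom 1 q - (1 :: 'c poly)"
  have cf: "coeff f i = (if 0 < i \<and> i < q then of_nat (q choose i) else 0)" for i
  proof -
    have "coeff ([:1, 1:] ^ q) i = (of_nat (q choose i) :: 'c)"
      by (cases "i \<le> q") (simp_all add: coeff_linear_poly_power binomial_eq_0 coeff_eq_0 degree_linear_power)
    then show ?thesis using q_ge_2 by (auto simp: f_def coeff_1 binomial_eq_0)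
  qed
  have "degree f < q" using q_ge_2 by (intro degree_lessI) (auto simp: cf)
  have "cabs (coeff f k) < 1"
  proof (rule poly_small_coeffs[of T])
    show "cabs t \<le> 1" if "t \<in> T" for t using that T(2) by (auto simp: oL_iff)
    show "cabs (s - t) = 1" if "s \<in> T" "t \<in> T" "s \<noteq> t" for s t
      proof -
      have "s - t \<in> oL" using that T(2) oL_diff by blast
      moreover have "\<not> cabs (s - t) < 1" using T(5) that by blast
      ultimately show ?thesis by (simp add: oL_iff)
    qed
    show "degree f < card T" using \<open>degree f < q\<close> T(3) by simp
    fix t assume "t \<in> T"
    then have t: "t \<in> oL" using T(2) by blast
    have "poly f t = ((t + 1) ^ q - (t + 1)) - (t ^ q - t)" by (simp add: f_def poly_monom add.commute)
    also have "cabs \<dots> < 1" using t oL_1 by (intro cabs_diff_less residue_Fermat oL_add)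
    finally show "cabs (poly f t) < 1" .
  qed (rule T(1))
  then show ?thesis using assms by (simp add: cf)
qed

text \<open>For u near 1, the polynomial (1 + X)^M - u has a small constant coefficient, hence a
  small root x. A conjugate of v = 1 + x differs from v by an M-th root of unity close to 1, so it
  equals v; thus v lies in L.\<close>

lemma units_power_open:
  assumes M: "M > 0"
  shows "\<exists>\<delta>>0. \<forall>u\<in>L. cabs (u - 1) < \<delta> \<longrightarrow> (\<exists>v\<in>L. cabs v = 1 \<and> v ^ M = u)"
proof -
  define Z where "Z = {z :: 'c. z ^ M = 1 \<and> z \<noteq> 1}"
  have "monom 1 M - 1 \<noteq> (0 :: 'c poly)"
  proof
    assume "monom 1 M - 1 = (0 :: 'c poly)"
    then have "coeff (monom 1 M - 1 :: 'c poly) M = 0" by simp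
    then show False using M by (simp add: coeff_1)
  qed
  then have "finite {z :: 'c. poly (monom 1 M - 1) z = 0}" by (rule poly_roots_finite)
  then have "finite Z" by (rule finite_subset[rotated]) (auto simp: Z_def poly_monom)
  \<comment> \<open>The distance from 1 to the nearest other M-th root of unity. The cap 1 also
    yields |1 + x| = 1 for |x| < d.\<close>
  define d where "d = Min (insert 1 ((\<lambda>z. cabs (z - 1)) ` Z))"
  have d0: "d > 0" unfolding d_def using \<open>finite Z\<close> by (subst Min_gr_iff) (auto simp: Z_def)
  have d1: "d \<le> 1" unfolding d_def using \<open>finite Z\<close> by (intro Min_le) auto
  have dz: "cabs (z - 1) \<ge> d" if "z ^ M = 1" "z \<noteq> 1" for z :: 'c
  proof -
    have "z \<in> Z" using that by (simp add: Z_def)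
    then show ?thesis unfolding d_def using \<open>finite Z\<close> by (intro Min_le) auto
  qed
  have "\<exists>v\<in>L. cabs v = 1 \<and> v ^ M = u" if u: "u \<in> L" "cabs (u - 1) < (d / 2) ^ M" for u
  proof -
    define f where "f = monom 1 M + [:- u:]"
    have df: "degree f = M" "lead_coeff f = 1"
      unfolding f_def using M by (simp_all add: degree_add_eq_left degree_monom_eq coeff_pCons split: nat.splits)
    define g where "g = pcompose f [:1, 1 :: 'c:]"
    have pg: "poly g x = (x + 1) ^ M - u" for x by (simp add: g_def f_def poly_pcompose poly_monom add.commute)
    have dg: "degree g = M" "lead_coeff g = 1" unfolding g_def using df lead_coeff_comp[of "[:1, 1:]" f] by (simp_all add: degree_pcompose)
    have "coeff g 0 = 1 - u" using pg[of 0] by (simp add: poly_0_coeff_0)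
    then have "\<exists>x. poly g x = 0 \<and> cabs x \<le> d / 2" using u dg M d0 by (intro small_root) (auto simp: cabs_minus_commute)
    then obtain x where x: "poly g x = 0" "cabs x \<le> d / 2" by blast
    define v where "v = 1 + x"
    have vM: "v ^ M = u" using x(1) pg[of x] by (simp add: v_def add.commute)
    have xd: "cabs x < d" using x(2) d0 by simp
    have v1: "cabs v = 1" using cabs_add_eq[of x 1] xd d1 by (simp add: v_def add.commute)
    then have v0: "v \<noteq> 0" by auto
    have "\<sigma> v = v" if s: "\<sigma> \<in> GL" for \<sigma>
    proof (rule ccontr)
      assume ne: "\<sigma> v \<noteq> v"
      have "\<sigma> v ^ M = v ^ M" using GL_power[OF s, of v M] GL_fix[OF s u(1)] vM by simp
      then have "(\<sigma> v / v) ^ M = 1" "\<sigma> v / v \<noteq> 1" using v0 ne by (auto simp: power_divide)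
      then have "d \<le> cabs (\<sigma> v / v - 1)" by (rule dz)
      also have "\<sigma> v / v - 1 = (\<sigma> v - v) / v" using v0 by (simp add: field_simps)
      also have "cabs \<dots> = cabs (\<sigma> x - x)" using v1 by (simp add: v_def GL_add[OF s] GL_1[OF s])
      also have "\<dots> < d" using xd GL_cabs[OF s, of x] by (intro cabs_diff_less) auto
      finally show False by simp
    qed
    then have "v \<in> L" by (intro GL_fixed) auto
    then show ?thesis using v1 vM by blast
  qed
  moreover have "(d / 2) ^ M > 0" using d0 by simp
  ultimately show ?thesis by blast
qed

end

section \<open>Power series on the open unit disc\<close>

lemma fps_shift1: "G = fps_const (G $ 0) + fps_X * fps_shift 1 (G :: 'a::comm_ring_1 fps)" by (rule fps_ext) (simp add: fps_X_mult_nth)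

lemma fps_compose_shift1:
  "v $ 0 = 0 \<Longrightarrow> G oo v = fps_const (G $ 0) + v * (fps_shift 1 G oo (v :: 'a::idom fps))"
  by (subst fps_shift1[of G], simp only: fps_compose_add_distrib fps_compose_mult_distrib)
     (simp add: fps_const_compose)

context Cp begin

definition intg :: "'c fps \<Rightarrow> bool" where "intg G \<longleftrightarrow> (\<forall>n. cabs (G $ n) \<le> 1)"

abbreviation ev :: "'c \<Rightarrow> 'c fps \<Rightarrow> 'c" where "ev x G \<equiv> fps_value G x"

lemma intgD: "intg G \<Longrightarrow> cabs (G $ n) \<le> 1" by (simp add: intg_def)

lemma intg_add: "intg G \<Longrightarrow> intg H \<Longrightarrow> intg (G + H)"
  and intg_diff: "intg G \<Longrightarrow> intg H \<Longrightarrow> intg (G - H)"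
  and intg_minus: "intg G \<Longrightarrow> intg (- G)" by (auto simp: intg_def cabs_add_le cabs_diff_le)

lemma intg_const: "cabs a \<le> 1 \<Longrightarrow> intg (fps_const a)" by (auto simp: intg_def)

lemma intg_0: "intg 0" and intg_1: "intg 1" and intg_X: "intg fps_X" by (auto simp: intg_def fps_X_def)

lemma intg_mult: "intg G \<Longrightarrow> intg H \<Longrightarrow> intg (G * H)"
  unfolding intg_def fps_mult_nth by (auto intro!: cabs_sum_le cabs_le_1_mult simp del: cabs_mult)

lemma intg_power: "intg G \<Longrightarrow> intg (G ^ n)" by (induction n) (auto simp: intg_1 intg_mult)

lemma intg_sum: "(\<And>i. i \<in> A \<Longrightarrow> intg (f i)) \<Longrightarrow> intg (sum f A)"
  by (induction A rule: infinite_finite_induct) (auto simp: intg_0 intg_add)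

lemma intg_compose: "intg G \<Longrightarrow> intg H \<Longrightarrow> intg (G oo H)"
  unfolding intg_def[of "G oo H"] fps_compose_nth by (auto intro!: cabs_sum_le cabs_le_1_mult intgD intg_power simp del: cabs_mult)

lemma intg_shift: "intg G \<Longrightarrow> intg (fps_shift n G)" by (auto simp: intg_def)

lemma ev_sums:
  assumes G: "intg G" and x: "cabs x < 1"
  shows "(\<lambda>N. \<Sum>n<N. G $ n * x ^ n) \<longlonglongrightarrow> ev x G"
proof -
  have "\<exists>l. (\<lambda>N. \<Sum>n<N. G $ n * x ^ n) \<longlonglongrightarrow> l"
  proof (rule nonarch_sums)
    fix e :: real assume "e > 0"
    then obtain N where N: "\<forall>n\<ge>N. cabs x ^ n < e" using small_power_mono[of "cabs x" e] x by auto
    have "cabs (G $ n * x ^ n) < e" if "n \<ge> N" for n using N that intgD[OF G] by (intro cabs_mult_less) auto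
    then show "\<exists>N. \<forall>n\<ge>N. cabs (G $ n * x ^ n) < e" by blast
  qed
  then obtain l where "(\<lambda>n. G $ n * x ^ n) sums l" unfolding sums_def by blast
  then show ?thesis using sums_unique unfolding fps_value_def sums_def by metis
qed

lemma ev_est:
  assumes G: "intg G" and x: "cabs x < 1"
  shows "cabs (ev x G - (\<Sum>n<N. G $ n * x ^ n)) \<le> cabs x ^ N"
proof (rule cabs_le_limit[OF ev_sums[OF G x], of N])
  fix n :: nat assume n: "n \<ge> N"
  show "cabs ((\<Sum>n<n. G $ n * x ^ n) - (\<Sum>n<N. G $ n * x ^ n)) \<le> cabs x ^ N"
  proof (rule cabs_sum_diff_le[OF _ n])
    fix i assume "i \<ge> N"
    then have "cabs x ^ i \<le> cabs x ^ N" using x by (intro power_decreasing) auto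
    then show "cabs (G $ i * x ^ i) \<le> cabs x ^ N" using intgD[OF G] by (intro cabs_mult_le) auto
  qed simp
qed

lemma ev_unique:
  assumes G: "intg G" and x: "cabs x < 1" and r: "0 \<le> r" "r < 1"
    and y: "\<And>N. cabs (y - (\<Sum>n<N. G $ n * x ^ n)) \<le> r ^ N" shows "ev x G = y"
proof (rule eq_of_cabs_le_power[of "max r (cabs x)"])
  fix N
  have "cabs (ev x G - (\<Sum>n<N. G $ n * x ^ n)) \<le> max r (cabs x) ^ N"
    using ev_est[OF G x, of N] power_mono[of "cabs x" "max r (cabs x)" N] by simp
  moreover have "cabs ((\<Sum>n<N. G $ n * x ^ n) - y) \<le> max r (cabs x) ^ N"
    using y[of N] power_mono[of r "max r (cabs x)" N] r by (simp add: cabs_minus_commute)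
  ultimately show "cabs (ev x G - y) \<le> max r (cabs x) ^ N" by (rule cabs_diff_triangle)
qed (use r x in auto)

lemma ev_le: "intg G \<Longrightarrow> cabs x < 1 \<Longrightarrow> cabs (ev x G) \<le> 1" using ev_est[of G x 0] by simp

lemma ev_near: "intg G \<Longrightarrow> cabs x < 1 \<Longrightarrow> cabs (ev x G - G $ 0) \<le> cabs x" using ev_est[of G x 1] by simp

lemma ev_le0: "intg G \<Longrightarrow> cabs x < 1 \<Longrightarrow> G $ 0 = 0 \<Longrightarrow> cabs (ev x G) \<le> cabs x"
  using ev_near[of G x] by simp

lemma ev_lt0: "intg G \<Longrightarrow> cabs x < 1 \<Longrightarrow> G $ 0 = 0 \<Longrightarrow> cabs (ev x G) < 1" using ev_le0[of G x] by simp

lemma ev_add: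
  assumes "intg G" "intg H" "cabs x < 1" shows "ev x (G + H) = ev x G + ev x H"
proof (rule ev_unique[OF intg_add[OF assms(1,2)] assms(3) _ assms(3)])
  fix N
  have "cabs ((ev x G - (\<Sum>n<N. G $ n * x ^ n)) + (ev x H - (\<Sum>n<N. H $ n * x ^ n))) \<le> cabs x ^ N"
    using assms by (intro cabs_add_le ev_est)
  then show "cabs (ev x G + ev x H - (\<Sum>n<N. (G + H) $ n * x ^ n)) \<le> cabs x ^ N" by (simp add: distrib_right sum.distrib algebra_simps)
qed simp

lemma ev_cmult:
  assumes "intg G" "cabs a \<le> 1" "cabs x < 1" shows "ev x (fps_const a * G) = a * ev x G"
proof (rule ev_unique[OF intg_mult[OF intg_const[OF assms(2)] assms(1)] assms(3) _ assms(3)])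
  fix N
  have "cabs (a * (ev x G - (\<Sum>n<N. G $ n * x ^ n))) \<le> cabs x ^ N" using assms by (intro cabs_mult_le ev_est)
  then show "cabs (a * ev x G - (\<Sum>n<N. (fps_const a * G) $ n * x ^ n)) \<le> cabs x ^ N"
    by (simp add: right_diff_distrib sum_distrib_left mult.assoc del: cabs_mult)
qed simp

lemma ev_0: "ev x 0 = 0" by (simp add: fps_value_def)

lemma ev_const: "ev x (fps_const a) = a"
proof -
  have "(\<lambda>n. fps_const a $ n * x ^ n) sums a" unfolding sums_def
    by (rule LIMSEQ_offset[of _ 1]) (simp add: sum.lessThan_Suc_shift del: sum.lessThan_Suc)
  then show ?thesis unfolding fps_value_def using sums_unique by metis
qed

lemma ev_1: "ev x 1 = 1" using ev_const[of 1 x] by simp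

lemma ev_X_mult:
  assumes "intg G" "cabs x < 1" shows "ev x (fps_X * G) = x * ev x G"
proof (rule ev_unique[OF intg_mult[OF intg_X assms(1)] assms(2) _ assms(2)])
  fix N
  show "cabs (x * ev x G - (\<Sum>n<N. (fps_X * G) $ n * x ^ n)) \<le> cabs x ^ N"
  proof (cases N)
    case 0
    have "cabs (x * ev x G) \<le> 1" using ev_le[OF assms] assms(2) by (intro cabs_le_1_mult) auto
    then show ?thesis using 0 by simp
  next
    case (Suc M)
    have "(\<Sum>n<Suc M. (fps_X * G) $ n * x ^ n) = x * (\<Sum>n<M. G $ n * x ^ n)"
      by (simp add: sum.lessThan_Suc_shift fps_X_mult_nth sum_distrib_left mult_ac del: sum.lessThan_Suc)
    moreover have "cabs x * cabs (ev x G - (\<Sum>n<M. G $ n * x ^ n)) \<le> cabs x * cabs x ^ M"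
      using ev_est[OF assms] by (intro mult_left_mono) auto
    ultimately show ?thesis using Suc by (simp add: right_diff_distrib[symmetric])
  qed
qed simp

lemma ev_shift: "intg G \<Longrightarrow> cabs x < 1 \<Longrightarrow> ev x G = G $ 0 + x * ev x (fps_shift 1 G)"
proof -
  assume *: "intg G" "cabs x < 1"
  have "ev x G = ev x (fps_const (G $ 0) + fps_X * fps_shift 1 G)" using fps_shift1[of G] by simp
  also have "\<dots> = G $ 0 + x * ev x (fps_shift 1 G)"
    using * by (subst ev_add) (auto simp: ev_const ev_X_mult intg_shift intgD intro!: intg_const intg_mult intg_X)
  finally show ?thesis .
qed

text \<open>Induction on the accuracy: splitting G into its constant coefficient and X times the
  rest reproduces the error with a factor x. The same argument proves
  \<open>ev_compose\<close>.\<close>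

lemma ev_mult:
  assumes H: "intg H" and x: "cabs x < 1" and G: "intg G"
  shows "ev x (G * H) = ev x G * ev x H"
proof (rule eq_of_cabs_le_power[OF cabs_nonneg x])
  fix N show "cabs (ev x (G * H) - ev x G * ev x H) \<le> cabs x ^ N" using G
  proof (induction N arbitrary: G)
    case 0
    then show ?case using H x by (auto intro!: cabs_diff_le ev_le intg_mult cabs_le_1_mult simp del: cabs_mult)
  next
    case (Suc N)
    let ?G = "fps_shift 1 G"
    have i: "intg ?G" using Suc.prems by (rule intg_shift)
    have "G * H = fps_const (G $ 0) * H + fps_X * (?G * H)" by (subst fps_shift1[of G]) (simp only: distrib_right mult.assoc)
    then have "ev x (G * H) = G $ 0 * ev x H + x * ev x (?G * H)"
      using i H x Suc.prems by (simp add: ev_add ev_cmult ev_X_mult intgD intg_mult intg_X intg_const)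
    then have "ev x (G * H) - ev x G * ev x H = x * (ev x (?G * H) - ev x ?G * ev x H)" using ev_shift[OF Suc.prems x] by (simp add: algebra_simps)
    moreover have "cabs x * cabs (ev x (?G * H) - ev x ?G * ev x H) \<le> cabs x * cabs x ^ N" using Suc.IH[OF i] by (intro mult_left_mono) auto
    ultimately show ?case by simp
  qed
qed

lemma ev_power: "intg G \<Longrightarrow> cabs x < 1 \<Longrightarrow> ev x (G ^ n) = ev x G ^ n"
  by (induction n) (auto simp: ev_1 ev_mult intg_power)

lemma ev_sum: "cabs x < 1 \<Longrightarrow> (\<And>i. i \<in> A \<Longrightarrow> intg (f i)) \<Longrightarrow> ev x (sum f A) = (\<Sum>i\<in>A. ev x (f i))"
  by (induction A rule: infinite_finite_induct) (auto simp: ev_0 ev_add intg_sum)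

lemma ev_minus: "intg G \<Longrightarrow> cabs x < 1 \<Longrightarrow> ev x (- G) = - ev x G"
  using ev_cmult[of G "-1" x] by (simp add: fps_const_neg[symmetric] del: fps_const_neg)

lemma ev_diff: "intg G \<Longrightarrow> intg H \<Longrightarrow> cabs x < 1 \<Longrightarrow> ev x (G - H) = ev x G - ev x H"
  using ev_add[of G "- H" x] ev_minus[of H x] intg_minus[of H] by simp

lemma ev_X: "cabs x < 1 \<Longrightarrow> ev x fps_X = x" using ev_X_mult[of 1 x] by (simp add: intg_1 ev_1)

lemma ev_compose:
  assumes H: "intg H" "H $ 0 = 0" and x: "cabs x < 1" and G: "intg G"
  shows "ev x (G oo H) = ev (ev x H) G"
proof (rule eq_of_cabs_le_power[OF cabs_nonneg x])
  have y: "cabs (ev x H) \<le> cabs x" using ev_le0 H x by blast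
  then have y1: "cabs (ev x H) < 1" using x by simp
  fix N show "cabs (ev x (G oo H) - ev (ev x H) G) \<le> cabs x ^ N" using G
  proof (induction N arbitrary: G)
    case 0
    then show ?case using H x y1 by (auto intro!: cabs_diff_le ev_le intg_compose)
  next
    case (Suc N)
    let ?G = "fps_shift 1 G"
    have i: "intg ?G" using Suc.prems by (rule intg_shift)
    have "ev x (G oo H) = G $ 0 + ev x H * ev x (?G oo H)" unfolding fps_compose_shift1[OF H(2), of G] using i H x Suc.prems
      by (simp add: ev_add ev_const ev_mult intgD intg_mult intg_compose intg_const)
    then have "ev x (G oo H) - ev (ev x H) G = ev x H * (ev x (?G oo H) - ev (ev x H) ?G)"
      using ev_shift[OF Suc.prems y1] by (simp add: algebra_simps)
    moreover have "cabs (ev x H) * cabs (ev x (?G oo H) - ev (ev x H) ?G) \<le> cabs x * cabs x ^ N" using Suc.IH[OF i] y by (intro mult_mono) auto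
    ultimately show ?case by simp
  qed
qed

text \<open>Zeros cannot accumulate at 0: if G = X^n H with H(0) nonzero, then H(x) is too close to
  H(0) to vanish for small x. The exponent 0 is excluded because 1 lies outside the open
  disc.\<close>

lemma ev_zero_imp:
  assumes G: "intg G" and a: "cabs (a :: 'c) < 1" "a \<noteq> 0" and z: "\<And>n. n > 0 \<Longrightarrow> ev (a ^ n) G = 0"
  shows "G = 0"
proof (rule ccontr)
  assume "G \<noteq> 0"
  define n where "n = subdegree G"
  define H where "H = fps_shift n G"
  have GH: "G = fps_X ^ n * H" unfolding H_def n_def by (metis fps_shift_times_fps_X_power mult.commute order_refl subdegree_decompose)
  have H: "intg H" using G by (simp add: H_def intg_shift)
  have H0: "H $ 0 \<noteq> 0" using \<open>G \<noteq> 0\<close> by (simp add: H_def n_def)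
  obtain N where N: "cabs a ^ N < cabs (H $ 0)" using small_power[OF a(1), of "cabs (H $ 0)"] H0 by auto
  define x where "x = a ^ Suc N"
  have x: "cabs x < 1" "x \<noteq> 0" using a by (auto simp: x_def power_Suc_less_one simp del: power_Suc)
  have xN: "cabs x < cabs (H $ 0)"
  proof -
    have "cabs x \<le> cabs a ^ N" using a by (simp add: x_def mult_left_le_one_le)
    then show ?thesis using N by simp
  qed
  have "ev x G = x ^ n * ev x H" unfolding GH using H x by (simp add: ev_mult ev_power ev_X intg_power intg_X)
  then have "ev x H = 0" using z[of "Suc N"] x by (simp add: x_def)
  then show False using ev_near[OF H x(1)] xN by simp
qed

text \<open>The positive powers of p serve as points accumulating at 0.\<close>

lemma ev_ext:
  assumes "intg G" "intg H" "\<And>x. cabs x < 1 \<Longrightarrow> ev x G = ev x H" shows "G = H"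
proof -
  have "G - H = 0"
  proof (rule ev_zero_imp[of _ "of_nat p"])
    fix n :: nat assume "n > 0"
    then have "cabs ((of_nat p :: 'c) ^ n) < 1" using cabs_p_less_1 by (simp add: power_less_one_iff)
    then show "ev (of_nat p ^ n) (G - H) = 0" using assms by (simp add: ev_diff)
  qed (use assms p_gt_1 cabs_p_less_1 in \<open>auto simp: intg_diff\<close>)
  then show ?thesis by simp
qed

end

text \<open>\<open>F(u(T),v(T))\<close> for \<open>u(0) = v(0) = 0\<close>; a formal group law is studied through its action on such curves.\<close>

definition cur :: "'a::field_char_0 fps \<Rightarrow> 'a fps \<Rightarrow> 'a fps fps \<Rightarrow> 'a fps" where
  "cur u v F = Abs_fps (\<lambda>n. \<Sum>j\<le>n. ((F $ j oo u) * v ^ j) $ n)"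

lemma mult_power_nth_eq_0: "v $ 0 = 0 \<Longrightarrow> n < j \<Longrightarrow> (A * v ^ j) $ n = (0 :: 'a::comm_ring_1)"
  unfolding fps_mult_nth by (intro sum.neutral) (auto simp: startsby_zero_power_prefix)

lemma mult_nth_eq_0_Suc:
  assumes "v $ 0 = (0 :: 'a::comm_ring_1)" "\<forall>m<N. G $ m = 0" "n < Suc N" shows "(v * G) $ n = 0"
  unfolding fps_mult_nth
proof (intro sum.neutral ballI)
  fix i assume "i \<in> {0..n}"
  then show "v $ i * G $ (n - i) = 0" using assms by (cases "i = 0") auto
qed

lemma cur_nth_extend:
  assumes "v $ 0 = 0" "n \<le> M" shows "cur u v F $ n = (\<Sum>j\<le>M. ((F $ j oo u) * v ^ j) $ n)"
  unfolding cur_def fps_nth_Abs_fps using assms by (intro sum.mono_neutral_left) (auto simp: mult_power_nth_eq_0)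

lemma cur_shift1:
  assumes v: "v $ 0 = 0" shows "cur u v F = (F $ 0 oo u) + v * cur u v (fps_shift 1 F)"
proof (rule fps_ext)
  fix n
  have "(v * cur u v (fps_shift 1 F)) $ n = (\<Sum>i=0..n. v $ i * (\<Sum>j\<le>n. ((F $ Suc j oo u) * v ^ j) $ (n - i)))"
    unfolding fps_mult_nth[of v] using v by (intro sum.cong refl) (simp add: cur_nth_extend[of v _ n])
  also have "\<dots> = (\<Sum>j\<le>n. (v * ((F $ Suc j oo u) * v ^ j)) $ n)" unfolding fps_mult_nth[of v] sum_distrib_left by (rule sum.swap)
  also have "\<dots> = (\<Sum>j\<le>n. ((F $ Suc j oo u) * v ^ Suc j) $ n)" by (simp add: mult_ac)
  finally have "((F $ 0 oo u) + v * cur u v (fps_shift 1 F)) $ n = (\<Sum>j\<le>Suc n. ((F $ j oo u) * v ^ j) $ n)"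
    by (simp add: sum.atMost_Suc_shift del: sum.atMost_Suc)
  then show "cur u v F $ n = ((F $ 0 oo u) + v * cur u v (fps_shift 1 F)) $ n" using cur_nth_extend[OF v, of n "Suc n" u F] by simp
qed

lemma cur_add: "cur u v (F + F') = cur u v F + cur u v F'" by (rule fps_ext) (simp add: cur_def fps_compose_add_distrib distrib_right sum.distrib)

lemma cur_minus: "cur u v (- F) = - cur u v F" by (rule fps_ext) (simp add: cur_def fps_compose_uminus sum_negf)

lemma cur_diff: "cur u v (F - F') = cur u v F - cur u v F'" using cur_add[of u v F "- F'"] cur_minus[of u v F'] by simp

lemma cur_const_mult:
  assumes u: "u $ 0 = 0" and v: "v $ 0 = 0" shows "cur u v (fps_const A * F) = (A oo u) * cur u v F"
proof (rule fps_ext)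
  fix n
  have "((A oo u) * cur u v F) $ n = (\<Sum>i=0..n. (A oo u) $ i * (\<Sum>j\<le>n. ((F $ j oo u) * v ^ j) $ (n - i)))"
    unfolding fps_mult_nth[of "A oo u"] using v by (intro sum.cong refl) (simp add: cur_nth_extend[of v _ n])
  also have "\<dots> = (\<Sum>j\<le>n. ((A oo u) * ((F $ j oo u) * v ^ j)) $ n)"
    unfolding fps_mult_nth[of "A oo u"] sum_distrib_left by (rule sum.swap)
  also have "\<dots> = cur u v (fps_const A * F) $ n" by (simp add: cur_def fps_compose_mult_distrib[OF u] mult.assoc)
  finally show "cur u v (fps_const A * F) $ n = ((A oo u) * cur u v F) $ n" by simp
qed

lemma cur_X_mult: "v $ 0 = 0 \<Longrightarrow> cur u v (fps_X * F) = v * cur u v F"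
proof -
  assume v: "v $ 0 = 0"
  have "fps_shift 1 (fps_X * F) = F" by (rule fps_ext) (simp add: fps_X_mult_nth)
  then show ?thesis using cur_shift1[OF v, of u "fps_X * F"] by simp
qed

lemma cur_0: "cur u v 0 = 0" by (rule fps_ext) (simp add: cur_def)

lemma cur_1: "cur u v 1 = 1"
proof (rule fps_ext)
  fix n
  have "(\<Sum>j\<le>n. ((1 $ j oo u) * v ^ j) $ n) = (\<Sum>j\<le>n. if j = 0 then 1 $ n else 0)" by (intro sum.cong) auto
  then show "cur u v 1 $ n = 1 $ n" by (simp add: cur_def del: fps_one_nth)
qed

lemma cur_mult:
  assumes u: "u $ 0 = 0" and v: "v $ 0 = 0" shows "cur u v (F * F') = cur u v F * cur u v F'"
proof -
  have "\<forall>n<N. (cur u v (F * F') - cur u v F * cur u v F') $ n = 0" for N F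
  proof (induction N arbitrary: F)
    case (Suc N)
    let ?F = "fps_shift 1 F"
    have "F * F' = fps_const (F $ 0) * F' + fps_X * (?F * F')" by (subst fps_shift1[of F]) (simp only: distrib_right mult.assoc)
    then have "cur u v (F * F') = (F $ 0 oo u) * cur u v F' + v * cur u v (?F * F')" using u v by (simp add: cur_add cur_const_mult cur_X_mult)
    then have e: "cur u v (F * F') - cur u v F * cur u v F' = v * (cur u v (?F * F') - cur u v ?F * cur u v F')"
      using cur_shift1[OF v, of u F] by (simp add: algebra_simps)
    show ?case unfolding e using mult_nth_eq_0_Suc[OF v] Suc.IH[of ?F] by blast
  qed simp
  then have "(cur u v (F * F') - cur u v F * cur u v F') $ n = 0" for n by blast
  then show ?thesis by (simp add: fps_eq_iff)
qed

lemma cur_power: "u $ 0 = 0 \<Longrightarrow> v $ 0 = 0 \<Longrightarrow> cur u v (F ^ r) = cur u v F ^ r"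
  by (induction r) (auto simp: cur_1 cur_mult)

lemma cur_nth_0: "cur u v F $ 0 = F $ 0 $ 0" by (simp add: cur_def)

lemma cur_nth_eq_0:
  assumes u: "u $ 0 = 0" and v: "v $ 0 = 0" and F: "\<And>i j. i + j \<le> n \<Longrightarrow> F $ j $ i = 0"
  shows "cur u v F $ n = 0"
proof -
  have "((F $ j oo u) * v ^ j) $ n = 0" if j: "j \<le> n" for j unfolding fps_mult_nth
  proof (intro sum.neutral ballI)
    fix i assume i: "i \<in> {0..n}"
    show "(F $ j oo u) $ i * v ^ j $ (n - i) = 0"
    proof (cases "n - i < j")
      case True then show ?thesis using v by (simp add: startsby_zero_power_prefix)
    next
      case False
      then have "(F $ j oo u) $ i = 0" unfolding fps_compose_nth using F i j by (intro sum.neutral) auto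
      then show ?thesis by simp
    qed
  qed
  then show ?thesis by (simp add: cur_def)
qed

lemma total_order_power:
  assumes F: "(F :: 'a::field_char_0 fps fps) $ 0 $ 0 = 0" shows "i + j < r \<Longrightarrow> (F ^ r) $ j $ i = 0"
proof (induction r arbitrary: i j)
  case (Suc r)
  have "(F * F ^ r) $ j $ i = (\<Sum>a=0..j. \<Sum>b=0..i. F $ a $ b * (F ^ r) $ (j - a) $ (i - b))" by (simp add: fps_mult_nth fps_sum_nth)
  also have "\<dots> = 0"
  proof (intro sum.neutral ballI)
    fix a b assume ab: "a \<in> {0..j}" "b \<in> {0..i}"
    show "F $ a $ b * (F ^ r) $ (j - a) $ (i - b) = 0"
    proof (cases "a = 0 \<and> b = 0")
      case True then show ?thesis using F by simp
    next
      case False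
      then have "(i - b) + (j - a) < r" using Suc.prems ab by auto
      then show ?thesis using Suc.IH by simp
    qed
  qed
  finally show ?case by simp
qed simp

text \<open>Powers of F beyond the n-th have total order greater than n, so for the coefficient of
  degree n the series h may be replaced by a polynomial, where multiplicativity applies.\<close>

lemma cur_subst_out:
  assumes u: "u $ 0 = 0" and v: "v $ 0 = 0" and F: "F $ 0 $ 0 = 0"
  shows "cur u v (subst_out h F) = h oo cur u v F"
proof (rule fps_ext)
  fix n
  define R where "R = (\<Sum>r\<le>n. fps_const (fps_const (h $ r)) * F ^ r)"
  have "cur u v (subst_out h F - R) $ n = 0"
  proof (rule cur_nth_eq_0[OF u v])
    fix i j assume ij: "i + j \<le> n"
    have "subst_out h F $ j $ i = (\<Sum>r\<le>n. h $ r * (F ^ r) $ j $ i)" unfolding subst_out_def fps_nth_Abs_fps using ij total_order_power[OF F]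
      by (intro sum.mono_neutral_left) auto
    then show "(subst_out h F - R) $ j $ i = 0" by (simp add: R_def fps_sum_nth)
  qed
  then have "cur u v (subst_out h F) $ n = cur u v R $ n" by (simp add: cur_diff)
  also have "cur u v R = (\<Sum>r\<le>n. fps_const (h $ r) * cur u v F ^ r)"
  proof -
    have "cur u v (sum f A) = (\<Sum>r\<in>A. cur u v (f r))" for f and A :: "nat set"
      by (induction A rule: infinite_finite_induct) (auto simp: cur_add cur_0)
    then show ?thesis unfolding R_def by (simp add: cur_const_mult[OF u v] cur_power[OF u v])
  qed
  finally show "cur u v (subst_out h F) $ n = (h oo cur u v F) $ n" by (simp add: fps_compose_nth fps_sum_nth atLeast0AtMost)
qed

lemma mult_compose_nth:
  assumes v: "v $ 0 = (0::'a::idom)" shows "(A * (B oo v)) $ n = (\<Sum>j\<le>n. B $ j * (A * v ^ j) $ n)"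
proof -
  have "(B oo v) $ (n - i) = (\<Sum>j\<le>n. B $ j * (v ^ j) $ (n - i))" if "i \<le> n" for i unfolding fps_compose_nth atLeast0AtMost using v
    by (intro sum.mono_neutral_left) (auto simp: startsby_zero_power_prefix)
  then have "(A * (B oo v)) $ n = (\<Sum>i=0..n. \<Sum>j\<le>n. A $ i * (B $ j * (v ^ j) $ (n - i)))"
    unfolding fps_mult_nth by (intro sum.cong refl) (simp add: sum_distrib_left)
  also have "\<dots> = (\<Sum>j\<le>n. \<Sum>i=0..n. A $ i * (B $ j * (v ^ j) $ (n - i)))" by (rule sum.swap)
  finally show ?thesis by (simp add: fps_mult_nth sum_distrib_left mult_ac)
qed

lemma cur_subst_in:
  assumes u: "u $ 0 = 0" and v: "v $ 0 = 0" and g: "g $ 0 = 0" and h: "h $ 0 = 0"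
  shows "cur u v (subst_in F g h) = cur (g oo u) (h oo v) F"
proof (rule fps_ext)
  fix n
  have row: "subst_in F g h $ j = (\<Sum>s\<le>j. fps_const (h ^ s $ j) * (F $ s oo g))" for j
  proof (rule fps_ext)
    fix i
    show "subst_in F g h $ j $ i = (\<Sum>s\<le>j. fps_const (h ^ s $ j) * (F $ s oo g)) $ i"
      by (simp add: subst_in_def fps_sum_nth fps_compose_nth atLeast0AtMost sum_distrib_left sum_distrib_right mult_ac)
  qed
  have "cur u v (subst_in F g h) $ n = (\<Sum>j\<le>n. \<Sum>s\<le>j. h ^ s $ j * ((F $ s oo g oo u) * v ^ j) $ n)"
    unfolding cur_def fps_nth_Abs_fps row
    by (simp add: fps_compose_sum_distrib fps_compose_mult_distrib[OF u] fps_const_compose sum_distrib_right fps_sum_nth mult.assoc)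
  also have "\<dots> = (\<Sum>j\<le>n. \<Sum>s\<le>n. h ^ s $ j * ((F $ s oo g oo u) * v ^ j) $ n)"
    using h by (intro sum.cong refl sum.mono_neutral_left) (auto simp: startsby_zero_power_prefix)
  also have "\<dots> = (\<Sum>s\<le>n. \<Sum>j\<le>n. h ^ s $ j * ((F $ s oo g oo u) * v ^ j) $ n)" by (rule sum.swap)
  also have "\<dots> = (\<Sum>s\<le>n. ((F $ s oo g oo u) * (h ^ s oo v)) $ n)" by (simp add: mult_compose_nth[OF v])
  also have "\<dots> = cur (g oo u) (h oo v) F $ n" using fps_compose_assoc[OF u g] by (simp add: cur_def fps_compose_power[OF v])
  finally show "cur u v (subst_in F g h) $ n = cur (g oo u) (h oo v) F $ n" .
qed

lemma cur_linear_nth: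
  "cur (fps_const a * fps_X) (fps_const b * fps_X) F $ n = (\<Sum>j\<le>n. F $ j $ (n - j) * a ^ (n - j) * b ^ j)"
proof -
  have "((F $ j oo (fps_const a * fps_X)) * (fps_const b * fps_X) ^ j) $ n = F $ j $ (n - j) * a ^ (n - j) * b ^ j" if "j \<le> n" for j
  proof -
    let ?A = "F $ j oo (fps_const a * fps_X)"
    have "?A * (fps_const b * fps_X) ^ j = fps_const (b ^ j) * (?A * fps_X ^ j)"
      unfolding power_mult_distrib fps_const_power by (rule mult.left_commute)
    then have "(?A * (fps_const b * fps_X) ^ j) $ n = b ^ j * (?A * fps_X ^ j) $ n" by (simp only: fps_mult_left_const_nth)
    also have "(?A * fps_X ^ j) $ n = a ^ (n - j) * F $ j $ (n - j)" using that unfolding fps_compose_linear by (simp add: fps_X_power_mult_right_nth)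
    finally show ?thesis by (simp only: mult_ac)
  qed
  then show ?thesis unfolding cur_def fps_nth_Abs_fps by (intro sum.cong) auto
qed

text \<open>Along the line (T, b T), the coefficient of T^n is a polynomial in b whose coefficients
  form the homogeneous part of degree n. It vanishes for all b in an infinite field.\<close>

lemma cur_ext:
  assumes "\<And>u v. u $ 0 = 0 \<Longrightarrow> v $ 0 = 0 \<Longrightarrow> cur u v F = cur u v F'"
  shows "F = (F' :: 'a::field_char_0 fps fps)"
proof (rule fps_ext, rule fps_ext)
  fix j i :: nat
  define n where "n = i + j"
  define P where "P = (\<Sum>k\<le>n. monom ((F - F') $ k $ (n - k)) k)"
  have "poly P b = 0" for b
  proof -
    have "cur (fps_const 1 * fps_X) (fps_const b * fps_X) (F - F') $ n = 0"
      unfolding cur_diff using assms[of "fps_const 1 * fps_X" "fps_const b * fps_X"] by simp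
    then show ?thesis unfolding cur_linear_nth by (simp add: P_def poly_sum poly_monom)
  qed
  then have "P = 0" using poly_all_0_iff_0 by blast
  then have "coeff P j = 0" by simp
  then have "(F - F') $ j $ (n - j) = 0" by (simp add: P_def coeff_sum n_def)
  then show "F $ j $ i = F' $ j $ i" by (simp add: n_def)
qed

text \<open>Turns the substitution of two-variable series into composition of series in one
  variable; every later identity between formal group homomorphisms is checked in this form.\<close>

lemma formal_hom_iff:
  assumes "F $ 0 $ 0 = 0"
  shows "formal_hom F F' h \<longleftrightarrow> h $ 0 = 0 \<and>
    (\<forall>u v. u $ 0 = 0 \<longrightarrow> v $ 0 = 0 \<longrightarrow> h oo cur u v F = cur (h oo u) (h oo v) F')"
proof -
  have "subst_out h F = subst_in F' h h \<longleftrightarrow>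
    (\<forall>u v. u $ 0 = 0 \<longrightarrow> v $ 0 = 0 \<longrightarrow> h oo cur u v F = cur (h oo u) (h oo v) F')" if h: "h $ 0 = 0"
  proof
    assume *: "subst_out h F = subst_in F' h h"
    then show "\<forall>u v. u $ 0 = 0 \<longrightarrow> v $ 0 = 0 \<longrightarrow> h oo cur u v F = cur (h oo u) (h oo v) F'"
      using cur_subst_out[OF _ _ assms, of _ _ h] cur_subst_in[OF _ _ h h, of _ _ F'] by metis
  next
    assume *: "\<forall>u v. u $ 0 = 0 \<longrightarrow> v $ 0 = 0 \<longrightarrow> h oo cur u v F = cur (h oo u) (h oo v) F'"
    show "subst_out h F = subst_in F' h h" by (rule cur_ext) (simp add: cur_subst_out assms cur_subst_in h *)
  qed
  then show ?thesis unfolding formal_hom_def by blast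
qed

lemma cur_const: "v $ 0 = 0 \<Longrightarrow> cur u v (fps_const A) = A oo u"
proof -
  assume v: "v $ 0 = 0"
  have "fps_shift 1 (fps_const A) = 0" by (rule fps_ext) simp
  then show ?thesis using cur_shift1[OF v, of u "fps_const A"] by (simp add: cur_0)
qed

lemma cur_Ga: "u $ 0 = 0 \<Longrightarrow> v $ 0 = 0 \<Longrightarrow> cur u v formal_Ga = u + v"
  using cur_X_mult[of v u 1] by (simp add: formal_Ga_def cur_add cur_const cur_1)

lemma cur_Gm: "u $ 0 = 0 \<Longrightarrow> v $ 0 = 0 \<Longrightarrow> cur u v formal_Gm = u + v + u * v"
  using cur_X_mult[of v u 1] by (simp add: formal_Gm_def cur_add cur_const cur_1 cur_const_mult)

section \<open>The logarithm and the endomorphisms of a Lubin--Tate group\<close>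

lemma compose_nth_lowest:
  assumes "u $ 0 = (0::'a::idom)" "\<And>k. k < n \<Longrightarrow> A $ k = 0" shows "(A oo u) $ n = A $ n * (u $ 1) ^ n"
proof -
  have "(A oo u) $ n = (\<Sum>i\<in>{0..n}. A $ i * u ^ i $ n)" by (rule fps_compose_nth)
  also have "\<dots> = (\<Sum>i\<in>{n}. A $ i * u ^ i $ n)" using assms by (intro sum.mono_neutral_right) auto
  finally show ?thesis using startsby_zero_power_nth_same[OF assms(1), of n] by simp
qed

lemma compose_nth_small: "u $ 0 = (0::'a::idom) \<Longrightarrow> (\<And>k. k < n \<Longrightarrow> A $ k = 0) \<Longrightarrow> m < n \<Longrightarrow> (A oo u) $ m = 0"
  unfolding fps_compose_nth by (intro sum.neutral) auto

lemma cur_nth_lowest: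
  assumes u: "u $ 0 = 0" and v: "v $ 0 = 0" and F: "\<And>i j. i + j < n \<Longrightarrow> F $ j $ i = 0"
  shows "cur u v F $ n = (\<Sum>j\<le>n. F $ j $ (n - j) * (u $ 1) ^ (n - j) * (v $ 1) ^ j)"
proof -
  have "((F $ j oo u) * v ^ j) $ n = F $ j $ (n - j) * (u $ 1) ^ (n - j) * (v $ 1) ^ j" if j: "j \<le> n" for j
  proof -
    have Fj: "\<And>k. k < n - j \<Longrightarrow> F $ j $ k = 0" using F j by auto
    have "((F $ j oo u) * v ^ j) $ n = (\<Sum>k\<in>{0..n}. (F $ j oo u) $ k * v ^ j $ (n - k))" by (rule fps_mult_nth)
    also have "\<dots> = (\<Sum>k\<in>{n - j}. (F $ j oo u) $ k * v ^ j $ (n - k))"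
    proof (rule sum.mono_neutral_right)
      show "\<forall>k\<in>{0..n} - {n - j}. (F $ j oo u) $ k * v ^ j $ (n - k) = 0"
      proof
        fix k assume k: "k \<in> {0..n} - {n - j}"
        show "(F $ j oo u) $ k * v ^ j $ (n - k) = 0"
        proof (cases "k < n - j")
          case True
          then show ?thesis using compose_nth_small[where u=u and A="F $ j" and n="n-j" and m=k] u Fj by simp
        next
          case False
          then have "n - k < j" using k j by auto
          then show ?thesis using v by (simp add: startsby_zero_power_prefix)
        qed
      qed
    qed auto
    also have "\<dots> = (F $ j oo u) $ (n - j) * (v $ 1) ^ j" using startsby_zero_power_nth_same[OF v, of j] j by simp
    also have "(F $ j oo u) $ (n - j) = F $ j $ (n - j) * (u $ 1) ^ (n - j)" using u Fj by (rule compose_nth_lowest)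
    finally show ?thesis .
  qed
  then show ?thesis by (simp add: cur_def)
qed

lemma homogeneous_zero:
  fixes c :: "nat \<Rightarrow> 'a::field_char_0"
  assumes "\<And>b. (\<Sum>j\<le>n. c j * b ^ j) = 0" "j \<le> n" shows "c j = 0"
proof -
  define P where "P = (\<Sum>k\<le>n. monom (c k) k)"
  have "poly P b = 0" for b using assms(1)[of b] by (simp add: P_def poly_sum poly_monom)
  then have "P = 0" using poly_all_0_iff_0 by blast
  then have "coeff P j = 0" by simp
  then show ?thesis using assms(2) by (simp add: P_def coeff_sum)
qed

lemma fps_exp_compose_add:
  fixes A B :: "'a::field_char_0 fps"
  assumes "A $ 0 = 0" "B $ 0 = 0"
  shows "fps_exp c oo (A + B) = (fps_exp c oo A) * (fps_exp c oo B)"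
proof -
  have AB: "(A + B) $ 0 = 0" using assms by simp
  have dd: "fps_deriv (fps_exp a oo V) = fps_const a * (fps_exp a oo V) * fps_deriv V" if "V $ 0 = 0" for a and V :: "'a fps"
    using that by (simp add: fps_compose_deriv fps_compose_mult_distrib fps_const_compose)
  \<comment> \<open>W is the quotient of the two sides: its derivative is 0 and its constant
    coefficient is 1.\<close>
  define W where "W = (fps_exp c oo A) * (fps_exp c oo B) * (fps_exp (- c) oo (A + B))"
  have "fps_deriv W = 0" unfolding W_def fps_deriv_mult dd[OF assms(1)] dd[OF assms(2)] dd[OF AB] fps_deriv_add fps_const_neg[symmetric]
    by (simp add: algebra_simps del: fps_const_neg)
  then have "W = fps_const (W $ 0)" using fps_deriv_eq_0_iff by metis
  also have "W $ 0 = 1" by (simp add: W_def)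
  finally have W: "W = 1" by simp
  have "(fps_exp (- c) oo (A + B)) * (fps_exp c oo (A + B)) = 1"
    unfolding fps_compose_mult_distrib[OF AB, symmetric] fps_exp_add_mult[symmetric] by simp
  then have "fps_exp c oo (A + B) = W * (fps_exp c oo (A + B))" using W by simp
  also have "\<dots> = (fps_exp c oo A) * (fps_exp c oo B) * ((fps_exp (- c) oo (A + B)) * (fps_exp c oo (A + B)))" by (simp add: W_def mult.assoc)
  finally show ?thesis using \<open>(fps_exp (- c) oo (A + B)) * (fps_exp c oo (A + B)) = 1\<close> by simp
qed

text \<open>The coefficients 0, 1, ... of a series determined degree by degree by a triangular
  system with diagonal entries \<open>d n\<close>; it serves to construct the logarithm.\<close>

function solve_rec :: "(nat \<Rightarrow> nat \<Rightarrow> 'a::field) \<Rightarrow> (nat \<Rightarrow> 'a) \<Rightarrow> nat \<Rightarrow> 'a" where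
  "solve_rec c d n = (if n \<le> 1 then of_nat n else (\<Sum>k\<in>{..<n}. solve_rec c d k * c k n) / d n)" by auto
termination by (relation "inv_image less_than (\<lambda>(c, d, n). n)") auto

declare solve_rec.simps [simp del]

section \<open>The logarithm of a Lubin-Tate group and the endomorphisms it defines\<close>

locale LT = LField p C L \<pi> for p and C :: "'c::{alg_closed_field,field_char_0,complete_space} itself"
    and L :: "'c set" and \<pi> :: 'c +
  fixes G :: "'c fps fps"
  assumes LT: "lubin_tate_group L \<pi> G"
begin

lemma fgl: "formal_group_law oL G" using LT by (simp add: lubin_tate_group_def)

lemma G_coeffs: "coeffs_in oL (G $ j)" and G_0: "G $ 0 = fps_X"
  and G_j0: "G $ j $ 0 = (if j = 1 then 1 else 0)" using fgl unfolding formal_group_law_def by blast+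

lemma G_00: "G $ 0 $ 0 = 0" by (simp add: G_0)

text \<open>A choice of the distinguished endomorphism; \<open>e_br\<close> identifies it with
  \<open>[\<pi>]\<close>.\<close>

definition e :: "'c fps" where
  "e = (SOME e. coeffs_in oL e \<and> formal_hom G G e \<and> e $ 1 = \<pi> \<and>
          (\<forall>n. e $ n - (if n = q then 1 else 0) \<in> (\<lambda>x. \<pi> * x) ` oL))"

lemma e_props: "coeffs_in oL e" "formal_hom G G e" "e $ 1 = \<pi>"
  "e $ n - (if n = q then 1 else 0) \<in> (\<lambda>x. \<pi> * x) ` oL"
proof -
  have "\<exists>e. coeffs_in oL e \<and> formal_hom G G e \<and> e $ 1 = \<pi> \<and>
          (\<forall>n. e $ n - (if n = q then 1 else 0) \<in> (\<lambda>x. \<pi> * x) ` oL)" using LT by (simp add: lubin_tate_group_def)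
  from someI_ex[OF this, folded e_def]
  show "coeffs_in oL e" "formal_hom G G e" "e $ 1 = \<pi>"
    "e $ n - (if n = q then 1 else 0) \<in> (\<lambda>x. \<pi> * x) ` oL" by blast+
qed

lemma e_0: "e $ 0 = 0" using e_props(2) by (simp add: formal_hom_def)

lemma cur_G_0: "cur u v G $ 0 = 0" by (simp add: cur_nth_0 G_0)

lemma cur_G_1: "u $ 0 = 0 \<Longrightarrow> v $ 0 = 0 \<Longrightarrow> cur u v G $ 1 = u $ 1 + v $ 1"
  using cur_nth_lowest[of u v 1 G] by (simp add: G_0 G_j0)

lemma e_cur: "u $ 0 = 0 \<Longrightarrow> v $ 0 = 0 \<Longrightarrow> e oo cur u v G = cur (e oo u) (e oo v) G"
  using e_props(2) unfolding formal_hom_iff[OF G_00] by blast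

lemma pi_power_ne: "n \<ge> 2 \<Longrightarrow> \<pi> - \<pi> ^ n \<noteq> 0"
proof
  assume n: "n \<ge> 2" and "\<pi> - \<pi> ^ n = 0"
  then have "cabs \<pi> = cabs \<pi> ^ n" by (metis cabs_power eq_iff_diff_eq_0)
  moreover have "cabs \<pi> ^ n < cabs \<pi> ^ 1" using n pi_pos pi_lt_1 by (intro power_strict_decreasing) auto
  ultimately show False by simp
qed

text \<open>The solution of lg(e(Z)) = \<pi> lg(Z) with leading term Z: in degree n the unknown
  coefficient is multiplied by \<pi> - \<pi>^n.\<close>

definition lg :: "'c fps" where
  "lg = Abs_fps (solve_rec (\<lambda>k n. e ^ k $ n) (\<lambda>n. \<pi> - \<pi> ^ n))"

lemma lg_0: "lg $ 0 = 0" and lg_1: "lg $ 1 = 1" by (simp_all add: lg_def solve_rec.simps)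

lemma lg_compose_1: "w $ 0 = 0 \<Longrightarrow> (lg oo w) $ Suc 0 = w $ Suc 0" using compose_nth_lowest[of w 1 lg] lg_0 lg_1 by simp

lemma lg_e: "lg oo e = fps_const \<pi> * lg"
proof (rule fps_ext)
  fix n
  have split: "(lg oo e) $ n = (\<Sum>k\<in>{..<n}. lg $ k * e ^ k $ n) + lg $ n * \<pi> ^ n"
    using startsby_zero_power_nth_same[OF e_0, of n] e_props(3) by (simp add: fps_compose_nth atLeast0AtMost lessThan_Suc_atMost[symmetric])
  show "(lg oo e) $ n = (fps_const \<pi> * lg) $ n"
  proof (cases "n \<ge> 2")
    case True
    have "lg $ n = (\<Sum>k\<in>{..<n}. lg $ k * e ^ k $ n) / (\<pi> - \<pi> ^ n)"
      unfolding lg_def fps_nth_Abs_fps using True by (subst solve_rec.simps) simp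
    then have "(\<Sum>k\<in>{..<n}. lg $ k * e ^ k $ n) = lg $ n * (\<pi> - \<pi> ^ n)" using pi_power_ne[OF True] by simp
    then show ?thesis unfolding split by (simp add: algebra_simps)
  next
    case False
    then consider "n = 0" | "n = 1" by linarith
    then show ?thesis
    proof cases
      case 1 then show ?thesis unfolding split by (simp add: lg_0)
    next
      case 2 then show ?thesis unfolding split using lg_0 lg_1 by simp
    qed
  qed
qed

text \<open>The defect of additivity D satisfies D(e(X), e(Y)) = \<pi> D(X, Y). Its lowest
  homogeneous part, of degree n say, is multiplied by \<pi>^n on the left and by \<pi> on the right,
  so it vanishes for n >= 2; degrees 0 and 1 are settled by the leading terms.\<close>

lemma lg_cur:
  assumes u: "u $ 0 = 0" and v: "v $ 0 = 0" shows "lg oo cur u v G = (lg oo u) + (lg oo v)"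
proof -
  define D where "D = subst_out lg G - subst_in formal_Ga lg lg"
  have D: "cur u v D = (lg oo cur u v G) - ((lg oo u) + (lg oo v))" if "u $ 0 = 0" "v $ 0 = 0" for u v
    unfolding D_def cur_diff using that lg_0 G_00 by (simp add: cur_subst_out cur_subst_in cur_Ga)
  have De: "cur (e oo u) (e oo v) D = fps_const \<pi> * cur u v D" if "u $ 0 = 0" "v $ 0 = 0" for u v
  proof -
    have "lg oo (e oo w) = fps_const \<pi> * (lg oo w)" if "w $ 0 = 0" for w
      using fps_compose_assoc[OF that e_0, of lg] that by (simp add: lg_e fps_compose_mult_distrib fps_const_compose)
    then show ?thesis using that cur_G_0 e_0 by (simp add: D e_cur[symmetric] algebra_simps)
  qed
  have "\<forall>i j. i + j = n \<longrightarrow> D $ j $ i = 0" for n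
  proof (induction n rule: less_induct)
    case (less n)
    then have low: "\<And>i j. i + j < n \<Longrightarrow> D $ j $ i = 0" by blast
    have "(\<Sum>j\<le>n. D $ j $ (n - j) * b ^ j) = 0" for b
    proof -
      let ?u = "fps_X :: 'c fps" and ?v = "fps_const b * fps_X"
      have eq: "cur ?u ?v D $ n = (\<Sum>j\<le>n. D $ j $ (n - j) * b ^ j)" using cur_nth_lowest[of ?u ?v n D] low by simp
      show ?thesis
      proof (cases "n = 0 \<or> n = 1")
        case True
        have "cur ?u ?v D $ n = 0" using True cur_G_0[of ?u ?v] cur_G_1[of ?u ?v] lg_0 lg_1 by (auto simp: D lg_compose_1)
        then show ?thesis using eq by simp
      next
        case False
        have "cur (e oo ?u) (e oo ?v) D $ n = (\<Sum>j\<le>n. D $ j $ (n - j) * ((e oo ?u) $ 1) ^ (n - j) * ((e oo ?v) $ 1) ^ j)"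
          by (rule cur_nth_lowest) (use e_0 low in auto)
        also have "(e oo ?u) $ 1 = \<pi>" using e_props(3) by simp
        also have "(e oo ?v) $ 1 = \<pi> * b" using e_props(3) e_0 by (subst compose_nth_lowest) auto
        also have "(\<Sum>j\<le>n. D $ j $ (n - j) * \<pi> ^ (n - j) * (\<pi> * b) ^ j) = \<pi> ^ n * (\<Sum>j\<le>n. D $ j $ (n - j) * b ^ j)"
          unfolding sum_distrib_left
        proof (rule sum.cong[OF refl])
          fix j assume "j \<in> {..n}"
          then have "\<pi> ^ n = \<pi> ^ (n - j) * \<pi> ^ j" by (simp add: power_add[symmetric])
          then show "D $ j $ (n - j) * \<pi> ^ (n - j) * (\<pi> * b) ^ j = \<pi> ^ n * (D $ j $ (n - j) * b ^ j)"
            by (simp add: power_mult_distrib mult_ac)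
        qed
        finally have "\<pi> * (\<Sum>j\<le>n. D $ j $ (n - j) * b ^ j) = \<pi> ^ n * (\<Sum>j\<le>n. D $ j $ (n - j) * b ^ j)"
          using De[of ?u ?v] eq by simp
        then have "(\<pi> - \<pi> ^ n) * (\<Sum>j\<le>n. D $ j $ (n - j) * b ^ j) = 0" by (simp add: left_diff_distrib)
        then show ?thesis using pi_power_ne[of n] False by simp
      qed
    qed
    then have "D $ j $ (n - j) = 0" if "j \<le> n" for j using homogeneous_zero[where c = "\<lambda>j. D $ j $ (n - j)" and n = n and j = j] that by blast
    then show ?case by (metis add_diff_cancel_right' le_add2)
  qed
  then have "cur u v D $ n = 0" for n using cur_nth_eq_0[OF u v] by blast
  then have "cur u v D = 0" by (simp add: fps_eq_iff)
  then show ?thesis using D[OF u v] by simp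
qed

text \<open>Along the curve of doubling, whose leading term is 2 T, the lowest coefficient of d
  satisfies 2^n d = 2 d. Hence an additive series is determined by its linear term.\<close>

lemma additive_zero:
  assumes d: "d $ 0 = 0" "d $ 1 = 0" and add: "\<And>u v. u $ 0 = 0 \<Longrightarrow> v $ 0 = 0 \<Longrightarrow> d oo cur u v G = (d oo u) + (d oo v)"
  shows "d = 0"
proof -
  let ?w = "cur fps_X fps_X G"
  have w: "?w $ 0 = 0" "?w $ 1 = 2" using cur_G_0 cur_G_1[of fps_X fps_X] by auto
  have "d $ n = 0" for n
  proof (induction n rule: less_induct)
    case (less n)
    show ?case
    proof (cases "n \<ge> 2")
      case True
      have "d $ n * 2 ^ n = d $ n + d $ n" using compose_nth_lowest[OF w(1), of n d] less w add[of fps_X fps_X] by simp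
      then have "d $ n * (2 ^ n - 2) = 0" by (simp add: algebra_simps)
      moreover have "(2 ^ n - 2 :: 'c) \<noteq> 0"
      proof -
        have "(2::nat) ^ n \<noteq> 2" using True power_strict_increasing[of 1 n "2::nat"] by auto
        then have "(of_nat (2 ^ n) :: 'c) \<noteq> of_nat 2" by (metis of_nat_eq_iff)
        then show ?thesis by simp
      qed
      ultimately show ?thesis by simp
    next
      case False
      then have "n = 0 \<or> n = 1" by linarith
      then show ?thesis using d by auto
    qed
  qed
  then show ?thesis by (simp add: fps_eq_iff)
qed

lemma formal_log_eq: "formal_log G = lg" unfolding formal_log_def
proof (rule the_equality)
  show "formal_hom G formal_Ga lg \<and> lg $ 1 = 1" unfolding formal_hom_iff[OF G_00] using lg_0 lg_1 lg_cur by (auto simp: cur_Ga)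
  fix l assume l: "formal_hom G formal_Ga l \<and> l $ 1 = 1"
  then have l0: "l $ 0 = 0" "\<And>u v. u $ 0 = 0 \<Longrightarrow> v $ 0 = 0 \<Longrightarrow> l oo cur u v G = (l oo u) + (l oo v)"
    unfolding formal_hom_iff[OF G_00] by (auto simp: cur_Ga)
  have "l - lg = 0" by (rule additive_zero) (use l l0 lg_0 lg_1 lg_cur in \<open>auto simp: fps_compose_sub_distrib\<close>)
  then show "l = lg" by simp
qed

definition lgi :: "'c fps" where "lgi = fps_inv lg"

lemma lgi_0: "lgi $ 0 = 0" by (simp add: lgi_def fps_inv_def)

lemma lgi_lg: "lgi oo lg = fps_X" and lg_lgi: "lg oo lgi = fps_X" unfolding lgi_def using fps_inv[of lg] fps_inv_right[of lg] lg_0 lg_1 by auto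

lemma lg_inj: "u $ 0 = 0 \<Longrightarrow> v $ 0 = 0 \<Longrightarrow> lg oo u = lg oo v \<Longrightarrow> u = v"
proof -
  assume u: "u $ 0 = 0" and v: "v $ 0 = 0" and eq: "lg oo u = lg oo v"
  have "lgi oo (lg oo u) = lgi oo (lg oo v)" using eq by simp
  then show ?thesis using fps_compose_assoc[OF u lg_0, of lgi] fps_compose_assoc[OF v lg_0, of lgi] by (simp add: lgi_lg u v)
qed

text \<open>The endomorphism \<open>[a]\<close>, defined for every a in the big field; integrality
  for a in \<open>oL\<close> is the content of \<open>br_coeffs\<close>.\<close>

definition br :: "'c \<Rightarrow> 'c fps" where "br a = lgi oo (fps_const a * lg)"

lemma br_0: "br a $ 0 = 0" by (simp add: br_def lgi_0)

lemma lg_br: "lg oo br a = fps_const a * lg" unfolding br_def using fps_compose_assoc[of "fps_const a * lg" lgi lg] lg_0 lgi_0 by (simp add: lg_lgi)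

lemma br_1: "br a $ 1 = a"
proof -
  have "(lg oo br a) $ 1 = br a $ 1" using lg_compose_1[OF br_0] by simp
  then show ?thesis using lg_1 by (simp add: lg_br)
qed

lemmas br_Suc_0 = br_1[unfolded One_nat_def]

lemma lg_br_compose: "u $ 0 = 0 \<Longrightarrow> lg oo (br a oo u) = fps_const a * (lg oo u)"
  using fps_compose_assoc[of u "br a" lg] by (simp add: br_0 lg_br fps_compose_mult_distrib fps_const_compose)

lemma br_cur:
  assumes u: "u $ 0 = 0" and v: "v $ 0 = 0" shows "br a oo cur u v G = cur (br a oo u) (br a oo v) G"
proof (rule lg_inj)
  show "lg oo (br a oo cur u v G) = lg oo cur (br a oo u) (br a oo v) G" using u v by (simp add: lg_br_compose cur_G_0 lg_cur br_0 algebra_simps)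
qed (simp_all add: br_0 cur_G_0)

lemma br_formal_hom: "formal_hom G G (br a)" unfolding formal_hom_iff[OF G_00] using br_0 br_cur by blast

lemma br_compose: "br a oo br b = br (a * b)"
proof (rule lg_inj)
  show "lg oo (br a oo br b) = lg oo br (a * b)" by (simp add: lg_br_compose br_0 lg_br mult.assoc[symmetric])
qed (simp_all add: br_0)

lemma br_add: "cur (br a) (br b) G = br (a + b)"
proof (rule lg_inj)
  show "lg oo cur (br a) (br b) G = lg oo br (a + b)" by (simp add: lg_cur br_0 lg_br distrib_right fps_const_add[symmetric] del: fps_const_add)
qed (simp_all add: br_0 cur_G_0)

lemma br_one: "br 1 = fps_X" by (rule lg_inj) (simp_all add: br_0 lg_br)

lemma br_zero: "br 0 = 0" by (rule lg_inj) (simp_all add: br_0 lg_br lg_0)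

text \<open>The composite of the logarithm with g is additive, hence a multiple of the
  logarithm.\<close>

lemma formal_hom_br: assumes "formal_hom G G g" shows "g = br (g $ 1)"
proof -
  have g: "g $ 0 = 0" "\<And>u v. u $ 0 = 0 \<Longrightarrow> v $ 0 = 0 \<Longrightarrow> g oo cur u v G = cur (g oo u) (g oo v) G"
    using assms unfolding formal_hom_iff[OF G_00] by auto
  have "(lg oo g) - fps_const (g $ 1) * lg = 0"
  proof (rule additive_zero)
    show "((lg oo g) - fps_const (g $ 1) * lg) $ 1 = 0" using compose_nth_lowest[of g 1 lg] g(1) lg_0 lg_1 by simp
    fix u v :: "'c fps" assume uv: "u $ 0 = 0" "v $ 0 = 0"
    have "(lg oo g) oo w = lg oo (g oo w)" if "w $ 0 = 0" for w using fps_compose_assoc[OF that g(1), of lg] by simp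
    then show "(lg oo g) - fps_const (g $ 1) * lg oo cur u v G =
        ((lg oo g) - fps_const (g $ 1) * lg oo u) + ((lg oo g) - fps_const (g $ 1) * lg oo v)"
      using uv by (simp add: fps_compose_sub_distrib fps_compose_mult_distrib fps_const_compose cur_G_0 g lg_cur algebra_simps)
  qed (simp add: lg_0)
  then have "lg oo g = lg oo br (g $ 1)" unfolding lg_br by (rule right_minus_eq[THEN iffD1])
  then show ?thesis by (rule lg_inj[OF g(1) br_0])
qed

lemma e_br: "e = br \<pi>" using formal_hom_br[OF e_props(2)] unfolding e_props(3) .

section \<open>Congruences modulo the maximal ideal and integrality of \<open>[a]\<close>\<close>

lemma coeffs_in_oL_intg: "coeffs_in oL A \<Longrightarrow> intg A" by (auto simp: coeffs_in_def intg_def oL_iff)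

lemma coeffs_add: "coeffs_in oL A \<Longrightarrow> coeffs_in oL B \<Longrightarrow> coeffs_in oL (A + B)"
  and coeffs_mult: "coeffs_in oL A \<Longrightarrow> coeffs_in oL B \<Longrightarrow> coeffs_in oL (A * B)"
  and coeffs_1: "coeffs_in oL 1" and coeffs_X: "coeffs_in oL fps_X" and coeffs_0: "coeffs_in oL 0"
  and coeffs_shift: "coeffs_in oL A \<Longrightarrow> coeffs_in oL (fps_shift n A)"
  and coeffs_const: "a \<in> oL \<Longrightarrow> coeffs_in oL (fps_const a)"
  by (auto simp: coeffs_in_def oL_add oL_0 oL_1 fps_mult_nth fps_X_def intro!: oL_sum oL_mult)

lemma coeffs_power: "coeffs_in oL A \<Longrightarrow> coeffs_in oL (A ^ n)" by (induction n) (auto simp: coeffs_1 coeffs_mult)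

lemma coeffs_compose: "coeffs_in oL A \<Longrightarrow> coeffs_in oL B \<Longrightarrow> coeffs_in oL (A oo B)"
  unfolding coeffs_in_def[of _ "A oo B"] fps_compose_nth using coeffs_power[of B] by (auto simp: coeffs_in_def intro!: oL_sum oL_mult)

text \<open>Congruence modulo the maximal ideal of the big field, so that the residue field of L
  need not be formed.\<close>

definition cgr :: "'c fps \<Rightarrow> 'c fps \<Rightarrow> bool" where "cgr A B \<longleftrightarrow> (\<forall>n. cabs (A $ n - B $ n) < 1)"

lemma cgr_refl: "cgr A A" by (simp add: cgr_def)

lemma cgr_sym: "cgr A B \<Longrightarrow> cgr B A" by (simp add: cgr_def cabs_minus_commute)

lemma cgr_trans: "cgr A B \<Longrightarrow> cgr B D \<Longrightarrow> cgr A D" unfolding cgr_def using cabs_diff_triangle_less by blast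

lemma cabs_sum_less: "(\<And>i. i \<in> A \<Longrightarrow> cabs (f i :: 'c) < 1) \<Longrightarrow> cabs (sum f A) < 1"
  by (induction A rule: infinite_finite_induct) (auto simp: cabs_add_less)

lemma cgr_mult:
  assumes "cgr A B" "cgr A' B'" "intg B" "intg A'" shows "cgr (A * A') (B * B')"
  unfolding cgr_def
proof
  fix n
  have "(A * A') $ n - (B * B') $ n = (\<Sum>i=0..n. A' $ (n - i) * (A $ i - B $ i) + B $ i * (A' $ (n - i) - B' $ (n - i)))"
    unfolding fps_mult_nth sum_subtractf[symmetric] by (intro sum.cong refl) (simp add: algebra_simps)
  also have "cabs \<dots> < 1" using assms by (intro cabs_sum_less cabs_add_less cabs_mult_less) (auto simp: cgr_def intg_def)
  finally show "cabs ((A * A') $ n - (B * B') $ n) < 1" .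
qed

lemma cgr_power: "cgr A B \<Longrightarrow> intg A \<Longrightarrow> intg B \<Longrightarrow> cgr (A ^ n) (B ^ n)"
  by (induction n) (auto simp: cgr_refl intro!: cgr_mult intg_power)

lemma cgr_compose_right:
  assumes "cgr A B" "intg D" "intg A" "intg B" shows "cgr (D oo A) (D oo B)"
  unfolding cgr_def fps_compose_nth sum_subtractf[symmetric] right_diff_distrib[symmetric]
  using assms cgr_power[OF assms(1,3,4)] by (auto intro!: cabs_sum_less cabs_mult_less simp: cgr_def intgD simp del: cabs_mult)

lemma cgr_compose_left:
  assumes "cgr A B" "intg D" shows "cgr (A oo D) (B oo D)"
  unfolding cgr_def fps_compose_nth sum_subtractf[symmetric] left_diff_distrib[symmetric] using assms intgD[OF intg_power[OF assms(2)]]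
  by (auto intro!: cabs_sum_less cabs_mult_less simp: cgr_def mult.commute[of "A $ _ - B $ _"] simp del: cabs_mult)

lemma cgr_add: "cgr A B \<Longrightarrow> cgr A' B' \<Longrightarrow> cgr (A + A') (B + B')" unfolding cgr_def fps_add_nth
proof
  fix n assume "\<forall>n. cabs (A $ n - B $ n) < 1" "\<forall>n. cabs (A' $ n - B' $ n) < 1"
  then have "cabs ((A $ n - B $ n) + (A' $ n - B' $ n)) < 1" by (intro cabs_add_less) auto
  then show "cabs (A $ n + A' $ n - (B $ n + B' $ n)) < 1" by (simp add: algebra_simps)
qed

lemma cgr_freshman:
  assumes "intg A" "intg B" shows "cgr ((A + B) ^ q) (A ^ q + B ^ q)"
proof -
  have "(A + B) ^ q = (\<Sum>k\<le>q. of_nat (q choose k) * A ^ k * B ^ (q - k))" by (rule binomial_ring)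
  also have "{..q} = insert 0 (insert q {0<..<q})" using q_ge_2 by auto
  also have "(\<Sum>k\<in>\<dots>. of_nat (q choose k) * A ^ k * B ^ (q - k)) =
      B ^ q + (A ^ q + (\<Sum>k\<in>{0<..<q}. of_nat (q choose k) * A ^ k * B ^ (q - k)))" using q_ge_2 by (subst sum.insert; simp)+
  finally have e: "(A + B) ^ q - (A ^ q + B ^ q) = (\<Sum>k\<in>{0<..<q}. of_nat (q choose k) * A ^ k * B ^ (q - k))" by simp
  have "cabs ((of_nat (q choose k) * A ^ k * B ^ (q - k)) $ n) < 1" if "k \<in> {0<..<q}" for k n
  proof -
    have "of_nat (q choose k) * A ^ k * B ^ (q - k) = fps_const (of_nat (q choose k)) * (A ^ k * B ^ (q - k))"
      unfolding fps_of_nat by (simp add: mult.assoc)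
    then have "(of_nat (q choose k) * A ^ k * B ^ (q - k)) $ n = (A ^ k * B ^ (q - k)) $ n * of_nat (q choose k)"
      by (simp only: fps_mult_left_const_nth mult.commute)
    moreover have "cabs ((A ^ k * B ^ (q - k)) $ n * of_nat (q choose k)) < 1"
      using that by (intro cabs_mult_less residue_binomial intgD intg_mult intg_power assms) auto
    ultimately show ?thesis by simp
  qed
  then have "cabs (((A + B) ^ q - (A ^ q + B ^ q)) $ n) < 1" for n unfolding e fps_sum_nth by (intro cabs_sum_less)
  then show ?thesis by (simp add: cgr_def)
qed

text \<open>Over a field with q elements, A(X)^q = A(X^q): the q-th power is additive by
  \<open>cgr_freshman\<close> and fixes constants by \<open>residue_Fermat\<close>. Splitting off
  the constant coefficient gives the induction.\<close>

lemma cgr_Frobenius: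
  assumes A: "coeffs_in oL A" shows "cgr (A ^ q) (A oo fps_X ^ q)"
proof -
  have q0: "((fps_X :: 'c fps) ^ q) $ 0 = 0" using q_ge_2 by (simp add: fps_X_power_nth)
  have "\<forall>n<N. cabs ((A ^ q) $ n - (A oo fps_X ^ q) $ n) < 1" for N using A
  proof (induction N arbitrary: A)
    case (Suc N)
    let ?B = "fps_shift 1 A" and ?a = "A $ 0"
    have B: "coeffs_in oL ?B" using Suc.prems by (rule coeffs_shift)
    have a: "?a \<in> oL" using Suc.prems by (simp add: coeffs_in_def)
    have "cgr ((fps_const ?a + fps_X * ?B) ^ q) (fps_const ?a ^ q + (fps_X * ?B) ^ q)"
      using a B by (intro cgr_freshman intg_const intg_mult intg_X coeffs_in_oL_intg) (auto simp: oL_iff)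
    then have 1: "cgr (A ^ q) (fps_const ?a ^ q + (fps_X * ?B) ^ q)" using fps_shift1[of A] by simp
    have "cgr (fps_const ?a ^ q) (fps_const ?a)" unfolding cgr_def using residue_Fermat[OF a] by (simp add: fps_const_power)
    then have "cgr (fps_const ?a ^ q + (fps_X * ?B) ^ q) (fps_const ?a + (fps_X * ?B) ^ q)" by (intro cgr_add cgr_refl)
    then have 2: "cgr (A ^ q) (fps_const ?a + (fps_X * ?B) ^ q)" using 1 cgr_trans by blast
    show ?case
    proof (intro allI impI)
      fix n assume n: "n < Suc N"
      have "cabs ((fps_const ?a + (fps_X * ?B) ^ q) $ n - (A oo fps_X ^ q) $ n) < 1"
      proof -
        have "(fps_const ?a + (fps_X * ?B) ^ q) - (A oo fps_X ^ q) = fps_X ^ q * (?B ^ q - (?B oo fps_X ^ q))"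
          unfolding fps_compose_shift1[OF q0, of A] by (simp add: power_mult_distrib right_diff_distrib)
        then have "(fps_const ?a + (fps_X * ?B) ^ q) $ n - (A oo fps_X ^ q) $ n = (if n < q then 0 else (?B ^ q - (?B oo fps_X ^ q)) $ (n - q))"
          by (metis fps_sub_nth fps_X_power_mult_nth)
        moreover have "n \<ge> q \<Longrightarrow> n - q < N" using n q_ge_2 by linarith
        ultimately show ?thesis using Suc.IH[OF B] by auto
      qed
      then show "cabs ((A ^ q) $ n - (A oo fps_X ^ q) $ n) < 1" using 2 cabs_diff_triangle_less unfolding cgr_def by blast
    qed
  qed simp
  then show ?thesis unfolding cgr_def by blast
qed

lemma e_cgr: "cgr e (fps_X ^ q)"
proof -
  have "cabs (e $ n - (if n = q then 1 else 0)) < 1" for n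
  proof -
    obtain y where "y \<in> oL" "e $ n - (if n = q then 1 else 0) = \<pi> * y" using e_props(4)[of n] by blast
    then show ?thesis using pi_lt_1 by (simp only: mult.commute[of \<pi>]) (intro cabs_mult_less, auto simp: oL_iff)
  qed
  then show ?thesis by (simp add: cgr_def fps_X_power_nth)
qed

text \<open>The Lubin-Tate argument. Since \<open>[a]\<close> commutes with e, its n-th coefficient
  times \<pi> - \<pi>^n is the n-th coefficient of h(e) - e(h), where h is \<open>[a]\<close>
  truncated below degree n. Modulo the maximal ideal both composites are h^q = h(X^q), so the
  difference is divisible by \<pi>, and \<pi> - \<pi>^n has the absolute value of \<pi>.\<close>

lemma br_coeffs:
  assumes a: "a \<in> oL" shows "coeffs_in oL (br a)"
proof -
  have "br a $ n \<in> oL" for n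
  proof (induction n rule: less_induct)
    case (less n)
    consider "n = 0" | "n = 1" | "n \<ge> 2" by linarith
    then show ?case
    proof cases
      case 1 then show ?thesis by (simp add: br_0 oL_0)
    next
      case 2 then show ?thesis using a by (simp add: br_Suc_0)
    next
      case 3
      define h where "h = Abs_fps (\<lambda>k. if k < n then br a $ k else 0)"
      have h: "coeffs_in oL h" using less by (auto simp: h_def coeffs_in_def oL_0)
      have h0: "h $ 0 = 0" by (simp add: h_def br_0)
      \<comment> \<open>Except in the first power, the coefficient of degree n involves only
        coefficients of \<open>br a\<close> of lower degree, as the constant one is 0.\<close>
      have pw: "(br a ^ k) $ n = (h ^ k) $ n" if k: "k \<noteq> 1" for k
      proof (cases "k = 0")
        case False
        then obtain m where m: "k = Suc (Suc m)" using k by (metis One_nat_def not0_implies_Suc)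
        have lowpow: "(br a ^ k) $ i = (h ^ k) $ i" if "i < n" for k i
        proof -
          have "br a $ i = h $ i" if "i < n" for i using that by (simp add: h_def)
          then show ?thesis using that
          proof (induction k arbitrary: i)
            case (Suc k)
            then show ?case unfolding power_Suc fps_mult_nth by (intro sum.cong) auto
          qed simp
        qed
        have "(br a * br a ^ Suc m) $ n = (\<Sum>i=0..n. br a $ i * br a ^ Suc m $ (n - i))" by (rule fps_mult_nth)
        also have "\<dots> = (\<Sum>i=0..n. h $ i * h ^ Suc m $ (n - i))"
        proof (rule sum.cong[OF refl])
          fix i assume i: "i \<in> {0..n}"
          consider "i = 0" | "i = n" | "0 < i" "i < n" using i by fastforce
          then show "br a $ i * br a ^ Suc m $ (n - i) = h $ i * h ^ Suc m $ (n - i)"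
          proof cases
            case 1 then show ?thesis by (simp add: br_0 h0)
          next
            case 2 then show ?thesis by (simp add: br_0 h0)
          next
            case 3
            then have "br a $ i = h $ i" "br a ^ Suc m $ (n - i) = h ^ Suc m $ (n - i)"
              using lowpow[of "n - i" "Suc m"] lowpow[of i 1] by (simp_all del: power_Suc)
            then show ?thesis by simp
          qed
        qed
        also have "\<dots> = (h * h ^ Suc m) $ n" by (rule fps_mult_nth[symmetric])
        finally show ?thesis unfolding m by simp
      qed simp
      have comm: "br a oo e = e oo br a" unfolding e_br br_compose by (simp add: mult.commute)
      have "(br a oo e) $ n = (h oo e) $ n + br a $ n * \<pi> ^ n"
      proof -
        have "(br a oo e) $ n = (\<Sum>k\<in>insert n {..<n}. br a $ k * e ^ k $ n)" unfolding fps_compose_nth by (intro sum.cong) auto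
        also have "\<dots> = br a $ n * \<pi> ^ n + (\<Sum>k<n. br a $ k * e ^ k $ n)"
          using startsby_zero_power_nth_same[OF e_0, of n] e_props(3) by simp
        also have "(\<Sum>k<n. br a $ k * e ^ k $ n) = (\<Sum>k\<in>insert n {..<n}. h $ k * e ^ k $ n)" by (simp add: h_def)
        also have "\<dots> = (h oo e) $ n" unfolding fps_compose_nth by (intro sum.cong) auto
        finally show ?thesis by simp
      qed
      moreover have "(e oo br a) $ n = (e oo h) $ n + \<pi> * br a $ n"
      proof -
        have "(e oo br a) $ n = (\<Sum>k\<in>{0..n}. e $ k * br a ^ k $ n)" by (rule fps_compose_nth)
        also have "\<dots> = (\<Sum>k\<in>{0..n}. e $ k * h ^ k $ n + (if k = 1 then \<pi> * br a $ n else 0))"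
          using pw e_props(3) by (intro sum.cong) (auto simp: h_def)
        also have "\<dots> = (e oo h) $ n + \<pi> * br a $ n" using 3 by (simp add: sum.distrib fps_compose_nth)
        finally show ?thesis .
      qed
      ultimately have eq: "br a $ n * (\<pi> - \<pi> ^ n) = (h oo e) $ n - (e oo h) $ n" using comm by (simp add: algebra_simps)
      have ie: "intg e" "intg h" using e_props(1) h by (auto intro: coeffs_in_oL_intg)
      have "cgr (h oo e) (h oo fps_X ^ q)" using ie e_cgr by (intro cgr_compose_right intg_power intg_X)
      moreover have "cgr (h oo fps_X ^ q) (h ^ q)" using cgr_Frobenius[OF h] cgr_sym by blast
      moreover have "cgr (h ^ q) (e oo h)"
      proof -
        have "h ^ q = fps_X ^ q oo h" using h0 by (simp add: fps_compose_power[symmetric] fps_X_fps_compose_startby0)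
        then show ?thesis using cgr_compose_left[OF cgr_sym[OF e_cgr] ie(2)] by simp
      qed
      ultimately have "cgr (h oo e) (e oo h)" using cgr_trans by blast
      then have lt: "cabs ((h oo e) $ n - (e oo h) $ n) < 1" by (simp add: cgr_def)
      have inL: "(h oo e) $ n - (e oo h) $ n \<in> oL"
        using coeffs_compose[OF h e_props(1)] coeffs_compose[OF e_props(1) h] by (auto simp: coeffs_in_def oL_diff)
      then have le: "cabs ((h oo e) $ n - (e oo h) $ n) \<le> cabs \<pi>" using lt by (intro L_less_1) (auto simp: oL_iff)
      have "cabs (\<pi> - \<pi> ^ n) = cabs \<pi>"
      proof -
        have "cabs \<pi> ^ n < cabs \<pi> ^ 1" using 3 pi_pos pi_lt_1 by (intro power_strict_decreasing) auto
        then show ?thesis using cabs_eq_of_near[of "\<pi> - \<pi> ^ n" \<pi>] by simp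
      qed
      then have "cabs (br a $ n) * cabs \<pi> \<le> cabs \<pi>" using le eq by (metis cabs_mult)
      then have "cabs (br a $ n) \<le> 1" using pi_pos by simp
      moreover have "br a $ n = ((h oo e) $ n - (e oo h) $ n) / (\<pi> - \<pi> ^ n)" using eq pi_power_ne[OF 3] by (simp add: field_simps)
      then have "br a $ n \<in> L" using inL pi_L subfld_L by (simp add: oL_iff subfld_intros)
      ultimately show ?thesis by (simp add: oL_iff)
    qed
  qed
  then show ?thesis by (simp add: coeffs_in_def)
qed

lemma formal_mult_eq: "a \<in> oL \<Longrightarrow> formal_mult L G a = br a"
  unfolding formal_mult_def by (rule the_equality) (use br_coeffs br_formal_hom br_1 formal_hom_br in auto)

lemma br_intg: "a \<in> oL \<Longrightarrow> intg (br a)" using br_coeffs coeffs_in_oL_intg by blast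

text \<open>The character exp(c log(Z)) of the formal group with values in the multiplicative group.
  Its coefficients are the values of the \<open>P_poly\<close> at c.\<close>

definition Kap :: "'c \<Rightarrow> 'c fps" where "Kap c = fps_exp c oo lg"

lemma Kap_0: "Kap c $ 0 = 1" by (simp add: Kap_def)

lemma Kap_1: "Kap c $ 1 = c" using lg_1 by (simp add: Kap_def fps_compose_nth)

lemma Kap_cur: "u $ 0 = 0 \<Longrightarrow> v $ 0 = 0 \<Longrightarrow> Kap c oo cur u v G = (Kap c oo u) * (Kap c oo v)"
  unfolding Kap_def using fps_compose_assoc[of _ lg "fps_exp c"] lg_0 by (simp add: fps_exp_compose_add lg_cur cur_G_0 flip: fps_compose_assoc)

lemma Kap_formal_hom: "formal_hom G formal_Gm (Kap c - 1)"
  unfolding formal_hom_iff[OF G_00] by (auto simp: Kap_0 fps_compose_sub_distrib Kap_cur cur_Gm algebra_simps)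

lemma Kap_br: "Kap c oo br a = Kap (a * c)"
proof -
  have "Kap c oo br a = fps_exp c oo (fps_const a * lg)"
    unfolding Kap_def using fps_compose_assoc[OF br_0 lg_0, of "fps_exp c" a] by (simp add: lg_br)
  also have "fps_const a * lg = (fps_const a * fps_X) oo lg"
    using lg_0 by (simp add: fps_compose_mult_distrib fps_const_compose fps_X_fps_compose_startby0)
  also have "fps_exp c oo \<dots> = (fps_exp c oo (fps_const a * fps_X)) oo lg" by (rule fps_compose_assoc[OF lg_0]) simp
  also have "fps_exp c oo (fps_const a * fps_X) = fps_exp (a * c)" using fps_exp_compose_linear[of c a] by (simp add: mult.commute)
  finally show ?thesis by (simp add: Kap_def)
qed

lemma poly_P: "poly (P_poly G n) y = Kap y $ n" by (simp add: poly_P_poly formal_log_eq Kap_def)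

end

section \<open>Weierstrass division and torsion points\<close>

context Cp begin

lemma intg_cur:
  assumes "intg u" "intg v" "\<And>j. intg (F $ j)" shows "intg (cur u v F)"
  unfolding intg_def cur_def fps_nth_Abs_fps using assms by (auto intro!: cabs_sum_le intgD intg_mult intg_compose intg_power)

lemma intg_translate: "(\<And>j. intg (F $ j)) \<Longrightarrow> cabs x < 1 \<Longrightarrow> intg (translate F x)"
  unfolding intg_def[of "translate F x"] by (simp add: translate_def ev_le)

text \<open>Links curves to points: evaluating at T = t inserts the point u(t) for X, which gives
  \<open>translate\<close>, and then v(t) for Y. The induction is that of
  \<open>ev_mult\<close>.\<close>

lemma ev_cur:
  assumes u: "intg u" "u $ 0 = 0" and v: "intg v" "v $ 0 = 0" and t: "cabs t < 1" and F: "\<And>j. intg (F $ j)"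
  shows "ev t (cur u v F) = ev (ev t v) (translate F (ev t u))"
proof (rule eq_of_cabs_le_power[OF cabs_nonneg t])
  have x1: "cabs (ev t u) < 1" and y: "cabs (ev t v) \<le> cabs t" using ev_lt0 ev_le0 u v t by auto
  then have y1: "cabs (ev t v) < 1" using t by simp
  fix N show "cabs (ev t (cur u v F) - ev (ev t v) (translate F (ev t u))) \<le> cabs t ^ N" using F
  proof (induction N arbitrary: F)
    case 0
    have "cabs (ev t (cur u v F)) \<le> 1" using 0 u v t by (intro ev_le intg_cur) auto
    moreover have "cabs (ev (ev t v) (translate F (ev t u))) \<le> 1" using 0 x1 y1 by (intro ev_le intg_translate) auto
    ultimately show ?case by (simp add: cabs_diff_le)
  next
    case (Suc N)
    let ?F = "fps_shift 1 F"
    have i: "intg (?F $ j)" for j using Suc.prems by simp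
    have "ev t (cur u v F) = ev (ev t u) (F $ 0) + ev t v * ev t (cur u v ?F)" unfolding cur_shift1[OF v(2), of u F] using i u v t Suc.prems
      by (simp add: ev_add ev_mult ev_compose intg_mult intg_compose intg_cur)
    moreover have "ev (ev t v) (translate F (ev t u)) = ev (ev t u) (F $ 0) + ev t v * ev (ev t v) (translate ?F (ev t u))"
    proof -
      have "fps_shift 1 (translate F (ev t u)) = translate ?F (ev t u)" by (rule fps_ext) (simp add: translate_def)
      then show ?thesis using ev_shift[OF intg_translate[OF Suc.prems x1] y1] by (simp add: translate_def)
    qed
    ultimately have "ev t (cur u v F) - ev (ev t v) (translate F (ev t u)) =
        ev t v * (ev t (cur u v ?F) - ev (ev t v) (translate ?F (ev t u)))" by (simp add: algebra_simps)
    moreover have "cabs (ev t v) * cabs (ev t (cur u v ?F) - ev (ev t v) (translate ?F (ev t u))) \<le> cabs t * cabs t ^ N"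
      using Suc.IH[OF i] y by (intro mult_mono) auto
    ultimately show ?case by simp
  qed
qed

text \<open>Division with remainder is needed over \<open>oL\<close> for traces and over
  \<open>o_Cp\<close> for characters; closedness makes the limits stay in the ring.\<close>

definition cring :: "'c set \<Rightarrow> bool" where
  "cring R \<longleftrightarrow> closed R \<and> R \<subseteq> o_Cp \<and> 0 \<in> R \<and> (\<forall>x\<in>R. - x \<in> R) \<and> (\<forall>x\<in>R. \<forall>y\<in>R. x + y \<in> R \<and> x * y \<in> R)"

lemma cring_o_Cp: "cring o_Cp"
proof -
  have "o_Cp = cball (0::'c) 1" by (auto simp: o_Cp_def cabs_def dist_commute)
  then have "closed (o_Cp :: 'c set)" using closed_cball by metis
  then show ?thesis unfolding cring_def by (auto simp: o_Cp_def cabs_add_le intro: mult_le_one)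
qed

lemma cring_sum: "cring R \<Longrightarrow> (\<And>i. i \<in> A \<Longrightarrow> f i \<in> R) \<Longrightarrow> sum f A \<in> R"
  by (induction A rule: infinite_finite_induct) (auto simp: cring_def)

lemma cring_coeffs_mult: "cring R \<Longrightarrow> coeffs_in R A \<Longrightarrow> coeffs_in R B \<Longrightarrow> coeffs_in R (A * B)"
  unfolding coeffs_in_def fps_mult_nth by (intro allI cring_sum) (auto simp: cring_def)

lemma coeffs_in_o_Cp: "coeffs_in o_Cp A \<longleftrightarrow> intg A" by (simp add: coeffs_in_def intg_def o_Cp_def)

lemma cring_power_mult: "cring R \<Longrightarrow> c \<in> R \<Longrightarrow> x \<in> R \<Longrightarrow> c ^ i * x \<in> R"
  by (induction i) (auto simp: cring_def mult.assoc)

lemma cring_series: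
  assumes R: "cring R" and c: "c \<in> R" "cabs c < 1" and x: "\<And>i. x i \<in> R"
  shows "\<exists>l\<in>R. \<forall>N. cabs (l - (\<Sum>i<N. c ^ i * x i)) \<le> cabs c ^ N"
proof -
  have x1: "cabs (x i) \<le> 1" for i using x[of i] R by (auto simp: cring_def o_Cp_def)
  have small: "cabs (c ^ i * x i) \<le> cabs c ^ i" for i using x1[of i] by (subst mult.commute) (intro cabs_mult_le, auto)
  obtain l where l: "(\<lambda>N. \<Sum>i<N. c ^ i * x i) \<longlonglongrightarrow> l"
  proof -
    have "\<exists>l. (\<lambda>N. \<Sum>i<N. c ^ i * x i) \<longlonglongrightarrow> l"
    proof (rule nonarch_sums)
      fix d :: real assume "d > 0"
      then obtain N where "\<forall>n\<ge>N. cabs c ^ n < d" using small_power_mono[of "cabs c" d] c by auto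
      then show "\<exists>N. \<forall>n\<ge>N. cabs (c ^ n * x n) < d" using small le_less_trans by blast
    qed
    then show ?thesis using that by blast
  qed
  have "l \<in> R" by (rule closed_LIMSEQ[OF _ _ l]) (use R c x cring_power_mult in \<open>auto simp: cring_def[of R] intro!: cring_sum\<close>)
  moreover have "cabs (l - (\<Sum>i<N. c ^ i * x i)) \<le> cabs c ^ N" for N
  proof (rule cabs_le_limit[OF l])
    fix n assume n: "n \<ge> N"
    show "cabs ((\<Sum>i<n. c ^ i * x i) - (\<Sum>i<N. c ^ i * x i)) \<le> cabs c ^ N"
    proof (rule cabs_sum_diff_le[OF _ n])
      fix i assume "i \<ge> N"
      then have "cabs c ^ i \<le> cabs c ^ N" using c by (intro power_decreasing) auto
      then show "cabs (c ^ i * x i) \<le> cabs c ^ N" using small[of i] by linarith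
    qed simp
  qed
  ultimately show ?thesis by blast
qed

text \<open>Write g = X^Q + c k. Division by X^Q just cuts a series in two; replacing X^Q by g
  leaves an error divisible by c, which is divided again. The quotients and remainders add up to
  geometrically convergent series.\<close>

lemma Weierstrass_division:
  assumes R: "cring R" and c: "c \<in> R" "cabs c < 1"
    and g: "\<And>n. \<exists>k\<in>R. g $ n - (if n = Q then 1 else 0) = c * k" and f: "coeffs_in R f"
  shows "\<exists>a r. coeffs_in R a \<and> coeffs_in R r \<and> (\<forall>n\<ge>Q. r $ n = 0) \<and> f = g * a + r"
proof -
  have "\<forall>n. \<exists>k. k \<in> R \<and> g $ n - (if n = Q then 1 else 0) = c * k" using g by blast
  then obtain kk where kk: "\<forall>n. kk n \<in> R \<and> g $ n - (if n = Q then 1 else 0) = c * kk n" by (rule choice[THEN exE])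
  define k where "k = Abs_fps kk"
  have kR: "coeffs_in R k" using kk by (simp add: k_def coeffs_in_def)
  have gk: "g = fps_X ^ Q + fps_const c * k"
  proof (rule fps_ext)
    fix n
    have "g $ n = (if n = Q then 1 else 0) + c * kk n" using kk by (metis add.commute diff_add_cancel)
    then show "g $ n = (fps_X ^ Q + fps_const c * k) $ n" by (simp add: k_def fps_X_power_nth)
  qed
  \<comment> \<open>The i-th iterate is the error that remains after i divisions, with the factor
    c^i removed.\<close>
  define F where "F i = rec_nat f (\<lambda>_ f. - (k * fps_shift Q f)) i" for i
  have F0: "F 0 = f" and FS: "F (Suc i) = - (k * fps_shift Q (F i))" for i by (simp_all add: F_def)
  have shR: "coeffs_in R (fps_shift Q h)" if "coeffs_in R h" for h using that by (simp add: coeffs_in_def)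
  have FR: "coeffs_in R (F i)" for i
  proof (induction i)
    case (Suc i)
    have "coeffs_in R (k * fps_shift Q (F i))" using Suc kR R by (intro cring_coeffs_mult shR)
    then show ?case using R unfolding FS by (simp add: coeffs_in_def cring_def)
  qed (simp add: F0 f)
  have step: "F i = g * fps_shift Q (F i) + fps_cutoff Q (F i) + fps_const c * F (Suc i)" for i
  proof -
    have "F i = fps_X ^ Q * fps_shift Q (F i) + fps_cutoff Q (F i)" by (rule fps_ext) (auto simp: fps_X_power_mult_nth)
    then show ?thesis unfolding gk FS by (simp add: algebra_simps)
  qed
  define A where "A N = (\<Sum>i<N. fps_const (c ^ i) * fps_shift Q (F i))" for N
  define B where "B N = (\<Sum>i<N. fps_const (c ^ i) * fps_cutoff Q (F i))" for N
  have part: "f = g * A N + B N + fps_const (c ^ N) * F N" for N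
  proof (induction N)
    case (Suc N)
    have "fps_const (c ^ N) * F N = g * (fps_const (c ^ N) * fps_shift Q (F N)) + fps_const (c ^ N) * fps_cutoff Q (F N)
        + fps_const (c ^ Suc N) * F (Suc N)"
      by (subst step) (simp add: distrib_left mult.assoc[symmetric] mult.commute[of _ g] fps_const_mult[symmetric] del: fps_const_mult)
    then show ?case using Suc unfolding A_def B_def by (simp add: distrib_left add_ac)
  qed (simp add: A_def B_def F0)
  have "\<exists>l\<in>R. \<forall>N. cabs (l - A N $ n) \<le> cabs c ^ N" for n
    using cring_series[OF R c, of "\<lambda>i. F i $ (n + Q)"] FR by (simp add: A_def fps_sum_nth coeffs_in_def)
  then have "\<forall>n. \<exists>l. l \<in> R \<and> (\<forall>N. cabs (l - A N $ n) \<le> cabs c ^ N)" by blast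
  then obtain a where a: "\<forall>n. a n \<in> R \<and> (\<forall>N. cabs (a n - A N $ n) \<le> cabs c ^ N)" by (rule choice[THEN exE])
  have "\<exists>l\<in>R. \<forall>N. cabs (l - (if n < Q then B N $ n else 0)) \<le> cabs c ^ N" for n
  proof (cases "n < Q")
    case True
    then show ?thesis using cring_series[OF R c, of "\<lambda>i. F i $ n"] FR by (simp add: B_def fps_sum_nth coeffs_in_def)
  next
    case False
    then show ?thesis using R by (intro bexI[of _ 0]) (auto simp: cring_def)
  qed
  then have "\<forall>n. \<exists>l. l \<in> R \<and> (\<forall>N. cabs (l - (if n < Q then B N $ n else 0)) \<le> cabs c ^ N)" by blast
  then obtain r where r: "\<forall>n. r n \<in> R \<and> (\<forall>N. cabs (r n - (if n < Q then B N $ n else 0)) \<le> cabs c ^ N)"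
    by (rule choice[THEN exE])
  define a' where "a' = Abs_fps a"
  define r' where "r' = Abs_fps r"
  have r0: "r' $ n = 0" if "n \<ge> Q" for n
  proof (rule eq_of_cabs_le_power[OF cabs_nonneg c(2)])
    fix N show "cabs (r' $ n - 0) \<le> cabs c ^ N" using r that by (simp add: r'_def) (metis diff_zero not_le)
  qed
  have BQ: "B N $ n = 0" if "n \<ge> Q" for n N using that by (simp add: B_def fps_sum_nth)
  have gi: "cabs (g $ n) \<le> 1" for n
  proof -
    have "c * kk n \<in> R" using c kk R by (auto simp: cring_def)
    then have "cabs (c * kk n) \<le> 1" using R by (auto simp: cring_def o_Cp_def)
    then show ?thesis unfolding gk by (auto simp: k_def fps_X_power_nth intro!: cabs_add_le simp del: cabs_mult)
  qed
  have "f $ n = (g * a' + r') $ n" for n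
  proof (rule eq_of_cabs_le_power[OF cabs_nonneg c(2)])
    fix N
    have "cabs ((g * (A N - a')) $ n) \<le> cabs c ^ N" unfolding fps_mult_nth using a gi
      by (intro cabs_sum_le cabs_mult_le) (auto simp: a'_def cabs_minus_commute)
    moreover have "cabs (B N $ n - r' $ n) \<le> cabs c ^ N"
    proof (cases "n < Q")
      case True
      then show ?thesis using r by (simp add: r'_def) (metis cabs_minus_commute)
    next
      case False
      then show ?thesis using BQ[of n N] r0[of n] by simp
    qed
    moreover have "cabs (c ^ N * F N $ n) \<le> cabs c ^ N"
    proof -
      have "F N $ n \<in> R" using FR by (simp add: coeffs_in_def)
      then have "cabs (F N $ n) \<le> 1" using R by (auto simp: cring_def o_Cp_def)
      then show ?thesis by (subst mult.commute) (intro cabs_mult_le, auto)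
    qed
    ultimately have "cabs ((g * (A N - a')) $ n + (B N $ n - r' $ n) + c ^ N * F N $ n) \<le> cabs c ^ N"
      by (intro cabs_add_le[of "(g * (A N - a')) $ n + (B N $ n - r' $ n)"] cabs_add_le[of "(g * (A N - a')) $ n"])
    moreover have "f $ n - (g * a' + r') $ n = (g * (A N - a')) $ n + (B N $ n - r' $ n) + c ^ N * F N $ n"
      by (subst part[of N]) (simp add: right_diff_distrib)
    ultimately show "cabs (f $ n - (g * a' + r') $ n) \<le> cabs c ^ N" by (simp only:)
  qed
  then have "f = g * a' + r'" by (simp add: fps_eq_iff)
  moreover have "coeffs_in R a'" "coeffs_in R r'" using a r by (auto simp: coeffs_in_def a'_def r'_def)
  ultimately show ?thesis using r0 by blast
qed

lemma ev_finite:
  assumes "\<And>n. n \<ge> Q \<Longrightarrow> r $ n = 0" "intg r" "cabs x < 1" shows "ev x r = (\<Sum>n<Q. r $ n * x ^ n)"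
proof -
  have eq: "(\<Sum>n<N + Q. r $ n * x ^ n) = (\<Sum>n<Q. r $ n * x ^ n)" for N using assms(1) by (intro sum.mono_neutral_right) auto
  have "(\<lambda>N. \<Sum>n<N + Q. r $ n * x ^ n) \<longlonglongrightarrow> (\<Sum>n<Q. r $ n * x ^ n)" unfolding eq by (rule tendsto_const)
  then have "(\<lambda>N. \<Sum>n<N. r $ n * x ^ n) \<longlonglongrightarrow> (\<Sum>n<Q. r $ n * x ^ n)" by (rule LIMSEQ_offset)
  then show ?thesis using LIMSEQ_unique[OF ev_sums[OF assms(2,3)]] by blast
qed

text \<open>Dividing X^Q by g gives X^Q = g a + r and P = X^Q - r. The coefficients of r are at most
  |c|, so all roots of P lie in the open disc; and a(0) is near 1, so a has no zeros there.\<close>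

lemma Weierstrass_poly:
  assumes c: "cabs c < 1" and Q: "Q > 0" and g: "\<And>n. cabs (g $ n - (if n = Q then 1 else 0)) \<le> cabs (c :: 'c)"
  shows "\<exists>P a. degree P = Q \<and> lead_coeff P = 1 \<and> intg a \<and>
    (\<forall>x. cabs x < 1 \<longrightarrow> cabs (ev x a) = 1 \<and> poly P x = ev x g * ev x a) \<and> (\<forall>x. poly P x = 0 \<longrightarrow> cabs x < 1)"
proof -
  have gi: "intg g" unfolding intg_def
  proof
    fix n
    have "cabs ((g $ n - (if n = Q then 1 else 0)) + (if n = Q then 1 else 0)) \<le> 1" using g[of n] c by (intro cabs_add_le) auto
    then show "cabs (g $ n) \<le> 1" by simp
  qed
  have "\<exists>a r. coeffs_in o_Cp a \<and> coeffs_in o_Cp r \<and> (\<forall>n\<ge>Q. r $ n = 0) \<and> fps_X ^ Q = g * a + r"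
  proof (rule Weierstrass_division[OF cring_o_Cp _ c])
    show "\<exists>k\<in>o_Cp. g $ n - (if n = Q then 1 else 0) = c * k" for n
    proof (cases "c = 0")
      case True
      then show ?thesis using g[of n] by (intro bexI[of _ 0]) (auto simp: o_Cp_def)
    next
      case False
      then show ?thesis using g[of n] by (intro bexI[of _ "(g $ n - (if n = Q then 1 else 0)) / c"]) (auto simp: o_Cp_def field_simps)
    qed
    show "coeffs_in o_Cp (fps_X ^ Q :: 'c fps)" unfolding coeffs_in_o_Cp by (intro intg_power intg_X)
  qed (use c in \<open>auto simp: o_Cp_def\<close>)
  then obtain a r where ar: "intg a" "intg r" "\<And>n. n \<ge> Q \<Longrightarrow> r $ n = 0" "fps_X ^ Q = g * a + r"
    unfolding coeffs_in_o_Cp by blast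
  define k where "k = g - fps_X ^ Q"
  have ka: "cabs ((k * a) $ n) \<le> cabs c" for n unfolding fps_mult_nth
  proof (rule cabs_sum_le)
    fix i
    have "cabs (k $ i) \<le> cabs c" using g[of i] by (simp add: k_def fps_X_power_nth)
    then show "cabs (k $ i * a $ (n - i)) \<le> cabs c" by (subst mult.commute) (intro cabs_mult_le intgD ar(1))
  qed simp
  have eq: "(fps_X ^ Q) $ n = (fps_X ^ Q * a) $ n + (k * a) $ n + r $ n" for n
  proof -
    have "fps_X ^ Q = fps_X ^ Q * a + k * a + r" using ar(4) by (simp add: k_def algebra_simps)
    then show ?thesis by (metis fps_add_nth)
  qed
  have rn: "cabs (r $ n) \<le> cabs c" for n
  proof (cases "n < Q")
    case True
    then have "r $ n = - (k * a) $ n" using eq[of n] by (simp add: fps_X_power_nth fps_X_power_mult_nth eq_neg_iff_add_eq_0 add.commute)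
    then show ?thesis using ka[of n] by simp
  qed (use ar(3) in simp)
  have "1 = a $ 0 + (k * a) $ Q" using eq[of Q] ar(3)[of Q] by (simp add: fps_X_power_nth fps_X_power_mult_nth)
  then have "1 - a $ 0 = (k * a) $ Q" by (metis add_diff_cancel_left')
  then have a0: "cabs (a $ 0 - 1) < 1" using ka[of Q] c by (simp add: cabs_minus_commute)
  have ea: "cabs (ev x a) = 1" if "cabs x < 1" for x
  proof -
    have "cabs (ev x a - a $ 0) < 1" using ev_near[OF ar(1) that] that by simp
    then have "cabs (ev x a - 1) < 1" using a0 cabs_diff_triangle_less by blast
    then show ?thesis using cabs_eq_of_near[of "ev x a" 1] by simp
  qed
  define P where "P = monom 1 Q - (\<Sum>n<Q. monom (r $ n) n)"
  have cP: "coeff P n = (if n = Q then 1 else if n < Q then - r $ n else 0)" for n by (simp add: P_def coeff_sum)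
  have dP: "degree P = Q"
  proof (rule order_antisym)
    show "degree P \<le> Q" by (rule degree_le) (simp add: cP)
    show "Q \<le> degree P" by (rule le_degree) (simp add: cP)
  qed
  have PX: "poly P x = x ^ Q - (\<Sum>n<Q. r $ n * x ^ n)" for x by (simp add: P_def poly_sum poly_monom)
  have "poly P x = ev x g * ev x a" if x: "cabs x < 1" for x
  proof -
    have "x ^ Q = ev x (g * a + r)" using x by (simp add: ar(4)[symmetric] ev_power ev_X intg_X)
    also have "\<dots> = ev x g * ev x a + (\<Sum>n<Q. r $ n * x ^ n)"
      using x gi ar(1,2) by (simp add: ev_add ev_mult intg_mult ev_finite[OF ar(3,2) x])
    finally show ?thesis unfolding PX by simp
  qed
  moreover have "cabs x < 1" if Px: "poly P x = 0" for x
  proof (rule ccontr)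
    assume "\<not> cabs x < 1"
    then have x1: "cabs x \<ge> 1" by simp
    have "cabs (r $ n * x ^ n) \<le> cabs c * cabs x ^ (Q - 1)" if "n < Q" for n
    proof -
      have "cabs x ^ n \<le> cabs x ^ (Q - 1)" using x1 that by (intro power_increasing) auto
      then show ?thesis using rn[of n] by (simp add: mult_mono)
    qed
    then have "cabs (\<Sum>n<Q. r $ n * x ^ n) \<le> cabs c * cabs x ^ (Q - 1)" by (intro cabs_sum_le) auto
    then have "cabs x ^ Q \<le> cabs c * cabs x ^ (Q - 1)" using Px unfolding PX by (metis cabs_power eq_iff_diff_eq_0)
    also have "\<dots> < 1 * cabs x ^ (Q - 1)"
    proof (rule mult_strict_right_mono[OF c])
      show "0 < cabs x ^ (Q - 1)" using x1 by (intro zero_less_power) linarith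
    qed
    also have "\<dots> \<le> cabs x ^ Q" using x1 by (simp add: power_increasing)
    finally show False by simp
  qed
  ultimately show ?thesis using dP cP ar(1) ea by (intro exI[of _ P] exI[of _ a]) auto
qed

lemma common_bound:
  assumes "cabs (x :: 'c) < 1" "cabs (y :: 'c) < 1" "cabs (z :: 'c) < 1"
  shows "\<exists>t::'c. t \<noteq> 0 \<and> cabs t < 1 \<and> cabs x \<le> cabs t \<and> cabs y \<le> cabs t \<and> cabs z \<le> cabs t"
proof -
  define S where "S = {x, y, z, of_nat p :: 'c}"
  have "Max (cabs ` S) \<in> cabs ` S" by (rule Max_in) (auto simp: S_def)
  then obtain t where t: "t \<in> S" "Max (cabs ` S) = cabs t" by auto
  have le: "cabs s \<le> cabs t" if "s \<in> S" for s unfolding t(2)[symmetric] using that by (intro Max_ge) (auto simp: S_def)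
  moreover have "cabs t < 1" using t(1) assms cabs_p_less_1 by (auto simp: S_def)
  moreover have "cabs t \<noteq> 0"
  proof -
    have "cabs (of_nat p :: 'c) > 0" using p_gt_1 by simp
    then show ?thesis using le[of "of_nat p"] by (simp add: S_def del: cabs_pos cabs_eq_0)
  qed
  then have "t \<noteq> 0" by auto
  moreover have "cabs x \<le> cabs t" "cabs y \<le> cabs t" "cabs z \<le> cabs t" using le by (auto simp: S_def)
  ultimately show ?thesis by blast
qed

text \<open>The line through x at parameter t. Given a common bound |t| < 1, points lie on integral
  curves, and evaluating at t turns identities along curves into identities between points.\<close>

definition cv :: "'c \<Rightarrow> 'c \<Rightarrow> 'c fps" where "cv t x = fps_const (x / t) * fps_X"

lemma cv: "t \<noteq> 0 \<Longrightarrow> cabs t < 1 \<Longrightarrow> cabs x \<le> cabs t \<Longrightarrow> intg (cv t x) \<and> cv t x $ 0 = 0 \<and> ev t (cv t x) = x"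
  by (auto simp: cv_def ev_cmult ev_X intg_X divide_le_eq_1 intro!: intg_mult intg_const)

end

context LT begin

section \<open>The group of points of the open disc and its \<pi>-torsion\<close>

lemma G_intg: "intg (G $ j)" using G_coeffs coeffs_in_oL_intg by blast

definition pl :: "'c \<Rightarrow> 'c \<Rightarrow> 'c" where "pl x y = ev y (translate G x)"

definition act :: "'c \<Rightarrow> 'c \<Rightarrow> 'c" where "act a x = ev x (br a)"

lemma pl_curve:
  assumes "intg u" "u $ 0 = 0" "intg v" "v $ 0 = 0" "cabs t < 1"
  shows "pl (ev t u) (ev t v) = ev t (cur u v G)"
  unfolding pl_def using ev_cur[OF assms(1-4) assms(5) G_intg] by simp

lemma intg_cur_G: "intg u \<Longrightarrow> intg v \<Longrightarrow> intg (cur u v G)" by (intro intg_cur G_intg)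

lemma cur_assoc:
  assumes "u $ 0 = 0" "v $ 0 = 0" "w $ 0 = 0" shows "cur (cur u v G) w G = cur u (cur v w G) G"
  by (rule lg_inj) (use assms in \<open>simp_all add: cur_G_0 lg_cur add.assoc\<close>)

lemma cur_comm: "u $ 0 = 0 \<Longrightarrow> v $ 0 = 0 \<Longrightarrow> cur u v G = cur v u G"
  by (rule lg_inj) (simp_all add: cur_G_0 lg_cur add.commute)

lemma pl_less: "cabs x < 1 \<Longrightarrow> cabs y < 1 \<Longrightarrow> cabs (pl x y) < 1"
proof -
  assume "cabs x < 1" "cabs y < 1"
  then obtain t :: 'c where t: "t \<noteq> 0" "cabs t < 1" "cabs x \<le> cabs t" "cabs y \<le> cabs t" using common_bound[of x y y] by blast
  then show ?thesis using cv[OF t(1,2,3)] cv[OF t(1,2,4)] pl_curve[of "cv t x" "cv t y" t]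
      ev_lt0[of "cur (cv t x) (cv t y) G" t] by (simp add: intg_cur_G cur_G_0)
qed

lemma pl_assoc:
  assumes "cabs x < 1" "cabs y < 1" "cabs z < 1" shows "pl (pl x y) z = pl x (pl y z)"
proof -
  obtain t :: 'c where t: "t \<noteq> 0" "cabs t < 1" "cabs x \<le> cabs t" "cabs y \<le> cabs t" "cabs z \<le> cabs t"
    using common_bound assms by blast
  note X = cv[OF t(1,2,3)] and Y = cv[OF t(1,2,4)] and Z = cv[OF t(1,2,5)]
  have "pl x y = ev t (cur (cv t x) (cv t y) G)" "pl y z = ev t (cur (cv t y) (cv t z) G)"
    using pl_curve[of "cv t x" "cv t y" t] pl_curve[of "cv t y" "cv t z" t] X Y Z t by simp_all
  then show ?thesis using pl_curve[of "cur (cv t x) (cv t y) G" "cv t z" t] pl_curve[of "cv t x" "cur (cv t y) (cv t z) G" t] X Y Z t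
    by (simp add: intg_cur_G cur_G_0 cur_assoc)
qed

lemma pl_comm:
  assumes "cabs x < 1" "cabs y < 1" shows "pl x y = pl y x"
proof -
  obtain t :: 'c where t: "t \<noteq> 0" "cabs t < 1" "cabs x \<le> cabs t" "cabs y \<le> cabs t" using common_bound[of x y y] assms by blast
  note X = cv[OF t(1,2,3)] and Y = cv[OF t(1,2,4)]
  show ?thesis using pl_curve[of "cv t x" "cv t y" t] pl_curve[of "cv t y" "cv t x" t] X Y t by (simp add: cur_comm)
qed

lemma pl_near: "cabs x < 1 \<Longrightarrow> cabs y < 1 \<Longrightarrow> cabs (pl x y - x) \<le> cabs y"
  using ev_near[OF intg_translate[OF G_intg], of x y] by (simp add: pl_def translate_def G_0 ev_X)

lemma pl_0_right: "cabs x < 1 \<Longrightarrow> pl x 0 = x" using pl_near[of x 0] by simp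

lemma pl_0_left: "cabs x < 1 \<Longrightarrow> pl 0 x = x" using pl_0_right[of x] pl_comm[of 0 x] by simp

lemma act_le: "a \<in> oL \<Longrightarrow> cabs x < 1 \<Longrightarrow> cabs (act a x) \<le> cabs x" unfolding act_def by (intro ev_le0 br_intg br_0)

lemma act_less: "a \<in> oL \<Longrightarrow> cabs x < 1 \<Longrightarrow> cabs (act a x) < 1" using act_le[of a x] by simp

lemma act_pl:
  assumes a: "a \<in> oL" and x: "cabs x < 1" "cabs y < 1" shows "act a (pl x y) = pl (act a x) (act a y)"
proof -
  obtain t :: 'c where t: "t \<noteq> 0" "cabs t < 1" "cabs x \<le> cabs t" "cabs y \<le> cabs t" using common_bound[of x y y] x by blast
  note X = cv[OF t(1,2,3)] and Y = cv[OF t(1,2,4)]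
  have "act a (pl x y) = ev t (br a oo cur (cv t x) (cv t y) G)"
    unfolding act_def using X Y t br_intg[OF a] pl_curve[of "cv t x" "cv t y" t] by (simp add: ev_compose intg_cur_G cur_G_0)
  also have "\<dots> = ev t (cur (br a oo cv t x) (br a oo cv t y) G)" using X Y by (simp add: br_cur)
  also have "\<dots> = pl (ev t (br a oo cv t x)) (ev t (br a oo cv t y))"
    using X Y t br_intg[OF a] by (intro pl_curve[symmetric] intg_compose) (auto simp: br_0)
  also have "\<dots> = pl (act a x) (act a y)" using X Y t br_intg[OF a] by (simp add: ev_compose act_def)
  finally show ?thesis .
qed

lemma act_act: "a \<in> oL \<Longrightarrow> b \<in> oL \<Longrightarrow> cabs x < 1 \<Longrightarrow> act a (act b x) = act (a * b) x"
  unfolding act_def br_compose[symmetric] by (intro ev_compose[symmetric] br_intg br_0)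

lemma act_add: "a \<in> oL \<Longrightarrow> b \<in> oL \<Longrightarrow> cabs x < 1 \<Longrightarrow> pl (act a x) (act b x) = act (a + b) x"
  unfolding act_def br_add[symmetric] by (intro pl_curve br_intg br_0)

lemma act_1: "cabs x < 1 \<Longrightarrow> act 1 x = x" and act_0: "act 0 x = 0" by (simp_all add: act_def br_one br_zero ev_X ev_0)

lemma act_at_0: "a \<in> oL \<Longrightarrow> act a 0 = 0" using act_le[of a 0] by simp

lemma act_unit: "a \<in> L \<Longrightarrow> cabs a = 1 \<Longrightarrow> cabs x < 1 \<Longrightarrow> cabs (act a x) = cabs x"
proof -
  assume a: "a \<in> L" "cabs a = 1" and x: "cabs x < 1"
  then have ao: "a \<in> oL" "inverse a \<in> oL" by (auto simp: oL_iff oL_inverse[unfolded oL_iff])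
  have "a \<noteq> 0" using a by auto
  then have "act (inverse a) (act a x) = x" using act_act[OF ao(2,1) x] act_1[OF x] by simp
  then have "cabs x \<le> cabs (act a x)" using act_le[OF ao(2), of "act a x"] act_less[OF ao(1) x] by simp
  then show ?thesis using act_le[OF ao(1) x] by simp
qed

lemma pl_inv: "cabs x < 1 \<Longrightarrow> pl x (act (-1) x) = 0" using act_add[of 1 "-1" x] oL_1 oL_minus[OF oL_1] by (simp add: act_1 act_0)

lemma pl_cancel:
  assumes "cabs x < 1" "cabs y < 1" "cabs z < 1" "pl x y = pl x z" shows "y = z"
proof -
  have m: "cabs (act (-1) x) < 1" using act_less[OF oL_minus[OF oL_1]] assms by simp
  have "pl (act (-1) x) (pl x w) = w" if "cabs w < 1" for w
    using pl_assoc[OF m assms(1) that] pl_comm[OF m assms(1)] pl_inv[OF assms(1)] pl_0_left[OF that] by simp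
  then show ?thesis using assms by metis
qed

lemma pl_cancel_right:
  assumes "cabs x < 1" "cabs y < 1" "cabs z < 1" "pl y x = pl z x" shows "y = z"
  using pl_cancel[OF assms(1-3)] assms pl_comm by metis

lemma e_near: "cabs (e $ n - (if n = q then 1 else 0)) \<le> cabs \<pi>"
proof -
  obtain y where "y \<in> oL" "e $ n - (if n = q then 1 else 0) = \<pi> * y" using e_props(4)[of n] by blast
  then show ?thesis by (simp add: oL_iff mult_left_le)
qed

lemma e_intg: "intg e" using e_props(1) coeffs_in_oL_intg by blast

lemma act_pi: "act \<pi> x = ev x e" by (simp add: act_def e_br)

lemma act_pi_surj:
  assumes w: "cabs w < 1" shows "\<exists>x. cabs x < 1 \<and> act \<pi> x = w"
proof -
  \<comment> \<open>Modulo the larger of \<pi> and w, the series e - w is X^q, so its Weierstrass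
    polynomial has degree q and a root in the disc.\<close>
  define c where "c = (if cabs w \<le> cabs \<pi> then \<pi> else w)"
  have c: "cabs c < 1" "cabs w \<le> cabs c" "cabs \<pi> \<le> cabs c" using w pi_lt_1 by (auto simp: c_def)
  define g where "g = e - fps_const w"
  have "cabs (g $ n - (if n = q then 1 else 0)) \<le> cabs c" for n
  proof -
    have "cabs ((e $ n - (if n = q then 1 else 0)) - (if n = 0 then w else 0)) \<le> cabs c"
      using e_near[of n] c by (intro cabs_diff_le[of "e $ n - (if n = q then 1 else 0)"]) auto
    moreover have "(e $ n - (if n = q then 1 else 0)) - (if n = 0 then w else 0) = g $ n - (if n = q then 1 else 0)" by (simp add: g_def)
    ultimately show ?thesis by simp
  qed
  then obtain P a where P: "degree P = q" "\<forall>x. cabs x < 1 \<longrightarrow> cabs (ev x a) = 1 \<and> poly P x = ev x g * ev x a"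
    "\<forall>x. poly P x = 0 \<longrightarrow> cabs x < 1" using Weierstrass_poly[OF c(1), of q g] q_ge_2 by auto
  obtain x where x: "poly P x = 0" using alg_closed_imp_poly_has_root[of P] P(1) q_ge_2 by auto
  then have x1: "cabs x < 1" using P(3) by blast
  then have "ev x g * ev x a = 0" "cabs (ev x a) = 1" using P(2) x by auto
  then have "ev x g = 0" by auto
  then have "act \<pi> x = w" unfolding act_pi g_def using x1 w by (simp add: ev_diff ev_const e_intg intg_const)
  then show ?thesis using x1 by blast
qed

abbreviation T1 :: "'c set" where "T1 \<equiv> torsion_points L G \<pi>"

lemma torsion_iff: "a \<in> oL \<Longrightarrow> z \<in> torsion_points L G a \<longleftrightarrow> cabs z < 1 \<and> act a z = 0"
  by (simp add: torsion_points_def formal_mult_eq act_def)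

text \<open>The torsion points are the roots of a polynomial P of degree q, so simplicity is the
  point. At x = z + w in the group, |P(x)| = |\<open>[\<pi>]\<close>(w)|, which is about |\<pi> w|;
  a double root z would give |P(x)| <= |w|^2.\<close>

lemma T1_card: "finite T1 \<and> card T1 = q"
proof -
  have q_pos: "q > 0" using q_ge_2 by simp
  obtain P a where P: "degree P = q" "lead_coeff P = 1" "intg a"
    "\<forall>x. cabs x < 1 \<longrightarrow> cabs (ev x a) = 1 \<and> poly P x = ev x e * ev x a"
    "\<forall>x. poly P x = 0 \<longrightarrow> cabs x < 1" using Weierstrass_poly[OF pi_lt_1 q_pos e_near] by (elim exE conjE)
  have P0: "P \<noteq> 0" using P(2) by auto
  have roots: "T1 = {x. poly P x = 0}"
  proof (intro set_eqI iffI)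
    fix x assume "x \<in> T1"
    then show "x \<in> {x. poly P x = 0}" using P(4) by (auto simp: torsion_iff[OF pi_oL] act_pi)
  next
    fix x assume "x \<in> {x. poly P x = 0}"
    then have "poly P x = 0" by simp
    then have x: "cabs x < 1" "ev x e * ev x a = 0" "cabs (ev x a) = 1" using P(4)[rule_format, of x] P(5)[rule_format, of x] by auto
    then have "ev x e = 0" by auto
    then show "x \<in> T1" using x by (simp add: torsion_iff[OF pi_oL] act_pi)
  qed
  obtain A where A: "size A = q" "P = (\<Prod>x\<in>#A. [:-x, 1:])" using alg_closed_imp_factorization[OF P0] P(1,2) by auto
  have PA: "poly P x = (\<Prod>y\<in>#A. x - y)" for x by (subst A(2)) (simp add: poly_prod_mset)
  have setA: "set_mset A = T1" unfolding roots by (auto simp: PA prod_mset_zero_iff)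
  have A1: "cabs y < 1" if "y \<in># A" for y using that setA by (auto simp: torsion_iff[OF pi_oL])
  have "count A z = 1" if z: "z \<in># A" for z
  proof (rule ccontr)
    assume "count A z \<noteq> 1"
    then have "count A z \<ge> 2" using z by (metis One_nat_def Suc_leI count_greater_zero_iff le_neq_implies_less numeral_2_eq_2)
    then have "{#z, z#} \<subseteq># A" by (simp add: subseteq_mset_def numeral_2_eq_2)
    then obtain B where B: "A = {#z, z#} + B" by (metis subset_mset.le_iff_add)
    have le1: "cabs (\<Prod>y\<in>#M. x - y) \<le> 1" if "\<forall>y\<in>#M. cabs y < 1" "cabs x < 1" for x and M :: "'c multiset" using that
    proof (induction M)
      case (add y M)
      have "cabs (x - y) \<le> 1" using add.prems by (intro cabs_diff_le) auto
      then show ?case using add by (auto intro: mult_le_one)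
    qed simp
    have z1: "cabs z < 1" "act \<pi> z = 0" using z setA by (auto simp: torsion_iff[OF pi_oL])
    \<comment> \<open>For w = \<pi>^2 the two estimates are |\<pi>|^3 and |\<pi>|^4, which
      contradict each other.\<close>
    define w where "w = \<pi> ^ 2"
    have w: "cabs w < 1" using pi_lt_1 by (simp add: w_def power_less_one_iff)
    define x where "x = pl z w"
    have x: "cabs x < 1" "cabs (x - z) \<le> cabs w" unfolding x_def using pl_less pl_near z1 w by auto
    have "cabs (poly P x) \<le> cabs (x - z) ^ 2 * 1"
    proof -
      have "poly P x = (x - z) ^ 2 * (\<Prod>y\<in>#B. x - y)" unfolding PA B by (simp add: power2_eq_square)
      moreover have "cabs (\<Prod>y\<in>#B. x - y) \<le> 1" using A1 x by (intro le1) (auto simp: B)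
      ultimately show ?thesis by (simp add: mult_left_le)
    qed
    also have "\<dots> \<le> cabs w ^ 2 * 1" using x by (intro mult_right_mono power_mono) auto
    finally have Px: "cabs (poly P x) \<le> cabs \<pi> ^ 4" by (simp add: w_def power_mult[symmetric])
    have "ev x e = act \<pi> w" unfolding act_pi[symmetric] x_def using act_pl[OF pi_oL z1(1) w] z1 act_less[OF pi_oL w] by (simp add: pl_0_left)
    moreover have "cabs (act \<pi> w) = cabs \<pi> ^ 3"
    proof (rule cabs_eq_of_near')
      have "cabs (ev w e - (\<Sum>n<2. e $ n * w ^ n)) \<le> cabs w ^ 2" by (rule ev_est[OF e_intg w])
      also have "(\<Sum>n<2. e $ n * w ^ n) = \<pi> * w" using e_props(3) e_0 by (simp add: numeral_2_eq_2)
      also have "cabs w ^ 2 = cabs \<pi> ^ 4" by (simp add: w_def power_mult[symmetric])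
      also have "\<dots> < cabs \<pi> ^ 3" using pi_pos pi_lt_1 by (intro power_strict_decreasing) auto
      finally show "cabs (act \<pi> w - \<pi> * w) < cabs \<pi> ^ 3" by (simp add: act_pi)
      show "cabs (\<pi> * w) = cabs \<pi> ^ 3" by (simp add: w_def power3_eq_cube power2_eq_square)
    qed
    ultimately have "cabs (poly P x) = cabs \<pi> ^ 3" using P(4)[rule_format, OF x(1)] by simp
    moreover have "cabs \<pi> ^ 4 < cabs \<pi> ^ 3" using pi_pos pi_lt_1 by (intro power_strict_decreasing) auto
    ultimately show False using Px by simp
  qed
  then have "size A = card (set_mset A)" by (simp add: size_multiset_overloaded_eq)
  then show ?thesis using A(1) setA by (metis finite_set_mset)
qed

end

section \<open>The cyclotomic and the Lubin--Tate character\<close>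

context Cp begin

lemma Zp_approx:
  assumes u: "u \<in> (Zp :: 'c set)" shows "\<exists>k. cabs (u - of_nat k) \<le> 1 / real p ^ n"
proof -
  have "1 / real p ^ n > 0" using p_gt_1 by simp
  then obtain a where a: "a \<in> \<int>" "cabs (u - a) < 1 / real p ^ n" using u unfolding Zp_def closure_cabs by meson
  obtain i where i: "a = of_int i" using a(1) Ints_cases by metis
  define k where "k = nat (i mod int (p ^ n))"
  have k: "int k = i mod int (p ^ n)" using p_gt_1 by (simp add: k_def)
  have "i - int k = int (p ^ n) * (i div int (p ^ n))" unfolding k by (simp add: minus_mod_eq_mult_div)
  then have "(of_int (i - int k) :: 'c) = of_nat p ^ n * of_int (i div int (p ^ n))" by simp
  then have e: "a - of_nat k = of_nat p ^ n * of_int (i div int (p ^ n))" by (simp add: i)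
  have "cabs (a - of_nat k) \<le> 1 / real p ^ n" unfolding e
    by (subst mult.commute) (intro cabs_mult_le cabs_of_int_le, simp add: cabs_p power_one_over)
  then have "cabs (u - of_nat k) \<le> 1 / real p ^ n" using a(2) cabs_diff_triangle[of u a _ "of_nat k"] by simp
  then show ?thesis by blast
qed

lemma cabs_of_int_le_power_iff: "cabs (of_int m :: 'c) \<le> 1 / real p ^ n \<longleftrightarrow> int p ^ n dvd m"
proof
  assume "int p ^ n dvd m"
  then obtain k where "m = int p ^ n * k" by blast
  then have "(of_int m :: 'c) = of_int k * of_nat p ^ n" by (simp add: mult.commute)
  then show "cabs (of_int m :: 'c) \<le> 1 / real p ^ n" by (simp only:) (intro cabs_mult_le cabs_of_int_le, simp add: cabs_p power_one_over)
next
  show "cabs (of_int m :: 'c) \<le> 1 / real p ^ n \<Longrightarrow> int p ^ n dvd m"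
  proof (induction n)
    case (Suc n)
    have "1 / real p ^ Suc n \<le> 1 / real p ^ n" using p_gt_1 by (simp add: field_simps)
    then have "int p ^ n dvd m" using Suc by auto
    then obtain k where k: "m = int p ^ n * k" by blast
    then have "cabs (of_int m :: 'c) = (1 / real p ^ n) * cabs (of_int k :: 'c)" by (simp add: cabs_p power_one_over)
    then have "cabs (of_int k :: 'c) \<le> 1 / real p" using Suc.prems p_gt_1 by (simp add: field_simps)
    also have "1 / real p < 1" using p_gt_1 by simp
    finally have "int p dvd k" using cabs_of_int_unit[of k] by force
    then show ?case unfolding k by (simp add: mult.commute)
  qed simp
qed

lemma prim_root: "\<exists>w :: 'c. w ^ p = 1 \<and> w \<noteq> 1"
proof -
  define P where "P = (\<Sum>i<p. monom (1::'c) i)"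
  have cP: "coeff P i = (if i < p then 1 else 0)" for i by (simp add: P_def coeff_sum)
  have "degree P \<ge> p - 1" using p_gt_1 by (intro le_degree) (simp add: cP)
  then have "degree P > 0" using p_gt_1 by simp
  then obtain w where w: "poly P w = 0" using alg_closed_imp_poly_has_root by blast
  have Pw: "poly P x = (\<Sum>i<p. x ^ i)" for x by (simp add: P_def poly_sum poly_monom)
  have "w ^ p - 1 = (w - 1) * (\<Sum>i<p. w ^ i)" by (rule power_diff_1_eq)
  then have "w ^ p = 1" using w by (simp add: Pw)
  moreover have "w \<noteq> 1" using w p_gt_1 by (auto simp: Pw)
  ultimately show ?thesis by blast
qed

lemma power_eq_of_dvd:
  assumes x: "(x :: 'c) ^ N = 1" and d: "int N dvd int a - int b" shows "x ^ a = x ^ b"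
proof -
  have *: "x ^ a = x ^ b" if "b \<le> a" "int N dvd int a - int b" for a b :: nat
  proof -
    have "int N dvd int (a - b)" using that by (simp add: of_nat_diff)
    then obtain k where "a - b = N * k" by auto
    then have "a = b + N * k" using that(1) by simp
    then show ?thesis using x by (simp add: power_add power_mult)
  qed
  show ?thesis
  proof (cases "b \<le> a")
    case False
    then show ?thesis using *[of a b] d by (simp add: dvd_diff_commute)
  qed (use * d in blast)
qed

text \<open>A compatible system of roots of unity. The index is shifted: \<open>w n\<close> has
  exact order p^(n+1).\<close>

definition cyc_tower :: "(nat \<Rightarrow> 'c) \<Rightarrow> bool" where
  "cyc_tower w \<longleftrightarrow> w 0 ^ p = 1 \<and> w 0 \<noteq> 1 \<and> (\<forall>n. w (Suc n) ^ p = w n)"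

lemma ex_cyc_tower: "\<exists>w. cyc_tower w"
proof -
  obtain w0 :: 'c where w0: "w0 ^ p = 1" "w0 \<noteq> 1" using prim_root by blast
  define w where "w = rec_nat w0 (\<lambda>_ x. SOME y. y ^ p = (x :: 'c))"
  have "w (Suc n) ^ p = w n" for n unfolding w_def using someI_ex[OF nth_root_exists[of p "w n"]] p_gt_1 by (simp add: w_def)
  then show ?thesis using w0 unfolding cyc_tower_def by (intro exI[of _ w]) (auto simp: w_def)
qed

lemma cyc_tower_down:
  assumes w: "cyc_tower w" shows "w (n + m) ^ (p ^ m) = w n"
proof (induction m)
  case (Suc m)
  have "w (n + Suc m) ^ (p ^ Suc m) = (w (Suc (n + m)) ^ p) ^ (p ^ m)" by (simp add: power_mult)
  then show ?case using Suc w by (simp add: cyc_tower_def)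
qed simp

lemma cyc_tower_order1:
  assumes w: "cyc_tower w" shows "w n ^ (p ^ Suc n) = 1"
proof -
  have "w n ^ (p ^ n * p) = (w n ^ p ^ n) ^ p" by (simp add: power_mult)
  also have "w n ^ p ^ n = w 0" using cyc_tower_down[OF w, of 0 n] by simp
  finally show ?thesis using w by (simp add: cyc_tower_def mult.commute)
qed

lemma cyc_tower_0_dvd:
  assumes w: "cyc_tower w" "w 0 ^ k = 1" shows "p dvd k"
proof (rule ccontr)
  assume "\<not> p dvd k"
  then have "coprime p k" using p_prime by (simp add: prime_imp_coprime)
  moreover have "k \<noteq> 0" using \<open>\<not> p dvd k\<close> by (metis dvd_0_right)
  ultimately obtain x y where xy: "k * x = p * y + 1" using bezout_nat[of k p] by (auto simp: coprime_commute coprime_iff_gcd_eq_1)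
  have "w 0 = (w 0 ^ p) ^ y * w 0" using w(1) by (simp add: cyc_tower_def)
  also have "\<dots> = w 0 ^ (p * y + 1)" by (simp add: power_mult power_add)
  also have "\<dots> = (w 0 ^ k) ^ x" unfolding xy[symmetric] by (simp add: power_mult)
  finally show False using w by (simp add: cyc_tower_def)
qed

text \<open>Raising to the power p goes one level down and yields all but one factor p; the last
  factor comes from \<open>w 0\<close>, which has order p.\<close>

lemma cyc_tower_dvd:
  assumes w: "cyc_tower w" shows "w n ^ k = 1 \<Longrightarrow> p ^ Suc n dvd k"
proof (induction n arbitrary: k)
  case 0
  then show ?case using cyc_tower_0_dvd[OF w] by simp
next
  case (Suc n)
  have "w n ^ k = (w (Suc n) ^ k) ^ p" using w by (simp add: cyc_tower_def power_mult[symmetric] mult.commute) (metis power_mult mult.commute)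
  then have "p ^ Suc n dvd k" using Suc by simp
  then obtain m where m: "k = p ^ Suc n * m" by blast
  have "w 0 ^ m = (w (0 + Suc n) ^ p ^ Suc n) ^ m" using cyc_tower_down[OF w, of 0 "Suc n"] by simp
  also have "\<dots> = w (Suc n) ^ k" unfolding m by (simp add: power_mult)
  finally have "p dvd m" using Suc.prems cyc_tower_0_dvd[OF w] by simp
  then show ?case unfolding m by (simp add: mult.commute[of p])
qed

lemma cyc_tower_eq_dvd:
  assumes w: "cyc_tower w" and eq: "w n ^ a = w n ^ b" shows "int (p ^ Suc n) dvd int a - int b"
proof -
  have w0: "w n \<noteq> 0" using cyc_tower_order1[OF w, of n] p_gt_1 by (metis power_0_left power_eq_0_iff not_one_less_zero zero_neq_one)
  have *: "int (p ^ Suc n) dvd int a - int b" if "b \<le> a" "w n ^ a = w n ^ b" for a b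
  proof -
    have "w n ^ (a - b) = 1" using that w0 by (simp add: power_diff)
    then have "p ^ Suc n dvd a - b" by (rule cyc_tower_dvd[OF w])
    then have "int (p ^ Suc n) dvd int (a - b)" by (simp only: int_dvd_int_iff)
    then show ?thesis using that(1) by (simp only: of_nat_diff)
  qed
  show ?thesis
  proof (cases "b \<le> a")
    case False
    then have "int (p ^ Suc n) dvd int b - int a" using *[of a b] eq by simp
    then show ?thesis by (simp only: dvd_diff_commute)
  qed (use * eq in blast)
qed

text \<open>The p powers of \<open>w 0\<close> are distinct, and X^p - 1 has at most p
  roots.\<close>

lemma cyc_tower_gen_0:
  assumes w: "cyc_tower w" and x: "x ^ p = 1" shows "\<exists>k. x = w 0 ^ k"
proof -
  define Z where "Z = {x :: 'c. x ^ p = 1}"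
  have M: "monom 1 p - 1 \<noteq> (0 :: 'c poly)" "degree (monom 1 p - (1 :: 'c poly)) \<le> p"
  proof -
    have "coeff (monom 1 p - 1 :: 'c poly) p = 1" using p_gt_1 by (simp add: coeff_1)
    then show "monom 1 p - 1 \<noteq> (0 :: 'c poly)" by (metis coeff_0 zero_neq_one)
    show "degree (monom 1 p - (1 :: 'c poly)) \<le> p" by (intro degree_le) (auto simp: coeff_1)
  qed
  have Zr: "Z = {x. poly (monom 1 p - 1) x = 0}" by (auto simp: Z_def poly_monom)
  have fZ: "finite Z" unfolding Zr using M(1) by (rule poly_roots_finite)
  have cZ: "card Z \<le> p" unfolding Zr using card_poly_roots_bound[OF M(1)] M(2) by linarith
  have inj: "inj_on (\<lambda>k. w 0 ^ k) {..<p}"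
  proof (rule inj_onI)
    fix a b assume ab: "a \<in> {..<p}" "b \<in> {..<p}" "w 0 ^ a = w 0 ^ b"
    have "int p dvd int a - int b" using cyc_tower_eq_dvd[OF w ab(3)] by simp
    then have "int a mod int p = int b mod int p" by (simp add: mod_eq_dvd_iff)
    then show "a = b" using ab by simp
  qed
  have sub: "(\<lambda>k. w 0 ^ k) ` {..<p} \<subseteq> Z"
    using w by (auto simp: Z_def cyc_tower_def power_mult[symmetric]) (metis mult.commute power_mult power_one)
  have "(\<lambda>k. w 0 ^ k) ` {..<p} = Z" using sub cZ card_image[OF inj] by (intro card_seteq[OF fZ]) auto
  moreover have "x \<in> Z" using x by (simp add: Z_def)
  ultimately show ?thesis by blast
qed

lemma cyc_tower_gen:
  assumes w: "cyc_tower w" shows "x ^ (p ^ Suc n) = 1 \<Longrightarrow> \<exists>k. x = w n ^ k"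
proof (induction n arbitrary: x)
  case 0
  then show ?case using cyc_tower_gen_0[OF w] by simp
next
  case (Suc n)
  have "(x ^ p) ^ p ^ Suc n = 1" using Suc.prems by (simp add: power_mult[symmetric])
  then obtain k where k: "x ^ p = w n ^ k" using Suc.IH by blast
  have wp: "w (Suc n) ^ p = w n" using w by (simp add: cyc_tower_def)
  have w0: "w (Suc n) \<noteq> 0" using cyc_tower_order1[OF w, of "Suc n"] p_gt_1 by (metis power_0_left power_eq_0_iff not_one_less_zero zero_neq_one)
  have "(x / w (Suc n) ^ k) ^ p = x ^ p / (w (Suc n) ^ p) ^ k" by (simp add: power_divide power_mult[symmetric] mult.commute)
  also have "\<dots> = 1" using k w0 by (simp add: wp) (metis power_eq_0_iff wp)
  finally obtain j where j: "x / w (Suc n) ^ k = w 0 ^ j" using cyc_tower_gen_0[OF w] by blast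
  have "w 0 = w (Suc n) ^ p ^ Suc n" using cyc_tower_down[OF w, of 0 "Suc n"] by simp
  then have "w 0 ^ j = w (Suc n) ^ (p ^ Suc n * j)" by (simp only: power_mult)
  moreover have "x = w 0 ^ j * w (Suc n) ^ k" using j w0 by (simp add: field_simps)
  ultimately have "x = w (Suc n) ^ (p ^ Suc n * j + k)" by (simp only: power_add)
  then show ?case by blast
qed

lemma limit_of_close:
  assumes "\<And>n. cabs (a (Suc n) - a n :: 'c) \<le> r ^ n" "0 \<le> r" "r < 1"
  shows "\<exists>l. a \<longlonglongrightarrow> l \<and> (\<forall>n. cabs (l - a n) \<le> r ^ n)"
proof -
  have "convergent a"
  proof (rule nonarch_Cauchy)
    fix d :: real assume "d > 0"
    then obtain N where "\<forall>n\<ge>N. r ^ n < d" using small_power_mono[of r d] assms by auto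
    then show "\<exists>N. \<forall>n\<ge>N. cabs (a (Suc n) - a n) < d" using assms(1) le_less_trans by blast
  qed
  then obtain l where l: "a \<longlonglongrightarrow> l" unfolding convergent_def by blast
  have "cabs (l - a n) \<le> r ^ n" for n
  proof (rule cabs_le_limit[OF l])
    fix m assume "m \<ge> n"
    then show "cabs (a m - a n) \<le> r ^ n"
    proof (induction m rule: dec_induct)
      case (step m)
      have "r ^ m \<le> r ^ n" using step assms by (intro power_decreasing) auto
      then have "cabs (a (Suc m) - a m) \<le> r ^ n" using assms(1)[of m] by linarith
      then show ?case using step.IH cabs_diff_triangle by blast
    qed (use assms in simp)
  qed
  then show ?thesis using l by blast
qed

end

context LField begin

lemma Zp_oL: "Zp \<subseteq> oL"
proof -
  have "(\<int> :: 'c set) \<subseteq> oL" by (auto simp: oL_iff subfld_of_int[OF subfld_L] cabs_of_int_le elim!: Ints_cases)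
  then show ?thesis unfolding Zp_def using closed_oL by (rule closure_minimal)
qed

text \<open>Existence and uniqueness behind the description. The exponents by which \<sigma> acts on
  the levels of a tower agree modulo growing powers of p, and their limit is the character; the
  tower determines it, since \<open>w n\<close> detects exponents modulo p^(n+1).\<close>

lemma chi_cyc_spec:
  assumes s: "\<sigma> \<in> GL"
  shows "chi_cyc p \<sigma> \<in> Zp \<and> (\<forall>n k \<zeta>. \<zeta> ^ (p ^ n) = 1 \<longrightarrow> cabs (chi_cyc p \<sigma> - of_nat k) \<le> 1 / real p ^ n \<longrightarrow> \<sigma> \<zeta> = \<zeta> ^ k)"
  unfolding chi_cyc_def
proof (rule theI')
  obtain w where w: "cyc_tower w" using ex_cyc_tower by blast
  have "\<exists>k. \<sigma> (w n) = w n ^ k" for n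
    using cyc_tower_order1[OF w, of n] GL_power[OF s, of "w n" "p ^ Suc n"] GL_1[OF s] by (intro cyc_tower_gen[OF w]) simp
  then have "\<forall>n. \<exists>k. \<sigma> (w n) = w n ^ k" by blast
  then obtain k where k: "\<forall>n. \<sigma> (w n) = w n ^ k n" by (rule choice[THEN exE])
  have wp: "w (Suc n) ^ p = w n" for n using w by (simp add: cyc_tower_def)
  have close: "cabs (of_nat a - of_nat b :: 'c) \<le> 1 / real p ^ Suc n" if "w n ^ a = w n ^ b" for n a b
  proof -
    have "int p ^ Suc n dvd int a - int b" using cyc_tower_eq_dvd[OF w that] by simp
    then have "cabs (of_int (int a - int b) :: 'c) \<le> 1 / real p ^ Suc n" by (simp only: cabs_of_int_le_power_iff)
    then show ?thesis by simp
  qed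
  have p1: "1 / real p < 1" "0 \<le> 1 / real p" using p_gt_1 by auto
  have "\<exists>l. (\<lambda>n. of_nat (k n)) \<longlonglongrightarrow> l \<and> (\<forall>n. cabs (l - of_nat (k n) :: 'c) \<le> (1 / real p) ^ n)"
  proof (rule limit_of_close[OF _ p1(2,1)])
    fix n
    have "w n ^ k (Suc n) = (w (Suc n) ^ k (Suc n)) ^ p" unfolding wp[of n, symmetric] by (simp add: power_mult[symmetric] mult.commute)
    also have "\<dots> = \<sigma> (w (Suc n) ^ p)" using k GL_power[OF s] by simp
    also have "\<dots> = w n ^ k n" using k by (simp add: wp)
    finally have "cabs (of_nat (k (Suc n)) - of_nat (k n) :: 'c) \<le> 1 / real p ^ Suc n" by (rule close)
    also have "1 / real p ^ Suc n \<le> (1 / real p) ^ n" using p_gt_1 by (simp add: power_one_over field_simps)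
    finally show "cabs (of_nat (k (Suc n)) - of_nat (k n) :: 'c) \<le> (1 / real p) ^ n" .
  qed
  then obtain u :: 'c where u: "(\<lambda>n. of_nat (k n)) \<longlonglongrightarrow> u" "\<And>n. cabs (u - of_nat (k n)) \<le> (1 / real p) ^ n" by blast
  have uZ: "u \<in> Zp"
  proof (rule closed_LIMSEQ[OF _ _ u(1)])
    show "closed (Zp :: 'c set)" by (simp add: Zp_def)
    show "of_nat (k n) \<in> (Zp :: 'c set)" for n unfolding Zp_def using closure_subset by (meson Ints_of_nat subsetD)
  qed
  have uw: "\<sigma> \<zeta> = \<zeta> ^ k'" if z: "\<zeta> ^ (p ^ n) = 1" and k': "cabs (u - of_nat k') \<le> 1 / real p ^ n" for n k' \<zeta>
  proof (cases n)
    case 0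
    then show ?thesis using z GL_1[OF s] by simp
  next
    case (Suc m)
    have kn: "cabs (u - of_nat (k n)) \<le> 1 / real p ^ n" using u(2)[of n] by (simp add: power_one_over)
    have "\<zeta> ^ (p ^ Suc n) = 1" using z by (simp add: mult.commute[of p] power_mult)
    then obtain j where j: "\<zeta> = w n ^ j" using cyc_tower_gen[OF w] by blast
    have "\<sigma> \<zeta> = \<zeta> ^ k n" unfolding j GL_power[OF s] k[rule_format] by (simp add: power_mult[symmetric] mult.commute)
    moreover have "\<zeta> ^ k n = \<zeta> ^ k'"
    proof (rule power_eq_of_dvd[OF z])
      have "cabs (of_nat (k n) - of_nat k' :: 'c) \<le> 1 / real p ^ n"
        using cabs_diff_triangle[of "of_nat (k n)" u _ "of_nat k'"] kn k' by (simp add: cabs_minus_commute)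
      then have "cabs (of_int (int (k n) - int k') :: 'c) \<le> 1 / real p ^ n" by simp
      then show "int (p ^ n) dvd int (k n) - int k'" unfolding cabs_of_int_le_power_iff by simp
    qed
    ultimately show ?thesis by simp
  qed
  show "\<exists>!u :: 'c. u \<in> Zp \<and> (\<forall>n k \<zeta>. \<zeta> ^ (p ^ n) = 1 \<longrightarrow> cabs (u - of_nat k) \<le> 1 / real p ^ n \<longrightarrow> \<sigma> \<zeta> = \<zeta> ^ k)"
  proof (rule ex1I[of _ u])
    show "u \<in> Zp \<and> (\<forall>n k \<zeta>. \<zeta> ^ (p ^ n) = 1 \<longrightarrow> cabs (u - of_nat k) \<le> 1 / real p ^ n \<longrightarrow> \<sigma> \<zeta> = \<zeta> ^ k)"
      using uZ uw by blast
    fix v :: 'c assume v: "v \<in> Zp \<and> (\<forall>n k \<zeta>. \<zeta> ^ (p ^ n) = 1 \<longrightarrow> cabs (v - of_nat k) \<le> 1 / real p ^ n \<longrightarrow> \<sigma> \<zeta> = \<zeta> ^ k)"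
    show "v = u"
    proof (rule eq_of_cabs_le_power[OF p1(2,1)])
      fix n
      obtain a where a: "cabs (u - of_nat a) \<le> 1 / real p ^ Suc n" using Zp_approx[OF uZ] by blast
      obtain b where b: "cabs (v - of_nat b) \<le> 1 / real p ^ Suc n" using Zp_approx v by blast
      have w1: "w n ^ (p ^ Suc n) = 1" by (rule cyc_tower_order1[OF w])
      have "\<sigma> (w n) = w n ^ a" using uw[OF w1 a] .
      moreover have "\<sigma> (w n) = w n ^ b" using v w1 b by blast
      ultimately have "cabs (of_nat a - of_nat b :: 'c) \<le> 1 / real p ^ Suc n" using close by metis
      then have "cabs (u - of_nat b) \<le> 1 / real p ^ Suc n" using a cabs_diff_triangle by blast
      then have "cabs (v - u) \<le> 1 / real p ^ Suc n" using b cabs_diff_triangle[of v "of_nat b" _ u] by (simp add: cabs_minus_commute)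
      also have "1 / real p ^ Suc n \<le> (1 / real p) ^ n" using p_gt_1 by (simp add: power_one_over field_simps)
      finally show "cabs (v - u) \<le> (1 / real p) ^ n" .
    qed
  qed
qed

lemma GL_ev:
  assumes s: "\<sigma> \<in> GL" and A: "intg A" and x: "cabs x < 1"
  shows "\<sigma> (ev x A) = ev (\<sigma> x) (Abs_fps (\<lambda>n. \<sigma> (A $ n)))"
proof (rule ev_unique[symmetric])
  show "intg (Abs_fps (\<lambda>n. \<sigma> (A $ n)))" using A by (simp add: intg_def GL_cabs[OF s])
  show "cabs (\<sigma> x) < 1" using x by (simp add: GL_cabs[OF s])
  fix N
  have "\<sigma> (ev x A) - (\<Sum>n<N. \<sigma> (A $ n) * \<sigma> x ^ n) = \<sigma> (ev x A - (\<Sum>n<N. A $ n * x ^ n))"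
    by (simp add: GL_diff[OF s] GL_sum[OF s] GL_mult[OF s] GL_power[OF s])
  then show "cabs (\<sigma> (ev x A) - (\<Sum>n<N. Abs_fps (\<lambda>n. \<sigma> (A $ n)) $ n * \<sigma> x ^ n)) \<le> cabs x ^ N"
    using ev_est[OF A x] by (simp add: GL_cabs[OF s])
qed (use x in auto)

end

context LT begin

section \<open>Torsion towers and the Lubin-Tate character\<close>

lemma GL_ev_oL:
  assumes s: "\<sigma> \<in> GL" and A: "coeffs_in oL A" and x: "cabs x < 1" shows "\<sigma> (ev x A) = ev (\<sigma> x) A"
proof -
  have "Abs_fps (\<lambda>n. \<sigma> (A $ n)) = A" using A GL_fix[OF s] by (simp add: fps_eq_iff coeffs_in_def oL_iff)
  then show ?thesis using GL_ev[OF s coeffs_in_oL_intg[OF A] x] by simp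
qed

lemma GL_act: "\<sigma> \<in> GL \<Longrightarrow> a \<in> oL \<Longrightarrow> cabs x < 1 \<Longrightarrow> \<sigma> (act a x) = act a (\<sigma> x)"
  unfolding act_def by (intro GL_ev_oL br_coeffs)

lemma act_diff_zero:
  assumes "a \<in> oL" "b \<in> oL" "cabs x < 1" shows "act a x = act b x \<longleftrightarrow> act (a - b) x = 0"
proof
  assume "act a x = act b x"
  then show "act (a - b) x = 0" using act_add[of a "- b" x] act_add[of b "- b" x] assms oL_minus by (simp add: act_0)
next
  assume "act (a - b) x = 0"
  then show "act a x = act b x" using act_add[of "a - b" b x] assms oL_diff act_less[of b x] by (simp add: pl_0_left)
qed

text \<open>A generator of the Tate module, with shifted index: \<open>z n\<close> has exact order
  \<pi>^(n+1).\<close>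

definition tors_tower :: "(nat \<Rightarrow> 'c) \<Rightarrow> bool" where
  "tors_tower z \<longleftrightarrow> z 0 \<noteq> 0 \<and> act \<pi> (z 0) = 0 \<and> (\<forall>n. cabs (z n) < 1 \<and> act \<pi> (z (Suc n)) = z n)"

lemma ex_tors_tower: "\<exists>z. tors_tower z"
proof -
  have "\<not> T1 \<subseteq> {0}"
  proof
    assume "T1 \<subseteq> {0}"
    then have "card T1 \<le> card {0::'c}" by (intro card_mono) auto
    then show False using T1_card q_ge_2 by simp
  qed
  then obtain z0 where "z0 \<in> T1" "z0 \<noteq> 0" by blast
  then have z0: "z0 \<noteq> 0" "cabs z0 < 1" "act \<pi> z0 = 0" by (auto simp: torsion_iff[OF pi_oL])
  define z where "z = rec_nat z0 (\<lambda>_ x. SOME y. cabs y < 1 \<and> act \<pi> y = x)"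
  have zS: "z (Suc n) = (SOME y. cabs y < 1 \<and> act \<pi> y = z n)" for n by (simp add: z_def)
  have z1: "cabs (z n) < 1" for n
  proof (induction n)
    case (Suc n)
    show ?case unfolding zS using someI_ex[OF act_pi_surj[OF Suc]] by blast
  qed (simp add: z_def z0)
  have "act \<pi> (z (Suc n)) = z n" for n unfolding zS using someI_ex[OF act_pi_surj[OF z1[of n]]] by blast
  then show ?thesis using z0 z1 unfolding tors_tower_def by (intro exI[of _ z]) (auto simp: z_def)
qed

context
  fixes z assumes z: "tors_tower z"
begin

lemma tz: "cabs (z n) < 1" and tz_Suc: "act \<pi> (z (Suc n)) = z n" and tz_0: "z 0 \<noteq> 0" "act \<pi> (z 0) = 0"
  using z by (auto simp: tors_tower_def)

lemma tz_down: "act (\<pi> ^ m) (z (n + m)) = z n"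
proof (induction m)
  case (Suc m)
  have "act (\<pi> ^ Suc m) (z (n + Suc m)) = act (\<pi> ^ m) (act \<pi> (z (Suc (n + m))))"
    using act_act[OF oL_power[OF pi_oL] pi_oL tz] by (simp add: mult.commute)
  then show ?case using Suc by (simp add: tz_Suc)
qed (simp add: act_1 tz)

lemma tz_ne: "z n \<noteq> 0" using tz_down[of n 0] tz_0 act_at_0[OF oL_power[OF pi_oL]] by auto

text \<open>With b = \<pi>^k u and u a unit, \<open>[b]\<close> maps \<open>z n\<close> to a point
  of the size of \<open>z (n - k)\<close> if k <= n, and kills it otherwise.\<close>

lemma tz_kernel:
  assumes b: "b \<in> oL" shows "act b (z n) = 0 \<longleftrightarrow> cabs b \<le> cabs \<pi> ^ Suc n"
proof
  assume "cabs b \<le> cabs \<pi> ^ Suc n"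
  then obtain y where y: "y \<in> oL" "b = \<pi> ^ Suc n * y" using L_dvd_power[of b "Suc n"] b by (auto simp: oL_iff simp del: power_Suc)
  have "act (\<pi> ^ Suc n) (z n) = act \<pi> (act (\<pi> ^ n) (z (0 + n)))" using act_act[OF pi_oL oL_power[OF pi_oL] tz] by simp
  then have "act (\<pi> ^ Suc n) (z n) = 0" using tz_0 by (simp only: tz_down)
  then show "act b (z n) = 0" using act_act[OF y(1) oL_power[OF pi_oL, of "Suc n"] tz, of n] y act_at_0[OF y(1)] by (simp add: mult.commute)
next
  assume a: "act b (z n) = 0"
  show "cabs b \<le> cabs \<pi> ^ Suc n"
  proof (cases "b = 0")
    case False
    then obtain k u where u: "u \<in> L" "cabs u = 1" "b = \<pi> ^ k * u" using oL_factor b by blast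
    have "k \<ge> Suc n"
    proof (rule ccontr)
      assume "\<not> k \<ge> Suc n"
      then have k: "n = (n - k) + k" by simp
      have "act b (z n) = act u (act (\<pi> ^ k) (z ((n - k) + k)))"
        using act_act[of u "\<pi> ^ k" "z n"] u k tz oL_power[OF pi_oL] by (simp add: oL_iff mult.commute)
      also have "\<dots> = act u (z (n - k))" by (simp only: tz_down)
      finally have "cabs (act b (z n)) = cabs (z (n - k))" using act_unit u tz by simp
      then show False using a tz_ne by simp
    qed
    then have "cabs \<pi> ^ k \<le> cabs \<pi> ^ Suc n" using pi_lt_1 by (intro power_decreasing) auto
    then show ?thesis using u by simp
  qed (use pi_pos in simp)
qed

lemma tz_eq: "a \<in> oL \<Longrightarrow> b \<in> oL \<Longrightarrow> act a (z n) = act b (z n) \<longleftrightarrow> cabs (a - b) \<le> cabs \<pi> ^ Suc n"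
  using act_diff_zero[of a b "z n"] tz_kernel[of "a - b" n] tz oL_diff by simp

text \<open>Counting: the q residue classes of a give q distinct points \<open>[a]\<close>(z 0), and
  there are only q torsion points.\<close>

lemma T1_gen: assumes "x \<in> T1" shows "\<exists>a\<in>oL. x = act a (z 0)"
proof -
  obtain T where T: "finite T" "T \<subseteq> oL" "card T = q" "\<forall>s\<in>T. \<forall>t\<in>T. cabs (s - t) < 1 \<longrightarrow> s = t"
    using residue_reps by (elim exE conjE)
  have inj: "inj_on (\<lambda>a. act a (z 0)) T"
  proof (rule inj_onI)
    fix a b assume ab: "a \<in> T" "b \<in> T" "act a (z 0) = act b (z 0)"
    then have "cabs (a - b) \<le> cabs \<pi> ^ Suc 0" using tz_eq T(2) by blast
    then have "cabs (a - b) < 1" using pi_lt_1 by simp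
    then show "a = b" using T(4) ab by blast
  qed
  have "(\<lambda>a. act a (z 0)) ` T \<subseteq> T1"
  proof clarify
    fix a assume "a \<in> T"
    then have a: "a \<in> oL" using T(2) by blast
    have "act \<pi> (act a (z 0)) = act a (act \<pi> (z 0))" using act_act a pi_oL tz by (simp add: mult.commute)
    then show "act a (z 0) \<in> T1" using act_less[OF a tz] act_at_0[OF a] tz_0 by (simp add: torsion_iff[OF pi_oL])
  qed
  then have "(\<lambda>a. act a (z 0)) ` T = T1" using T1_card card_image[OF inj] T(3) by (intro card_seteq) auto
  then show ?thesis using assms T(2) by blast
qed

text \<open>If \<open>[\<pi>]\<close> x = \<open>[a]\<close> z_n, then x and \<open>[a]\<close>
  z_(n+1) differ by a point of \<open>T1\<close>; such a point is a multiple of z_0 and therefore of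
  z_(n+1).\<close>

lemma tors_gen: "cabs x < 1 \<Longrightarrow> act (\<pi> ^ Suc n) x = 0 \<Longrightarrow> \<exists>a\<in>oL. x = act a (z n)"
proof (induction n arbitrary: x)
  case 0
  then show ?case using T1_gen[of x] by (simp add: torsion_iff[OF pi_oL])
next
  case (Suc n)
  have po: "\<pi> ^ m \<in> oL" for m by (rule oL_power[OF pi_oL])
  have "act (\<pi> ^ Suc n) (act \<pi> x) = 0" using Suc.prems act_act[OF po[of "Suc n"] pi_oL] by (simp add: mult_ac)
  then obtain a where a: "a \<in> oL" "act \<pi> x = act a (z n)" using Suc.IH[of "act \<pi> x"] act_less[OF pi_oL Suc.prems(1)] by blast
  let ?y = "act a (z (Suc n))"
  have y: "cabs ?y < 1" using act_less[OF a(1) tz] .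
  have m1: "-1 \<in> oL" using oL_minus[OF oL_1] .
  define d where "d = pl x (act (-1) ?y)"
  have my: "cabs (act (-1) ?y) < 1" using act_less[OF m1 y] .
  have d: "cabs d < 1" unfolding d_def using pl_less Suc.prems(1) my by blast
  have piy: "act \<pi> ?y = act \<pi> x"
    using act_act[OF pi_oL a(1) tz, of "Suc n"] act_act[OF a(1) pi_oL tz, of "Suc n"] by (simp add: a(2) tz_Suc mult.commute)
  have "act \<pi> d = pl (act \<pi> x) (act (-1) (act \<pi> ?y))"
    unfolding d_def using act_pl[OF pi_oL Suc.prems(1) my] act_act[OF pi_oL m1 y] act_act[OF m1 pi_oL y] by simp
  also have "\<dots> = 0" unfolding piy using pl_inv act_less[OF pi_oL Suc.prems(1)] by blast
  finally have "d \<in> T1" using d by (simp add: torsion_iff[OF pi_oL])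
  then obtain b where b: "b \<in> oL" "d = act b (z 0)" using T1_gen by blast
  have "z 0 = act (\<pi> ^ Suc n) (z (0 + Suc n))" by (simp only: tz_down)
  then have d': "d = act (b * \<pi> ^ Suc n) (z (Suc n))" using b act_act[OF b(1) po[of "Suc n"] tz, of "Suc n"] by (simp del: power_Suc)
  have bo: "b * \<pi> ^ Suc n \<in> oL" using b po by (intro oL_mult)
  have "pl d ?y = pl x (pl (act (-1) ?y) ?y)" unfolding d_def by (rule pl_assoc[OF Suc.prems(1) my y])
  also have "pl (act (-1) ?y) ?y = 0" using pl_inv[OF y] pl_comm[OF y my] by simp
  also have "pl x 0 = x" using pl_0_right Suc.prems by blast
  finally have "x = act (b * \<pi> ^ Suc n + a) (z (Suc n))" unfolding d' using act_add[OF bo a(1) tz] by simp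
  moreover have "b * \<pi> ^ Suc n + a \<in> oL" using a bo by (intro oL_add)
  ultimately show ?case by blast
qed

text \<open>The multiplier by which \<sigma> acts on \<open>z n\<close> is determined modulo
  \<pi>^(n+1); the multipliers converge. The limit is a unit because \<sigma> does not kill
  \<open>z 0\<close>, and every torsion point is a multiple of some \<open>z n\<close>.\<close>

lemma chi_LT_ex:
  assumes s: "\<sigma> \<in> GL"
  shows "\<exists>!u. u \<in> o_units L \<and> (\<forall>n. \<forall>x\<in>torsion_points L G (\<pi> ^ n). \<sigma> x = fps_value (formal_mult L G u) x)"
proof -
  have po: "\<pi> ^ m \<in> oL" for m by (rule oL_power[OF pi_oL])
  have unit_oL: "u \<in> oL" if "u \<in> o_units L" for u using that by (auto simp: o_units_def oL_iff)
  have sz: "cabs (\<sigma> (z n)) < 1" for n using tz GL_cabs[OF s] by simp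
  have ker: "act (\<pi> ^ Suc n) (z n) = 0" for n using tz_kernel[OF po, of "Suc n" n] by simp
  have "\<exists>a. a \<in> oL \<and> \<sigma> (z n) = act a (z n)" for n
    using tors_gen[OF sz, of n n] GL_act[OF s po[of "Suc n"] tz[of n]] ker[of n] GL_0[OF s] by auto
  then have "\<forall>n. \<exists>a. a \<in> oL \<and> \<sigma> (z n) = act a (z n)" by blast
  then obtain a where a: "\<forall>n. a n \<in> oL \<and> \<sigma> (z n) = act (a n) (z n)" by (rule choice[THEN exE])
  have close: "cabs (a (Suc n) - a n) \<le> cabs \<pi> ^ Suc n" for n
  proof -
    have "act (a (Suc n)) (z n) = act (a (Suc n)) (act \<pi> (z (Suc n)))" by (simp add: tz_Suc)
    also have "\<dots> = act \<pi> (act (a (Suc n)) (z (Suc n)))" using a act_act pi_oL tz by (simp add: mult.commute)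
    also have "\<dots> = \<sigma> (act \<pi> (z (Suc n)))" using a GL_act[OF s pi_oL tz] by simp
    also have "\<dots> = act (a n) (z n)" using a by (simp add: tz_Suc)
    finally show ?thesis using tz_eq a by blast
  qed
  have "cabs (a (Suc n) - a n) \<le> cabs \<pi> ^ n" for n
  proof -
    have "cabs \<pi> ^ Suc n \<le> cabs \<pi> ^ n" using pi_lt_1 by (intro power_decreasing) auto
    then show ?thesis using close[of n] by linarith
  qed
  then obtain u where u: "a \<longlonglongrightarrow> u" "\<And>n. cabs (u - a n) \<le> cabs \<pi> ^ n"
    using limit_of_close[of a "cabs \<pi>"] pi_lt_1 by auto
  have uo: "u \<in> oL" using closed_LIMSEQ[OF closed_oL _ u(1)] a by blast
  have su: "\<sigma> (z n) = act u (z n)" for n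
  proof -
    have "cabs (a (Suc n) - a n) \<le> cabs \<pi> ^ Suc n" "cabs (u - a (Suc n)) \<le> cabs \<pi> ^ Suc n" using close u by blast+
    then have "cabs (u - a n) \<le> cabs \<pi> ^ Suc n" using cabs_diff_triangle by blast
    then have "act u (z n) = act (a n) (z n)" using tz_eq uo a by blast
    then show ?thesis using a by simp
  qed
  have "cabs u = 1"
  proof (rule ccontr)
    assume "cabs u \<noteq> 1"
    then have "cabs u < 1" using uo by (simp add: oL_iff)
    then have "cabs u \<le> cabs \<pi> ^ Suc 0" using L_less_1 uo by (simp add: oL_iff)
    then have "\<sigma> (z 0) = 0" using tz_kernel[OF uo] su by simp
    then show False using GL_cabs[OF s, of "z 0"] tz_ne[of 0] by simp
  qed
  then have uu: "u \<in> o_units L" using uo by (simp add: o_units_def oL_iff)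
  show ?thesis
  proof (rule ex1I[of _ u])
    have "\<sigma> x = act u x" if x: "x \<in> torsion_points L G (\<pi> ^ n)" for n x
    proof (cases n)
      case 0
      then have "x = 0" using x act_1[of x] by (simp add: torsion_iff[OF oL_1])
      then show ?thesis using GL_0[OF s] act_at_0[OF uo] by simp
    next
      case (Suc m)
      then obtain b where b: "b \<in> oL" "x = act b (z m)" using tors_gen[of x m] x by (auto simp: torsion_iff[OF po] simp del: power_Suc)
      have "\<sigma> x = act b (act u (z m))" using b GL_act[OF s b(1) tz] su by simp
      also have "\<dots> = act u x" using act_act b uo tz by (simp add: mult.commute)
      finally show ?thesis .
    qed
    then show "u \<in> o_units L \<and> (\<forall>n. \<forall>x\<in>torsion_points L G (\<pi> ^ n). \<sigma> x = fps_value (formal_mult L G u) x)"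
      using uu by (simp add: formal_mult_eq[OF uo] act_def)
    fix v assume v: "v \<in> o_units L \<and> (\<forall>n. \<forall>x\<in>torsion_points L G (\<pi> ^ n). \<sigma> x = fps_value (formal_mult L G v) x)"
    have vo: "v \<in> oL" using unit_oL v by blast
    show "v = u"
    proof (rule eq_of_cabs_le_power[OF cabs_nonneg pi_lt_1])
      fix n
      have "z n \<in> torsion_points L G (\<pi> ^ Suc n)" using ker[of n] tz[of n] by (simp add: torsion_iff[OF po] del: power_Suc)
      then have "\<sigma> (z n) = act v (z n)" using v unfolding act_def formal_mult_eq[OF vo] by blast
      then have "cabs (v - u) \<le> cabs \<pi> ^ Suc n" using su[of n] tz_eq[OF vo uo, of n] by metis
      also have "\<dots> \<le> cabs \<pi> ^ n" using pi_lt_1 by (intro power_decreasing) auto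
      finally show "cabs (v - u) \<le> cabs \<pi> ^ n" .
    qed
  qed
qed

end

lemma chi_LT_spec:
  assumes s: "\<sigma> \<in> GL"
  shows "chi_LT L \<pi> G \<sigma> \<in> o_units L" and "cabs x < 1 \<Longrightarrow> act (\<pi> ^ n) x = 0 \<Longrightarrow> \<sigma> x = act (chi_LT L \<pi> G \<sigma>) x"
proof -
  obtain z where "tors_tower z" using ex_tors_tower by blast
  from theI'[OF chi_LT_ex[OF this s], folded chi_LT_def]
  have *: "chi_LT L \<pi> G \<sigma> \<in> o_units L"
    "\<forall>n. \<forall>x\<in>torsion_points L G (\<pi> ^ n). \<sigma> x = fps_value (formal_mult L G (chi_LT L \<pi> G \<sigma>)) x" by blast+
  show "chi_LT L \<pi> G \<sigma> \<in> o_units L" by (rule *(1))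
  then have o: "chi_LT L \<pi> G \<sigma> \<in> oL" by (auto simp: o_units_def oL_iff)
  assume "cabs x < 1" "act (\<pi> ^ n) x = 0"
  then have "x \<in> torsion_points L G (\<pi> ^ n)" by (simp add: torsion_iff[OF oL_power[OF pi_oL]])
  then show "\<sigma> x = act (chi_LT L \<pi> G \<sigma>) x" using *(2) unfolding act_def formal_mult_eq[OF o] by blast
qed

end

section \<open>Traces over the torsion points and the period\<close>

context LT begin

lemma cring_oL: "cring oL" unfolding cring_def using closed_oL by (auto simp: oL_0 oL_minus oL_add oL_mult) (auto simp: oL_iff o_Cp_def)

lemma e_cond_oL: "\<exists>k\<in>oL. e $ n - (if n = q then 1 else 0) = \<pi> * k" using e_props(4)[of n] by blast

lemma pi_small: "\<pi> \<in> o_Cp" using pi_lt_1 by (simp add: o_Cp_def)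

lemma oL_o_Cp: "oL \<subseteq> o_Cp" by (auto simp: oL_iff o_Cp_def)

lemma T1_less: "z \<in> T1 \<Longrightarrow> cabs z < 1" and T1_act: "z \<in> T1 \<Longrightarrow> act \<pi> z = 0"
  by (auto simp: torsion_iff[OF pi_oL])

lemma act_pi_translate: "z \<in> T1 \<Longrightarrow> cabs x < 1 \<Longrightarrow> act \<pi> (pl z x) = act \<pi> x"
  using act_pl[OF pi_oL T1_less, of z x] T1_act[of z] act_less[OF pi_oL, of x] by (simp add: pl_0_left)

text \<open>Coleman's descent: expand \<open>f = \<Sum>\<^sub>j X\<^sup>j (H\<^sub>j \<circ> e)\<close> with \<open>j < q\<close>; for fixed \<open>x\<close>, the polynomial
  \<open>\<Sum>\<^sub>j H\<^sub>j(e(x)) X\<^sup>j - f(x)\<close> of degree less than \<open>q\<close> vanishes at the \<open>q\<close> translates of \<open>x\<close>.\<close>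

lemma descent:
  assumes R: "cring R" and pR: "\<pi> \<in> R" and ec: "\<And>n. \<exists>k\<in>R. e $ n - (if n = q then 1 else 0) = \<pi> * k"
    and f: "coeffs_in R f" and inv: "\<And>z x. z \<in> T1 \<Longrightarrow> cabs x < 1 \<Longrightarrow> ev (pl z x) f = ev x f"
  shows "\<exists>H. coeffs_in R H \<and> f = H oo e"
proof -
  define Q where "Q f = (SOME a. coeffs_in R a \<and> coeffs_in R (f - e * a) \<and> (\<forall>n\<ge>q. (f - e * a) $ n = 0))" for f
  have Q: "coeffs_in R (Q f) \<and> coeffs_in R (f - e * Q f) \<and> (\<forall>n\<ge>q. (f - e * Q f) $ n = 0)" if "coeffs_in R f" for f
  proof -
    obtain a r where "coeffs_in R a" "coeffs_in R r" "\<forall>n\<ge>q. r $ n = 0" "f = e * a + r"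
      using Weierstrass_division[OF R pR pi_lt_1 ec \<open>coeffs_in R f\<close>] by blast
    then have "\<exists>a. coeffs_in R a \<and> coeffs_in R (f - e * a) \<and> (\<forall>n\<ge>q. (f - e * a) $ n = 0)" by (intro exI[of _ a]) simp
    from someI_ex[OF this] show ?thesis unfolding Q_def .
  qed
  define F where "F = rec_nat f (\<lambda>_. Q)"
  have F0: "F 0 = f" and FS: "F (Suc k) = Q (F k)" for k by (simp_all add: F_def)
  have FR: "coeffs_in R (F k)" for k by (induction k) (simp_all add: F0 FS f Q)
  define r where "r k = F k - e * F (Suc k)" for k
  have r: "coeffs_in R (r k)" "\<And>n. n \<ge> q \<Longrightarrow> r k $ n = 0" for k using Q[OF FR[of k]] by (auto simp: r_def FS)
  have intgR: "intg A" if "coeffs_in R A" for A using that R by (auto simp: coeffs_in_def intg_def cring_def o_Cp_def)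
  \<comment> \<open>The remainders \<open>r k\<close> are the digits of f in base e, each of degree
    below q. Collecting the coefficients of X^j over all k gives the j-th series of the
    expansion.\<close>
  define H where "H j = Abs_fps (\<lambda>k. r k $ j)" for j
  have HR: "coeffs_in R (H j)" for j using r(1) by (simp add: H_def coeffs_in_def)
  have val: "ev x f = (\<Sum>j<q. ev (ev x e) (H j) * x ^ j)" if x: "cabs x < 1" for x
  proof (rule eq_of_cabs_le_power[OF cabs_nonneg x])
    fix N
    let ?g = "ev x e"
    have g: "cabs ?g \<le> cabs x" using ev_le0[OF e_intg x e_0] .
    then have g1: "cabs ?g < 1" using x by simp
    have "ev x f = (\<Sum>k<N. ?g ^ k * ev x (r k)) + ?g ^ N * ev x (F N)"
    proof (induction N)
      case (Suc N)
      have "F N = r N + e * F (Suc N)" by (simp add: r_def)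
      then have "ev x (F N) = ev x (r N) + ?g * ev x (F (Suc N))" using x e_intg intgR[OF r(1)] intgR[OF FR] by (simp add: ev_add ev_mult intg_mult)
      then show ?case using Suc by (simp add: algebra_simps)
    qed (simp add: F0)
    also have "(\<Sum>k<N. ?g ^ k * ev x (r k)) = (\<Sum>k<N. \<Sum>j<q. H j $ k * ?g ^ k * x ^ j)"
      by (simp add: ev_finite[OF r(2) intgR[OF r(1)] x] sum_distrib_left H_def mult_ac)
    also have "\<dots> = (\<Sum>j<q. (\<Sum>k<N. H j $ k * ?g ^ k) * x ^ j)" by (subst sum.swap) (simp add: sum_distrib_right)
    finally have e1: "ev x f - (\<Sum>j<q. ev ?g (H j) * x ^ j) =
        ?g ^ N * ev x (F N) - (\<Sum>j<q. (ev ?g (H j) - (\<Sum>k<N. H j $ k * ?g ^ k)) * x ^ j)" by (simp add: left_diff_distrib sum_subtractf)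
    have gN: "cabs ?g ^ N \<le> cabs x ^ N" using g by (intro power_mono) auto
    have "cabs (ev x (F N) * ?g ^ N) \<le> cabs x ^ N" using ev_le[OF intgR[OF FR] x] gN by (intro cabs_mult_le) auto
    moreover have "cabs (\<Sum>j<q. x ^ j * (ev ?g (H j) - (\<Sum>k<N. H j $ k * ?g ^ k))) \<le> cabs x ^ N"
    proof (rule cabs_sum_le)
      fix j
      have "cabs (ev ?g (H j) - (\<Sum>k<N. H j $ k * ?g ^ k)) \<le> cabs x ^ N" using ev_est[OF intgR[OF HR[of j]] g1, of N] gN by linarith
      then show "cabs (x ^ j * (ev ?g (H j) - (\<Sum>k<N. H j $ k * ?g ^ k))) \<le> cabs x ^ N" using x by (intro cabs_mult_le cabs_le_1_power) auto
    qed simp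
    ultimately show "cabs (ev x f - (\<Sum>j<q. ev ?g (H j) * x ^ j)) \<le> cabs x ^ N"
      unfolding e1 by (intro cabs_diff_le) (simp_all only: mult.commute)
  qed
  have "ev x f = ev x (H 0 oo e)" if x: "cabs x < 1" for x
  proof -
    define P where "P = (\<Sum>j<q. monom (ev (ev x e) (H j)) j) - [:ev x f:]"
    have cP: "coeff P j = (if j < q then ev (ev x e) (H j) else 0) - (if j = 0 then ev x f else 0)" for j
      by (simp add: P_def coeff_sum coeff_pCons split: nat.splits)
    have "degree P < q" using q_ge_2 by (intro degree_lessI) (auto simp: cP)
    have "P = 0"
    proof (rule ccontr)
      assume "P \<noteq> 0"
      have inj: "inj_on (\<lambda>z. pl z x) T1" using pl_cancel_right[OF x] T1_less by (intro inj_onI) blast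
      have "(\<lambda>z. pl z x) ` T1 \<subseteq> {y. poly P y = 0}"
      proof clarify
        fix z assume z: "z \<in> T1"
        have y: "cabs (pl z x) < 1" using pl_less T1_less z x by blast
        have "ev (pl z x) f = (\<Sum>j<q. ev (ev x e) (H j) * pl z x ^ j)" using val[OF y] act_pi_translate[OF z x] by (simp add: act_pi)
        then show "poly P (pl z x) = 0" using inv[OF z x] by (simp add: P_def poly_sum poly_monom)
      qed
      then have "card ((\<lambda>z. pl z x) ` T1) \<le> card {y. poly P y = 0}" by (intro card_mono poly_roots_finite \<open>P \<noteq> 0\<close>)
      also have "\<dots> \<le> degree P" by (rule card_poly_roots_bound[OF \<open>P \<noteq> 0\<close>])
      finally show False using card_image[OF inj] T1_card \<open>degree P < q\<close> by simp
    qed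
    then have "coeff P 0 = 0" by simp
    then have "ev x f = ev (ev x e) (H 0)" using q_ge_2 by (simp add: cP)
    then show ?thesis using ev_compose[OF e_intg e_0 x intgR[OF HR]] by simp
  qed
  then have "f = H 0 oo e" by (intro ev_ext intg_compose intgR[OF f] intgR[OF HR] e_intg)
  then show ?thesis using HR by blast
qed

section \<open>Traces of the powers of Z over the torsion points\<close>

lemma intg_translate_G: "cabs z < 1 \<Longrightarrow> intg (translate G z)" by (intro intg_translate G_intg)

lemma translate_0: "cabs z < 1 \<Longrightarrow> translate G z $ 0 = z" by (simp add: translate_def G_0 ev_X)

definition Tr :: "nat \<Rightarrow> 'c fps" where "Tr i = (\<Sum>z\<in>T1. translate G z ^ i)"

lemma Tr_intg: "intg (Tr i)" unfolding Tr_def using T1_less by (intro intg_sum intg_power intg_translate_G)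

lemma ev_Tr: "cabs x < 1 \<Longrightarrow> ev x (Tr i) = (\<Sum>z\<in>T1. pl z x ^ i)"
  unfolding Tr_def using T1_less by (simp add: ev_sum ev_power intg_power intg_translate_G pl_def)

lemma GL_T1: assumes s: "\<sigma> \<in> GL" shows "\<sigma> ` T1 = T1"
proof (rule endo_inj_surj)
  show "\<sigma> ` T1 \<subseteq> T1"
  proof clarify
    fix z assume z: "z \<in> T1"
    have "act \<pi> (\<sigma> z) = \<sigma> (act \<pi> z)" using GL_act[OF s pi_oL T1_less[OF z]] by simp
    also have "\<dots> = 0" using T1_act[OF z] GL_0[OF s] by simp
    finally have "act \<pi> (\<sigma> z) = 0" .
    moreover have "cabs (\<sigma> z) < 1" using T1_less[OF z] GL_cabs[OF s] by simp
    ultimately show "\<sigma> z \<in> T1" using torsion_iff[OF pi_oL] by blast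
  qed
  show "inj_on \<sigma> T1" using GL_inj[OF s] by (auto simp: inj_on_def)
qed (use T1_card in simp)

text \<open>The Galois group permutes the torsion points, so it fixes the coefficients, and its
  fixed field is L by \<open>GL_fixed\<close>.\<close>

lemma Tr_oL: "coeffs_in oL (Tr i)"
proof -
  have "Tr i $ n \<in> L" for n
  proof (rule GL_fixed, intro ballI)
    fix \<sigma> assume s: "\<sigma> \<in> GL"
    have tr: "\<sigma> (translate G z $ n) = translate G (\<sigma> z) $ n" if "z \<in> T1" for z n
      using GL_ev_oL[OF s G_coeffs T1_less[OF that]] by (simp add: translate_def)
    have pw: "\<sigma> ((translate G z ^ i) $ n) = (translate G (\<sigma> z) ^ i) $ n" if "z \<in> T1" for z n
    proof (induction i arbitrary: n)
      case 0 then show ?case by (simp add: GL_0[OF s] GL_1[OF s])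
    next
      case (Suc i)
      then show ?case by (simp add: fps_mult_nth GL_sum[OF s] GL_mult[OF s] tr[OF that])
    qed
    have "\<sigma> (Tr i $ n) = (\<Sum>z\<in>T1. (translate G (\<sigma> z) ^ i) $ n)" by (simp add: Tr_def fps_sum_nth GL_sum[OF s] pw)
    also have "\<dots> = (\<Sum>z\<in>\<sigma> ` T1. (translate G z ^ i) $ n)" using GL_inj[OF s] by (subst sum.reindex) (auto simp: inj_on_def)
    finally show "\<sigma> (Tr i $ n) = Tr i $ n" by (simp add: GL_T1[OF s] Tr_def fps_sum_nth)
  qed
  then show ?thesis using intgD[OF Tr_intg] by (simp add: coeffs_in_def oL_iff)
qed

lemma T1_translate:
  assumes z: "z \<in> T1" shows "(\<lambda>y. pl y z) ` T1 = T1" "inj_on (\<lambda>y. pl y z) T1"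
proof -
  show inj: "inj_on (\<lambda>y. pl y z) T1" using pl_cancel_right[OF T1_less[OF z]] T1_less by (intro inj_onI) blast
  have "(\<lambda>y. pl y z) ` T1 \<subseteq> T1"
  proof clarify
    fix y assume y: "y \<in> T1"
    have "act \<pi> (pl y z) = 0" using act_pi_translate[OF y T1_less[OF z]] T1_act[OF z] by simp
    moreover have "cabs (pl y z) < 1" using pl_less T1_less y z by blast
    ultimately show "pl y z \<in> T1" using torsion_iff[OF pi_oL] by blast
  qed
  then show "(\<lambda>y. pl y z) ` T1 = T1" using inj T1_card by (intro endo_inj_surj) auto
qed

text \<open>Translation by a torsion point only permutes the summands, so the trace is invariant and
  descends.\<close>

lemma Tr_descent: "\<exists>h. coeffs_in oL h \<and> Tr i = h oo e"
proof (rule descent[OF cring_oL pi_oL e_cond_oL Tr_oL])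
  fix z x :: 'c assume z: "z \<in> T1" and x: "cabs x < 1"
  have "ev (pl z x) (Tr i) = (\<Sum>y\<in>T1. pl y (pl z x) ^ i)" using pl_less[OF T1_less[OF z] x] by (rule ev_Tr)
  also have "\<dots> = (\<Sum>y\<in>T1. pl (pl y z) x ^ i)" using pl_assoc T1_less z x by (intro sum.cong refl) simp
  also have "\<dots> = (\<Sum>y\<in>(\<lambda>y. pl y z) ` T1. pl y x ^ i)" using T1_translate(2)[OF z] by (simp add: sum.reindex)
  finally show "ev (pl z x) (Tr i) = ev x (Tr i)" using T1_translate(1)[OF z] x by (simp add: ev_Tr)
qed

text \<open>The value of \<open>psi_Col\<close> on Z^i, with coefficients in
  \<open>oL\<close>.\<close>

definition hh :: "nat \<Rightarrow> 'c fps" where "hh i = (SOME h. coeffs_in oL h \<and> Tr i = h oo e)"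

lemma hh: "coeffs_in oL (hh i)" "Tr i = hh i oo e" using someI_ex[OF Tr_descent[of i], folded hh_def] by blast+

text \<open>The constant coefficient of a translate is the torsion point itself. A contribution to
  the n-th coefficient of the i-th power uses at least i - n constant coefficients.\<close>

lemma Tr_small:
  assumes "\<mu> \<ge> 0" "\<And>z. z \<in> T1 \<Longrightarrow> cabs z \<le> \<mu>" "\<mu> < 1" shows "cabs (Tr i $ n) \<le> \<mu> ^ (i - n)"
proof -
  have "cabs ((A ^ i) $ n) \<le> \<mu> ^ (i - n)" if A: "intg A" "cabs (A $ 0) \<le> \<mu>" for A
  proof (induction i arbitrary: n)
    case 0 then show ?case by simp
  next
    case (Suc i)
    show ?case unfolding power_Suc fps_mult_nth
    proof (rule cabs_sum_le)
      fix k assume k: "k \<in> {0..n}"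
      show "cabs (A $ k * A ^ i $ (n - k)) \<le> \<mu> ^ (Suc i - n)"
      proof (cases "k = 0")
        case True
        have "cabs (A $ 0) * cabs (A ^ i $ n) \<le> \<mu> * \<mu> ^ (i - n)" using A Suc assms(1) by (intro mult_mono) auto
        also have "\<dots> \<le> \<mu> ^ (Suc i - n)" using assms(1,3) by (cases "n \<le> i") (auto simp: Suc_diff_le)
        finally show ?thesis using True by simp
      next
        case False
        then have "Suc i - n \<le> i - (n - k)" using k by auto
        then have "\<mu> ^ (i - (n - k)) \<le> \<mu> ^ (Suc i - n)" using assms by (intro power_decreasing) auto
        then have "cabs (A ^ i $ (n - k)) \<le> \<mu> ^ (Suc i - n)" using Suc[of "n - k"] by linarith
        then show ?thesis using intgD[OF A(1)] by (intro cabs_mult_le) auto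
      qed
    qed (use assms in simp)
  qed
  then show ?thesis unfolding Tr_def fps_sum_nth using assms T1_less by (intro cabs_sum_le) (auto simp: intg_translate_G translate_0)
qed

lemma T1_bound: "\<exists>\<mu>. \<mu> > 0 \<and> \<mu> < 1 \<and> (\<forall>z\<in>T1. cabs z \<le> \<mu>)"
proof -
  define \<mu> where "\<mu> = Max (insert (cabs \<pi>) (cabs ` T1))"
  have fin: "finite (insert (cabs \<pi>) (cabs ` T1))" using T1_card by simp
  have "\<mu> \<in> insert (cabs \<pi>) (cabs ` T1)" unfolding \<mu>_def using fin by (intro Max_in) auto
  then have "\<mu> < 1" using T1_less pi_lt_1 by auto
  moreover have "cabs \<pi> \<le> \<mu>" and "\<forall>z\<in>T1. cabs z \<le> \<mu>" unfolding \<mu>_def using fin by (auto intro: Max_ge)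
  moreover have "0 < \<mu>" using pi_pos \<open>cabs \<pi> \<le> \<mu>\<close> by linarith
  ultimately show ?thesis by blast
qed

lemma Tr_tendsto: "\<exists>M. \<forall>i\<ge>M. \<forall>n\<le>N. cabs (Tr i $ n) \<le> cabs \<pi> ^ R"
proof -
  obtain \<mu> where m: "\<mu> > 0" "\<mu> < 1" "\<forall>z\<in>T1. cabs z \<le> \<mu>" using T1_bound by blast
  obtain K where K: "\<forall>k\<ge>K. \<mu> ^ k < cabs \<pi> ^ R" using small_power_mono[of \<mu> "cabs \<pi> ^ R"] m pi_pos by auto
  have "cabs (Tr i $ n) \<le> cabs \<pi> ^ R" if "i \<ge> K + N" "n \<le> N" for i n
  proof -
    have "cabs (Tr i $ n) \<le> \<mu> ^ (i - n)" using Tr_small m by simp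
    also have "\<dots> < cabs \<pi> ^ R" using K that by auto
    finally show ?thesis by simp
  qed
  then show ?thesis by blast
qed

lemma e_power_nth: "cabs ((e ^ k) $ n - (if n = q * k then 1 else 0)) \<le> cabs \<pi>"
proof -
  have "cgr (e ^ k) ((fps_X ^ q) ^ k)" using e_cgr e_intg by (intro cgr_power intg_power intg_X)
  then have "cabs ((e ^ k) $ n - (if n = q * k then 1 else 0)) < 1" by (simp add: cgr_def power_mult[symmetric] fps_X_power_nth)
  moreover have "(e ^ k) $ n - (if n = q * k then 1 else 0) \<in> L"
    using coeffs_power[OF e_props(1), of k] subfld_0[OF subfld_L] subfld_1[OF subfld_L] by (auto simp: coeffs_in_def oL_iff subfld_diff[OF subfld_L])
  ultimately show ?thesis by (intro L_less_1)
qed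

text \<open>As e^j is X^(q j) modulo \<pi>, the k-th coefficient of h is the (q k)-th one of h(e) up
  to \<pi> times coefficients of h of index at most q k. Each further factor \<pi> thus costs a
  factor q in the range of degrees, which explains q^M N.\<close>

lemma compose_e_small:
  assumes h: "intg h" "e' = h oo e"
  shows "(\<forall>n\<le>q ^ M * N. cabs (e' $ n) \<le> cabs \<pi> ^ M) \<Longrightarrow> \<forall>k\<le>N. cabs (h $ k) \<le> cabs \<pi> ^ M"
proof -
  assume small: "\<forall>n\<le>q ^ M * N. cabs (e' $ n) \<le> cabs \<pi> ^ M"
  have "m \<le> M \<Longrightarrow> \<forall>k\<le>q ^ (M - m) * N. cabs (h $ k) \<le> cabs \<pi> ^ m" for m
  proof (induction m)
    case 0 then show ?case using h by (simp add: intg_def)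
  next
    case (Suc m)
    show ?case
    proof (intro allI impI)
      fix k assume k: "k \<le> q ^ (M - Suc m) * N"
      have qk: "q * k \<le> q ^ (M - m) * N"
      proof -
        have "q * k \<le> q * (q ^ (M - Suc m) * N)" using k by simp
        also have "\<dots> = q ^ (M - m) * N" using Suc.prems by (simp add: mult.assoc[symmetric] power_Suc[symmetric] Suc_diff_Suc del: power_Suc)
        finally show ?thesis .
      qed
      also have "\<dots> \<le> q ^ M * N" using q_ge_2 by (intro mult_right_mono power_increasing) auto
      finally have "cabs (e' $ (q * k)) \<le> cabs \<pi> ^ M" using small by blast
      also have "\<dots> \<le> cabs \<pi> ^ Suc m" using Suc.prems pi_lt_1 by (intro power_decreasing) auto
      finally have 1: "cabs (e' $ (q * k)) \<le> cabs \<pi> ^ Suc m" .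
      have kq: "k \<le> q * k" using q_ge_2 by simp
      have "e' $ (q * k) = (\<Sum>j=0..q * k. h $ j * (e ^ j) $ (q * k))" unfolding h(2) by (rule fps_compose_nth)
      also have "\<dots> = (\<Sum>j=0..q * k. h $ j * ((e ^ j) $ (q * k) - (if q * k = q * j then 1 else 0))) +
          (\<Sum>j=0..q * k. h $ j * (if q * k = q * j then 1 else 0))" by (simp add: sum.distrib[symmetric] algebra_simps)
      also have "(\<Sum>j=0..q * k. h $ j * (if q * k = q * j then 1 else 0)) = (\<Sum>j=0..q * k. if j = k then h $ k else 0)"
        using q_ge_2 by (intro sum.cong refl) auto
      also have "\<dots> = h $ k" using kq by simp
      finally have 2: "h $ k = e' $ (q * k) - (\<Sum>j=0..q * k. h $ j * ((e ^ j) $ (q * k) - (if q * k = q * j then 1 else 0)))" by simp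
      have "cabs (\<Sum>j=0..q * k. h $ j * ((e ^ j) $ (q * k) - (if q * k = q * j then 1 else 0))) \<le> cabs \<pi> ^ Suc m"
      proof (rule cabs_sum_le)
        fix j assume "j \<in> {0..q * k}"
        then have "j \<le> q ^ (M - m) * N" using qk by simp
        then have "cabs (h $ j) \<le> cabs \<pi> ^ m" using Suc by simp
        then have "cabs (h $ j) * cabs ((e ^ j) $ (q * k) - (if q * k = q * j then 1 else 0)) \<le> cabs \<pi> ^ m * cabs \<pi>"
          using e_power_nth by (rule mult_mono) simp_all
        then show "cabs (h $ j * ((e ^ j) $ (q * k) - (if q * k = q * j then 1 else 0))) \<le> cabs \<pi> ^ Suc m" by (simp add: mult.commute)
      qed simp
      then show "cabs (h $ k) \<le> cabs \<pi> ^ Suc m" unfolding 2 using 1 by (intro cabs_diff_le)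
    qed
  qed
  from this[of M] show ?thesis by simp
qed

lemma hh_tendsto: "\<exists>M. \<forall>i\<ge>M. \<forall>n\<le>N. cabs (hh i $ n) \<le> cabs \<pi> ^ R"
proof -
  obtain M where M: "\<forall>i\<ge>M. \<forall>n\<le>q ^ R * N. cabs (Tr i $ n) \<le> cabs \<pi> ^ R" using Tr_tendsto by blast
  have "\<forall>n\<le>N. cabs (hh i $ n) \<le> cabs \<pi> ^ R" if "i \<ge> M" for i
    by (rule compose_e_small[OF _ hh(2)]) (use M that coeffs_in_oL_intg[OF hh(1)] in auto)
  then show ?thesis by blast
qed

lemma Tr_0: "Tr i $ 0 = (\<Sum>z\<in>T1. z ^ i)" using ev_Tr[of 0 i] pl_0_right T1_less ev_near[OF Tr_intg, of 0 i] by simp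

end

section \<open>The period as a character of torsion points, and its Galois action\<close>

locale Period = LT p C L \<pi> G for p and C :: "'c::{alg_closed_field,field_char_0,complete_space} itself"
    and L :: "'c set" and \<pi> :: 'c and G :: "'c fps fps" +
  fixes \<Omega> :: 'c
  assumes period: "is_period L G \<Omega>"
begin

lemma period_set: "{h. intg h \<and> formal_hom G formal_Gm h} = {Kap (a * \<Omega>) - 1 |a. a \<in> oL}"
proof -
  have "((fps_exp \<Omega> oo formal_log G) - 1) oo formal_mult L G a = Kap (a * \<Omega>) - 1" if "a \<in> oL" for a
    using that by (simp add: formal_log_eq formal_mult_eq fps_compose_sub_distrib Kap_br flip: Kap_def)
  then have "{((fps_exp \<Omega> oo formal_log G) - 1) oo formal_mult L G a | a. a \<in> oL} = {Kap (a * \<Omega>) - 1 |a. a \<in> oL}"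
    by (intro Collect_cong) (metis (no_types, lifting))
  then show ?thesis using period by (simp add: is_period_def coeffs_in_o_Cp)
qed

lemma Kap_intg: "a \<in> oL \<Longrightarrow> intg (Kap (a * \<Omega>))"
proof -
  assume "a \<in> oL"
  then have "Kap (a * \<Omega>) - 1 \<in> {h. intg h \<and> formal_hom G formal_Gm h}" unfolding period_set by blast
  then have "intg (Kap (a * \<Omega>) - 1 + 1)" by (intro intg_add intg_1) simp
  then show ?thesis by simp
qed

lemma Kap_intg_imp: "intg (Kap c) \<Longrightarrow> \<exists>a\<in>oL. c = a * \<Omega>"
proof -
  assume "intg (Kap c)"
  then have "Kap c - 1 \<in> {h. intg h \<and> formal_hom G formal_Gm h}" using Kap_formal_hom by (simp add: intg_diff intg_1)
  then obtain a where "a \<in> oL" "Kap c - 1 = Kap (a * \<Omega>) - 1" unfolding period_set by blast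
  then show ?thesis using Kap_1 by (intro bexI[of _ a]) (metis diff_add_cancel)
qed

text \<open>The character of the points of the disc attached to the period; on torsion points its
  values are roots of unity of p-power order.\<close>

definition kap :: "'c \<Rightarrow> 'c" where "kap x = ev x (Kap \<Omega>)"

lemma Kap_Om_intg: "intg (Kap \<Omega>)" using Kap_intg[OF oL_1] by simp

lemma kap_act: "a \<in> oL \<Longrightarrow> cabs x < 1 \<Longrightarrow> kap (act a x) = ev x (Kap (a * \<Omega>))"
  unfolding kap_def act_def Kap_br[symmetric] by (intro ev_compose[symmetric] br_intg br_0 Kap_Om_intg)

lemma kap_pl:
  assumes x: "cabs x < 1" "cabs y < 1" shows "kap (pl x y) = kap x * kap y"
proof -
  obtain t :: 'c where t: "t \<noteq> 0" "cabs t < 1" "cabs x \<le> cabs t" "cabs y \<le> cabs t" using common_bound[of x y y] x by blast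
  note X = cv[OF t(1,2,3)] and Y = cv[OF t(1,2,4)]
  have "kap (pl x y) = ev t (Kap \<Omega> oo cur (cv t x) (cv t y) G)"
    unfolding kap_def using X Y t Kap_Om_intg pl_curve[of "cv t x" "cv t y" t] by (simp add: ev_compose intg_cur_G cur_G_0)
  also have "\<dots> = ev t ((Kap \<Omega> oo cv t x) * (Kap \<Omega> oo cv t y))" using X Y by (simp add: Kap_cur)
  also have "\<dots> = kap x * kap y" using X Y t Kap_Om_intg by (simp add: ev_mult ev_compose intg_compose kap_def)
  finally show ?thesis .
qed

lemma kap_0: "kap 0 = 1" using ev_near[OF Kap_Om_intg, of 0] by (simp add: kap_def Kap_0)

lemma kap_power: "cabs x < 1 \<Longrightarrow> kap (act (of_nat n) x) = kap x ^ n"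
proof (induction n)
  case (Suc n)
  have "act (of_nat (Suc n)) x = pl (act 1 x) (act (of_nat n) x)" using act_add[OF oL_1 oL_of_nat Suc.prems] by simp
  then show ?case using Suc act_less[OF oL_of_nat Suc.prems] by (simp add: act_1 kap_pl)
qed (simp add: act_0 kap_0)

text \<open>If the character is trivial on \<open>T1\<close>, then \<open>Kap \<Omega>\<close> is
  invariant under translation and descends along \<open>[\<pi>]\<close>. So exp((\<Omega>/\<pi>)
  log) is integral, and \<Omega>/\<pi> would be an integral multiple of \<Omega>.\<close>

lemma kap_translate_trivial:
  assumes triv: "\<And>z. z \<in> T1 \<Longrightarrow> kap z = 1" shows "\<Omega> = 0"
proof (rule ccontr)
  assume O: "\<Omega> \<noteq> 0"
  have "\<exists>H. coeffs_in o_Cp H \<and> Kap \<Omega> = H oo e"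
  proof (rule descent[OF cring_o_Cp pi_small])
    show "\<exists>k\<in>o_Cp. e $ n - (if n = q then 1 else 0) = \<pi> * k" for n using e_cond_oL oL_o_Cp by blast
    show "coeffs_in o_Cp (Kap \<Omega>)" using Kap_Om_intg by (simp add: coeffs_in_o_Cp)
    show "ev (pl z x) (Kap \<Omega>) = ev x (Kap \<Omega>)" if "z \<in> T1" "cabs x < 1" for z x
      using kap_pl[OF T1_less that(2)] that triv by (simp add: kap_def)
  qed
  then obtain H where H: "intg H" "Kap \<Omega> = H oo br \<pi>" unfolding coeffs_in_o_Cp e_br by blast
  have "Kap ((1 / \<pi>) * \<Omega>) = H oo (br \<pi> oo br (1 / \<pi>))"
    unfolding Kap_br[symmetric] H(2) by (rule fps_compose_assoc[symmetric]) (simp_all add: br_0)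
  also have "br \<pi> oo br (1 / \<pi>) = fps_X" using pi_nz by (simp add: br_compose br_one)
  finally have "intg (Kap ((1 / \<pi>) * \<Omega>))" using H(1) by simp
  then obtain a where a: "a \<in> oL" "(1 / \<pi>) * \<Omega> = a * \<Omega>" using Kap_intg_imp by blast
  then have "1 = a * \<pi>" using O pi_nz by (simp add: field_simps)
  then have "1 = cabs a * cabs \<pi>" by (metis cabs_1 cabs_mult)
  also have "\<dots> \<le> 1 * cabs \<pi>" using a by (intro mult_right_mono) (auto simp: oL_iff)
  finally show False using pi_lt_1 by simp
qed

lemma lg_L: "lg $ n \<in> L"
proof (induction n rule: less_induct)
  case (less n)
  show ?case
  proof (cases "n \<le> 1")
    case True
    then show ?thesis by (simp add: lg_def solve_rec.simps subfld_of_nat[OF subfld_L])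
  next
    case False
    have "lg $ n = (\<Sum>k\<in>{..<n}. lg $ k * e ^ k $ n) / (\<pi> - \<pi> ^ n)"
      unfolding lg_def fps_nth_Abs_fps using False by (subst solve_rec.simps) simp
    moreover have "e ^ k $ n \<in> L" for k using coeffs_power[OF e_props(1), of k] by (simp add: coeffs_in_def oL_iff)
    ultimately show ?thesis using less pi_L by (simp only:) (intro subfld_intros subfld_L; simp)
  qed
qed

lemma lg_power_L: "(lg ^ k) $ n \<in> L"
proof (induction k arbitrary: n)
  case (Suc k)
  then show ?case unfolding power_Suc fps_mult_nth by (intro subfld_sum[OF subfld_L] subfld_mult[OF subfld_L] lg_L)
qed (simp add: subfld_0[OF subfld_L] subfld_1[OF subfld_L])

lemma GL_Kap:
  assumes s: "\<sigma> \<in> GL" shows "\<sigma> (Kap c $ n) = Kap (\<sigma> c) $ n"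
proof -
  have "\<sigma> (fact i) = fact i" for i :: nat
    using GL_fix[OF s, of "of_nat (fact i)"] subfld_of_nat[OF subfld_L, of "fact i"] by (simp only: of_nat_fact)
  then show ?thesis unfolding Kap_def fps_compose_nth
    using GL_fix[OF s lg_power_L] by (simp add: GL_sum[OF s] GL_mult[OF s] GL_divide[OF s] GL_power[OF s])
qed

text \<open>The coefficients of the character are polynomials over L in \<Omega>. Hence \<sigma>
  carries the integral character of \<Omega> to that of \<sigma>(\<Omega>), which is again
  integral.\<close>

lemma sigma_Omega_ex: assumes s: "\<sigma> \<in> GL" shows "\<exists>a\<in>oL. \<sigma> \<Omega> = a * \<Omega>"
proof (rule Kap_intg_imp)
  show "intg (Kap (\<sigma> \<Omega>))" unfolding intg_def GL_Kap[OF s, symmetric] GL_cabs[OF s] using intgD[OF Kap_Om_intg] by blast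
qed

text \<open>Let \<sigma>(\<Omega>) = a \<Omega>, and let X and Y be the cyclotomic and Lubin-Tate
  characters of \<sigma>. At a torsion point x, \<sigma>(kap x) is kap(\<open>[X]\<close> x) because
  kap x is a root of unity, and kap(\<open>[a Y]\<close> x) by transport of coefficients and
  argument. So kap is trivial on all \<open>[b]\<close> x with b = X - a Y; if b were nonzero, these
  points would include \<open>T1\<close>.\<close>

theorem sigma_Omega:
  assumes s: "\<sigma> \<in> GL" shows "\<sigma> \<Omega> = tau p L \<pi> G \<sigma> * \<Omega>"
proof (cases "\<Omega> = 0")
  case True then show ?thesis using GL_0[OF s] by simp
next
  case False
  obtain a where a: "a \<in> oL" "\<sigma> \<Omega> = a * \<Omega>" using sigma_Omega_ex[OF s] by blast
  define X where "X = chi_cyc p \<sigma>"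
  define Y where "Y = chi_LT L \<pi> G \<sigma>"
  have X: "X \<in> oL" using chi_cyc_spec[OF s] Zp_oL by (auto simp: X_def)
  have Y: "Y \<in> L" "cabs Y = 1" "Y \<in> oL" using chi_LT_spec(1)[OF s] by (auto simp: Y_def o_units_def oL_iff)
  define b where "b = X - a * Y"
  have b: "b \<in> oL" unfolding b_def using X a Y by (intro oL_diff oL_mult)
  have triv: "kap (act b x) = 1" if x: "cabs x < 1" "act (\<pi> ^ n) x = 0" for x n
  proof -
    \<comment> \<open>This power of p is divisible by \<pi>^n, so it kills x, and X may be replaced
      by an integer that agrees with it to this precision.\<close>
    obtain M where M: "cabs (of_nat p :: 'c) ^ M < cabs \<pi> ^ n" using small_power[OF cabs_p_less_1, of "cabs \<pi> ^ n"] pi_pos by auto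
    have kill: "act c x = 0" if c: "c \<in> oL" "cabs c \<le> cabs \<pi> ^ n" for c
    proof -
      obtain y where y: "y \<in> oL" "c = \<pi> ^ n * y" using L_dvd_power[of c n] c by (auto simp: oL_iff)
      then show ?thesis using act_act[OF y(1) oL_power[OF pi_oL] x(1), of n] x(2) act_at_0[OF y(1)] by (simp add: mult.commute)
    qed
    have "cabs (of_nat (p ^ M) :: 'c) \<le> cabs \<pi> ^ n" using M by simp
    then have "kap x ^ (p ^ M) = 1" using kap_power[OF x(1), of "p ^ M"] kill[OF oL_of_nat, of "p ^ M"] by (simp add: kap_0)
    obtain k where k: "cabs (X - of_nat k) \<le> 1 / real p ^ M" using Zp_approx[of "chi_cyc p \<sigma>" M] chi_cyc_spec[OF s] unfolding X_def by blast
    have Xk: "act X x = act (of_nat k) x"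
    proof -
      have "cabs (X - of_nat k) \<le> cabs \<pi> ^ n" using k M by (simp add: cabs_p power_one_over)
      then have "act (X - of_nat k) x = 0" using X by (intro kill oL_diff oL_of_nat)
      then show ?thesis using act_diff_zero X oL_of_nat x by blast
    qed
    have "\<sigma> (kap x) = kap x ^ k" using chi_cyc_spec[OF s] \<open>kap x ^ (p ^ M) = 1\<close> k unfolding X_def by blast
    also have "\<dots> = kap (act X x)" using kap_power[OF x(1)] Xk by simp
    finally have 1: "\<sigma> (kap x) = kap (act X x)" .
    have "\<sigma> (kap x) = ev (\<sigma> x) (Abs_fps (\<lambda>n. \<sigma> (Kap \<Omega> $ n)))" unfolding kap_def by (rule GL_ev[OF s Kap_Om_intg x(1)])
    also have "Abs_fps (\<lambda>n. \<sigma> (Kap \<Omega> $ n)) = Kap (a * \<Omega>)" by (rule fps_ext) (simp add: GL_Kap[OF s] a)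
    also have "\<sigma> x = act Y x" using chi_LT_spec(2)[OF s x] by (simp add: Y_def)
    also have "ev (act Y x) (Kap (a * \<Omega>)) = kap (act (a * Y) x)"
      using kap_act[OF a(1) act_less[OF Y(3) x(1)]] act_act[OF a(1) Y(3) x(1)] by simp
    finally have 2: "kap (act X x) = kap (act (a * Y) x)" using 1 by simp
    have aY: "a * Y \<in> oL" using a Y oL_mult by blast
    have "pl (act b x) (act (a * Y) x) = act X x" using act_add[OF b aY x(1)] by (simp add: b_def)
    then have "kap (act X x) = kap (act b x) * kap (act (a * Y) x)" using kap_pl[OF act_less[OF b x(1)] act_less[OF aY x(1)]] by simp
    moreover have "kap (act (a * Y) x) \<noteq> 0"
    proof
      assume "kap (act (a * Y) x) = 0"
      then have "kap (act X x) = 0" using 2 by simp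
      then have "kap x ^ k = 0" using \<open>\<sigma> (kap x) = kap x ^ k\<close> 1 by simp
      then have "kap x = 0" by simp
      then show False using \<open>kap x ^ (p ^ M) = 1\<close> p_gt_1 by (simp add: power_0_left)
    qed
    ultimately show ?thesis using 2 by simp
  qed
  have "b = 0"
  proof (rule ccontr)
    assume "b \<noteq> 0"
    then obtain k v where v: "v \<in> L" "cabs v = 1" "b = \<pi> ^ k * v" using oL_factor b by blast
    obtain z where z: "tors_tower z" using ex_tors_tower by blast
    have po: "\<pi> ^ m \<in> oL" for m by (rule oL_power[OF pi_oL])
    have vi: "inverse v \<in> oL" "v \<noteq> 0" using oL_inverse v by auto
    have "kap y = 1" if y: "y \<in> T1" for y
    proof -
      obtain d where d: "d \<in> oL" "y = act d (z 0)" using T1_gen[OF z y] by blast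
      have dv: "d * inverse v \<in> oL" using d vi oL_mult by blast
      \<comment> \<open>For b = \<pi>^k v this is a preimage of y under \<open>[b]\<close>: the
        inverse of v cancels the unit, and \<open>\<pi> ^ k\<close> leads from \<open>z k\<close>
        down to \<open>z 0\<close>.\<close>
      define x where "x = act (d * inverse v) (z k)"
      have x: "cabs x < 1" unfolding x_def using act_less[OF dv tz[OF z]] .
      have "act b x = act (b * (d * inverse v)) (z k)" unfolding x_def using act_act[OF b dv tz[OF z]] .
      also have "b * (d * inverse v) = d * \<pi> ^ k" using v vi by simp
      also have "act (d * \<pi> ^ k) (z k) = act d (act (\<pi> ^ k) (z (0 + k)))" using act_act[OF d(1) po tz[OF z]] by simp
      also have "\<dots> = y" using tz_down[OF z, of k 0] d by simp
      finally have "act b x = y" .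
      moreover have "act (\<pi> ^ Suc k) x = 0"
      proof -
        have "act (\<pi> ^ Suc k) (z k) = 0" using tz_kernel[OF z po, of "Suc k" k] by simp
        then show ?thesis unfolding x_def
          using act_act[OF po[of "Suc k"] dv tz[OF z], of k] act_act[OF dv po[of "Suc k"] tz[OF z], of k] act_at_0[OF dv] by (simp only: mult.commute)
      qed
      ultimately show ?thesis using triv[OF x] by blast
    qed
    then show False using kap_translate_trivial False by blast
  qed
  then have "X = a * Y" by (simp add: b_def)
  then have "a = X * inverse Y" using Y by (metis cabs_0 mult.assoc mult.right_neutral right_inverse zero_neq_one)
  then show ?thesis unfolding a(2) tau_def X_def Y_def by simp
qed

end

section \<open>The operators on power series over the coefficient ring\<close>

lemma cmul_nth: "(fps_const c * F) $ n = c * (F $ n :: 'a::comm_ring)"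
proof -
  have "(fps_const c * F) $ n = (\<Sum>i=0..n. (if i = 0 then c else 0) * F $ (n - i))" by (simp add: fps_mult_nth)
  also have "\<dots> = (\<Sum>i\<in>{0}. (if i = 0 then c else 0) * F $ (n - i))" by (intro sum.mono_neutral_right) auto
  finally show ?thesis by simp
qed

locale Coef = Period p C L \<pi> G \<Omega> for p and C :: "'c::{alg_closed_field,field_char_0,complete_space} itself"
    and L :: "'c set" and \<pi> :: 'c and G :: "'c fps fps" and \<Omega> :: 'c +
  fixes \<iota> :: "'c \<Rightarrow> 's::comm_ring"
  assumes oalg: "o_algebra L \<iota>" and complete: "adically_complete \<iota> \<pi>"
begin

lemma io_add: "x \<in> oL \<Longrightarrow> y \<in> oL \<Longrightarrow> \<iota> (x + y) = \<iota> x + \<iota> y"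
  and io_mult: "x \<in> oL \<Longrightarrow> y \<in> oL \<Longrightarrow> \<iota> (x * y) = \<iota> x * \<iota> y"
  and io_1: "\<iota> 1 * s = s" using oalg by (auto simp: o_algebra_def)

lemma io_0: "\<iota> 0 = 0" using io_add[OF oL_0 oL_0] by simp

lemma io_minus: "x \<in> oL \<Longrightarrow> \<iota> (- x) = - \<iota> x"
  using io_add[of x "- x"] oL_minus[of x] by (simp add: io_0 eq_neg_iff_add_eq_0 add.commute)

lemma io_diff: "x \<in> oL \<Longrightarrow> y \<in> oL \<Longrightarrow> \<iota> (x - y) = \<iota> x - \<iota> y"
  using io_add[of x "- y"] oL_minus[of y] by (simp add: io_minus)

lemma io_sum: "(\<And>i. i \<in> A \<Longrightarrow> f i \<in> oL) \<Longrightarrow> \<iota> (sum f A) = (\<Sum>i\<in>A. \<iota> (f i))"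
  by (induction A rule: infinite_finite_induct) (auto simp: io_0 io_add oL_sum)

section \<open>Congruences, limits and series in the complete algebra S\<close>

abbreviation "asum \<equiv> adic_suminf \<iota> \<pi>"
abbreviation "lrel \<equiv> loc_rel L \<iota>"
abbreviation cong :: "nat \<Rightarrow> 's \<Rightarrow> 's \<Rightarrow> bool" where "cong n s t \<equiv> adic_cong \<iota> \<pi> n s t"

lemma cong_refl: "cong n s s" unfolding adic_cong_def by (rule exI[of _ 0]) simp

lemma cong_add: "cong n s t \<Longrightarrow> cong n s' t' \<Longrightarrow> cong n (s + s') (t + t')"
proof -
  assume "cong n s t" "cong n s' t'"
  then obtain r r' where "s - t = \<iota> (\<pi> ^ n) * r" "s' - t' = \<iota> (\<pi> ^ n) * r'" by (auto simp: adic_cong_def)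
  then have "(s + s') - (t + t') = \<iota> (\<pi> ^ n) * (r + r')" by (simp add: distrib_left algebra_simps)
  then show ?thesis unfolding adic_cong_def by blast
qed

lemma cong_mult: "cong n s t \<Longrightarrow> cong n (a * s) (a * t)"
proof -
  assume "cong n s t"
  then obtain r where "s - t = \<iota> (\<pi> ^ n) * r" by (auto simp: adic_cong_def)
  then have "a * s - a * t = \<iota> (\<pi> ^ n) * (a * r)" by (simp add: right_diff_distrib[symmetric] mult.left_commute)
  then show ?thesis unfolding adic_cong_def by blast
qed

lemma cong_minus: "cong n s t \<Longrightarrow> cong n (- s) (- t)"
proof -
  assume "cong n s t"
  then obtain r where "s - t = \<iota> (\<pi> ^ n) * r" by (auto simp: adic_cong_def)
  moreover have "- s - (- t) = - (s - t)" by simp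
  ultimately have "- s - (- t) = \<iota> (\<pi> ^ n) * (- r)" by (simp only: mult_minus_right)
  then show ?thesis unfolding adic_cong_def by blast
qed

lemma cong_diff: "cong n s t \<Longrightarrow> cong n s' t' \<Longrightarrow> cong n (s - s') (t - t')"
  using cong_add[of n s t "- s'" "- t'"] cong_minus[of n s' t'] by simp

lemma cong_iff_diff: "cong n s t \<longleftrightarrow> cong n (s - t) 0" by (simp add: adic_cong_def)

lemma cong_sym: "cong n s t \<Longrightarrow> cong n t s" using cong_minus[of n "s - t" 0] cong_iff_diff[of n s t] cong_iff_diff[of n t s] by simp

lemma cong_trans [trans]: "cong n s t \<Longrightarrow> cong n t u \<Longrightarrow> cong n s u"
  using cong_add[of n "s - t" 0 "t - u" 0] cong_iff_diff[of n s t] cong_iff_diff[of n t u] cong_iff_diff[of n s u] by simp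

lemma cong_sum: "(\<And>i. i \<in> A \<Longrightarrow> cong n (f i) (g i)) \<Longrightarrow> cong n (sum f A) (sum g A)"
  by (induction A rule: infinite_finite_induct) (auto simp: cong_refl cong_add)

lemma cong_mono: assumes "m \<le> n" "cong n s t" shows "cong m s t"
proof -
  obtain r where "s - t = \<iota> (\<pi> ^ n) * r" using assms(2) by (auto simp: adic_cong_def)
  moreover have "\<iota> (\<pi> ^ n) = \<iota> (\<pi> ^ m) * \<iota> (\<pi> ^ (n - m))"
    using io_mult[OF oL_power[OF pi_oL, of m] oL_power[OF pi_oL, of "n - m"]] assms(1) by (simp add: power_add[symmetric])
  ultimately have "s - t = \<iota> (\<pi> ^ m) * (\<iota> (\<pi> ^ (n - m)) * r)" by (simp add: mult.assoc)
  then show ?thesis unfolding adic_cong_def by blast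
qed

lemma cong_0: "cong 0 s t" unfolding adic_cong_def by (intro exI[of _ "s - t"]) (simp add: io_1)

lemma io_small: "a \<in> oL \<Longrightarrow> cabs a \<le> cabs \<pi> ^ n \<Longrightarrow> cong n (\<iota> a * s) 0"
proof -
  assume a: "a \<in> oL" "cabs a \<le> cabs \<pi> ^ n"
  then obtain y where y: "y \<in> oL" "a = \<pi> ^ n * y" using L_dvd_power[of a n] by (auto simp: oL_iff)
  then have "\<iota> a * s - 0 = \<iota> (\<pi> ^ n) * (\<iota> y * s)" using io_mult[OF oL_power[OF pi_oL, of n] y(1)] by (simp add: mult.assoc)
  then show ?thesis unfolding adic_cong_def by blast
qed

lemma io_close: "a \<in> oL \<Longrightarrow> b \<in> oL \<Longrightarrow> cabs (a - b) \<le> cabs \<pi> ^ n \<Longrightarrow> cong n (\<iota> a * s) (\<iota> b * s)"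
  using io_small[of "a - b" n s] oL_diff[of a b] io_diff[of a b] cong_iff_diff[of n "\<iota> a * s" "\<iota> b * s"] by (simp add: left_diff_distrib)

lemma cong_all: "(\<And>n. cong n s t) \<Longrightarrow> s = t"
proof -
  assume "\<And>n. cong n s t"
  then have "\<forall>n. cong n (s - t) 0" using cong_iff_diff by blast
  then have "s - t = 0" using complete[unfolded adically_complete_def, THEN conjunct1, rule_format, of "s - t"] by blast
  then show ?thesis by simp
qed

definition adlim :: "(nat \<Rightarrow> 's) \<Rightarrow> 's \<Rightarrow> bool" where
  "adlim X l \<longleftrightarrow> (\<forall>n. \<exists>M. \<forall>m\<ge>M. cong n (X m) l)"

lemma adlim_unique: "adlim X l \<Longrightarrow> adlim X l' \<Longrightarrow> l = l'"
proof (rule cong_all)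
  fix n assume "adlim X l" "adlim X l'"
  then obtain M M' where "\<forall>m\<ge>M. cong n (X m) l" "\<forall>m\<ge>M'. cong n (X m) l'" unfolding adlim_def by meson
  then have "cong n (X (max M M')) l" "cong n (X (max M M')) l'" by auto
  then show "cong n l l'" using cong_sym cong_trans by blast
qed

text \<open>Completeness is assumed only for sequences whose n-th step is divisible by \<pi>^n, so a
  subsequence of that kind is extracted. Its indices \<open>M n\<close> are partial sums of the
  thresholds, hence monotone and at least as large as each threshold.\<close>

lemma adlim_exists:
  assumes X: "\<And>n. \<exists>M. \<forall>m\<ge>M. cong n (X (Suc m)) (X m)" shows "\<exists>l. adlim X l"
proof -
  have "\<forall>n. \<exists>M. \<forall>m\<ge>M. cong n (X (Suc m)) (X m)" using X by blast
  then obtain K where K: "\<forall>n. \<forall>m\<ge>K n. cong n (X (Suc m)) (X m)" by (rule choice[THEN exE])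
  define M where "M n = (\<Sum>i\<le>n. K i)" for n
  have MK: "K n \<le> M n" for n unfolding M_def by (rule member_le_sum) auto
  have Mm: "M n \<le> M (Suc n)" for n by (simp add: M_def)
  have same: "cong n (X m) (X (M n))" if "m \<ge> M n" for n m using that
  proof (induction m rule: dec_induct)
    case (step m)
    have "cong n (X (Suc m)) (X m)" using K MK[of n] step by (meson order_trans)
    then show ?case using step.IH cong_trans by blast
  qed (rule cong_refl)
  have "\<forall>n. cong n (X (M (Suc n))) (X (M n))" using same Mm by blast
  then obtain l where l: "\<forall>n. cong n l (X (M n))" using complete[unfolded adically_complete_def, THEN conjunct2, rule_format, of "\<lambda>n. X (M n)"] by blast
  have "adlim X l" unfolding adlim_def
  proof
    fix n show "\<exists>M. \<forall>m\<ge>M. cong n (X m) l" using same[of n] l cong_sym cong_trans by blast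
  qed
  then show ?thesis by blast
qed

lemma adlim_add: "adlim X l \<Longrightarrow> adlim Y k \<Longrightarrow> adlim (\<lambda>m. X m + Y m) (l + k)" unfolding adlim_def
proof
  fix n assume "\<forall>n. \<exists>M. \<forall>m\<ge>M. cong n (X m) l" "\<forall>n. \<exists>M. \<forall>m\<ge>M. cong n (Y m) k"
  then obtain M M' where "\<forall>m\<ge>M. cong n (X m) l" "\<forall>m\<ge>M'. cong n (Y m) k" by meson
  then have "\<forall>m\<ge>max M M'. cong n (X m + Y m) (l + k)" by (auto intro: cong_add)
  then show "\<exists>M. \<forall>m\<ge>M. cong n (X m + Y m) (l + k)" by blast
qed

lemma adlim_mult: "adlim X l \<Longrightarrow> adlim (\<lambda>m. a * X m) (a * l)" unfolding adlim_def using cong_mult by blast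

lemma adlim_const: "adlim (\<lambda>_. l) l" unfolding adlim_def using cong_refl by blast

lemma adic_suminf_eq: "adlim (\<lambda>m. \<Sum>i<m. u i) l \<Longrightarrow> asum u = l"
  unfolding adic_suminf_def adlim_def[symmetric] using adlim_unique by blast

definition adnull :: "(nat \<Rightarrow> 's) \<Rightarrow> bool" where
  "adnull u \<longleftrightarrow> (\<forall>n. \<exists>M. \<forall>i\<ge>M. cong n (u i) 0)"

lemma adlim_suminf: assumes "adnull u" shows "adlim (\<lambda>m. \<Sum>i<m. u i) (asum u)"
proof -
  have "\<exists>l. adlim (\<lambda>m. \<Sum>i<m. u i) l"
  proof (rule adlim_exists)
    fix n
    obtain M where "\<forall>i\<ge>M. cong n (u i) 0" using assms unfolding adnull_def by blast
    then have "\<forall>m\<ge>M. cong n (\<Sum>i<Suc m. u i) (\<Sum>i<m. u i)" using cong_add[OF cong_refl, of n _ 0] by fastforce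
    then show "\<exists>M. \<forall>m\<ge>M. cong n (\<Sum>i<Suc m. u i) (\<Sum>i<m. u i)" by blast
  qed
  then show ?thesis using adic_suminf_eq by blast
qed

lemma adic_suminf_trunc:
  assumes u: "adnull u" and M: "\<And>i. i \<ge> M \<Longrightarrow> cong n (u i) 0"
  shows "cong n (asum u) (\<Sum>i<M. u i)"
proof -
  obtain K where K: "\<forall>m\<ge>K. cong n (\<Sum>i<m. u i) (asum u)" using adlim_suminf[OF u] unfolding adlim_def by blast
  have "cong n (\<Sum>i<m. u i) (\<Sum>i<M. u i)" if "m \<ge> M" for m using that
  proof (induction m rule: dec_induct)
    case (step m)
    then have "cong n ((\<Sum>i<m. u i) + u m) ((\<Sum>i<M. u i) + 0)" using M by (intro cong_add) auto
    then show ?case by simp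
  qed (rule cong_refl)
  then have "cong n (\<Sum>i<max K M. u i) (\<Sum>i<M. u i)" by simp
  moreover have "cong n (\<Sum>i<max K M. u i) (asum u)" using K by simp
  ultimately show ?thesis using cong_sym cong_trans by blast
qed

section \<open>Injectivity of \<open>phi\<close> and construction of \<open>psi_Col\<close>\<close>

definition ph :: "'s fps \<Rightarrow> 's fps" where "ph = phi L \<pi> G \<iota>"

lemma ph_nth: "ph F $ n = (\<Sum>i\<le>n. \<iota> ((e ^ i) $ n) * F $ i)" by (simp add: ph_def phi_def formal_mult_eq[OF pi_oL] e_br)

lemma e_pow_oL: "(e ^ i) $ n \<in> oL" using coeffs_power[OF e_props(1)] by (simp add: coeffs_in_def)

lemma hh_oL: "hh i $ n \<in> oL" using hh(1) by (simp add: coeffs_in_def)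

lemma Tr_nth_oL: "Tr i $ n \<in> oL" using Tr_oL by (simp add: coeffs_in_def)

lemma e_pow_0: "n < i \<Longrightarrow> (e ^ i) $ n = 0" using e_0 by (simp add: startsby_zero_power_prefix)

lemma ph_nth_extend: "n < M \<Longrightarrow> ph F $ n = (\<Sum>i<M. \<iota> ((e ^ i) $ n) * F $ i)"
  unfolding ph_nth by (intro sum.mono_neutral_left) (auto simp: e_pow_0 io_0)

lemma ph_diff: "ph (F - H) = ph F - ph H" by (rule fps_ext) (simp add: ph_nth right_diff_distrib sum_subtractf)

lemma ph_cmul: "ph (fps_const s * F) = fps_const s * ph F" by (rule fps_ext) (simp add: ph_nth cmul_nth sum_distrib_left mult.left_commute)

text \<open>Modulo \<pi> the map sends F(Z) to F(Z^q). So the (q k)-th coefficient of the image is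
  the k-th one of F up to \<pi> times coefficients of F, and by induction these are divisible by
  every power of \<pi>.\<close>

lemma ph_inj0: assumes "ph F = 0" shows "F = 0"
proof -
  have "\<forall>k. cong M (F $ k) 0" for M
  proof (induction M)
    case 0 then show ?case by (simp add: cong_0)
  next
    case (Suc M)
    show ?case
    proof
      fix k
      have kq: "k \<le> q * k" using q_ge_2 by simp
      have "0 = (\<Sum>j\<le>q * k. \<iota> ((e ^ j) $ (q * k)) * F $ j)" using ph_nth[of F "q * k"] assms by simp
      also have "cong (Suc M) \<dots> (\<Sum>j\<le>q * k. if j = k then F $ k else 0)"
      proof (rule cong_sum)
        fix j
        define d where "d = (e ^ j) $ (q * k) - (if q * k = q * j then 1 else 0)"
        have dL: "d \<in> oL" unfolding d_def using e_pow_oL oL_0 oL_1 by (auto intro: oL_diff)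
        have "cabs d \<le> cabs \<pi> ^ 1" unfolding d_def using e_power_nth[of j "q * k"] by simp
        then obtain y where y: "y \<in> oL" "d = \<pi> * y" using L_dvd_power[of d 1] dL by (auto simp: oL_iff)
        obtain r where r: "F $ j - 0 = \<iota> (\<pi> ^ M) * r" using Suc unfolding adic_cong_def by blast
        have "\<iota> d * F $ j = \<iota> (\<pi> ^ Suc M) * (\<iota> y * r)"
          using r io_mult[OF pi_oL y(1)] io_mult[OF pi_oL oL_power[OF pi_oL, of M]] by (simp add: y(2) mult_ac)
        then have c: "cong (Suc M) (\<iota> d * F $ j) 0" unfolding adic_cong_def by auto
        have "(e ^ j) $ (q * k) = d + (if q * k = q * j then 1 else 0)" by (simp add: d_def)
        then have "\<iota> ((e ^ j) $ (q * k)) * F $ j = \<iota> d * F $ j + (if j = k then F $ k else 0)"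
          using io_add[OF dL oL_1] q_ge_2 by (auto simp: distrib_right io_1)
        then show "cong (Suc M) (\<iota> ((e ^ j) $ (q * k)) * F $ j) (if j = k then F $ k else 0)"
          using cong_add[OF c cong_refl[of "Suc M" "if j = k then F $ k else 0"]] by simp
      qed
      finally have "cong (Suc M) 0 (F $ k)" using kq by simp
      then show "cong (Suc M) (F $ k) 0" by (rule cong_sym)
    qed
  qed
  then have "F $ k = 0" for k using cong_all by blast
  then show ?thesis by (simp add: fps_eq_iff)
qed

lemma ph_inj: "ph F = ph H \<Longrightarrow> F = H" using ph_inj0[of "F - H"] by (simp add: ph_diff)

lemma adnull_hh: "adnull (\<lambda>i. \<iota> (hh i $ n) * F i)" unfolding adnull_def
proof
  fix R
  obtain M where "\<forall>i\<ge>M. \<forall>n'\<le>n. cabs (hh i $ n') \<le> cabs \<pi> ^ R" using hh_tendsto by blast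
  then show "\<exists>M. \<forall>i\<ge>M. cong R (\<iota> (hh i $ n) * F i) 0" using io_small[OF hh_oL] by blast
qed

lemma adnull_Tr: "adnull (\<lambda>i. \<iota> (Tr i $ n) * F i)" unfolding adnull_def
proof
  fix R
  obtain M where "\<forall>i\<ge>M. \<forall>n'\<le>n. cabs (Tr i $ n') \<le> cabs \<pi> ^ R" using Tr_tendsto by blast
  then show "\<exists>M. \<forall>i\<ge>M. cong R (\<iota> (Tr i $ n) * F i) 0" using io_small[OF Tr_nth_oL] by blast
qed

text \<open>The extension of Z^i -> \<open>hh i\<close> to infinite sums, which converge by
  \<open>hh_tendsto\<close>.\<close>

definition PS :: "'s fps \<Rightarrow> 's fps" where
  "PS F = Abs_fps (\<lambda>n. asum (\<lambda>i. \<iota> (hh i $ n) * F $ i))"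

lemma PS_nth: "PS F $ n = asum (\<lambda>i. \<iota> (hh i $ n) * F $ i)" by (simp add: PS_def)

lemma TT_nth: "torsion_trace L \<pi> G \<iota> F $ n = asum (\<lambda>i. \<iota> (Tr i $ n) * F $ i)" by (simp add: torsion_trace_def Tr_def)

lemma PS_add: "PS (F + H) = PS F + PS H"
proof (rule fps_ext)
  fix n
  have "adlim (\<lambda>m. (\<Sum>i<m. \<iota> (hh i $ n) * F $ i) + (\<Sum>i<m. \<iota> (hh i $ n) * H $ i)) (PS F $ n + PS H $ n)"
    unfolding PS_nth by (intro adlim_add adlim_suminf adnull_hh)
  then show "PS (F + H) $ n = (PS F + PS H) $ n" unfolding PS_nth[of "F + H"] by (intro adic_suminf_eq) (simp add: distrib_left sum.distrib)
qed

lemma PS_cmul: "PS (fps_const s * F) = fps_const s * PS F"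
proof (rule fps_ext)
  fix n
  have "adlim (\<lambda>m. s * (\<Sum>i<m. \<iota> (hh i $ n) * F $ i)) (s * PS F $ n)" unfolding PS_nth by (intro adlim_mult adlim_suminf adnull_hh)
  then show "PS (fps_const s * F) $ n = (fps_const s * PS F) $ n" unfolding PS_nth[of "fps_const s * F"] cmul_nth
    by (intro adic_suminf_eq) (simp add: sum_distrib_left mult.left_commute)
qed

text \<open>Modulo \<pi>^R only finitely many i matter, and for these the claim is the interchange
  of two finite sums together with the defining equation of \<open>hh\<close>.\<close>

lemma ph_PS: "ph (PS F) = torsion_trace L \<pi> G \<iota> F"
proof (rule fps_ext)
  fix n
  show "ph (PS F) $ n = torsion_trace L \<pi> G \<iota> F $ n"
  proof (rule cong_all)
    fix R
    obtain M1 where M1: "\<forall>i\<ge>M1. \<forall>k\<le>n. cabs (hh i $ k) \<le> cabs \<pi> ^ R" using hh_tendsto by blast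
    obtain M2 where M2: "\<forall>i\<ge>M2. \<forall>k\<le>n. cabs (Tr i $ k) \<le> cabs \<pi> ^ R" using Tr_tendsto by blast
    define M where "M = max M1 M2"
    have 1: "cong R (PS F $ k) (\<Sum>i<M. \<iota> (hh i $ k) * F $ i)" if "k \<le> n" for k
      unfolding PS_nth using M1 that by (intro adic_suminf_trunc adnull_hh io_small hh_oL) (simp add: M_def)
    have 2: "cong R (torsion_trace L \<pi> G \<iota> F $ n) (\<Sum>i<M. \<iota> (Tr i $ n) * F $ i)"
      unfolding TT_nth using M2 by (intro adic_suminf_trunc adnull_Tr io_small Tr_nth_oL) (simp add: M_def)
    have "cong R (ph (PS F) $ n) (\<Sum>k\<le>n. \<iota> ((e ^ k) $ n) * (\<Sum>i<M. \<iota> (hh i $ k) * F $ i))"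
      unfolding ph_nth using 1 by (intro cong_sum cong_mult) simp
    also have "(\<Sum>k\<le>n. \<iota> ((e ^ k) $ n) * (\<Sum>i<M. \<iota> (hh i $ k) * F $ i)) = (\<Sum>i<M. \<iota> (Tr i $ n) * F $ i)"
    proof -
      have "\<iota> (Tr i $ n) = (\<Sum>k\<le>n. \<iota> (hh i $ k) * \<iota> ((e ^ k) $ n))" for i
      proof -
        have "Tr i $ n = (\<Sum>k\<le>n. hh i $ k * (e ^ k) $ n)" by (subst hh(2)) (simp add: fps_compose_nth atLeast0AtMost)
        then show ?thesis using io_sum[of "{..n}" "\<lambda>k. hh i $ k * (e ^ k) $ n"] io_mult[OF hh_oL e_pow_oL] oL_mult[OF hh_oL e_pow_oL] by simp
      qed
      then show ?thesis by (simp add: sum_distrib_left sum_distrib_right mult_ac sum.swap[of _ "{..n}"])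
    qed
    finally show "cong R (ph (PS F) $ n) (torsion_trace L \<pi> G \<iota> F $ n)" using 2 cong_sym cong_trans by blast
  qed
qed

lemma psi_Col_eq: "psi_Col L \<pi> G \<iota> = PS" unfolding psi_Col_def
proof (rule the_equality)
  show "S_linear PS \<and> (\<forall>F. phi L \<pi> G \<iota> (PS F) = torsion_trace L \<pi> G \<iota> F)"
    using ph_PS PS_add PS_cmul by (simp add: S_linear_def ph_def)
  fix \<psi> assume "S_linear \<psi> \<and> (\<forall>F. phi L \<pi> G \<iota> (\<psi> F) = torsion_trace L \<pi> G \<iota> F)"
  then have "ph (\<psi> F) = ph (PS F)" for F using ph_PS by (simp add: ph_def)
  then show "\<psi> = PS" using ph_inj by blast
qed

text \<open>In the limit the sum is the n-th coefficient of the trace of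
  \<open>[\<pi>]\<close>(Z)^k, which is q \<open>[\<pi>]\<close>(Z)^k because \<open>[\<pi>]\<close>
  is invariant under translation by torsion points. The identity is verified by values in the disc,
  and the tail is estimated afterwards.\<close>

lemma Tr_e_series:
  assumes M: "\<And>i. i \<ge> M \<Longrightarrow> cabs (Tr i $ n) \<le> cabs \<pi> ^ R"
  shows "cabs ((\<Sum>i<M. (e ^ k) $ i * Tr i $ n) - of_nat q * (e ^ k) $ n) \<le> cabs \<pi> ^ R"
proof -
  have ei: "cabs ((e ^ k) $ i) \<le> 1" for i using e_pow_oL by (simp add: oL_iff)
  define E where "E m = (\<Sum>i<m. fps_const ((e ^ k) $ i) * Tr i)" for m
  have En: "E m $ n = (\<Sum>i<m. (e ^ k) $ i * Tr i $ n)" for m n by (simp add: E_def fps_sum_nth)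
  have tail: "cabs (E m $ n - E M $ n) \<le> cabs \<pi> ^ R" if "\<And>i. i \<ge> M \<Longrightarrow> cabs (Tr i $ n) \<le> cabs \<pi> ^ R" "m \<ge> M" for m M n R
    unfolding En using that ei by (intro cabs_sum_diff_le cabs_mult_le) auto
  have "\<exists>l. (\<lambda>m. E m $ n) \<longlonglongrightarrow> l" for n unfolding En
  proof (rule nonarch_sums)
    fix d :: real assume "d > 0"
    then obtain R where R: "cabs \<pi> ^ R < d" using small_power[OF pi_lt_1] by blast
    obtain M where M: "\<forall>i\<ge>M. \<forall>n'\<le>n. cabs (Tr i $ n') \<le> cabs \<pi> ^ R" using Tr_tendsto by blast
    have "cabs ((e ^ k) $ i * Tr i $ n) < d" if "i \<ge> M" for i
    proof (rule cabs_mult_less[OF ei])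
      have "cabs (Tr i $ n) \<le> cabs \<pi> ^ R" using M that by blast
      then show "cabs (Tr i $ n) < d" using R by linarith
    qed
    then show "\<exists>N. \<forall>i\<ge>N. cabs ((e ^ k) $ i * Tr i $ n) < d" by blast
  qed
  then have "\<forall>n. \<exists>l. (\<lambda>m. E m $ n) \<longlonglongrightarrow> l" by blast
  then obtain E' where E': "\<forall>n. (\<lambda>m. E m $ n) \<longlonglongrightarrow> E' n" by (rule choice[THEN exE])
  have lim: "cabs (E' n - E M $ n) \<le> cabs \<pi> ^ R" if "\<And>i. i \<ge> M \<Longrightarrow> cabs (Tr i $ n) \<le> cabs \<pi> ^ R" for M n R
    by (rule cabs_le_limit[OF E'[rule_format], of M]) (use tail that in blast)
  have Eint: "intg (E m)" for m unfolding E_def using ei by (intro intg_sum intg_mult intg_const Tr_intg)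
  define EE where "EE = Abs_fps E'"
  have EEint: "intg EE" unfolding intg_def
  proof
    fix n
    have "cabs (E' n - 0) \<le> 1" by (rule cabs_le_limit[OF E'[rule_format], of 0]) (use intgD[OF Eint] in simp)
    then show "cabs (EE $ n) \<le> 1" by (simp add: EE_def)
  qed
  have "EE = fps_const (of_nat q) * e ^ k"
  proof (rule ev_ext[OF EEint])
    show "intg (fps_const (of_nat q) * e ^ k)" by (intro intg_mult intg_const intg_power e_intg cabs_of_nat_le)
    fix x :: 'c assume x: "cabs x < 1"
    show "ev x EE = ev x (fps_const (of_nat q) * e ^ k)"
    proof (rule LIMSEQ_cabs_unique)
      fix d :: real assume d: "d > 0"
      obtain R where R: "cabs \<pi> ^ R < d" using small_power[OF pi_lt_1 d] by blast
      obtain N where N: "cabs x ^ N < d" using small_power[OF x d] by blast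
      obtain M1 where M1: "\<forall>i\<ge>M1. \<forall>n\<le>N. cabs (Tr i $ n) \<le> cabs \<pi> ^ R" using Tr_tendsto by blast
      \<comment> \<open>A common bound below 1 for the translates of x; the truncation errors of e^k
        at these points are then at most \<nu>^M.\<close>
      define \<nu> where "\<nu> = Max (insert 0 ((\<lambda>z. cabs (pl z x)) ` T1))"
      have fin: "finite (insert 0 ((\<lambda>z. cabs (pl z x)) ` T1))" using T1_card by simp
      have "\<nu> \<in> insert 0 ((\<lambda>z. cabs (pl z x)) ` T1)" unfolding \<nu>_def by (rule Max_in[OF fin]) auto
      then have \<nu>: "\<nu> < 1" "\<nu> \<ge> 0" using pl_less T1_less x by auto
      have \<nu>z: "cabs (pl z x) \<le> \<nu>" if "z \<in> T1" for z unfolding \<nu>_def using fin that by (intro Max_ge) auto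
      obtain M2 where M2: "\<forall>m\<ge>M2. \<nu> ^ m < d" using small_power_mono[of \<nu> d] \<nu> d by auto
      define M where "M = max M1 M2"
      have 1: "cabs (ev x EE - ev x (E M)) \<le> d"
      proof -
        have di: "intg (EE - E M)" using EEint Eint by (rule intg_diff)
        have "cabs (ev x (EE - E M) - (\<Sum>n<N. (EE - E M) $ n * x ^ n)) \<le> d" using ev_est[OF di x, of N] N by linarith
        moreover have "cabs (\<Sum>n<N. x ^ n * (EE - E M) $ n) \<le> d"
        proof (rule cabs_sum_le)
          fix n assume "n \<in> {..<N}"
          then have "cabs (E' n - E M $ n) \<le> cabs \<pi> ^ R" using M1 by (intro lim) (simp add: M_def)
          then have "cabs ((EE - E M) $ n) \<le> d" using R by (simp add: EE_def)
          then show "cabs (x ^ n * (EE - E M) $ n) \<le> d" using x by (intro cabs_mult_le cabs_le_1_power) auto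
        qed (use d in simp)
        ultimately have "cabs ((ev x (EE - E M) - (\<Sum>n<N. (EE - E M) $ n * x ^ n)) + (\<Sum>n<N. x ^ n * (EE - E M) $ n)) \<le> d"
          by (rule cabs_add_le)
        then show ?thesis using EEint Eint x by (simp add: ev_diff mult.commute)
      qed
      have 2: "cabs (ev x (E M) - of_nat q * ev x e ^ k) \<le> d"
      proof -
        have "ev x (E M) = (\<Sum>i<M. (e ^ k) $ i * (\<Sum>z\<in>T1. pl z x ^ i))"
          unfolding E_def using x ei by (simp add: ev_sum ev_cmult ev_Tr Tr_intg intg_mult intg_const)
        also have "\<dots> = (\<Sum>z\<in>T1. \<Sum>i<M. (e ^ k) $ i * pl z x ^ i)" unfolding sum_distrib_left by (rule sum.swap)
        finally have a: "ev x (E M) = (\<Sum>z\<in>T1. \<Sum>i<M. (e ^ k) $ i * pl z x ^ i)" .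
        have b: "of_nat q * ev x e ^ k = (\<Sum>z\<in>T1. ev (pl z x) (e ^ k))"
        proof -
          have "ev (pl z x) (e ^ k) = ev x e ^ k" if "z \<in> T1" for z
            using act_pi_translate[OF that x] pl_less[OF T1_less[OF that] x] by (simp add: ev_power e_intg act_pi)
          then show ?thesis using T1_card by simp
        qed
        have "cabs (\<Sum>z\<in>T1. ev (pl z x) (e ^ k) - (\<Sum>i<M. (e ^ k) $ i * pl z x ^ i)) \<le> d"
        proof (rule cabs_sum_le)
          fix z assume z: "z \<in> T1"
          have "cabs (ev (pl z x) (e ^ k) - (\<Sum>i<M. (e ^ k) $ i * pl z x ^ i)) \<le> cabs (pl z x) ^ M"
            using pl_less[OF T1_less[OF z] x] by (intro ev_est intg_power e_intg)
          also have "\<dots> \<le> \<nu> ^ M" using \<nu>z[OF z] by (intro power_mono) auto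
          also have "\<dots> \<le> d" using M2 by (auto simp: M_def intro: less_imp_le)
          finally show "cabs (ev (pl z x) (e ^ k) - (\<Sum>i<M. (e ^ k) $ i * pl z x ^ i)) \<le> d" .
        qed (use d in simp)
        then have "cabs (of_nat q * ev x e ^ k - ev x (E M)) \<le> d" unfolding a b by (simp only: sum_subtractf)
        then show ?thesis by (subst cabs_minus_commute)
      qed
      have "ev x (fps_const (of_nat q) * e ^ k) = of_nat q * ev x e ^ k" using x by (simp add: ev_cmult ev_power intg_power e_intg cabs_of_nat_le)
      then show "cabs (ev x EE - ev x (fps_const (of_nat q) * e ^ k)) \<le> d" using cabs_diff_triangle[OF 1 2] by simp
    qed
  qed
  then have "EE $ n = (fps_const (of_nat q) * e ^ k) $ n" by simp
  then have "E' n = of_nat q * (e ^ k) $ n" by (simp only: EE_def fps_nth_Abs_fps fps_mult_left_const_nth)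
  then have "cabs (of_nat q * (e ^ k) $ n - E M $ n) \<le> cabs \<pi> ^ R" using lim[OF M] by simp
  then show ?thesis unfolding En by (subst cabs_minus_commute)
qed

abbreviation qS :: "'s" where "qS \<equiv> \<iota> (of_nat q)"

text \<open>It is enough to compare after \<open>ph\<close>, where \<open>PS\<close> becomes the
  trace; modulo \<pi>^R the trace of \<open>ph F\<close> is a finite combination to which
  \<open>Tr_e_series\<close> applies.\<close>

lemma PS_ph: "PS (ph F) = fps_const qS * F"
proof (rule ph_inj, rule fps_ext)
  fix n
  show "ph (PS (ph F)) $ n = ph (fps_const qS * F) $ n"
  proof (rule cong_all)
    fix R
    obtain M1 where M1: "\<forall>i\<ge>M1. \<forall>k\<le>n. cabs (Tr i $ k) \<le> cabs \<pi> ^ R" using Tr_tendsto by blast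
    define M where "M = max M1 (Suc n)"
    have small: "cabs (Tr i $ n) \<le> cabs \<pi> ^ R" if "i \<ge> M" for i using M1 that by (simp add: M_def)
    have "cong R (ph (PS (ph F)) $ n) (\<Sum>i<M. \<iota> (Tr i $ n) * ph F $ i)"
      unfolding ph_PS TT_nth using small by (intro adic_suminf_trunc adnull_Tr io_small Tr_nth_oL)
    also have "(\<Sum>i<M. \<iota> (Tr i $ n) * ph F $ i) = (\<Sum>i<M. \<Sum>k<M. \<iota> ((e ^ k) $ i * Tr i $ n) * F $ k)"
    proof (rule sum.cong[OF refl])
      fix i assume "i \<in> {..<M}"
      then have "ph F $ i = (\<Sum>k<M. \<iota> ((e ^ k) $ i) * F $ k)" by (intro ph_nth_extend) simp
      then show "\<iota> (Tr i $ n) * ph F $ i = (\<Sum>k<M. \<iota> ((e ^ k) $ i * Tr i $ n) * F $ k)"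
        unfolding io_mult[OF e_pow_oL Tr_nth_oL] by (simp add: sum_distrib_left mult_ac)
    qed
    also have "\<dots> = (\<Sum>k<M. \<iota> (\<Sum>i<M. (e ^ k) $ i * Tr i $ n) * F $ k)"
      by (subst sum.swap) (simp add: io_sum oL_mult e_pow_oL Tr_nth_oL sum_distrib_right)
    also have "cong R \<dots> (\<Sum>k<M. \<iota> (of_nat q * (e ^ k) $ n) * F $ k)"
      using Tr_e_series[OF small] by (intro cong_sum io_close oL_sum oL_mult e_pow_oL Tr_nth_oL oL_of_nat) auto
    also have "(\<Sum>k<M. \<iota> (of_nat q * (e ^ k) $ n) * F $ k) = qS * ph F $ n"
      using ph_nth_extend[of n M F] by (simp add: M_def io_mult[OF oL_of_nat e_pow_oL] sum_distrib_left mult.assoc)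
    also have "\<dots> = ph (fps_const qS * F) $ n" by (simp add: ph_cmul cmul_nth)
    finally show "cong R (ph (PS (ph F)) $ n) (ph (fps_const qS * F) $ n)" .
  qed
qed


section \<open>Fractions in the localization and the operator \<open>psi_q\<close>\<close>

abbreviation kf :: "'c \<Rightarrow> 's fps" where "kf a \<equiv> fps_const (\<iota> a)"

lemma kf_mult: "a \<in> oL \<Longrightarrow> b \<in> oL \<Longrightarrow> kf (a * b) * F = kf a * (kf b * F)"
  by (rule fps_ext) (simp add: cmul_nth io_mult mult.assoc)

lemma kf_1: "kf 1 * F = F" by (rule fps_ext) (simp add: cmul_nth io_1)

lemma kf_diff: "kf a * (F - H) = kf a * F - kf a * H" by (rule right_diff_distrib)

abbreviation "nzL \<equiv> oL - {0 :: 'c}"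

lemma nzL_mult: "a \<in> nzL \<Longrightarrow> b \<in> nzL \<Longrightarrow> a * b \<in> nzL" using oL_mult by auto

lemma nzL_1: "1 \<in> nzL" using oL_1 by simp

lemma nzL_q: "of_nat q ^ n \<in> nzL" using q_ge_2 oL_power[OF oL_of_nat] by auto

lemma loc_rel_iff: "((F, s), (H, t)) \<in> lrel \<longleftrightarrow>
    s \<in> nzL \<and> t \<in> nzL \<and> (\<exists>u\<in>nzL. kf (u * t) * F = kf (u * s) * H)" unfolding loc_rel_def by (auto simp: kf_mult kf_diff)

lemma loc_rel_sym: "((F, s), (H, t)) \<in> lrel \<Longrightarrow> ((H, t), (F, s)) \<in> lrel" unfolding loc_rel_iff by metis

lemma loc_rel_trans:
  assumes "((F, s), (H, t)) \<in> lrel" "((H, t), (K, r)) \<in> lrel"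
  shows "((F, s), (K, r)) \<in> lrel"
proof -
  obtain u where u: "u \<in> nzL" "kf (u * t) * F = kf (u * s) * H" using assms(1) unfolding loc_rel_iff by blast
  obtain v where v: "v \<in> nzL" "kf (v * r) * H = kf (v * t) * K" using assms(2) unfolding loc_rel_iff by blast
  have str: "s \<in> nzL" "t \<in> nzL" "r \<in> nzL" using assms unfolding loc_rel_iff by blast+
  have "kf (u * v * t * r) * F = kf (v * r) * (kf (u * t) * F)" using u(1) v(1) str by (subst kf_mult[symmetric]) (auto simp: oL_mult mult_ac)
  also have "\<dots> = kf (u * s) * (kf (v * r) * H)" unfolding u(2) by (rule mult.left_commute)
  also have "\<dots> = kf (u * v * t * s) * K" unfolding v(2) using u(1) v(1) str by (subst kf_mult[symmetric]) (auto simp: oL_mult mult_ac)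
  finally have "kf (u * v * t * r) * F = kf (u * v * t * s) * K" .
  moreover have "u * v * t \<in> nzL" using u(1) v(1) str nzL_mult by blast
  ultimately show ?thesis unfolding loc_rel_iff using str by blast
qed

lemma loc_rel_refl: "s \<in> nzL \<Longrightarrow> ((F, s), (F, s)) \<in> lrel" unfolding loc_rel_iff using nzL_1 by blast

lemma loc_class_eq:
  assumes "s \<in> nzL" "t \<in> nzL"
  shows "lrel `` {(F, s)} = lrel `` {(H, t)} \<longleftrightarrow> ((F, s), (H, t)) \<in> lrel"
proof
  assume "lrel `` {(F, s)} = lrel `` {(H, t)}"
  moreover have "(H, t) \<in> lrel `` {(H, t)}" using loc_rel_refl assms(2) by blast
  ultimately show "((F, s), (H, t)) \<in> lrel" by blast
next
  assume *: "((F, s), (H, t)) \<in> lrel"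
  show "lrel `` {(F, s)} = lrel `` {(H, t)}" using loc_rel_trans[OF *] loc_rel_trans[OF loc_rel_sym[OF *]] by auto
qed

text \<open>The operator is a union over all representatives; linearity of \<open>PS\<close> makes
  their classes coincide.\<close>

lemma psi_q_class:
  assumes s: "s \<in> nzL"
  shows "psi_q L \<pi> G \<iota> (lrel `` {(F, s)}) = lrel `` {(PS F, of_nat q * s)}"
proof -
  have *: "lrel `` {(PS H, of_nat q * t)} = lrel `` {(PS F, of_nat q * s)}"
    if rel: "((F, s), (H, t)) \<in> lrel" for H t
  proof -
    obtain u where u: "u \<in> nzL" "kf (u * t) * F = kf (u * s) * H" and t: "t \<in> nzL" using rel unfolding loc_rel_iff by blast
    have q: "of_nat q \<in> nzL" using nzL_q[of 1] by simp
    have "PS (kf (u * t) * F) = PS (kf (u * s) * H)" by (simp only: u(2))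
    then have "kf (of_nat q) * (kf (u * t) * PS F) = kf (of_nat q) * (kf (u * s) * PS H)" by (simp only: PS_cmul)
    then have "kf (u * (of_nat q * t)) * PS F = kf (u * (of_nat q * s)) * PS H"
      using u(1) t s q kf_mult[of "of_nat q" "u * t" "PS F"] kf_mult[of "of_nat q" "u * s" "PS H"]
      by (simp add: oL_mult mult.left_commute del: of_nat_mult)
    then have "((PS F, of_nat q * s), (PS H, of_nat q * t)) \<in> lrel" unfolding loc_rel_iff using u(1) s t q nzL_mult by blast
    then show ?thesis using loc_class_eq nzL_mult[OF q s] nzL_mult[OF q t] by blast
  qed
  have "(F, s) \<in> lrel `` {(F, s)}" using loc_rel_refl s by blast
  then show ?thesis unfolding psi_q_def psi_Col_eq using * by fast
qed

lemma psi_q_iter: "(psi_q L \<pi> G \<iota> ^^ n) (loc_emb L \<iota> F) = lrel `` {((PS ^^ n) F, of_nat q ^ n)}"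
  by (induction n) (simp_all add: loc_emb_def psi_q_class[OF nzL_q])

lemma psi_q_int_iff:
  "F \<in> psi_q_int L \<pi> G \<iota> \<longleftrightarrow> (\<forall>n. \<exists>H. \<exists>u\<in>nzL. kf u * (PS ^^ n) F = kf (u * of_nat q ^ n) * H)"
proof -
  have "(psi_q L \<pi> G \<iota> ^^ n) (loc_emb L \<iota> F) = loc_emb L \<iota> H \<longleftrightarrow> (\<exists>u\<in>nzL. kf u * (PS ^^ n) F = kf (u * of_nat q ^ n) * H)" for n H
    unfolding psi_q_iter unfolding loc_emb_def loc_class_eq[OF nzL_q nzL_1] loc_rel_iff using nzL_q[of n] nzL_1 by simp
  then show ?thesis unfolding psi_q_int_def image_iff mem_Collect_eq bex_UNIV by simp
qed

lemma psi_q_kernel_iff: "F \<in> psi_q_kernel L \<pi> G \<iota> \<longleftrightarrow> (\<exists>u\<in>nzL. kf u * PS F = 0)"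
proof -
  have "F \<in> psi_q_kernel L \<pi> G \<iota> \<longleftrightarrow> ((PS F, of_nat q), (0, 1)) \<in> lrel"
    unfolding psi_q_kernel_def loc_emb_def using psi_q_class[OF nzL_1, of F] loc_class_eq[OF nzL_q[of 1] nzL_1, of "PS F" 0] by simp
  then show ?thesis unfolding loc_rel_iff using nzL_q[of 1] nzL_1 by simp
qed

lemma PS_0: "PS 0 = 0" using PS_cmul[of 0 0] by simp

lemma ph_0: "ph 0 = 0" by (rule fps_ext) (simp add: ph_nth)

lemma PS_diff: "PS (F - H) = PS F - PS H" using PS_add[of "F - H" H] by (simp add: eq_diff_eq)

text \<open>Written out as a series because the type class of S provides no 1 from which the
  variable could be formed.\<close>

abbreviation monoS :: "'s \<Rightarrow> nat \<Rightarrow> 's fps" where "monoS t n \<equiv> Abs_fps (\<lambda>i. if i = n then t else 0)"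

lemma torsion_trace_mono: "torsion_trace L \<pi> G \<iota> (monoS t k) $ n = \<iota> (Tr k $ n) * t"
proof -
  have *: "(\<Sum>i<m. \<iota> (Tr i $ n) * monoS t k $ i) = \<iota> (Tr k $ n) * t" if m: "m \<ge> Suc k" for m
  proof -
    have "(\<Sum>i<m. \<iota> (Tr i $ n) * monoS t k $ i) = (\<Sum>i\<in>{k}. \<iota> (Tr i $ n) * monoS t k $ i)"
      using m by (intro sum.mono_neutral_right) auto
    then show ?thesis by simp
  qed
  show ?thesis unfolding TT_nth
  proof (rule adic_suminf_eq, unfold adlim_def, rule allI)
    fix j
    have "cong j (\<Sum>i<m. \<iota> (Tr i $ n) * monoS t k $ i) (\<iota> (Tr k $ n) * t)" if "m \<ge> Suc k" for m
      unfolding *[OF that] by (rule cong_refl)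
    then show "\<exists>M. \<forall>m\<ge>M. cong j (\<Sum>i<m. \<iota> (Tr i $ n) * monoS t k $ i) (\<iota> (Tr k $ n) * t)" by blast
  qed
qed

end

context LT begin

section \<open>Power sums of the torsion points\<close>

lemma cabs_q: "cabs (of_nat q :: 'c) < 1" using residue_binomial[of 1] q_ge_2 by simp

lemma T1_0: "0 \<in> T1" using torsion_iff[OF pi_oL, of 0] act_at_0[OF pi_oL] by simp

text \<open>Dividing 0 = \<open>[\<pi>]\<close>(z) by z gives z^(q-1) + \<pi> = -\<pi> z B(z) with
  an integral series B.\<close>

lemma T1_power:
  assumes z: "z \<in> T1" "z \<noteq> 0" shows "cabs (z ^ (q - 1) + \<pi>) < cabs \<pi>"
proof -
  have z1: "cabs z < 1" and ez: "ev z e = 0" using T1_less T1_act act_pi z by auto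
  define D where "D = e - fps_X ^ q - fps_const \<pi> * fps_X"
  define B where "B = fps_const (1 / \<pi>) * fps_shift 2 D"
  have Dn: "cabs (D $ n) \<le> cabs \<pi>" for n
  proof -
    have "D $ n = (e $ n - (if n = q then 1 else 0)) - (if n = 1 then \<pi> else 0)" by (simp add: D_def fps_X_power_nth)
    then show ?thesis using cabs_diff_le[OF e_near[of n], of "if n = 1 then \<pi> else 0"] by simp
  qed
  have B: "intg B" unfolding intg_def
  proof
    fix n
    have "cabs (B $ n * \<pi>) = cabs (D $ (n + 2))" using pi_nz by (simp add: B_def del: cabs_mult)
    then have "cabs (B $ n) * cabs \<pi> = cabs (D $ (n + 2))" by (simp only: cabs_mult)
    then have "cabs (B $ n) * cabs \<pi> \<le> 1 * cabs \<pi>" using Dn by simp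
    then show "cabs (B $ n) \<le> 1" using pi_pos by simp
  qed
  have D0: "D $ 0 = 0" "D $ 1 = 0" using q_ge_2 e_0 e_props(3) by (simp_all add: D_def fps_X_power_nth)
  have "D = fps_const \<pi> * (fps_X ^ 2 * B)"
  proof (rule fps_ext)
    fix n :: nat
    have "n = 0 \<or> n = 1 \<or> (\<exists>m. n = m + 2)" by presburger
    then consider "n = 0" | "n = 1" | m where "n = m + 2" by blast
    then show "D $ n = (fps_const \<pi> * (fps_X ^ 2 * B)) $ n" by cases (use D0 pi_nz in \<open>simp_all add: fps_X_power_mult_nth B_def\<close>)
  qed
  then have "e = fps_X ^ q + fps_const \<pi> * fps_X + fps_const \<pi> * (fps_X ^ 2 * B)" by (simp add: D_def algebra_simps)
  then have "ev z e = z ^ q + \<pi> * z + \<pi> * (z ^ 2 * ev z B)"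
    using z1 B pi_lt_1 by (simp add: ev_add ev_cmult ev_mult ev_power ev_X ev_const intg_add intg_mult intg_power intg_X intg_const)
  moreover have "z ^ q = z * z ^ (q - 1)" using q_ge_2 by (cases q) auto
  ultimately have "z * (z ^ (q - 1) + \<pi> + \<pi> * (z * ev z B)) = 0" using ez by (simp add: algebra_simps power2_eq_square)
  then have "z ^ (q - 1) + \<pi> = - (\<pi> * (z * ev z B))" using z(2) by (simp add: eq_neg_iff_add_eq_0)
  moreover have "cabs (\<pi> * (z * ev z B)) < cabs \<pi> * 1"
  proof -
    have "cabs (ev z B * z) < 1" using ev_le[OF B z1] z1 by (rule cabs_mult_less)
    then show ?thesis unfolding cabs_mult[of \<pi>] using pi_pos by (intro mult_strict_left_mono) (simp_all add: mult.commute)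
  qed
  ultimately show ?thesis by simp
qed

definition pw :: "nat \<Rightarrow> 'c" where "pw n = (\<Sum>z\<in>T1. z ^ n)"

lemma pw_oL: "pw n \<in> oL" using Tr_oL[of n] unfolding coeffs_in_def pw_def Tr_0[symmetric] by blast

lemma cabs_pw: "cabs (pw n) < 1"
proof (cases "n = 0")
  case True then show ?thesis using cabs_q T1_card by (simp add: pw_def)
next
  case False
  then obtain m where n: "n = Suc m" by (cases n) auto
  have "cabs (z ^ n) < 1" if "z \<in> T1" for z
  proof -
    have "cabs (z ^ m * z) < 1" using T1_less[OF that] by (intro cabs_mult_less cabs_le_1_power) auto
    then show ?thesis by (simp add: n mult.commute)
  qed
  then show ?thesis unfolding pw_def by (rule cabs_sum_less)
qed

text \<open>Each of the q - 1 nonzero torsion points contributes -\<pi> up to smaller terms, and -(q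
  - 1) \<pi> is \<pi> up to the smaller term q \<pi>.\<close>

lemma cabs_pw_q: "cabs (pw (q - 1)) = cabs \<pi>"
proof -
  have "pw (q - 1) = (\<Sum>z\<in>T1 - {0}. z ^ (q - 1)) + 0 ^ (q - 1)" unfolding pw_def using T1_card T1_0 by (simp add: sum.remove add.commute)
  then have "pw (q - 1) = (\<Sum>z\<in>T1 - {0}. (z ^ (q - 1) + \<pi>) - \<pi>)" using q_ge_2 by simp
  also have "\<dots> = (\<Sum>z\<in>T1 - {0}. z ^ (q - 1) + \<pi>) - of_nat (q - 1) * \<pi>"
  proof -
    have "card (T1 - {0}) = q - 1" using T1_card T1_0 by (simp add: card_Diff_singleton)
    then show ?thesis by (simp only: sum_subtractf sum_constant)
  qed
  finally have a: "pw (q - 1) - \<pi> = (\<Sum>z\<in>T1 - {0}. z ^ (q - 1) + \<pi>) - of_nat q * \<pi>"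
    using q_ge_2 by (simp add: algebra_simps of_nat_diff)
  have "cabs ((\<Sum>z\<in>T1 - {0}. (z ^ (q - 1) + \<pi>) / \<pi>)) < 1"
    using T1_power pi_pos by (intro cabs_sum_less) (auto simp: divide_less_eq cabs_divide)
  then have "cabs (\<Sum>z\<in>T1 - {0}. z ^ (q - 1) + \<pi>) < cabs \<pi>"
    using pi_pos by (simp add: sum_divide_distrib[symmetric] divide_less_eq cabs_divide)
  moreover have "cabs (of_nat q * \<pi>) < cabs \<pi> * 1"
    unfolding cabs_mult mult.commute[of "cabs \<pi>"] using cabs_q pi_pos by (intro mult_strict_right_mono) auto
  ultimately have "cabs (pw (q - 1) - \<pi>) < cabs \<pi>" unfolding a by (intro cabs_diff_less) auto
  then show ?thesis by (rule cabs_eq_of_near)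
qed

end

context Period begin

text \<open>Orthogonality: translating by a point where the character differs from 1 multiplies the
  sum by that value.\<close>

lemma sum_kap: assumes "\<Omega> \<noteq> 0" shows "(\<Sum>z\<in>T1. kap z) = 0"
proof -
  obtain w where w: "w \<in> T1" "kap w \<noteq> 1" using kap_translate_trivial assms by blast
  have "(\<Sum>z\<in>T1. kap z) = (\<Sum>z\<in>(\<lambda>y. pl y w) ` T1. kap z)" by (simp add: T1_translate[OF w(1)])
  also have "\<dots> = (\<Sum>z\<in>T1. kap (pl z w))" by (simp add: sum.reindex[OF T1_translate(2)[OF w(1)]])
  also have "\<dots> = (\<Sum>z\<in>T1. kap z) * kap w" unfolding sum_distrib_right using T1_less w(1) by (intro sum.cong kap_pl) auto
  finally show ?thesis using w(2) by auto
qed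

text \<open>Interchanging the sums gives truncations of kap at the torsion points, whose full values
  add up to 0.\<close>

lemma sum_pw_Kap:
  assumes "\<Omega> \<noteq> 0" "\<forall>z\<in>T1. cabs z \<le> \<mu>" "\<mu> \<ge> 0"
  shows "cabs (\<Sum>n<N. pw n * Kap \<Omega> $ n) \<le> \<mu> ^ N"
proof -
  have "(\<Sum>n<N. pw n * Kap \<Omega> $ n) = (\<Sum>z\<in>T1. \<Sum>n<N. Kap \<Omega> $ n * z ^ n)"
    by (subst sum.swap) (simp add: pw_def sum_distrib_left sum_distrib_right mult.commute)
  also have "\<dots> = - (\<Sum>z\<in>T1. kap z - (\<Sum>n<N. Kap \<Omega> $ n * z ^ n))" using sum_kap[OF assms(1)] by (simp add: sum_subtractf)
  finally have "cabs (\<Sum>n<N. pw n * Kap \<Omega> $ n) = cabs (\<Sum>z\<in>T1. kap z - (\<Sum>n<N. Kap \<Omega> $ n * z ^ n))" by simp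
  also have "\<dots> \<le> \<mu> ^ N"
  proof (rule cabs_sum_le)
    fix z assume z: "z \<in> T1"
    have "cabs (kap z - (\<Sum>n<N. Kap \<Omega> $ n * z ^ n)) \<le> cabs z ^ N" unfolding kap_def by (rule ev_est[OF Kap_Om_intg T1_less[OF z]])
    also have "\<dots> \<le> \<mu> ^ N" using assms(2) z by (intro power_mono) auto
    finally show "cabs (kap z - (\<Sum>n<N. Kap \<Omega> $ n * z ^ n)) \<le> \<mu> ^ N" .
  qed (use assms(3) in simp)
  finally show ?thesis .
qed

text \<open>If the trace of Z were q Z plus a constant, its invariance under translation by a
  torsion point z would give q z = 0. This provides the coefficient that shows the period to be
  nonzero.\<close>

lemma Tr_1_not_linear: "\<exists>n\<ge>1. Tr 1 $ n \<noteq> (if n = 1 then of_nat q else 0)"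
proof (rule ccontr)
  assume "\<not> ?thesis"
  then have *: "Tr 1 $ n = (if n = 1 then of_nat q else 0)" if "n \<ge> 1" for n using that by blast
  have T: "Tr 1 = fps_const (of_nat q) * fps_X + fps_const (Tr 1 $ 0)"
  proof (rule fps_ext)
    fix n show "Tr 1 $ n = (fps_const (of_nat q) * fps_X + fps_const (Tr 1 $ 0)) $ n" using *[of n] by (cases n) (auto simp: fps_X_def)
  qed
  have c0: "cabs (Tr 1 $ 0) \<le> 1" using Tr_intg intgD by blast
  have evT: "ev x (Tr 1) = of_nat q * x + Tr 1 $ 0" if "cabs x < 1" for x
    by (subst T) (use that c0 in \<open>simp add: ev_add ev_cmult ev_const ev_X intg_mult intg_const intg_X cabs_of_nat_le\<close>)
  have "z = 0" if z: "z \<in> T1" for z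
  proof -
    have "ev z (Tr 1) = (\<Sum>y\<in>T1. pl y z)" using ev_Tr[OF T1_less[OF z], of 1] by simp
    also have "\<dots> = (\<Sum>y\<in>T1. y)" using sum.reindex[OF T1_translate(2)[OF z], of "\<lambda>x. x"] T1_translate(1)[OF z] by simp
    also have "\<dots> = Tr 1 $ 0" by (simp only: Tr_0 power_one_right)
    finally show ?thesis using evT[OF T1_less[OF z]] q_ge_2 by simp
  qed
  then have "T1 \<subseteq> {0}" by blast
  then have "card T1 \<le> 1" using card_mono[of "{0}" T1] by simp
  then show False using T1_card q_ge_2 by simp
qed

end

section \<open>Consequences of the hypothesis on the first map\<close>

locale Dual = Coef p C L \<pi> G \<Omega> \<iota>
  for p and C :: "'c::{alg_closed_field,field_char_0,complete_space} itself"
    and L :: "'c set" and \<pi> :: 'c and G :: "'c fps fps" and \<Omega> :: 'c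
    and \<iota> :: "'c \<Rightarrow> 's::comm_ring" +
  assumes tau_onto: "tau p L \<pi> G ` galois_group L = o_units L"
    and K1_iso: "S_module_iso (K1_star G \<Omega>) (Hom_o_infty p L \<pi> G \<iota>) (psi_q_kernel L \<pi> G \<iota>)"
begin

abbreviation "K1 \<equiv> K1_star G \<Omega>"
abbreviation "KerS \<equiv> psi_q_kernel L \<pi> G \<iota>"
abbreviation "IntS \<equiv> psi_q_int L \<pi> G \<iota>"
abbreviation "oi \<equiv> o_infty p L \<pi> G"
abbreviation "tt \<equiv> tau p L \<pi> G"
abbreviation "Hoi \<equiv> Hom_o_infty p L \<pi> G \<iota>"

lemma oi_iff: "x \<in> oi \<longleftrightarrow> (\<forall>\<sigma>\<in>GL. tt \<sigma> = 1 \<longrightarrow> \<sigma> x = x) \<and> cabs x \<le> 1"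
  by (auto simp: o_infty_def o_Cp_def)

lemma oL_oi: "a \<in> oL \<Longrightarrow> a \<in> oi" by (auto simp: oi_iff oL_iff GL_fix)

lemma oi_add: "x \<in> oi \<Longrightarrow> y \<in> oi \<Longrightarrow> x + y \<in> oi" by (auto simp: oi_iff GL_add intro: cabs_add_le)

lemma oi_mult: "x \<in> oi \<Longrightarrow> y \<in> oi \<Longrightarrow> x * y \<in> oi" by (auto simp: oi_iff GL_mult mult_le_one)

lemma oi_cmult: "a \<in> oL \<Longrightarrow> y \<in> oi \<Longrightarrow> a * y \<in> oi" using oi_mult oL_oi by blast

lemma oi_diff: "x \<in> oi \<Longrightarrow> y \<in> oi \<Longrightarrow> x - y \<in> oi" by (auto simp: oi_iff GL_diff intro: cabs_diff_le)

lemma oi_sum: "(\<And>i. i \<in> A \<Longrightarrow> f i \<in> oi) \<Longrightarrow> sum f A \<in> oi"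
  by (induction A rule: infinite_finite_induct) (auto simp: oi_add oL_oi[OF oL_0])

lemma oi_dvd: assumes x: "x \<in> oi" "cabs x \<le> cabs \<pi> ^ n" shows "x / \<pi> ^ n \<in> oi"
proof -
  have "\<pi> ^ n \<in> L" using oL_power[OF pi_oL] oL_iff by blast
  then have "\<forall>\<sigma>\<in>GL. tt \<sigma> = 1 \<longrightarrow> \<sigma> (x / \<pi> ^ n) = x / \<pi> ^ n" using GL_divide GL_fix x(1) oi_iff by metis
  moreover have "cabs (x / \<pi> ^ n) \<le> 1" using x(2) pi_pos by (simp add: divide_le_eq)
  ultimately show ?thesis using x(1) by (simp add: oi_iff)
qed

lemma Kap_oi: assumes a: "a \<in> oL" shows "Kap (a * \<Omega>) $ n \<in> oi"
proof -
  have "\<sigma> (Kap (a * \<Omega>) $ n) = Kap (a * \<Omega>) $ n" if s: "\<sigma> \<in> GL" "tt \<sigma> = 1" for \<sigma>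
    using GL_Kap[OF s(1), of "a * \<Omega>" n] sigma_Omega[OF s(1)] GL_mult[OF s(1)] GL_fix[OF s(1)] a s(2) by (simp add: oL_iff)
  then show ?thesis using intgD[OF Kap_intg[OF a]] by (simp add: oi_iff)
qed

lemma Kap_Om_oi: "Kap \<Omega> $ n \<in> oi" using Kap_oi[OF oL_1] by simp

lemma Hoi_add: "l \<in> Hoi \<Longrightarrow> x \<in> oi \<Longrightarrow> y \<in> oi \<Longrightarrow> l (x + y) = l x + l y"
  and Hoi_cmult: "l \<in> Hoi \<Longrightarrow> a \<in> oL \<Longrightarrow> x \<in> oi \<Longrightarrow> l (a * x) = \<iota> a * l x"
  and Hoi_out: "l \<in> Hoi \<Longrightarrow> x \<notin> oi \<Longrightarrow> l x = 0" by (auto simp: Hom_o_infty_def Hom_o_def)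

lemma Hoi_0: "l \<in> Hoi \<Longrightarrow> l 0 = 0" using Hoi_add[of l 0 0] oL_oi[OF oL_0] by simp

lemma Hoi_sum:
  assumes "l \<in> Hoi" "\<And>i. i \<in> A \<Longrightarrow> c i \<in> oL" "\<And>i. i \<in> A \<Longrightarrow> x i \<in> oi"
  shows "l (\<Sum>i\<in>A. c i * x i) = (\<Sum>i\<in>A. \<iota> (c i) * l (x i))"
  using assms(2,3) by (induction A rule: infinite_finite_induct)
     (auto simp: Hoi_0[OF assms(1)] Hoi_add[OF assms(1)] Hoi_cmult[OF assms(1)] oi_cmult oi_sum)

text \<open>Linear functionals on \<open>oi\<close> are automatically continuous, because an element
  of size at most |\<pi>|^n is \<pi>^n times an element of \<open>oi\<close>.\<close>

lemma Hoi_small: assumes l: "l \<in> Hoi" and x: "x \<in> oi" "cabs x \<le> cabs \<pi> ^ n" shows "cong n (l x) 0"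
proof -
  have "\<pi> ^ n * (x / \<pi> ^ n) = x" using pi_nz by simp
  then have "l x = \<iota> (\<pi> ^ n) * l (x / \<pi> ^ n)" using Hoi_cmult[OF l oL_power[OF pi_oL, of n] oi_dvd[OF x]] by metis
  then show ?thesis unfolding adic_cong_def by auto
qed

lemma K1_nth: "K1 l $ n = l (Kap \<Omega> $ n)" by (simp add: K1_star_def poly_P)

lemma K1_bij: "bij_betw (K1) Hoi KerS" using K1_iso by (simp add: S_module_iso_def)

lemma K1_onto: "F \<in> KerS \<Longrightarrow> \<exists>l\<in>Hoi. K1 l = F" using K1_bij unfolding bij_betw_def by (metis imageE)

lemma K1_kernel: "l \<in> Hoi \<Longrightarrow> K1 l \<in> KerS" using K1_bij bij_betwE by blast

lemma K1_eq_0: assumes "l \<in> Hoi" "K1 l = 0" shows "l x = 0"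
proof -
  have z: "(\<lambda>_. 0) \<in> Hoi" by (simp add: Hom_o_infty_def Hom_o_def)
  have "K1 (\<lambda>_. 0) = 0" by (rule fps_ext) (simp add: K1_nth)
  then have "l = (\<lambda>_. 0)" using K1_bij assms z unfolding bij_betw_def inj_on_def by metis
  then show ?thesis by simp
qed

text \<open>The kernel of \<open>\<psi>\<close> contains \<open>t Z\<^sup>n\<close> if \<open>\<pi> t = 0\<close>.  The nontrivial character \<open>kap\<close> sums to \<open>0\<close> over
  the torsion points, hence \<open>\<Sum>\<^sub>n s\<^sub>n P\<^sub>n(\<Omega>) = 0\<close> for the power sums \<open>s\<^sub>n\<close> of these points.  All \<open>s\<^sub>n\<close> are
  divisible by \<open>\<pi>\<close>, and \<open>s\<close> at \<open>q - 1\<close> exactly once, so a functional with \<open>P\<^sub>n(\<Omega>) \<mapsto> 0\<close> for all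
  \<open>n \<noteq> q - 1\<close> also kills \<open>P\<^sub>n(\<Omega>)\<close> for \<open>n = q - 1\<close>.\<close>

lemma pi_torsion_free: assumes t: "\<iota> \<pi> * t = 0" shows "t = 0"
proof -
  have ker: "monoS t n \<in> KerS" for n
  proof -
    have "kf \<pi> * monoS t n = 0" by (rule fps_ext) (simp add: cmul_nth t)
    then have "kf \<pi> * PS (monoS t n) = 0" using PS_cmul[of "\<iota> \<pi>" "monoS t n"] PS_0 by simp
    then show ?thesis unfolding psi_q_kernel_iff using pi_nz pi_oL by blast
  qed
  show ?thesis
  proof (cases "\<Omega> = 0")
    case True
    \<comment> \<open>If \<Omega> = 0, the coefficient of Z in any image of \<open>K1\<close> is
      l(\<Omega>) = 0, but t Z is such an image.\<close>
    obtain l where l: "l \<in> Hoi" "K1 l = monoS t 1" using K1_onto[OF ker] by blast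
    have "K1 l $ 1 = l \<Omega>" unfolding K1_nth Kap_1 ..
    also have "\<dots> = 0" unfolding True by (rule Hoi_0[OF l(1)])
    finally show ?thesis unfolding l(2) by simp
  next
    case False
    obtain l where l: "l \<in> Hoi" "K1 l = monoS t (q - 1)" using K1_onto[OF ker] by blast
    have lK: "l (Kap \<Omega> $ n) = (if n = q - 1 then t else 0)" for n using l(2) K1_nth[of l n] by simp
    define s where "s n = pw n / \<pi>" for n
    have s: "s n \<in> oL" "pw n = \<pi> * s n" for n
    proof -
      have "pw n \<in> {x \<in> L. cabs x < 1}" using cabs_pw pw_oL by (simp add: oL_iff)
      then have "pw n \<in> (\<lambda>x. \<pi> * x) ` oL" using unif unfolding uniformizer_def by blast
      then obtain y where "y \<in> oL" "pw n = \<pi> * y" by blast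
      then show "s n \<in> oL" "pw n = \<pi> * s n" using pi_nz by (auto simp: s_def)
    qed
    have s1: "cabs (s (q - 1)) = 1" unfolding s_def using cabs_pw_q pi_nz by simp
    have "\<iota> (s (q - 1)) * t = 0"
    proof (rule cong_all)
      fix R
      obtain \<mu> where \<mu>: "\<mu> > 0" "\<mu> < 1" "\<forall>z\<in>T1. cabs z \<le> \<mu>" using T1_bound by blast
      obtain N where N: "\<forall>n\<ge>N. \<mu> ^ n < cabs \<pi> ^ Suc R" using small_power_mono[of \<mu> "cabs \<pi> ^ Suc R"] \<mu> pi_pos by auto
      \<comment> \<open>At least N for the estimate, and at least q so that the index q - 1 occurs
        in the sum.\<close>
      define M where "M = max N q"
      define y where "y = (\<Sum>n<M. s n * Kap \<Omega> $ n)"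
      have "cabs (\<pi> * y) \<le> \<mu> ^ M"
        using sum_pw_Kap[OF False \<mu>(3), of M] \<mu>(1) by (simp add: y_def sum_distrib_left s(2) mult.assoc del: cabs_mult)
      then have "cabs \<pi> * cabs y \<le> cabs \<pi> * cabs \<pi> ^ R" using N[rule_format, of M] by (simp add: M_def)
      then have y: "cabs y \<le> cabs \<pi> ^ R" using pi_pos by simp
      have yi: "y \<in> oi" unfolding y_def using s(1) Kap_Om_oi by (intro oi_sum oi_cmult)
      have "l y = (\<Sum>n<M. \<iota> (s n) * l (Kap \<Omega> $ n))" unfolding y_def using s(1) Kap_Om_oi by (intro Hoi_sum[OF l(1)])
      also have "\<dots> = (\<Sum>n\<in>{q - 1}. \<iota> (s n) * l (Kap \<Omega> $ n))"
        using q_ge_2 by (intro sum.mono_neutral_right) (auto simp: M_def lK)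
      finally have "l y = \<iota> (s (q - 1)) * t" by (simp add: lK)
      then show "cong R (\<iota> (s (q - 1)) * t) 0" using Hoi_small[OF l(1) yi y] by simp
    qed
    then have "\<iota> (inverse (s (q - 1))) * (\<iota> (s (q - 1)) * t) = 0" by simp
    moreover have "inverse (s (q - 1)) \<in> oL" using s(1) s1 oL_inverse by (simp add: oL_iff)
    moreover have "s (q - 1) \<noteq> 0" using s1 by auto
    ultimately show "t = 0" using io_mult[of "inverse (s (q - 1))" "s (q - 1)"] s(1) io_1 by (simp add: mult.assoc[symmetric])
  qed
qed

lemma torsion_free: assumes a: "a \<in> nzL" and t: "\<iota> a * t = 0" shows "t = 0"
proof -
  obtain k u where ku: "u \<in> L" "cabs u = 1" "a = \<pi> ^ k * u" using oL_factor a by blast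
  have u: "u \<in> oL" "inverse u \<in> oL" "u \<noteq> 0" using ku oL_inverse by (auto simp: oL_iff)
  have "\<iota> (inverse u) * (\<iota> a * t) = \<iota> (inverse u * a) * t" using a u io_mult[of "inverse u" a] by (simp add: mult.assoc)
  moreover have "inverse u * a = \<pi> ^ k" using u(3) by (simp add: ku(3))
  ultimately have k: "\<iota> (\<pi> ^ k) * t = 0" using t by simp
  have "\<iota> (\<pi> ^ k) * t = 0 \<Longrightarrow> t = 0" for k
  proof (induction k)
    case (Suc k)
    have "\<iota> \<pi> * (\<iota> (\<pi> ^ k) * t) = 0" using Suc.prems io_mult[OF pi_oL oL_power[OF pi_oL, of k]] by (simp add: mult.assoc)
    then show ?case using pi_torsion_free Suc.IH by blast
  qed (simp add: io_1)
  then show ?thesis using k by blast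
qed

lemma kf_cancel: assumes a: "a \<in> nzL" and eq: "kf a * F = kf a * H" shows "F = H"
proof (rule fps_ext)
  fix n
  have "\<iota> a * F $ n = \<iota> a * H $ n" using eq cmul_nth by metis
  then have "\<iota> a * (F $ n - H $ n) = 0" by (simp add: right_diff_distrib)
  then have "F $ n - H $ n = 0" by (rule torsion_free[OF a])
  then show "F $ n = H $ n" by simp
qed

lemma kernel_iff: "F \<in> KerS \<longleftrightarrow> PS F = 0"
proof
  assume "F \<in> KerS"
  then obtain u where "u \<in> nzL" "kf u * PS F = kf u * 0" unfolding psi_q_kernel_iff by auto
  then show "PS F = 0" by (rule kf_cancel)
qed (use psi_q_kernel_iff nzL_1 in auto)

text \<open>Torsion-freeness allows the auxiliary denominator in the localization to be
  cancelled.\<close>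

lemma int_iff: "F \<in> IntS \<longleftrightarrow> (\<forall>n. \<exists>H. (PS ^^ n) F = kf (of_nat q ^ n) * H)"
proof -
  have "kf u * (PS ^^ n) F = kf (u * of_nat q ^ n) * H \<longleftrightarrow> (PS ^^ n) F = kf (of_nat q ^ n) * H" if "u \<in> nzL" for u n H
    using kf_mult[of u "of_nat q ^ n" H] kf_cancel[OF that, of "(PS ^^ n) F" "kf (of_nat q ^ n) * H"] that nzL_q[of n] by auto
  then show ?thesis unfolding psi_q_int_iff using nzL_1 by blast
qed

text \<open>If \<open>\<Omega> = 0\<close>, then the image of the first map consists of constants, but \<open>q Z - \<phi>(\<psi>(Z))\<close> is killed by \<open>\<psi>\<close>.\<close>

lemma Omega_nz: assumes t: "(t :: 's) \<noteq> 0" shows "\<Omega> \<noteq> 0"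
proof
  assume O: "\<Omega> = 0"
  define F where "F = kf (of_nat q) * monoS t 1 - ph (PS (monoS t 1))"
  have "PS F = 0" unfolding F_def PS_diff PS_cmul PS_ph by simp
  then obtain l where l: "l \<in> Hoi" "K1 l = F" using K1_onto kernel_iff by blast
  obtain n where n: "n \<ge> 1" "Tr 1 $ n \<noteq> (if n = 1 then of_nat q else 0)" using Tr_1_not_linear by blast
  have "Kap 0 $ n = (0 :: 'c)" using n(1) by (simp add: Kap_def)
  then have "F $ n = 0" using l K1_nth[of l n] Hoi_0[OF l(1)] by (simp add: O)
  moreover have "F $ n = \<iota> ((if n = 1 then of_nat q else 0) - Tr 1 $ n) * t"
    unfolding F_def ph_PS fps_sub_nth cmul_nth torsion_trace_mono using oL_of_nat[of q] Tr_nth_oL[of 1 n] oL_0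
    by (auto simp: io_diff io_0 io_minus left_diff_distrib)
  ultimately show False
    using torsion_free[of "(if n = 1 then of_nat q else 0) - Tr 1 $ n" t] n(2) t oL_of_nat Tr_nth_oL oL_0 by (auto simp: oL_diff oL_minus)
qed

end

section \<open>Galois-equivariant functions\<close>

context Cp begin

lemma poly_continuous_cabs:
  fixes P :: "'c poly"
  shows "e > 0 \<Longrightarrow> \<exists>d>0. \<forall>y. cabs (y - x) < d \<longrightarrow> cabs (poly P y - poly P x) < e"
proof (induction P arbitrary: e)
  case 0
  then show ?case by (intro exI[of _ 1]) auto
next
  case (pCons a P)
  define B where "B = 1 + cabs x + cabs (poly P x)"
  have B: "B > 0" unfolding B_def using cabs_nonneg[of x] cabs_nonneg[of "poly P x"] by linarith
  obtain d where d: "d > 0" "\<forall>y. cabs (y - x) < d \<longrightarrow> cabs (poly P y - poly P x) < e / B"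
    using pCons.IH[of "e / B"] pCons.prems B by auto
  define r where "r = min 1 (min d (e / B))"
  have r: "r > 0" using d B pCons.prems by (simp add: r_def)
  have "cabs (poly (pCons a P) y - poly (pCons a P) x) < e" if y: "cabs (y - x) < r" for y
  proof -
    have y1: "cabs y \<le> B"
    proof -
      have "cabs ((y - x) + x) \<le> max (cabs (y - x)) (cabs x)" by (rule cabs_add)
      then have "cabs y \<le> max (cabs (y - x)) (cabs x)" by simp
      moreover have "cabs (y - x) < 1" using y by (simp add: r_def)
      ultimately show ?thesis unfolding B_def using cabs_nonneg[of x] cabs_nonneg[of "poly P x"] by linarith
    qed
    have "cabs y * cabs (poly P y - poly P x) < e"
    proof -
      have "cabs y * cabs (poly P y - poly P x) \<le> B * cabs (poly P y - poly P x)" using y1 by (intro mult_right_mono) auto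
      also have "\<dots> < B * (e / B)" using d(2)[rule_format, of y] y B by (intro mult_strict_left_mono) (auto simp: r_def)
      finally show ?thesis using B by simp
    qed
    moreover have "cabs (y - x) * cabs (poly P x) < e"
    proof -
      have "cabs (y - x) * cabs (poly P x) \<le> cabs (y - x) * B" unfolding B_def by (intro mult_left_mono) auto
      also have "\<dots> < e / B * B" using y B by (intro mult_strict_right_mono) (auto simp: r_def)
      finally show ?thesis using B by simp
    qed
    ultimately have "cabs (y * (poly P y - poly P x) + (y - x) * poly P x) < e" by (intro cabs_add_less) simp_all
    moreover have "y * (poly P y - poly P x) + (y - x) * poly P x = poly (pCons a P) y - poly (pCons a P) x" by (simp add: algebra_simps)
    ultimately show ?thesis by simp
  qed
  then show ?case using r by blast
qed

end

context Dual begin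

abbreviation "CG \<equiv> C_Gal p L \<pi> G"

lemma CG_iff: "f \<in> CG \<longleftrightarrow>
    (\<forall>a\<in>oL. \<forall>\<epsilon>>0. \<exists>\<delta>>0. \<forall>b\<in>oL. cabs (b - a) < \<delta> \<longrightarrow> cabs (f b - f a) < \<epsilon>) \<and>
    (\<forall>a\<in>oL. cabs (f a) \<le> 1) \<and> (\<forall>a. a \<notin> oL \<longrightarrow> f a = 0) \<and>
    (\<forall>a\<in>oL. \<forall>\<sigma>\<in>GL. \<sigma> (f a) = f (tt \<sigma> * a))" unfolding C_Gal_def by (auto simp: continuous_cabs o_Cp_def)

lemma CG_cont: "f \<in> CG \<Longrightarrow> a \<in> oL \<Longrightarrow> \<epsilon> > 0 \<Longrightarrow> \<exists>\<delta>>0. \<forall>b\<in>oL. cabs (b - a) < \<delta> \<longrightarrow> cabs (f b - f a) < \<epsilon>"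
  and CG_le: "f \<in> CG \<Longrightarrow> a \<in> oL \<Longrightarrow> cabs (f a) \<le> 1"
  and CG_out: "f \<in> CG \<Longrightarrow> a \<notin> oL \<Longrightarrow> f a = 0"
  and CG_gal: "f \<in> CG \<Longrightarrow> a \<in> oL \<Longrightarrow> \<sigma> \<in> GL \<Longrightarrow> \<sigma> (f a) = f (tt \<sigma> * a)"
  by (auto simp: CG_iff)

lemma tt_unit: "\<sigma> \<in> GL \<Longrightarrow> tt \<sigma> \<in> L" "\<sigma> \<in> GL \<Longrightarrow> cabs (tt \<sigma>) = 1"
  using tau_onto by (auto simp: o_units_def)

lemma tt_oL: "\<sigma> \<in> GL \<Longrightarrow> tt \<sigma> \<in> oL" using tt_unit by (simp add: oL_iff)

lemma tt_onto: "u \<in> L \<Longrightarrow> cabs u = 1 \<Longrightarrow> \<exists>\<sigma>\<in>GL. tt \<sigma> = u"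
proof -
  assume "u \<in> L" "cabs u = 1"
  then have "u \<in> tt ` GL" unfolding tau_onto by (simp add: o_units_def)
  then show ?thesis by blast
qed

lemma CG_oi: "f \<in> CG \<Longrightarrow> a \<in> oL \<Longrightarrow> f a \<in> oi" by (simp add: oi_iff CG_gal CG_le)

text \<open>Equivariance at 0 says that f(0) is fixed by the whole group, since multiplication by
  \<tau>(\<sigma>) does not move 0.\<close>

lemma CG_0: assumes f: "f \<in> CG" shows "f 0 \<in> oL"
proof -
  have "\<forall>\<sigma>\<in>GL. \<sigma> (f 0) = f 0" using CG_gal[OF f oL_0] by simp
  then have "f 0 \<in> L" by (rule GL_fixed)
  then show ?thesis using CG_le[OF f oL_0] by (simp add: oL_iff)
qed

lemma CG_add: assumes f: "f \<in> CG" and g: "g \<in> CG" shows "(\<lambda>a. f a + g a) \<in> CG" unfolding CG_iff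
proof (intro conjI ballI allI impI)
  fix a and \<epsilon> :: real assume a: "a \<in> oL" and \<epsilon>: "\<epsilon> > 0"
  obtain d1 where d1: "d1 > 0" "\<forall>b\<in>oL. cabs (b - a) < d1 \<longrightarrow> cabs (f b - f a) < \<epsilon>" using CG_cont[OF f a \<epsilon>] by blast
  obtain d2 where d2: "d2 > 0" "\<forall>b\<in>oL. cabs (b - a) < d2 \<longrightarrow> cabs (g b - g a) < \<epsilon>" using CG_cont[OF g a \<epsilon>] by blast
  have "cabs ((f b + g b) - (f a + g a)) < \<epsilon>" if "b \<in> oL" "cabs (b - a) < min d1 d2" for b
    using cabs_add_less[of "f b - f a" \<epsilon> "g b - g a"] d1(2) d2(2) that by (simp add: algebra_simps)
  then show "\<exists>\<delta>>0. \<forall>b\<in>oL. cabs (b - a) < \<delta> \<longrightarrow> cabs ((f b + g b) - (f a + g a)) < \<epsilon>"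
    using d1(1) d2(1) by (intro exI[of _ "min d1 d2"]) auto
qed (simp_all add: CG_le[OF f] CG_le[OF g] CG_out[OF f] CG_out[OF g] CG_gal[OF f] CG_gal[OF g] GL_add cabs_add_le)

lemma CG_cmult: assumes f: "f \<in> CG" and c: "c \<in> oL" shows "(\<lambda>a. c * f a) \<in> CG" unfolding CG_iff
proof (intro conjI ballI allI impI)
  fix a and \<epsilon> :: real assume a: "a \<in> oL" and \<epsilon>: "\<epsilon> > 0"
  obtain d where d: "d > 0" "\<forall>b\<in>oL. cabs (b - a) < d \<longrightarrow> cabs (f b - f a) < \<epsilon>" using CG_cont[OF f a \<epsilon>] by blast
  have "cabs (c * f b - c * f a) < \<epsilon>" if "b \<in> oL" "cabs (b - a) < d" for b
    unfolding right_diff_distrib[symmetric] using c d(2) that by (intro cabs_mult_less) (auto simp: oL_iff)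
  then show "\<exists>\<delta>>0. \<forall>b\<in>oL. cabs (b - a) < \<delta> \<longrightarrow> cabs (c * f b - c * f a) < \<epsilon>"
    using d(1) by blast
next
  fix a assume "a \<in> oL" then show "cabs (c * f a) \<le> 1" using CG_le[OF f] c by (intro cabs_le_1_mult) (auto simp: oL_iff)
next
  fix a \<sigma> assume "a \<in> oL" "\<sigma> \<in> GL"
  then show "\<sigma> (c * f a) = c * f (tt \<sigma> * a)" using CG_gal[OF f] c by (simp add: GL_mult GL_fix oL_iff)
qed (use f CG_out in auto)

lemma CG_zero: "(\<lambda>_. 0) \<in> CG" unfolding CG_iff by (auto simp: GL_0 intro: exI[of _ 1])

lemma CG_sum:
  assumes "\<And>i. i \<in> A \<Longrightarrow> c i \<in> oL" "\<And>i. i \<in> A \<Longrightarrow> f i \<in> CG"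
  shows "(\<lambda>a. \<Sum>i\<in>A. c i * f i a) \<in> CG"
  using assms
proof (induction A rule: infinite_finite_induct)
  case (insert i A)
  then show ?case using CG_add[OF CG_cmult[of "f i" "c i"], of "\<lambda>a. \<Sum>i\<in>A. c i * f i a"] by simp
qed (simp_all add: CG_zero)

lemma CG_dvd:
  assumes f: "f \<in> CG" and le: "\<And>a. a \<in> oL \<Longrightarrow> cabs (f a) \<le> cabs \<pi> ^ n"
  shows "(\<lambda>a. f a / \<pi> ^ n) \<in> CG"
  unfolding CG_iff
proof (intro conjI ballI allI impI)
  fix a and \<epsilon> :: real assume a: "a \<in> oL" and \<epsilon>: "\<epsilon> > 0"
  then have e2: "\<epsilon> * cabs \<pi> ^ n > 0" using pi_pos by simp
  obtain d where d: "d > 0" "\<forall>b\<in>oL. cabs (b - a) < d \<longrightarrow> cabs (f b - f a) < \<epsilon> * cabs \<pi> ^ n" using CG_cont[OF f a e2] by blast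
  have "cabs (f b / \<pi> ^ n - f a / \<pi> ^ n) < \<epsilon>" if "b \<in> oL" "cabs (b - a) < d" for b
    unfolding diff_divide_distrib[symmetric] using d(2) that pi_pos by (simp add: divide_less_eq)
  then show "\<exists>\<delta>>0. \<forall>b\<in>oL. cabs (b - a) < \<delta> \<longrightarrow> cabs (f b / \<pi> ^ n - f a / \<pi> ^ n) < \<epsilon>"
    using d(1) by blast
next
  fix a assume "a \<in> oL" then show "cabs (f a / \<pi> ^ n) \<le> 1" using le pi_pos by (simp add: divide_le_eq)
next
  fix a \<sigma> assume a: "a \<in> oL" and s: "\<sigma> \<in> GL"
  have "\<pi> ^ n \<in> L" using oL_power[OF pi_oL] oL_iff by blast
  then show "\<sigma> (f a / \<pi> ^ n) = f (tt \<sigma> * a) / \<pi> ^ n" using CG_gal[OF f a s] s by (simp only: GL_divide GL_fix)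
qed (use f CG_out in auto)

section \<open>The functions a -> P_n(a \<Omega>) and scaling of the argument by \<pi>\<close>

definition ff :: "nat \<Rightarrow> 'c \<Rightarrow> 'c" where "ff n a = (if a \<in> oL then Kap (a * \<Omega>) $ n else 0)"

lemma ff_CG: "ff n \<in> CG" unfolding CG_iff
proof (intro conjI ballI allI impI)
  fix a and \<epsilon> :: real assume a: "a \<in> oL" and \<epsilon>: "\<epsilon> > 0"
  obtain d where d: "d > 0" "\<forall>y. cabs (y - a * \<Omega>) < d \<longrightarrow> cabs (poly (P_poly G n) y - poly (P_poly G n) (a * \<Omega>)) < \<epsilon>"
    using poly_continuous_cabs[OF \<epsilon>, of "a * \<Omega>"] by blast
  define r where "r = d / (1 + cabs \<Omega>)"
  have O: "1 + cabs \<Omega> > 0" using cabs_nonneg[of \<Omega>] by linarith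
  have r: "r > 0" using d(1) O by (simp add: r_def)
  have "cabs (ff n b - ff n a) < \<epsilon>" if b: "b \<in> oL" "cabs (b - a) < r" for b
  proof -
    have "cabs (b * \<Omega> - a * \<Omega>) = cabs (b - a) * cabs \<Omega>" by (simp flip: left_diff_distrib)
    also have "\<dots> \<le> cabs (b - a) * (1 + cabs \<Omega>)" by (intro mult_left_mono) auto
    also have "\<dots> < d" using b(2) O by (simp add: r_def less_divide_eq)
    finally show ?thesis using d(2) a b(1) by (simp add: ff_def poly_P)
  qed
  then show "\<exists>\<delta>>0. \<forall>b\<in>oL. cabs (b - a) < \<delta> \<longrightarrow> cabs (ff n b - ff n a) < \<epsilon>" using r by blast
next
  fix a assume "a \<in> oL" then show "cabs (ff n a) \<le> 1" using intgD[OF Kap_intg] by (simp add: ff_def)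
next
  fix a \<sigma> assume a: "a \<in> oL" and s: "\<sigma> \<in> GL"
  have "\<sigma> (a * \<Omega>) = tt \<sigma> * a * \<Omega>" using a s sigma_Omega[OF s] by (simp add: GL_mult GL_fix oL_iff mult_ac)
  then show "\<sigma> (ff n a) = ff n (tt \<sigma> * a)" using GL_Kap[OF s] a oL_mult[OF tt_oL[OF s]] by (simp add: ff_def)
qed (simp add: ff_def)

lemma ff_0: "ff 0 a = (if a \<in> oL then 1 else 0)" by (simp add: ff_def Kap_0)

lemma Kap_pi: "Kap (\<pi> * c) $ n = (\<Sum>k\<le>n. (e ^ k) $ n * Kap c $ k)"
  unfolding Kap_br[symmetric] e_br[symmetric] by (simp add: fps_compose_nth atLeast0AtMost mult.commute)

text \<open>Functions vanish outside \<open>oL\<close>, so this is f transported to \<pi>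
  \<open>oL\<close> and extended by 0 to the units.\<close>

definition shrink :: "('c \<Rightarrow> 'c) \<Rightarrow> 'c \<Rightarrow> 'c" where "shrink f a = f (a / \<pi>)"

definition stretch :: "('c \<Rightarrow> 'c) \<Rightarrow> 'c \<Rightarrow> 'c" where "stretch f a = (if a \<in> oL then f (\<pi> * a) else 0)"

lemma div_pi_oL: "a / \<pi> \<in> oL \<Longrightarrow> a \<in> oL" using oL_mult[OF pi_oL, of "a / \<pi>"] pi_nz by simp

text \<open>Points of \<open>oL\<close> at distance less than |\<pi>| lie in \<pi> \<open>oL\<close>
  simultaneously or not at all, so extension by 0 preserves continuity.\<close>

lemma shrink_CG: assumes f: "f \<in> CG" shows "shrink f \<in> CG" unfolding CG_iff
proof (intro conjI ballI allI impI)
  fix a and \<epsilon> :: real assume a: "a \<in> oL" and \<epsilon>: "\<epsilon> > 0"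
  have near: "b / \<pi> - a / \<pi> \<in> oL" if b: "b \<in> oL" "cabs (b - a) < cabs \<pi>" for b
  proof -
    have "b - a \<in> L" "cabs (b - a) \<le> cabs \<pi> ^ 1" using oL_diff[OF b(1) a] b(2) by (auto simp: oL_iff)
    then obtain y where "y \<in> oL" "b - a = \<pi> ^ 1 * y" using L_dvd_power by blast
    then have "y \<in> oL" "(b - a) / \<pi> = y" using pi_nz by auto
    then show ?thesis by (simp add: diff_divide_distrib)
  qed
  show "\<exists>\<delta>>0. \<forall>b\<in>oL. cabs (b - a) < \<delta> \<longrightarrow> cabs (shrink f b - shrink f a) < \<epsilon>"
  proof (cases "a / \<pi> \<in> oL")
    case True
    obtain d where d: "d > 0" "\<forall>b\<in>oL. cabs (b - a / \<pi>) < d \<longrightarrow> cabs (f b - f (a / \<pi>)) < \<epsilon>" using CG_cont[OF f True \<epsilon>] by blast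
    have "cabs (shrink f b - shrink f a) < \<epsilon>" if b: "b \<in> oL" "cabs (b - a) < min 1 d * cabs \<pi>" for b
    proof -
      have "min 1 d * cabs \<pi> \<le> 1 * cabs \<pi>" by (intro mult_right_mono) auto
      then have bo: "b / \<pi> \<in> oL" using oL_add[OF near[OF b(1)] True] b(2) by simp
      have "cabs (b / \<pi> - a / \<pi>) < min 1 d"
        unfolding diff_divide_distrib[symmetric] cabs_divide using b(2) pi_pos by (simp only: divide_less_eq if_True)
      then show ?thesis unfolding shrink_def using d(2) bo by simp
    qed
    moreover have "min 1 d * cabs \<pi> > 0" using d(1) pi_pos by simp
    ultimately show ?thesis by blast
  next
    case False
    have "b / \<pi> \<notin> oL" if b: "b \<in> oL" "cabs (b - a) < cabs \<pi>" for b
    proof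
      assume "b / \<pi> \<in> oL"
      then have "b / \<pi> - (b / \<pi> - a / \<pi>) \<in> oL" using near[OF b] by (rule oL_diff)
      then show False using False by simp
    qed
    then have "\<forall>b\<in>oL. cabs (b - a) < cabs \<pi> \<longrightarrow> cabs (shrink f b - shrink f a) < \<epsilon>"
      using False CG_out[OF f] \<epsilon> by (simp add: shrink_def)
    then show ?thesis using pi_pos by blast
  qed
next
  fix a assume "a \<in> oL" then show "cabs (shrink f a) \<le> 1"
    using CG_le[OF f, of "a / \<pi>"] CG_out[OF f, of "a / \<pi>"] by (cases "a / \<pi> \<in> oL") (auto simp: shrink_def)
next
  fix a \<sigma> assume a: "a \<in> oL" and s: "\<sigma> \<in> GL"
  show "\<sigma> (shrink f a) = shrink f (tt \<sigma> * a)"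
  proof (cases "a / \<pi> \<in> oL")
    case True
    then show ?thesis using CG_gal[OF f True s] by (simp add: shrink_def)
  next
    case False
    have "tt \<sigma> * a / \<pi> \<notin> oL"
    proof
      assume "tt \<sigma> * a / \<pi> \<in> oL"
      then have "inverse (tt \<sigma>) * (tt \<sigma> * a / \<pi>) \<in> oL" using tt_unit[OF s] by (intro oL_mult oL_inverse)
      moreover have "tt \<sigma> \<noteq> 0" using tt_unit[OF s] by auto
      ultimately show False using False by (simp add: field_simps)
    qed
    then show ?thesis using False CG_out[OF f] s by (simp add: shrink_def GL_0)
  qed
next
  fix a :: 'c assume "a \<notin> oL" then show "shrink f a = 0" using div_pi_oL CG_out[OF f] by (auto simp: shrink_def)
qed

lemma stretch_CG: assumes f: "f \<in> CG" shows "stretch f \<in> CG" unfolding CG_iff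
proof (intro conjI ballI allI impI)
  fix a and \<epsilon> :: real assume a: "a \<in> oL" and \<epsilon>: "\<epsilon> > 0"
  obtain d where d: "d > 0" "\<forall>b\<in>oL. cabs (b - \<pi> * a) < d \<longrightarrow> cabs (f b - f (\<pi> * a)) < \<epsilon>"
    using CG_cont[OF f oL_mult[OF pi_oL a] \<epsilon>] by blast
  have "cabs (stretch f b - stretch f a) < \<epsilon>" if b: "b \<in> oL" "cabs (b - a) < d" for b
  proof -
    have "cabs (\<pi> * (b - a)) < d" using pi_lt_1 b(2) by (intro cabs_mult_less) auto
    then show ?thesis using d(2) oL_mult[OF pi_oL b(1)] a b(1) by (simp add: stretch_def right_diff_distrib)
  qed
  then show "\<exists>\<delta>>0. \<forall>b\<in>oL. cabs (b - a) < \<delta> \<longrightarrow> cabs (stretch f b - stretch f a) < \<epsilon>" using d(1) by blast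
next
  fix a \<sigma> assume a: "a \<in> oL" and s: "\<sigma> \<in> GL"
  then show "\<sigma> (stretch f a) = stretch f (tt \<sigma> * a)" using CG_gal[OF f oL_mult[OF pi_oL a] s] oL_mult[OF tt_oL[OF s] a]
    by (simp add: stretch_def mult.left_commute)
qed (use f CG_le oL_mult[OF pi_oL] in \<open>auto simp: stretch_def\<close>)

lemma stretch_ff: "stretch (ff n) = (\<lambda>a. \<Sum>k\<le>n. (e ^ k) $ n * ff k a)"
proof
  fix a show "stretch (ff n) a = (\<Sum>k\<le>n. (e ^ k) $ n * ff k a)"
    using Kap_pi[of "a * \<Omega>" n] oL_mult[OF pi_oL, of a] by (simp add: stretch_def ff_def mult.assoc)
qed

lemma stretch_iter: "a \<in> oL \<Longrightarrow> (stretch ^^ m) f a = f (\<pi> ^ m * a)"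
proof (induction m arbitrary: a)
  case (Suc m)
  have "(stretch ^^ Suc m) f a = (stretch ^^ m) f (\<pi> * a)" using Suc.prems by (simp add: stretch_def)
  also have "\<dots> = f (\<pi> ^ m * (\<pi> * a))" using Suc.IH oL_mult[OF pi_oL Suc.prems] by blast
  finally show ?case by (simp add: mult_ac)
qed simp

context
  assumes Om: "\<Omega> \<noteq> 0"
begin

lemma tt_comp: assumes s: "\<sigma> \<in> GL" and r: "\<rho> \<in> GL" shows "tt (\<lambda>x. \<sigma> (\<rho> x)) = tt \<sigma> * tt \<rho>"
proof -
  have "tt (\<lambda>x. \<sigma> (\<rho> x)) * \<Omega> = \<sigma> (\<rho> \<Omega>)" using sigma_Omega[OF GL_comp[OF s r]] by simp
  also have "\<dots> = tt \<rho> * (tt \<sigma> * \<Omega>)" unfolding sigma_Omega[OF r] GL_mult[OF s] GL_fix[OF s tt_unit(1)[OF r]] sigma_Omega[OF s] ..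
  finally show ?thesis using Om by (simp add: mult_ac)
qed

lemma tt_id: "tt (\<lambda>x. x) = 1" using sigma_Omega[OF GL_id] Om by simp

definition kert :: "('c \<Rightarrow> 'c) set" where "kert = {\<sigma>\<in>GL. tt \<sigma> = 1}"

lemma subgp_kert: "subgp kert" unfolding subgp_def kert_def using GL_id GL_comp tt_id tt_comp by auto

text \<open>The inverse of \<rho> composed with \<sigma> lies in the kernel of \<tau> and therefore
  fixes x.\<close>

lemma same_tt: assumes s: "\<sigma> \<in> GL" and r: "\<rho> \<in> GL" and eq: "tt \<sigma> = tt \<rho>" and x: "\<forall>\<sigma>\<in>kert. \<sigma> x = x" shows "\<sigma> x = \<rho> x"
proof -
  obtain \<eta> where h: "\<eta> \<in> GL" "\<forall>x. \<eta> (\<rho> x) = x" "\<forall>x. \<rho> (\<eta> x) = x" using GL_inv[OF r] by blast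
  have "tt \<rho> * tt \<eta> = 1" using tt_comp[OF r h(1)] h(3) tt_id by simp
  then have "tt (\<lambda>x. \<eta> (\<sigma> x)) = 1" using tt_comp[OF h(1) s] eq by (simp add: mult.commute)
  then have "(\<lambda>x. \<eta> (\<sigma> x)) \<in> kert" using GL_comp[OF h(1) s] by (simp add: kert_def)
  from x[rule_format, OF this] have "\<eta> (\<sigma> x) = x" .
  then show ?thesis using h(3) by metis
qed

lemma GL_iter: "\<sigma> \<in> GL \<Longrightarrow> \<sigma> ^^ n \<in> GL \<and> tt (\<sigma> ^^ n) = tt \<sigma> ^ n"
proof (induction n)
  case 0 then show ?case using GL_id tt_id by (simp add: id_def)
next
  case (Suc n)
  then show ?case using GL_comp[of \<sigma> "\<sigma> ^^ n"] tt_comp[of \<sigma> "\<sigma> ^^ n"] by (simp add: comp_def)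
qed

text \<open>Among the iterates of \<sigma> at y two coincide, so some period is at most the number c
  of conjugates. All such periods divide c!, which does not depend on \<sigma>.\<close>

lemma iter_fixed:
  assumes y: "y \<in> Lbar" shows "\<exists>M>0. \<forall>\<sigma>\<in>GL. (\<sigma> ^^ M) y = y"
proof -
  have fin: "finite (orbit GL y)" using finite_orbit[OF subset_refl y] .
  define c where "c = card (orbit GL y)"
  have "(\<sigma> ^^ fact c) y = y" if s: "\<sigma> \<in> GL" for \<sigma>
  proof -
    have sub: "(\<lambda>i. (\<sigma> ^^ i) y) ` {..c} \<subseteq> orbit GL y" using GL_iter[OF s] by (auto simp: orbit_def)
    have "\<not> inj_on (\<lambda>i. (\<sigma> ^^ i) y) {..c}"
    proof
      assume "inj_on (\<lambda>i. (\<sigma> ^^ i) y) {..c}"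
      then have "card {..c} \<le> card (orbit GL y)" using sub fin by (rule card_inj_on_le)
      then show False by (simp add: c_def)
    qed
    then obtain i j where ij: "i < j" "j \<le> c" "(\<sigma> ^^ i) y = (\<sigma> ^^ j) y" unfolding inj_on_def by (metis atMost_iff nat_neq_iff)
    define d where "d = j - i"
    have d: "0 < d" "d \<le> c" using ij by (auto simp: d_def)
    have "(\<sigma> ^^ i) ((\<sigma> ^^ d) y) = (\<sigma> ^^ i) y" using ij by (simp add: d_def funpow_add[symmetric, unfolded comp_def, THEN fun_cong])
    then have dy: "(\<sigma> ^^ d) y = y" using GL_inj[of "\<sigma> ^^ i"] GL_iter[OF s] by (simp add: inj_def)
    have iter: "((\<sigma> ^^ d) ^^ m) y = y" for m by (induction m) (simp_all add: dy)
    have "d dvd fact c" using d by (intro dvd_fact) auto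
    then obtain m where "fact c = d * m" by blast
    then show ?thesis using iter[of m] by (simp add: funpow_mult)
  qed
  then show ?thesis by (intro exI[of _ "fact c"]) auto
qed

text \<open>By Ax--Sen--Tate, \<open>x\<close> is close to an algebraic \<open>y\<close> fixed by the kernel of \<open>\<tau>\<close>.  Some power \<open>\<sigma>\<^sup>M\<close>, with \<open>M\<close>
  independent of \<open>\<sigma>\<close>, fixes \<open>y\<close>, and a unit near \<open>1\<close> is an \<open>M\<close>-th power.\<close>

lemma orbit_continuous:
  assumes x: "x \<in> oi" and \<epsilon>: "\<epsilon> > 0"
  shows "\<exists>\<delta>>0. \<forall>\<sigma>\<in>GL. cabs (tt \<sigma> - 1) < \<delta> \<longrightarrow> cabs (\<sigma> x - x) < \<epsilon>"
proof -
  have "\<forall>\<sigma>\<in>kert. \<sigma> x = x" using x by (simp add: oi_iff kert_def)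
  then obtain y where y: "y \<in> Lbar" "\<forall>\<sigma>\<in>kert. \<sigma> y = y" "cabs (x - y) < \<epsilon>" using Ax_Sen_Tate[OF subgp_kert _ \<epsilon>] by blast
  obtain M where M: "M > 0" "\<forall>\<sigma>\<in>GL. (\<sigma> ^^ M) y = y" using iter_fixed[OF y(1)] by blast
  obtain \<delta> where \<delta>: "\<delta> > 0" "\<forall>u\<in>L. cabs (u - 1) < \<delta> \<longrightarrow> (\<exists>v\<in>L. cabs v = 1 \<and> v ^ M = u)" using units_power_open[OF M(1)] by blast
  have "cabs (\<sigma> x - x) < \<epsilon>" if s: "\<sigma> \<in> GL" "cabs (tt \<sigma> - 1) < \<delta>" for \<sigma>
  proof -
    obtain v where v: "v \<in> L" "cabs v = 1" "v ^ M = tt \<sigma>" using \<delta>(2) s tt_unit(1) by blast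
    obtain \<rho> where r: "\<rho> \<in> GL" "tt \<rho> = v" using tt_onto v by blast
    have "\<sigma> y = (\<rho> ^^ M) y"       using GL_iter[OF r(1), of M] r(2) v(3) by (intro same_tt[OF s(1) _ _ y(2)]) simp_all
    then have sy: "\<sigma> y = y" using M(2) r(1) by simp
    have "cabs (\<sigma> (x - y)) < \<epsilon>" using GL_cabs[OF s(1)] y(3) by simp
    then have "cabs (\<sigma> (x - y) - (x - y)) < \<epsilon>" using y(3) by (rule cabs_diff_less)
    then show ?thesis using GL_diff[OF s(1)] sy by simp
  qed
  then show ?thesis using \<delta>(1) by blast
qed

text \<open>The orbit map of x on the units, extended by 0. By \<open>same_tt\<close> the value does
  not depend on the chosen \<sigma>.\<close>

definition dl :: "'c \<Rightarrow> 'c \<Rightarrow> 'c" where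
  "dl x u = (if u \<in> L \<and> cabs u = 1 then (SOME \<sigma>. \<sigma> \<in> GL \<and> tt \<sigma> = u) x else 0)"

lemma dl_tt: assumes x: "x \<in> oi" and s: "\<sigma> \<in> GL" shows "dl x (tt \<sigma>) = \<sigma> x"
proof -
  define \<rho> where "\<rho> = (SOME \<rho>. \<rho> \<in> GL \<and> tt \<rho> = tt \<sigma>)"
  have r: "\<rho> \<in> GL \<and> tt \<rho> = tt \<sigma>" unfolding \<rho>_def by (rule someI[of "\<lambda>\<rho>. \<rho> \<in> GL \<and> tt \<rho> = tt \<sigma>" \<sigma>]) (use s in simp)
  have "\<forall>\<sigma>\<in>kert. \<sigma> x = x" using x by (simp add: oi_iff kert_def)
  then have "\<rho> x = \<sigma> x" using r s same_tt by blast
  then show ?thesis using tt_unit[OF s] by (simp add: dl_def flip: \<rho>_def)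
qed

lemma dl_out: "\<not> (u \<in> L \<and> cabs u = 1) \<Longrightarrow> dl x u = 0" unfolding dl_def by (rule if_not_P)

lemma dl_cases: obtains "\<not> (u \<in> L \<and> cabs u = 1)" | \<sigma> where "\<sigma> \<in> GL" "tt \<sigma> = u" using tt_onto by blast

lemma dl_add: assumes x: "x \<in> oi" and y: "y \<in> oi" shows "dl (x + y) u = dl x u + dl y u"
proof (cases rule: dl_cases[of u])
  case (2 \<sigma>)
  then show ?thesis using dl_tt[OF x 2(1)] dl_tt[OF y 2(1)] dl_tt[OF oi_add[OF x y] 2(1)] GL_add[OF 2(1)] by simp
qed (simp add: dl_out)

lemma dl_cmult: assumes a: "a \<in> oL" and x: "x \<in> oi" shows "dl (a * x) u = a * dl x u"
proof (cases rule: dl_cases[of u])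
  case (2 \<sigma>)
  have "\<sigma> a = a" using GL_fix[OF 2(1)] a by (simp add: oL_iff)
  then show ?thesis using 2 dl_tt[OF x 2(1)] dl_tt[OF oi_cmult[OF a x] 2(1)] GL_mult[OF 2(1), of a x] by simp
qed (simp add: dl_out)

lemma dl_CG: assumes x: "x \<in> oi" shows "dl x \<in> CG" unfolding CG_iff
proof (intro conjI ballI allI impI)
  fix a and \<epsilon> :: real assume a: "a \<in> oL" and \<epsilon>: "\<epsilon> > 0"
  obtain \<delta> where \<delta>: "\<delta> > 0" "\<forall>\<sigma>\<in>GL. cabs (tt \<sigma> - 1) < \<delta> \<longrightarrow> cabs (\<sigma> x - x) < \<epsilon>" using orbit_continuous[OF x \<epsilon>] by blast
  have "cabs (dl x b - dl x a) < \<epsilon>" if b: "b \<in> oL" "cabs (b - a) < min 1 \<delta>" for b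
  proof (cases "cabs a = 1")
    case True
    then have b1: "cabs b = 1" using b(2) cabs_eq_of_near[of b a] by simp
    obtain \<sigma> where s: "\<sigma> \<in> GL" "tt \<sigma> = a" using tt_onto True a oL_iff by blast
    \<comment> \<open>Continuity at a is reduced to continuity at 1: the values at b and a are
      \<sigma>(\<rho>(x)) and \<sigma>(x), where \<tau>(\<rho>) = b/a and \<sigma> is an
      isometry.\<close>
    have "inverse a * b \<in> L" using oL_mult[OF oL_inverse b(1), of a] a True by (simp add: oL_iff)
    then obtain \<rho> where r: "\<rho> \<in> GL" "tt \<rho> = inverse a * b" using tt_onto b1 True by force
    have an: "a \<noteq> 0" using True by auto
    have "tt (\<lambda>x. \<sigma> (\<rho> x)) = b" using tt_comp[OF s(1) r(1)] an by (simp add: s r)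
    then have "dl x b = \<sigma> (\<rho> x)" using dl_tt[OF x GL_comp[OF s(1) r(1)]] by simp
    moreover have "dl x a = \<sigma> x" using dl_tt[OF x s(1)] s(2) by simp
    moreover have "cabs (\<rho> x - x) < \<epsilon>"
    proof -
      have "tt \<rho> - 1 = inverse a * (b - a)" using an by (simp add: r field_simps)
      then have "cabs (tt \<rho> - 1) = cabs (b - a)" using True by simp
      then show ?thesis using \<delta>(2) r(1) b(2) by simp
    qed
    ultimately show ?thesis using GL_cabs[OF s(1), of "\<rho> x - x"] GL_diff[OF s(1)] by simp
  next
    case False
    then have "cabs b \<noteq> 1" using b(2) cabs_eq_of_near[of a b] by (auto simp: cabs_minus_commute)
    then show ?thesis using False \<epsilon> dl_out by simp
  qed
  then show "\<exists>\<delta>>0. \<forall>b\<in>oL. cabs (b - a) < \<delta> \<longrightarrow> cabs (dl x b - dl x a) < \<epsilon>"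
    using \<delta>(1) by (intro exI[of _ "min 1 \<delta>"]) auto
next
  fix a show "cabs (dl x a) \<le> 1" by (rule dl_cases[of a]) (use x dl_tt dl_out GL_cabs oi_iff in auto)
next
  fix a :: 'c assume "a \<notin> oL" then show "dl x a = 0" by (intro dl_out) (auto simp: oL_iff)
next
  fix a \<sigma> assume a: "a \<in> oL" and s: "\<sigma> \<in> GL"
  show "\<sigma> (dl x a) = dl x (tt \<sigma> * a)"
  proof (cases rule: dl_cases[of a])
    case 1
    then have "cabs (tt \<sigma> * a) \<noteq> 1" using a tt_unit[OF s] by (simp add: oL_iff)
    then show ?thesis using 1 dl_out GL_0[OF s] by simp
  next
    case (2 \<rho>)
    then show ?thesis using dl_tt[OF x] tt_comp[OF s 2(1)] GL_comp[OF s 2(1)] by metis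
  qed
qed

lemma CG_decomp: assumes f: "f \<in> CG" shows "f = (\<lambda>a. dl (f 1) a + shrink (stretch f) a)"
proof
  fix a
  show "f a = dl (f 1) a + shrink (stretch f) a"
  proof (cases rule: dl_cases[of a])
    case 1
    have "a / \<pi> \<in> oL" if a: "a \<in> oL"
    proof -
      have "a \<in> {x \<in> L. cabs x < 1}" using a 1 by (simp add: oL_iff)
      then have "a \<in> (\<lambda>x. \<pi> * x) ` oL" using unif unfolding uniformizer_def by blast
      then show ?thesis using pi_nz by auto
    qed
    then show ?thesis using 1 dl_out div_pi_oL[of a] CG_out[OF f] pi_nz by (auto simp: shrink_def stretch_def)
  next
    case (2 \<sigma>)
    have "a / \<pi> \<notin> oL" using tt_unit[OF 2(1)] 2(2) pi_lt_1 pi_pos by (auto simp: oL_iff divide_le_eq)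
    moreover have "\<sigma> (f 1) = f a" using CG_gal[OF f oL_1 2(1)] 2(2) by simp
    ultimately show ?thesis using dl_tt[OF CG_oi[OF f oL_1] 2(1)] 2(2) by (simp add: shrink_def stretch_def)
  qed
qed

end

end

section \<open>The second map\<close>

context Dual begin

abbreviation "HC \<equiv> Hom_C_Gal p L \<pi> G \<iota>"
abbreviation "KS \<equiv> K_star L G \<Omega>"

lemma KS_nth: "KS l $ n = l (ff n)"
proof -
  have "(\<lambda>a. if a \<in> oL then poly (P_poly G n) (a * \<Omega>) else 0) = ff n" by (rule ext) (simp add: ff_def poly_P)
  then show ?thesis by (simp add: K_star_def)
qed

lemma HC_add: "l \<in> HC \<Longrightarrow> f \<in> CG \<Longrightarrow> g \<in> CG \<Longrightarrow> l (\<lambda>a. f a + g a) = l f + l g"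
  and HC_cmult: "l \<in> HC \<Longrightarrow> c \<in> oL \<Longrightarrow> f \<in> CG \<Longrightarrow> l (\<lambda>a. c * f a) = \<iota> c * l f"
  and HC_out: "l \<in> HC \<Longrightarrow> f \<notin> CG \<Longrightarrow> l f = 0" by (auto simp: Hom_C_Gal_def Hom_o_def)

lemma HC_I:
  assumes "\<And>f g. f \<in> CG \<Longrightarrow> g \<in> CG \<Longrightarrow> l (\<lambda>a. f a + g a) = l f + l g"
    "\<And>c f. c \<in> oL \<Longrightarrow> f \<in> CG \<Longrightarrow> l (\<lambda>a. c * f a) = \<iota> c * l f" "\<And>f. f \<notin> CG \<Longrightarrow> l f = 0"
  shows "l \<in> HC"
  using assms by (simp add: Hom_C_Gal_def Hom_o_def)

lemma HC_zero: "l \<in> HC \<Longrightarrow> l (\<lambda>_. 0) = 0" using HC_cmult[of l 0 "\<lambda>_. 0"] CG_zero oL_0 by (simp add: io_0)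

lemma HC_sum:
  assumes l: "l \<in> HC" and c: "\<And>i. i \<in> A \<Longrightarrow> c i \<in> oL" and f: "\<And>i. i \<in> A \<Longrightarrow> f i \<in> CG"
  shows "l (\<lambda>a. \<Sum>i\<in>A. c i * f i a) = (\<Sum>i\<in>A. \<iota> (c i) * l (f i))"
  using c f
proof (induction A rule: infinite_finite_induct)
  case (insert i A)
  have "l (\<lambda>a. c i * f i a + (\<Sum>i\<in>A. c i * f i a)) = l (\<lambda>a. c i * f i a) + l (\<lambda>a. \<Sum>i\<in>A. c i * f i a)"
    using insert.prems by (intro HC_add[OF l] CG_cmult CG_sum) auto
  then show ?case using insert HC_cmult[OF l] by simp
qed (simp_all add: HC_zero[OF l])

lemma HC_diff: assumes l: "l \<in> HC" and k: "k \<in> HC" shows "(\<lambda>f. l f - k f) \<in> HC"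
  by (rule HC_I) (simp_all add: HC_add[OF l] HC_add[OF k] HC_cmult[OF l] HC_cmult[OF k] HC_out[OF l] HC_out[OF k] right_diff_distrib)

text \<open>The transpose of \<open>shrink\<close>; by \<open>PS_KS\<close> it corresponds to psi_q
  under the second map.\<close>

definition shrink_dual :: "(('c \<Rightarrow> 'c) \<Rightarrow> 's) \<Rightarrow> ('c \<Rightarrow> 'c) \<Rightarrow> 's" where
  "shrink_dual l f = (if f \<in> CG then l (shrink f) else 0)"

lemma shrink_dual_HC: assumes l: "l \<in> HC" shows "shrink_dual l \<in> HC"
proof (rule HC_I)
  fix f g assume fg: "f \<in> CG" "g \<in> CG"
  have "shrink (\<lambda>a. f a + g a) = (\<lambda>a. shrink f a + shrink g a)" by (simp add: shrink_def fun_eq_iff)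
  then show "shrink_dual l (\<lambda>a. f a + g a) = shrink_dual l f + shrink_dual l g"
    using HC_add[OF l shrink_CG[OF fg(1)] shrink_CG[OF fg(2)]] CG_add[OF fg] fg by (simp add: shrink_dual_def)
next
  fix c f assume cf: "c \<in> oL" "f \<in> CG"
  have "shrink (\<lambda>a. c * f a) = (\<lambda>a. c * shrink f a)" by (simp add: shrink_def fun_eq_iff)
  then show "shrink_dual l (\<lambda>a. c * f a) = \<iota> c * shrink_dual l f"
    using HC_cmult[OF l cf(1) shrink_CG[OF cf(2)]] CG_cmult[OF cf(2,1)] cf(2) by (simp add: shrink_dual_def)
qed (simp add: shrink_dual_def)

lemma shrink_dual_iter: "l \<in> HC \<Longrightarrow> (shrink_dual ^^ n) l \<in> HC" by (induction n) (auto simp: shrink_dual_HC)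

lemma ph_iter_K1:
  assumes l: "l \<in> Hoi" shows "(ph ^^ m) (K1 l) $ n = l (Kap (\<pi> ^ m * \<Omega>) $ n)"
proof (induction m arbitrary: n)
  case 0 then show ?case by (simp add: K1_nth)
next
  case (Suc m)
  have "(ph ^^ Suc m) (K1 l) $ n = (\<Sum>i\<le>n. \<iota> ((e ^ i) $ n) * l (Kap (\<pi> ^ m * \<Omega>) $ i))" by (simp add: ph_nth Suc.IH)
  also have "\<dots> = l (\<Sum>i\<le>n. (e ^ i) $ n * Kap (\<pi> ^ m * \<Omega>) $ i)"
    by (rule Hoi_sum[OF l, symmetric]) (auto intro: e_pow_oL Kap_oi oL_power[OF pi_oL])
  also have "\<dots> = l (Kap (\<pi> ^ Suc m * \<Omega>) $ n)" by (simp add: Kap_pi[symmetric] mult.assoc)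
  finally show ?case .
qed

lemma cong_pi: assumes "cong k s 0" shows "cong (k + n) (\<iota> (\<pi> ^ n) * s) 0"
proof -
  obtain r where "s = \<iota> (\<pi> ^ k) * r" using assms by (auto simp: adic_cong_def)
  then have "\<iota> (\<pi> ^ n) * s - 0 = \<iota> (\<pi> ^ (k + n)) * r"
    using io_mult[OF oL_power[OF pi_oL, of n] oL_power[OF pi_oL, of k]] by (simp add: power_add mult_ac)
  then show ?thesis unfolding adic_cong_def by blast
qed

text \<open>The matrix of \<open>ph\<close> is triangular with diagonal entry \<pi>^n. In degree n >
  0 the diagonal gains a factor \<pi>, the lower degrees are already divisible by one power more,
  and degree 0 does not contribute.\<close>

lemma ph_iter_small: "n \<ge> 1 \<Longrightarrow> cong (Suc M - n) ((ph ^^ M) H $ n) 0"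
proof (induction M arbitrary: n)
  case 0 then show ?case by (simp add: cong_0)
next
  case (Suc M)
  have "cong (Suc (Suc M) - n) (\<Sum>i\<le>n. \<iota> ((e ^ i) $ n) * (ph ^^ M) H $ i) (\<Sum>i\<le>n. 0)"
  proof (rule cong_sum)
    fix i assume "i \<in> {..n}"
    then consider "i = 0" | "0 < i" "i < n" | "i = n" by fastforce
    then show "cong (Suc (Suc M) - n) (\<iota> ((e ^ i) $ n) * (ph ^^ M) H $ i) 0"
    proof cases
      case 1 then show ?thesis using Suc.prems by (simp add: io_0 cong_refl)
    next
      case 2
      have "cong (Suc M - i) ((ph ^^ M) H $ i) 0" using 2 by (intro Suc.IH) simp
      then have "cong (Suc (Suc M) - n) ((ph ^^ M) H $ i) 0" using 2 by (intro cong_mono[of "Suc (Suc M) - n" "Suc M - i"]) auto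
      then show ?thesis using cong_mult[of _ _ 0] by simp
    next
      case 3
      have "(e ^ n) $ n = \<pi> ^ n" using startsby_zero_power_nth_same[OF e_0, of n] e_props(3) by simp
      then have "cong (Suc M - n + n) (\<iota> ((e ^ i) $ n) * (ph ^^ M) H $ i) 0" using cong_pi[OF Suc.IH[OF Suc.prems]] 3 by simp
      then show ?thesis using Suc.prems by (intro cong_mono[of "Suc (Suc M) - n" "Suc M - n + n"]) auto
    qed
  qed
  then show ?case by (simp add: ph_nth)
qed

lemma ph_iter_diff: "(ph ^^ m) (F - H) = (ph ^^ m) F - (ph ^^ m) H" by (induction m) (simp_all add: ph_diff)

context
  assumes Om: "\<Omega> \<noteq> 0"
begin

text \<open>The part of a functional that sees only functions supported on the units, which are
  given by their values at 1.\<close>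

definition res_dual :: "(('c \<Rightarrow> 'c) \<Rightarrow> 's) \<Rightarrow> 'c \<Rightarrow> 's" where
  "res_dual l x = (if x \<in> oi then l (dl x) else 0)"

lemma res_dual_Hoi: assumes l: "l \<in> HC" shows "res_dual l \<in> Hoi"
proof -
  have "res_dual l (x + y) = res_dual l x + res_dual l y" if xy: "x \<in> oi" "y \<in> oi" for x y
  proof -
    have "dl (x + y) = (\<lambda>u. dl x u + dl y u)" using dl_add[OF Om xy] by blast
    then show ?thesis using HC_add[OF l dl_CG[OF Om xy(1)] dl_CG[OF Om xy(2)]] oi_add[OF xy] xy by (simp add: res_dual_def)
  qed
  moreover have "res_dual l (a * x) = \<iota> a * res_dual l x" if ax: "a \<in> oL" "x \<in> oi" for a x
  proof -
    have "dl (a * x) = (\<lambda>u. a * dl x u)" using dl_cmult[OF Om ax] by blast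
    then show ?thesis using HC_cmult[OF l ax(1) dl_CG[OF Om ax(2)]] oi_cmult[OF ax] ax(2) by (simp add: res_dual_def)
  qed
  ultimately show ?thesis by (simp add: Hom_o_infty_def Hom_o_def res_dual_def)
qed

lemma HC_decomp: assumes l: "l \<in> HC" and f: "f \<in> CG" shows "l f = res_dual l (f 1) + shrink_dual l (stretch f)"
proof -
  have "l (\<lambda>a. dl (f 1) a + shrink (stretch f) a) = l (dl (f 1)) + l (shrink (stretch f))" using f by (intro HC_add[OF l] dl_CG[OF Om] shrink_CG stretch_CG CG_oi oL_1)
  then show ?thesis using CG_decomp[OF Om f] CG_oi[OF f oL_1] stretch_CG[OF f] by (simp add: res_dual_def shrink_dual_def)
qed

lemma KS_decomp: assumes l: "l \<in> HC" shows "KS l = K1 (res_dual l) + ph (KS (shrink_dual l))"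
proof (rule fps_ext)
  fix n
  have "shrink_dual l (stretch (ff n)) = (\<Sum>k\<le>n. \<iota> ((e ^ k) $ n) * shrink_dual l (ff k))"
    unfolding stretch_ff by (rule HC_sum[OF shrink_dual_HC[OF l]]) (auto intro: e_pow_oL ff_CG)
  moreover have "ff n 1 = Kap \<Omega> $ n" using oL_1 by (simp add: ff_def)
  ultimately show "KS l $ n = (K1 (res_dual l) + ph (KS (shrink_dual l))) $ n" using HC_decomp[OF l ff_CG, of n] by (simp add: KS_nth K1_nth ph_nth)
qed

lemma PS_KS: assumes l: "l \<in> HC" shows "PS (KS l) = kf (of_nat q) * KS (shrink_dual l)"
proof -
  have "PS (K1 (res_dual l)) = 0" using K1_kernel[OF res_dual_Hoi[OF l]] kernel_iff by blast
  then show ?thesis using KS_decomp[OF l] by (metis PS_add PS_ph add_0)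
qed

lemma KS_int: assumes l: "l \<in> HC" shows "KS l \<in> IntS"
proof -
  have "(PS ^^ n) (KS l) = kf (of_nat q ^ n) * KS ((shrink_dual ^^ n) l)" for n
  proof (induction n)
    case 0 then show ?case by (simp add: kf_1)
  next
    case (Suc n)
    have "(PS ^^ Suc n) (KS l) = kf (of_nat q ^ n) * (kf (of_nat q) * KS ((shrink_dual ^^ Suc n) l))"
      using Suc.IH PS_KS[OF shrink_dual_iter[OF l]] by (simp add: PS_cmul)
    also have "\<dots> = kf (of_nat q ^ Suc n) * KS ((shrink_dual ^^ Suc n) l)"
      using oL_of_nat oL_power[OF oL_of_nat] by (subst kf_mult[symmetric]) (auto simp: mult.commute)
    finally show ?case .
  qed
  then show ?thesis unfolding int_iff by blast
qed

lemma CG_near_0: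
  assumes f: "f \<in> CG" shows "\<exists>M. \<forall>m\<ge>M. \<forall>a\<in>oL. cabs (f (\<pi> ^ m * a) - f 0) \<le> cabs \<pi> ^ R"
proof -
  have "cabs \<pi> ^ R > 0" using pi_pos by simp
  then obtain d where d: "d > 0" "\<forall>b\<in>oL. cabs (b - 0) < d \<longrightarrow> cabs (f b - f 0) < cabs \<pi> ^ R" using CG_cont[OF f oL_0] by blast
  obtain M where M: "\<forall>m\<ge>M. cabs \<pi> ^ m < d" using small_power_mono[of "cabs \<pi>" d] pi_lt_1 d(1) by auto
  have "cabs (f (\<pi> ^ m * a) - f 0) \<le> cabs \<pi> ^ R" if m: "m \<ge> M" and a: "a \<in> oL" for m a
  proof -
    have "cabs (a * \<pi> ^ m) < d" using M m a by (intro cabs_mult_less) (auto simp: oL_iff)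
    then have "cabs (\<pi> ^ m * a - 0) < d" by (simp add: mult.commute)
    then show ?thesis using d(2) oL_mult[OF oL_power[OF pi_oL] a] by (intro less_imp_le) blast
  qed
  then show ?thesis by blast
qed

lemma KS_eq_0: assumes l: "l \<in> HC" and K: "KS l = 0" shows "l f = 0"
proof -
  have step: "KS (shrink_dual l) = 0 \<and> (\<forall>f\<in>CG. l f = shrink_dual l (stretch f))" if l: "l \<in> HC" and K: "KS l = 0" for l
  proof -
    have "kf (of_nat q) * KS (shrink_dual l) = kf (of_nat q) * 0" using PS_KS[OF l] K PS_0 by simp
    then have z: "KS (shrink_dual l) = 0" using kf_cancel[of "of_nat q"] nzL_q[of 1] by simp
    then have "K1 (res_dual l) = 0" using KS_decomp[OF l] K ph_0 by simp
    then have "res_dual l x = 0" for x using K1_eq_0[OF res_dual_Hoi[OF l]] by blast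
    then show ?thesis using z HC_decomp[OF l] by simp
  qed
  have iter: "KS ((shrink_dual ^^ m) l) = 0 \<and> (\<forall>f\<in>CG. (stretch ^^ m) f \<in> CG \<and> l f = (shrink_dual ^^ m) l ((stretch ^^ m) f))" for m
  proof (induction m)
    case (Suc m)
    then show ?case using step[OF shrink_dual_iter[OF l, of m]] stretch_CG by simp
  qed (simp add: K)
  show ?thesis
  proof (cases "f \<in> CG")
    case f: True
    show ?thesis
    proof (rule cong_all)
      fix R
      obtain m where m: "\<forall>a\<in>oL. cabs (f (\<pi> ^ m * a) - f 0) \<le> cabs \<pi> ^ R" using CG_near_0[OF f, of R] by blast
      define k where "k = (shrink_dual ^^ m) l"
      define g where "g = (stretch ^^ m) f"
      have k: "k \<in> HC" unfolding k_def by (rule shrink_dual_iter[OF l])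
      have g: "g \<in> CG" "l f = k g" using iter[of m] f by (auto simp: k_def g_def)
      have k0: "k (ff 0) = 0" using iter[of m] KS_nth[of k 0] by (simp add: k_def)
      \<comment> \<open>\<open>ff 0\<close> is the constant function 1, and k maps it to the
        constant coefficient of KS k = 0. So subtracting f(0) does not change the value of k and
        makes all values divisible by \<pi>^R.\<close>
      define r where "r a = g a + (- f 0) * ff 0 a" for a
      have r: "r \<in> CG" unfolding r_def using g(1) ff_CG oL_minus[OF CG_0[OF f]] by (intro CG_add CG_cmult)
      have rle: "cabs (r a) \<le> cabs \<pi> ^ R" if "a \<in> oL" for a using m that by (simp add: r_def g_def ff_0 stretch_iter)
      have "k r = k g + k (\<lambda>a. (- f 0) * ff 0 a)"
        unfolding r_def[abs_def] using g(1) ff_CG oL_minus[OF CG_0[OF f]] by (intro HC_add[OF k] CG_cmult)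
      also have "k (\<lambda>a. (- f 0) * ff 0 a) = \<iota> (- f 0) * k (ff 0)" using oL_minus[OF CG_0[OF f]] ff_CG by (rule HC_cmult[OF k])
      finally have "l f = k r" using k0 g(2) by simp
      moreover have "r = (\<lambda>a. \<pi> ^ R * (r a / \<pi> ^ R))" using pi_nz by simp
      moreover have "k (\<lambda>a. \<pi> ^ R * (r a / \<pi> ^ R)) = \<iota> (\<pi> ^ R) * k (\<lambda>a. r a / \<pi> ^ R)"
        by (rule HC_cmult[OF k oL_power[OF pi_oL] CG_dvd[OF r rle]])
      ultimately have "l f - 0 = \<iota> (\<pi> ^ R) * k (\<lambda>a. r a / \<pi> ^ R)" by (metis diff_zero)
      then show "cong R (l f) 0" unfolding adic_cong_def by blast
    qed
  qed (rule HC_out[OF l])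
qed

lemma KS_inj: "inj_on KS HC"
proof (rule inj_onI)
  fix l k assume lk: "l \<in> HC" "k \<in> HC" "KS l = KS k"
  have "KS (\<lambda>f. l f - k f) = KS l - KS k" by (rule fps_ext) (simp add: KS_nth)
  then have "l f - k f = 0" for f using KS_eq_0[OF HC_diff[OF lk(1,2)]] lk(3) by simp
  then show "l = k" by (simp add: fun_eq_iff)
qed

lemma KS_surj: assumes F: "F \<in> IntS" shows "\<exists>l\<in>HC. KS l = F"
proof -
  have "\<forall>n. \<exists>H. (PS ^^ n) F = kf (of_nat q ^ n) * H" using F int_iff by blast
  \<comment> \<open>\<open>FF n\<close> is the n-th iterate of psi_q at F as an element of A;
    torsion-freeness makes it unique.\<close>
  then obtain FF where FF: "\<forall>n. (PS ^^ n) F = kf (of_nat q ^ n) * FF n" by (rule choice[THEN exE])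
  have FF0: "FF 0 = F" using FF[rule_format, of 0] by (simp add: kf_1)
  have PSF: "PS (FF n) = kf (of_nat q) * FF (Suc n)" for n
  proof (rule kf_cancel[OF nzL_q])
    have "kf (of_nat q ^ n) * PS (FF n) = (PS ^^ Suc n) F" using FF by (simp add: PS_cmul)
    also have "\<dots> = kf (of_nat q ^ n * of_nat q) * FF (Suc n)" using FF[rule_format, of "Suc n"] by (simp only: power_Suc2)
    finally show "kf (of_nat q ^ n) * PS (FF n) = kf (of_nat q ^ n) * (kf (of_nat q) * FF (Suc n))"
      using kf_mult[OF oL_power[OF oL_of_nat] oL_of_nat] by simp
  qed
  have "PS (FF n - ph (FF (Suc n))) = 0" for n unfolding PS_diff PS_ph PSF by (rule diff_self)
  then have "FF n - ph (FF (Suc n)) \<in> KerS" for n unfolding kernel_iff .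
  then have "\<exists>l. l \<in> Hoi \<and> K1 l = FF n - ph (FF (Suc n))" for n using K1_onto[of "FF n - ph (FF (Suc n))"] by blast
  then have "\<forall>n. \<exists>l. l \<in> Hoi \<and> K1 l = FF n - ph (FF (Suc n))" by blast
  then obtain \<l> where \<l>: "\<forall>n. \<l> n \<in> Hoi \<and> K1 (\<l> n) = FF n - ph (FF (Suc n))" by (rule choice[THEN exE])
  have lH: "\<l> n \<in> Hoi" for n using \<l> by blast
  define td where "td f m = \<l> m (f (\<pi> ^ m) - f 0)" for f m
  have fd: "f (\<pi> ^ m) - f 0 \<in> oi" if "f \<in> CG" for f m using that oL_power[OF pi_oL] oL_0 by (intro oi_diff CG_oi)
  have null: "adnull (td f)" if f: "f \<in> CG" for f unfolding adnull_def
  proof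
    fix R
    obtain M where M: "\<forall>m\<ge>M. \<forall>a\<in>oL. cabs (f (\<pi> ^ m * a) - f 0) \<le> cabs \<pi> ^ R" using CG_near_0[OF f] by blast
    have "cong R (td f m) 0" if "m \<ge> M" for m unfolding td_def using M[rule_format, OF that oL_1] by (intro Hoi_small[OF lH fd[OF f]]) simp
    then show "\<exists>M. \<forall>i\<ge>M. cong R (td f i) 0" by blast
  qed
  \<comment> \<open>Iterating \<open>HC_decomp\<close> forces this formula: \<open>f\<close> is \<open>f(0)\<close> plus the sum over \<open>m\<close> of the functions that are
    supported on \<open>\<pi>\<^sup>mo\<^sub>L\<^sup>\<times>\<close> and determined by \<open>f(\<pi>\<^sup>m) - f(0)\<close>.\<close>
  define lam where "lam f = (if f \<in> CG then \<iota> (f 0) * F $ 0 + asum (td f) else 0)" for f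
  have lam: "lam \<in> HC"
  proof (rule HC_I)
    fix f g assume f: "f \<in> CG" and g: "g \<in> CG"
    have "td (\<lambda>a. f a + g a) m = td f m + td g m" for m using Hoi_add[OF lH fd[OF f] fd[OF g], of m m m] by (simp add: td_def add_diff_add)
    then have "asum (td (\<lambda>a. f a + g a)) = asum (td f) + asum (td g)"
      using adlim_add[OF adlim_suminf[OF null[OF f]] adlim_suminf[OF null[OF g]]] by (intro adic_suminf_eq) (simp add: sum.distrib)
    then show "lam (\<lambda>a. f a + g a) = lam f + lam g"
      using f g CG_add[OF f g] io_add[OF CG_0[OF f] CG_0[OF g]] by (simp add: lam_def distrib_right)
  next
    fix c f assume c: "c \<in> oL" and f: "f \<in> CG"
    have "td (\<lambda>a. c * f a) m = \<iota> c * td f m" for m using Hoi_cmult[OF lH c fd[OF f], of m m] by (simp add: td_def right_diff_distrib)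
    then have "asum (td (\<lambda>a. c * f a)) = \<iota> c * asum (td f)"
      using adlim_mult[OF adlim_suminf[OF null[OF f]], of "\<iota> c"] by (intro adic_suminf_eq) (simp add: sum_distrib_left)
    then show "lam (\<lambda>a. c * f a) = \<iota> c * lam f"
      using c f CG_cmult[OF f c] io_mult[OF c CG_0[OF f]] by (simp add: lam_def distrib_left mult.assoc)
  qed (simp add: lam_def)
  have "KS lam = F"
  proof (rule fps_ext)
    fix n
    show "KS lam $ n = F $ n"
    proof (cases "n = 0")
      case True
      \<comment> \<open>P_0 is constant, so all differences vanish and the constant coefficient
        comes from the separate term alone.\<close>
      have "td (ff 0) m = 0" for m using Hoi_0[OF lH] oL_power[OF pi_oL] oL_0 by (simp add: td_def ff_0)
      then have "asum (td (ff 0)) = 0" using adlim_const[of 0] by (intro adic_suminf_eq) simp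
      then show ?thesis using True ff_CG oL_0 io_1 by (simp add: KS_nth lam_def ff_0)
    next
      case False
      have f0: "ff n 0 = 0" using False by (simp add: ff_def Kap_def)
      have "td (ff n) m = (ph ^^ m) (FF m) $ n - (ph ^^ Suc m) (FF (Suc m)) $ n" for m
      proof -
        have "td (ff n) m = (ph ^^ m) (K1 (\<l> m)) $ n"
          unfolding ph_iter_K1[OF lH] using oL_power[OF pi_oL] f0 by (simp add: td_def ff_def[of n "\<pi> ^ m"])
        also have "K1 (\<l> m) = FF m - ph (FF (Suc m))" using \<l> by blast
        finally show ?thesis by (simp add: ph_iter_diff funpow_swap1)
      qed
      \<comment> \<open>The sum telescopes; the remaining term is an M-fold iterate of
        \<open>ph\<close>, whose coefficient of degree n > 0 tends to 0 whatever the argument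
        \<open>FF M\<close> is.\<close>
      then have part: "(\<Sum>m<M. td (ff n) m) = F $ n - (ph ^^ M) (FF M) $ n" for M
        using sum_lessThan_telescope'[of "\<lambda>m. (ph ^^ m) (FF m) $ n" M] by (simp add: FF0 del: funpow.simps)
      have "adlim (\<lambda>M. \<Sum>m<M. td (ff n) m) (F $ n)" unfolding adlim_def part
      proof
        fix R
        have "cong R (F $ n - (ph ^^ M) (FF M) $ n) (F $ n)" if "M \<ge> R + n" for M
        proof -
          have "cong (Suc M - n) ((ph ^^ M) (FF M) $ n) 0" using False by (intro ph_iter_small) simp
          then have "cong R ((ph ^^ M) (FF M) $ n) 0" using that by (intro cong_mono[of R "Suc M - n"]) auto
          then show ?thesis using cong_diff[OF cong_refl, of R _ 0 "F $ n"] by simp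
        qed
        then show "\<exists>M. \<forall>m\<ge>M. cong R (F $ n - (ph ^^ m) (FF m) $ n) (F $ n)" by blast
      qed
      then have "asum (td (ff n)) = F $ n" by (rule adic_suminf_eq)
      then show ?thesis using ff_CG f0 io_0 by (simp add: KS_nth lam_def)
    qed
  qed
  then show ?thesis using lam by blast
qed

end

lemma KS_bij: "bij_betw KS HC IntS"
proof (cases "\<exists>t :: 's. t \<noteq> 0")
  case True
  then have "\<Omega> \<noteq> 0" using Omega_nz by blast
  then show ?thesis unfolding bij_betw_def using KS_inj KS_int KS_surj by blast
next
  \<comment> \<open>For S = 0 there is nothing to know about the period: both sides consist of a
    single element.\<close>
  case False
  then have z: "t = 0" for t :: 's by blast
  have F0: "F = 0" for F :: "'s fps" by (rule fps_ext) (simp add: z)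
  have l0: "l = (\<lambda>_. 0)" for l :: "('c \<Rightarrow> 'c) \<Rightarrow> 's" using z by blast
  have "(\<lambda>_. 0) \<in> HC" by (rule HC_I) simp_all
  then have "F \<in> KS ` HC" for F using F0[of F] F0[of "KS (\<lambda>_. 0)"] by (metis imageI)
  moreover have "F \<in> IntS" for F
  proof -
    have "kf 1 * (PS ^^ n) F = kf (1 * of_nat q ^ n) * 0" for n using F0[of "kf 1 * (PS ^^ n) F"] by simp
    then show ?thesis unfolding psi_q_int_iff using nzL_1 by blast
  qed
  moreover have "inj_on KS HC"
  proof (rule inj_onI)
    fix l k :: "('c \<Rightarrow> 'c) \<Rightarrow> 's" show "l = k" by (simp only: l0[of l] l0[of k])
  qed
  ultimately show ?thesis unfolding bij_betw_def by blast
qed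

theorem K_star_iso: "S_module_iso KS HC IntS" unfolding S_module_iso_def using KS_bij by (auto intro!: fps_ext simp: KS_nth cmul_nth)

end

theorem theorem3p39:
  fixes p :: nat
    and L :: "'c::{alg_closed_field,field_char_0,complete_space} set"
    and \<pi> \<Omega> :: 'c
    and G :: "'c fps fps"
    and \<iota> :: "'c \<Rightarrow> 's::comm_ring"
  assumes "is_Cp p TYPE('c)"
    and "finite_ext_Qp L"
    and "uniformizer L \<pi>"
    and "lubin_tate_group L \<pi> G"
    and "is_period L G \<Omega>"
    and "o_algebra L \<iota>"
    and "adically_complete \<iota> \<pi>"
    and "tau p L \<pi> G ` galois_group L = o_units L"
    and "S_module_iso (K1_star G \<Omega>) (Hom_o_infty p L \<pi> G \<iota>) (psi_q_kernel L \<pi> G \<iota>)"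
  shows "S_module_iso (K_star L G \<Omega>) (Hom_C_Gal p L \<pi> G \<iota>) (psi_q_int L \<pi> G \<iota>)"
proof -
  interpret Dual p "TYPE('c)" L \<pi> G \<Omega> \<iota> using assms by unfold_locales
  show ?thesis by (rule K_star_iso)
qed

end
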